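(* Let $A$ be an associative bialgebra over a field $k$, with unit and counit. The two tensor products $\otimes_1$ and $\otimes_2$ on the category $\mathsf{Tetra}(A)$ of tetramodules over $A$, together with the maps $$\eta_{M,N,P,Q}\colon (M\otimes_2N)\otimes_1(P\otimes_2Q)\to(M\otimes_1P)\otimes_2(N\otimes_1Q)$$ (all defined in the context), define a 2-fold monoidal structure on $\mathsf{Tetra}(A)$, with the tautological tetramodule $A$ as common unit object.
   Context: **Bialgebras and tetramodules.** A bialgebra is a vector space $A$ with an associative product $*$ and a coassociative coproduct $\Delta(a)=\Delta^1(a)\otimes\Delta^2(a)$ (Sweedler notation) with $\Delta(a*b)=\Delta(a)*\Delta(b)$, a unit and a counit. A tetramodule over $A$ (Hopf bimodule) is a vector space $M$ such that $A\oplus\epsilon M$, $\epsilon^2=0$, is a bialgebra whose structure restricts to the given one on $A$. Explicitly: $M$ is an $A$-bimodule (maps $m_\ell\colon A\otimes M\to M$, $m_r\colon M\otimes A\to M$, also written $*$ or by juxtaposition) and an $A$-bicomodule (maps $\Delta_\ell\colon M\to A\otimes M$, $\Delta_r\colon M\to M\otimes A$, written $\Delta_\ell(m)=\Delta_\ell^1(m)\otimes\Delta_\ell^2(m)$ etc.) with $\Delta_\ell(a*m)=(\Delta^1(a)*\Delta^1_\ell(m))\otimes(\Delta^2(a)*\Delta_\ell^2(m))$, $\Delta_\ell(m*a)=(\Delta^1_\ell(m)*\Delta^1(a))\otimes(\Delta_\ell^2(m)*\Delta^2(a))$, $\Delta_r(a*m)=(\Delta^1(a)*\Delta^1_r(m))\otimes(\Delta^2(a)*\Delta_r^2(m))$,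 $\Delta_r(m*a)=(\Delta^1_r(m)*\Delta^1(a))\otimes(\Delta_r^2(m)*\Delta^2(a))$. Morphisms are linear maps commuting with the four structures. The tautological tetramodule is $A$ itself. **External products.** For tetramodules $M_1,M_2$ both $M_1\boxtimes_1M_2$ and $M_1\boxtimes_2M_2$ have underlying space $M_1\otimes_kM_2$. For $\boxtimes_1$: $a(m_1\boxtimes m_2)=(am_1)\boxtimes m_2$, $(m_1\boxtimes m_2)a=m_1\boxtimes(m_2a)$, $\Delta_\ell(m_1\boxtimes m_2)=(\Delta^1_\ell(m_1)*\Delta^1_\ell(m_2))\otimes(\Delta_\ell^2(m_1)\boxtimes\Delta_\ell^2(m_2))$, $\Delta_r(m_1\boxtimes m_2)=(\Delta_r^1(m_1)\boxtimes\Delta_r^1(m_2))\otimes(\Delta_r^2(m_1)*\Delta_r^2(m_2))$. For $\boxtimes_2$: $a(m_1\boxtimes m_2)=(\Delta^1(a)m_1)\boxtimes(\Delta^2(a)m_2)$, $(m_1\boxtimes m_2)a=(m_1\Delta^1(a))\boxtimes(m_2\Delta^2(a))$, $\Delta_\ell(m_1\boxtimes m_2)=\Delta_\ell^1(m_1)\otimes(\Delta_\ell^2(m_1)\boxtimes m_2)$, $\Delta_r(m_1\boxtimes m_2)=(m_1\boxtimes\Delta_r^1(m_2))\otimes\Delta_r^2(m_2)$. **Internal products.** $M_1\otimes_1M_2$ is the quotient tetramodule of $M_1\boxtimes_1M_2$ by the span of $(m_1a)\boxtimes_1m_2-m_1\boxtimes_1(am_2)$. $M_1\otimes_2M_2$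 is the sub-tetramodule of $M_1\boxtimes_2M_2$ consisting of $\sum_im_{1i}\boxtimes_2m_{2i}$ with $\sum_i\Delta_r(m_{1i})\otimes_km_{2i}=\sum_im_{1i}\otimes_k\Delta_\ell(m_{2i})$. The identifications $A\otimes_1M\cong M\cong M\otimes_1A$ are $m_\ell,m_r$, and $M\cong A\otimes_2M$, $M\cong M\otimes_2A$ are $\Delta_\ell,\Delta_r$. **The map $\eta$.** The permutation $\phi_0\colon(M\boxtimes_2N)\boxtimes_1(P\boxtimes_2Q)\to(M\boxtimes_1P)\boxtimes_2(N\boxtimes_1Q)$, $m\otimes n\otimes p\otimes q\mapsto m\otimes p\otimes n\otimes q$, followed by the projections $M\boxtimes_1P\to M\otimes_1P$, $N\boxtimes_1Q\to N\otimes_1Q$, descends to a map $(M\boxtimes_2N)\otimes_1(P\boxtimes_2Q)\to(M\otimes_1P)\boxtimes_2(N\otimes_1Q)$; its restriction to $(M\otimes_2N)\otimes_1(P\otimes_2Q)$ takes values in $(M\otimes_1P)\otimes_2(N\otimes_1Q)$ and is $\eta_{M,N,P,Q}$. **2-fold monoidal structure.** Two monoidal structures $\otimes_1,\otimes_2$ on a category with a common unit object $A$ and a natural transformation $\eta$ as in the claim (not required to be an isomorphism) such that $\eta_{X,Y,A,A}=\eta_{A,A,X,Y}=\mathrm{id}_{X\otimes_2Y}$, $\eta_{X,A,Y,A}=\eta_{A,X,A,Y}=\mathrm{id}_{X\otimes_1Y}$, and $$\eta_{U\otimes_1W,V\otimes_1X,Y,Z}\circ(\eta_{U,V,W,X}\otimes_1\mathrm{id}_{Y\otimes_2Z})=\eta_{U,V,W\otimes_1Y,X\otimes_1Z}\circ(\mathrm{id}_{U\otimes_2V}\otimes_1\eta_{W,X,Y,Z}),$$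 $$(\eta_{U,V,X,Y}\otimes_2\mathrm{id}_{W\otimes_1Z})\circ\eta_{U\otimes_2V,W,X\otimes_2Y,Z}=(\mathrm{id}_{U\otimes_1X}\otimes_2\eta_{V,W,Y,Z})\circ\eta_{U,V\otimes_2W,X,Y\otimes_2Z},$$ where the canonical associativity and unit isomorphisms of $\otimes_1$ and $\otimes_2$ are used as identifications. *)

theory Defs
  imports "HOL-Algebra.Module" "HOL-Algebra.AbelCoset"
begin

record ('o, 'm) cat =
  Ob :: "'o set"
  Hom :: "'o \<Rightarrow> 'o \<Rightarrow> 'm set"
  Id :: "'o \<Rightarrow> 'm"
  Comp :: "'m \<Rightarrow> 'm \<Rightarrow> 'm"  (infixr \<open>\<cdot>\<index>\<close> 55)

locale category =
  fixes C :: "('o, 'm) cat" (structure)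
  assumes Id_in_Hom: "X \<in> Ob C \<Longrightarrow> Id C X \<in> Hom C X X"
    and Comp_in_Hom:
      "\<lbrakk>X \<in> Ob C; Y \<in> Ob C; Z \<in> Ob C; f \<in> Hom C X Y; g \<in> Hom C Y Z\<rbrakk> \<Longrightarrow> g \<cdot> f \<in> Hom C X Z"
    and Comp_Id: "\<lbrakk>X \<in> Ob C; Y \<in> Ob C; f \<in> Hom C X Y\<rbrakk> \<Longrightarrow> f \<cdot> Id C X = f"
    and Id_Comp: "\<lbrakk>X \<in> Ob C; Y \<in> Ob C; f \<in> Hom C X Y\<rbrakk> \<Longrightarrow> Id C Y \<cdot> f = f"
    and Comp_assoc:
      "\<lbrakk>W \<in> Ob C; X \<in> Ob C; Y \<in> Ob C; Z \<in> Ob C; f \<in> Hom C W X; g \<in> Hom C X Y; h \<in> Hom C Y Z\<rbrakk>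
        \<Longrightarrow> (h \<cdot> g) \<cdot> f = h \<cdot> (g \<cdot> f)"

definition Iso :: "('o, 'm) cat \<Rightarrow> 'o \<Rightarrow> 'o \<Rightarrow> 'm set" where
  "Iso C X Y = {f \<in> Hom C X Y. \<exists>g \<in> Hom C Y X. g \<cdot>\<^bsub>C\<^esub> f = Id C X \<and> f \<cdot>\<^bsub>C\<^esub> g = Id C Y}"

text \<open>A tensor product on objects and on morphisms, with components of the associativity
  isomorphism \<open>(X \<diamondop> Y) \<diamondop> Z \<rightarrow> X \<diamondop> (Y \<diamondop> Z)\<close> and of the unit isomorphisms \<open>I \<diamondop> X \<rightarrow> X\<close>
  and \<open>X \<diamondop> I \<rightarrow> X\<close>.\<close>

record ('o, 'm) tensor_structure =
  tobj :: "'o \<Rightarrow> 'o \<Rightarrow> 'o"  (infixr \<open>\<diamondop>\<index>\<close> 70)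
  tmor :: "'m \<Rightarrow> 'm \<Rightarrow> 'm"  (infixr \<open>\<star>\<index>\<close> 70)
  assoc :: "'o \<Rightarrow> 'o \<Rightarrow> 'o \<Rightarrow> 'm"
  lunit :: "'o \<Rightarrow> 'm"
  runit :: "'o \<Rightarrow> 'm"

locale monoidal_category = category C for C :: "('o, 'm) cat" (structure) +
  fixes I :: 'o and T :: "('o, 'm) tensor_structure"
  assumes unit_Ob: "I \<in> Ob C"
    and tobj_Ob: "\<lbrakk>X \<in> Ob C; Y \<in> Ob C\<rbrakk> \<Longrightarrow> X \<diamondop>\<^bsub>T\<^esub> Y \<in> Ob C"
    and tmor_Hom:
      "\<lbrakk>X \<in> Ob C; X' \<in> Ob C; Y \<in> Ob C; Y' \<in> Ob C; f \<in> Hom C X X'; g \<in> Hom C Y Y'\<rbrakk>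
        \<Longrightarrow> f \<star>\<^bsub>T\<^esub> g \<in> Hom C (X \<diamondop>\<^bsub>T\<^esub> Y) (X' \<diamondop>\<^bsub>T\<^esub> Y')"
    and tmor_Id: "\<lbrakk>X \<in> Ob C; Y \<in> Ob C\<rbrakk> \<Longrightarrow> Id C X \<star>\<^bsub>T\<^esub> Id C Y = Id C (X \<diamondop>\<^bsub>T\<^esub> Y)"
    and tmor_Comp:
      "\<lbrakk>X \<in> Ob C; X' \<in> Ob C; X'' \<in> Ob C; Y \<in> Ob C; Y' \<in> Ob C; Y'' \<in> Ob C;
        f \<in> Hom C X X'; f' \<in> Hom C X' X''; g \<in> Hom C Y Y'; g' \<in> Hom C Y' Y''\<rbrakk>
        \<Longrightarrow> (f' \<cdot> f) \<star>\<^bsub>T\<^esub> (g' \<cdot> g) = (f' \<star>\<^bsub>T\<^esub> g') \<cdot> (f \<star>\<^bsub>T\<^esub> g)"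
    and assoc_Iso:
      "\<lbrakk>X \<in> Ob C; Y \<in> Ob C; Z \<in> Ob C\<rbrakk>
        \<Longrightarrow> assoc T X Y Z \<in> Iso C ((X \<diamondop>\<^bsub>T\<^esub> Y) \<diamondop>\<^bsub>T\<^esub> Z) (X \<diamondop>\<^bsub>T\<^esub> (Y \<diamondop>\<^bsub>T\<^esub> Z))"
    and lunit_Iso: "X \<in> Ob C \<Longrightarrow> lunit T X \<in> Iso C (I \<diamondop>\<^bsub>T\<^esub> X) X"
    and runit_Iso: "X \<in> Ob C \<Longrightarrow> runit T X \<in> Iso C (X \<diamondop>\<^bsub>T\<^esub> I) X"
    and assoc_natural:
      "\<lbrakk>X \<in> Ob C; X' \<in> Ob C; Y \<in> Ob C; Y' \<in> Ob C; Z \<in> Ob C; Z' \<in> Ob C;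
        f \<in> Hom C X X'; g \<in> Hom C Y Y'; h \<in> Hom C Z Z'\<rbrakk>
        \<Longrightarrow> assoc T X' Y' Z' \<cdot> ((f \<star>\<^bsub>T\<^esub> g) \<star>\<^bsub>T\<^esub> h) = (f \<star>\<^bsub>T\<^esub> (g \<star>\<^bsub>T\<^esub> h)) \<cdot> assoc T X Y Z"
    and lunit_natural:
      "\<lbrakk>X \<in> Ob C; X' \<in> Ob C; f \<in> Hom C X X'\<rbrakk>
        \<Longrightarrow> lunit T X' \<cdot> (Id C I \<star>\<^bsub>T\<^esub> f) = f \<cdot> lunit T X"
    and runit_natural:
      "\<lbrakk>X \<in> Ob C; X' \<in> Ob C; f \<in> Hom C X X'\<rbrakk>
        \<Longrightarrow> runit T X' \<cdot> (f \<star>\<^bsub>T\<^esub> Id C I) = f \<cdot> runit T X"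
    and pentagon:
      "\<lbrakk>W \<in> Ob C; X \<in> Ob C; Y \<in> Ob C; Z \<in> Ob C\<rbrakk>
        \<Longrightarrow> assoc T W X (Y \<diamondop>\<^bsub>T\<^esub> Z) \<cdot> assoc T (W \<diamondop>\<^bsub>T\<^esub> X) Y Z
          = (Id C W \<star>\<^bsub>T\<^esub> assoc T X Y Z) \<cdot> assoc T W (X \<diamondop>\<^bsub>T\<^esub> Y) Z \<cdot> (assoc T W X Y \<star>\<^bsub>T\<^esub> Id C Z)"
    and triangle:
      "\<lbrakk>X \<in> Ob C; Y \<in> Ob C\<rbrakk>
        \<Longrightarrow> (Id C X \<star>\<^bsub>T\<^esub> lunit T Y) \<cdot> assoc T X I Y = runit T X \<star>\<^bsub>T\<^esub> Id C Y"

text \<open>The two structures share the unit object \<open>I\<close>.  In each equation for \<open>\<eta>\<close> the identifications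
  of sources and of targets are written out with the associativity and unit isomorphisms; e.g.
  \<open>\<eta> X Y I I = id\<close> means that
  \<open>(X \<diamondop>\<^sub>2 Y) \<diamondop>\<^sub>1 (I \<diamondop>\<^sub>2 I) \<rightarrow> (X \<diamondop>\<^sub>1 I) \<diamondop>\<^sub>2 (Y \<diamondop>\<^sub>1 I) \<rightarrow> X \<diamondop>\<^sub>2 Y\<close> is the canonical isomorphism
  \<open>(X \<diamondop>\<^sub>2 Y) \<diamondop>\<^sub>1 (I \<diamondop>\<^sub>2 I) \<rightarrow> (X \<diamondop>\<^sub>2 Y) \<diamondop>\<^sub>1 I \<rightarrow> X \<diamondop>\<^sub>2 Y\<close>.\<close>

locale two_fold_monoidal_category =
  monoidal_category C I T1 + T2: monoidal_category C I T2
  for C :: "('o, 'm) cat" (structure) and I :: 'o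
    and T1 :: "('o, 'm) tensor_structure" and T2 :: "('o, 'm) tensor_structure" +
  fixes \<eta> :: "'o \<Rightarrow> 'o \<Rightarrow> 'o \<Rightarrow> 'o \<Rightarrow> 'm"
  assumes eta_Hom:
      "\<lbrakk>M \<in> Ob C; N \<in> Ob C; P \<in> Ob C; Q \<in> Ob C\<rbrakk>
        \<Longrightarrow> \<eta> M N P Q \<in> Hom C ((M \<diamondop>\<^bsub>T2\<^esub> N) \<diamondop>\<^bsub>T1\<^esub> (P \<diamondop>\<^bsub>T2\<^esub> Q)) ((M \<diamondop>\<^bsub>T1\<^esub> P) \<diamondop>\<^bsub>T2\<^esub> (N \<diamondop>\<^bsub>T1\<^esub> Q))"
    and eta_natural:
      "\<lbrakk>M \<in> Ob C; M' \<in> Ob C; N \<in> Ob C; N' \<in> Ob C; P \<in> Ob C; P' \<in> Ob C; Q \<in> Ob C; Q' \<in> Ob C;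
        f \<in> Hom C M M'; g \<in> Hom C N N'; h \<in> Hom C P P'; j \<in> Hom C Q Q'\<rbrakk>
        \<Longrightarrow> \<eta> M' N' P' Q' \<cdot> ((f \<star>\<^bsub>T2\<^esub> g) \<star>\<^bsub>T1\<^esub> (h \<star>\<^bsub>T2\<^esub> j))
          = ((f \<star>\<^bsub>T1\<^esub> h) \<star>\<^bsub>T2\<^esub> (g \<star>\<^bsub>T1\<^esub> j)) \<cdot> \<eta> M N P Q"
    and eta_XYII:
      "\<lbrakk>X \<in> Ob C; Y \<in> Ob C\<rbrakk>
        \<Longrightarrow> (runit T1 X \<star>\<^bsub>T2\<^esub> runit T1 Y) \<cdot> \<eta> X Y I I
          = runit T1 (X \<diamondop>\<^bsub>T2\<^esub> Y) \<cdot> (Id C (X \<diamondop>\<^bsub>T2\<^esub> Y) \<star>\<^bsub>T1\<^esub> lunit T2 I)"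
    and eta_IIXY:
      "\<lbrakk>X \<in> Ob C; Y \<in> Ob C\<rbrakk>
        \<Longrightarrow> (lunit T1 X \<star>\<^bsub>T2\<^esub> lunit T1 Y) \<cdot> \<eta> I I X Y
          = lunit T1 (X \<diamondop>\<^bsub>T2\<^esub> Y) \<cdot> (lunit T2 I \<star>\<^bsub>T1\<^esub> Id C (X \<diamondop>\<^bsub>T2\<^esub> Y))"
    and eta_XIYI:
      "\<lbrakk>X \<in> Ob C; Y \<in> Ob C\<rbrakk>
        \<Longrightarrow> runit T2 (X \<diamondop>\<^bsub>T1\<^esub> Y) \<cdot> (Id C (X \<diamondop>\<^bsub>T1\<^esub> Y) \<star>\<^bsub>T2\<^esub> lunit T1 I) \<cdot> \<eta> X I Y I
          = runit T2 X \<star>\<^bsub>T1\<^esub> runit T2 Y"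
    and eta_IXIY:
      "\<lbrakk>X \<in> Ob C; Y \<in> Ob C\<rbrakk>
        \<Longrightarrow> lunit T2 (X \<diamondop>\<^bsub>T1\<^esub> Y) \<cdot> (lunit T1 I \<star>\<^bsub>T2\<^esub> Id C (X \<diamondop>\<^bsub>T1\<^esub> Y)) \<cdot> \<eta> I X I Y
          = lunit T2 X \<star>\<^bsub>T1\<^esub> lunit T2 Y"
    and eta_assoc1:
      "\<lbrakk>U \<in> Ob C; V \<in> Ob C; W \<in> Ob C; X \<in> Ob C; Y \<in> Ob C; Z \<in> Ob C\<rbrakk>
        \<Longrightarrow> (assoc T1 U W Y \<star>\<^bsub>T2\<^esub> assoc T1 V X Z)
              \<cdot> \<eta> (U \<diamondop>\<^bsub>T1\<^esub> W) (V \<diamondop>\<^bsub>T1\<^esub> X) Y Z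
              \<cdot> (\<eta> U V W X \<star>\<^bsub>T1\<^esub> Id C (Y \<diamondop>\<^bsub>T2\<^esub> Z))
          = \<eta> U V (W \<diamondop>\<^bsub>T1\<^esub> Y) (X \<diamondop>\<^bsub>T1\<^esub> Z)
              \<cdot> (Id C (U \<diamondop>\<^bsub>T2\<^esub> V) \<star>\<^bsub>T1\<^esub> \<eta> W X Y Z)
              \<cdot> assoc T1 (U \<diamondop>\<^bsub>T2\<^esub> V) (W \<diamondop>\<^bsub>T2\<^esub> X) (Y \<diamondop>\<^bsub>T2\<^esub> Z)"
    and eta_assoc2:
      "\<lbrakk>U \<in> Ob C; V \<in> Ob C; W \<in> Ob C; X \<in> Ob C; Y \<in> Ob C; Z \<in> Ob C\<rbrakk>
        \<Longrightarrow> assoc T2 (U \<diamondop>\<^bsub>T1\<^esub> X) (V \<diamondop>\<^bsub>T1\<^esub> Y) (W \<diamondop>\<^bsub>T1\<^esub> Z)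
              \<cdot> (\<eta> U V X Y \<star>\<^bsub>T2\<^esub> Id C (W \<diamondop>\<^bsub>T1\<^esub> Z))
              \<cdot> \<eta> (U \<diamondop>\<^bsub>T2\<^esub> V) W (X \<diamondop>\<^bsub>T2\<^esub> Y) Z
          = (Id C (U \<diamondop>\<^bsub>T1\<^esub> X) \<star>\<^bsub>T2\<^esub> \<eta> V W Y Z)
              \<cdot> \<eta> U (V \<diamondop>\<^bsub>T2\<^esub> W) X (Y \<diamondop>\<^bsub>T2\<^esub> Z)
              \<cdot> (assoc T2 U V W \<star>\<^bsub>T1\<^esub> assoc T2 X Y Z)"

text \<open>All vector spaces are HOL-Algebra modules over a field \<open>K\<close> with carrier a subset of one type
  \<open>'u\<close>; the components \<open>mult\<close> and \<open>one\<close> of the record carry no information, except for the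
  bialgebra.  For infinite \<open>'u\<close> the spaces of this kind are closed, up to isomorphism, under tensor
  products (a tensor is a finite sum of pure tensors, so \<open>V \<otimes> W\<close> is finite or at most as large as
  \<open>'u\<close>), which makes the choice in \<open>tensor_pair\<close> below meaningful.  Hence the universal property
  in \<open>is_tensor\<close> may be tested on spaces inside \<open>'u\<close> only.\<close>

definition linear_map ::
    "('k, 'c) ring_scheme \<Rightarrow> ('k, 'u, 'v) module_scheme \<Rightarrow> ('k, 'u, 'w) module_scheme \<Rightarrow> ('u \<Rightarrow> 'u) \<Rightarrow> bool"
  where "linear_map K V W f \<longleftrightarrow>
    f \<in> carrier V \<rightarrow> carrier W \<and>
    (\<forall>x \<in> carrier V. \<forall>y \<in> carrier V. f (x \<oplus>\<^bsub>V\<^esub> y) = f x \<oplus>\<^bsub>W\<^esub> f y) \<and>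
    (\<forall>c \<in> carrier K. \<forall>x \<in> carrier V. f (c \<odot>\<^bsub>V\<^esub> x) = c \<odot>\<^bsub>W\<^esub> f x)"

definition bilinear_map ::
    "('k, 'c) ring_scheme \<Rightarrow> ('k, 'u, 'v) module_scheme \<Rightarrow> ('k, 'u, 'w) module_scheme
      \<Rightarrow> ('k, 'u, 'p) module_scheme \<Rightarrow> ('u \<Rightarrow> 'u \<Rightarrow> 'u) \<Rightarrow> bool"
  where "bilinear_map K V W P f \<longleftrightarrow>
    (\<forall>v \<in> carrier V. linear_map K W P (\<lambda>w. f v w)) \<and>
    (\<forall>w \<in> carrier W. linear_map K V P (\<lambda>v. f v w))"

definition is_tensor ::
    "('k, 'c) ring_scheme \<Rightarrow> ('k, 'u, 'v) module_scheme \<Rightarrow> ('k, 'u, 'w) module_scheme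
      \<Rightarrow> ('k, 'u) module \<Rightarrow> ('u \<Rightarrow> 'u \<Rightarrow> 'u) \<Rightarrow> bool"
  where "is_tensor K V W T \<tau> \<longleftrightarrow>
    module K T \<and> bilinear_map K V W T \<tau> \<and>
    (\<forall>(P :: ('k, 'u) module) f. module K P \<and> bilinear_map K V W P f \<longrightarrow>
      (\<exists>!F. F \<in> extensional (carrier T) \<and> linear_map K T P F \<and>
            (\<forall>v \<in> carrier V. \<forall>w \<in> carrier W. F (\<tau> v w) = f v w)))"

definition qrep :: "('k, 'u, 'v) module_scheme \<Rightarrow> 'u set \<Rightarrow> 'u \<Rightarrow> 'u" where
  "qrep V R x = (SOME y. y \<in> R +>\<^bsub>V\<^esub> x)"

text \<open>The quotient space \<open>V / R\<close>, each coset being represented by a chosen element of it; the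
  projection is \<open>qrep V R\<close>.  As points of the quotient are themselves elements of \<open>V\<close>, the
  map induced on the quotient by a map on \<open>V\<close> vanishing on \<open>R\<close> is given by the same function.\<close>

definition quot_space :: "('k, 'u, 'v) module_scheme \<Rightarrow> 'u set \<Rightarrow> ('k, 'u) module" where
  "quot_space V R = \<lparr>carrier = qrep V R ` carrier V, mult = undefined, one = undefined,
     zero = qrep V R \<zero>\<^bsub>V\<^esub>, add = (\<lambda>x y. qrep V R (x \<oplus>\<^bsub>V\<^esub> y)),
     smult = (\<lambda>c x. qrep V R (c \<odot>\<^bsub>V\<^esub> x))\<rparr>"

record ('k, 'u) bialgebra = "('k, 'u) module" +
  comult :: "'u \<Rightarrow> 'u"
  counit :: "'u \<Rightarrow> 'k"

record ('k, 'u) tetramodule = "('k, 'u) module" +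
  lact :: "'u \<Rightarrow> 'u \<Rightarrow> 'u"     \<comment> \<open>\<open>lact M a m = a m\<close>\<close>
  ract :: "'u \<Rightarrow> 'u \<Rightarrow> 'u"     \<comment> \<open>\<open>ract M m a = m a\<close>\<close>
  lcoact :: "'u \<Rightarrow> 'u"
  rcoact :: "'u \<Rightarrow> 'u"

record ('k, 'u) tetra_mor =
  Dom :: "('k, 'u) tetramodule"
  Cod :: "('k, 'u) tetramodule"
  Map :: "'u \<Rightarrow> 'u"

context
  fixes K :: "('k, 'c) ring_scheme"
begin

definition span_of :: "('k, 'u, 'v) module_scheme \<Rightarrow> 'u set \<Rightarrow> 'u set" where
  "span_of V S = \<Inter>{H. submodule H K V \<and> S \<subseteq> H}"

definition tensor_pair ::
    "('k, 'u, 'v) module_scheme \<Rightarrow> ('k, 'u, 'w) module_scheme \<Rightarrow> ('k, 'u) module \<times> ('u \<Rightarrow> 'u \<Rightarrow> 'u)"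
  where "tensor_pair V W = (SOME (T, \<tau>). is_tensor K V W T \<tau>)"

definition tensor ::
    "('k, 'u, 'v) module_scheme \<Rightarrow> ('k, 'u, 'w) module_scheme \<Rightarrow> ('k, 'u) module"
    (infixr \<open>\<otimes>\<^sub>k\<close> 70)
  where "V \<otimes>\<^sub>k W = fst (tensor_pair V W)"

definition tens ::
    "('k, 'u, 'v) module_scheme \<Rightarrow> ('k, 'u, 'w) module_scheme \<Rightarrow> 'u \<Rightarrow> 'u \<Rightarrow> 'u"
  where "tens V W = snd (tensor_pair V W)"

text \<open>\<open>sweedler V W P t f\<close> is the sum of \<open>f v w\<close> in \<open>P\<close> over the terms of a decomposition of
  \<open>t\<close> in \<open>V \<otimes> W\<close> into pure tensors \<open>v \<otimes> w\<close>, for \<open>f\<close> bilinear.\<close>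

definition sweedler ::
    "('k, 'u, 'v) module_scheme \<Rightarrow> ('k, 'u, 'w) module_scheme \<Rightarrow> ('k, 'u, 'p) module_scheme
      \<Rightarrow> 'u \<Rightarrow> ('u \<Rightarrow> 'u \<Rightarrow> 'u) \<Rightarrow> 'u"
  where "sweedler V W P t f =
    (THE F. F \<in> extensional (carrier (V \<otimes>\<^sub>k W)) \<and> linear_map K (V \<otimes>\<^sub>k W) P F \<and>
            (\<forall>v \<in> carrier V. \<forall>w \<in> carrier W. F (tens V W v w) = f v w)) t"

definition tmap ::
    "('k, 'u, 'v) module_scheme \<Rightarrow> ('k, 'u, 'w) module_scheme
      \<Rightarrow> ('k, 'u, 'v1) module_scheme \<Rightarrow> ('k, 'u, 'w1) module_scheme
      \<Rightarrow> ('u \<Rightarrow> 'u) \<Rightarrow> ('u \<Rightarrow> 'u) \<Rightarrow> 'u \<Rightarrow> 'u"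
  where "tmap V W V' W' f g t = sweedler V W (V' \<otimes>\<^sub>k W') t (\<lambda>v w. tens V' W' (f v) (g w))"

text \<open>The canonical map \<open>(V \<otimes> W) \<otimes> X \<rightarrow> V \<otimes> (W \<otimes> X)\<close>.\<close>

definition tassoc ::
    "('k, 'u, 'v) module_scheme \<Rightarrow> ('k, 'u, 'w) module_scheme \<Rightarrow> ('k, 'u, 'x) module_scheme
      \<Rightarrow> 'u \<Rightarrow> 'u"
  where "tassoc V W X t =
    sweedler (V \<otimes>\<^sub>k W) X (V \<otimes>\<^sub>k W \<otimes>\<^sub>k X) t
      (\<lambda>s x. sweedler V W (V \<otimes>\<^sub>k W \<otimes>\<^sub>k X) s (\<lambda>v w. tens V (W \<otimes>\<^sub>k X) v (tens W X w x)))"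

definition bialgebra :: "('k, 'u) bialgebra \<Rightarrow> bool" where
  "bialgebra A \<longleftrightarrow>
    ring A \<and> module K A \<and> bilinear_map K A A A (mult A) \<and>
    linear_map K A (A \<otimes>\<^sub>k A) (comult A) \<and>
    (\<forall>a \<in> carrier A. tassoc A A A (tmap A A (A \<otimes>\<^sub>k A) A (comult A) (\<lambda>b. b) (comult A a))
       = tmap A A A (A \<otimes>\<^sub>k A) (\<lambda>b. b) (comult A) (comult A a)) \<and>
    counit A \<in> carrier A \<rightarrow> carrier K \<and>
    (\<forall>a \<in> carrier A. \<forall>b \<in> carrier A. counit A (a \<oplus>\<^bsub>A\<^esub> b) = counit A a \<oplus>\<^bsub>K\<^esub> counit A b) \<and>
    (\<forall>c \<in> carrier K. \<forall>a \<in> carrier A. counit A (c \<odot>\<^bsub>A\<^esub> a) = c \<otimes>\<^bsub>K\<^esub> counit A a) \<and>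
    (\<forall>a \<in> carrier A. sweedler A A A (comult A a) (\<lambda>a1 a2. counit A a1 \<odot>\<^bsub>A\<^esub> a2) = a) \<and>
    (\<forall>a \<in> carrier A. sweedler A A A (comult A a) (\<lambda>a1 a2. counit A a2 \<odot>\<^bsub>A\<^esub> a1) = a) \<and>
    (\<forall>a \<in> carrier A. \<forall>b \<in> carrier A. comult A (a \<otimes>\<^bsub>A\<^esub> b)
       = sweedler A A (A \<otimes>\<^sub>k A) (comult A a) (\<lambda>a1 a2.
           sweedler A A (A \<otimes>\<^sub>k A) (comult A b) (\<lambda>b1 b2.
             tens A A (a1 \<otimes>\<^bsub>A\<^esub> b1) (a2 \<otimes>\<^bsub>A\<^esub> b2)))) \<and>
    comult A \<one>\<^bsub>A\<^esub> = tens A A \<one>\<^bsub>A\<^esub> \<one>\<^bsub>A\<^esub> \<and>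
    (\<forall>a \<in> carrier A. \<forall>b \<in> carrier A. counit A (a \<otimes>\<^bsub>A\<^esub> b) = counit A a \<otimes>\<^bsub>K\<^esub> counit A b) \<and>
    counit A \<one>\<^bsub>A\<^esub> = \<one>\<^bsub>K\<^esub>"

context
  fixes A :: "('k, 'u) bialgebra"
begin

definition bimodule :: "('k, 'u) tetramodule \<Rightarrow> bool" where
  "bimodule M \<longleftrightarrow>
    module K M \<and> bilinear_map K A M M (lact M) \<and> bilinear_map K M A M (ract M) \<and>
    (\<forall>a \<in> carrier A. \<forall>b \<in> carrier A. \<forall>m \<in> carrier M.
       lact M (a \<otimes>\<^bsub>A\<^esub> b) m = lact M a (lact M b m) \<and>
       ract M m (a \<otimes>\<^bsub>A\<^esub> b) = ract M (ract M m a) b \<and>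
       ract M (lact M a m) b = lact M a (ract M m b)) \<and>
    (\<forall>m \<in> carrier M. lact M \<one>\<^bsub>A\<^esub> m = m \<and> ract M m \<one>\<^bsub>A\<^esub> = m)"

definition bicomodule :: "('k, 'u) tetramodule \<Rightarrow> bool" where
  "bicomodule M \<longleftrightarrow>
    module K M \<and> linear_map K M (A \<otimes>\<^sub>k M) (lcoact M) \<and> linear_map K M (M \<otimes>\<^sub>k A) (rcoact M) \<and>
    (\<forall>m \<in> carrier M.
       tassoc A A M (tmap A M (A \<otimes>\<^sub>k A) M (comult A) (\<lambda>x. x) (lcoact M m))
         = tmap A M A (A \<otimes>\<^sub>k M) (\<lambda>a. a) (lcoact M) (lcoact M m) \<and>
       tassoc M A A (tmap M A (M \<otimes>\<^sub>k A) A (rcoact M) (\<lambda>a. a) (rcoact M m))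
         = tmap M A M (A \<otimes>\<^sub>k A) (\<lambda>x. x) (comult A) (rcoact M m) \<and>
       tassoc A M A (tmap M A (A \<otimes>\<^sub>k M) A (lcoact M) (\<lambda>a. a) (rcoact M m))
         = tmap A M A (M \<otimes>\<^sub>k A) (\<lambda>a. a) (rcoact M) (lcoact M m)) \<and>
    (\<forall>m \<in> carrier M.
       sweedler A M M (lcoact M m) (\<lambda>a x. counit A a \<odot>\<^bsub>M\<^esub> x) = m \<and>
       sweedler M A M (rcoact M m) (\<lambda>x a. counit A a \<odot>\<^bsub>M\<^esub> x) = m)"

definition tetramodule :: "('k, 'u) tetramodule \<Rightarrow> bool" where
  "tetramodule M \<longleftrightarrow>
    bimodule M \<and> bicomodule M \<and>
    (\<forall>a \<in> carrier A. \<forall>m \<in> carrier M.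
       lcoact M (lact M a m) =
         sweedler A A (A \<otimes>\<^sub>k M) (comult A a) (\<lambda>a1 a2.
           sweedler A M (A \<otimes>\<^sub>k M) (lcoact M m) (\<lambda>b x. tens A M (a1 \<otimes>\<^bsub>A\<^esub> b) (lact M a2 x))) \<and>
       lcoact M (ract M m a) =
         sweedler A A (A \<otimes>\<^sub>k M) (comult A a) (\<lambda>a1 a2.
           sweedler A M (A \<otimes>\<^sub>k M) (lcoact M m) (\<lambda>b x. tens A M (b \<otimes>\<^bsub>A\<^esub> a1) (ract M x a2))) \<and>
       rcoact M (lact M a m) =
         sweedler A A (M \<otimes>\<^sub>k A) (comult A a) (\<lambda>a1 a2.
           sweedler M A (M \<otimes>\<^sub>k A) (rcoact M m) (\<lambda>x b. tens M A (lact M a1 x) (a2 \<otimes>\<^bsub>A\<^esub> b))) \<and>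
       rcoact M (ract M m a) =
         sweedler A A (M \<otimes>\<^sub>k A) (comult A a) (\<lambda>a1 a2.
           sweedler M A (M \<otimes>\<^sub>k A) (rcoact M m) (\<lambda>x b. tens M A (ract M x a1) (b \<otimes>\<^bsub>A\<^esub> a2))))"

definition taut :: "('k, 'u) tetramodule" where
  "taut = module.extend (module.truncate A)
            (tetramodule.fields (mult A) (mult A) (comult A) (comult A))"

definition tetra_map ::
    "('k, 'u) tetramodule \<Rightarrow> ('k, 'u) tetramodule \<Rightarrow> ('u \<Rightarrow> 'u) \<Rightarrow> bool"
  where "tetra_map M N f \<longleftrightarrow>
    f \<in> extensional (carrier M) \<and> linear_map K M N f \<and>
    (\<forall>a \<in> carrier A. \<forall>m \<in> carrier M.
       f (lact M a m) = lact N a (f m) \<and> f (ract M m a) = ract N (f m) a) \<and>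
    (\<forall>m \<in> carrier M.
       lcoact N (f m) = tmap A M A N (\<lambda>a. a) f (lcoact M m) \<and>
       rcoact N (f m) = tmap M A N A f (\<lambda>a. a) (rcoact M m))"

definition Tetra :: "(('k, 'u) tetramodule, ('k, 'u) tetra_mor) cat" where
  "Tetra = \<lparr>Ob = {M. tetramodule M},
     Hom = (\<lambda>M N. {\<lparr>Dom = M, Cod = N, Map = f\<rparr> | f. tetra_map M N f}),
     Id = (\<lambda>M. \<lparr>Dom = M, Cod = M, Map = restrict (\<lambda>x. x) (carrier M)\<rparr>),
     Comp = (\<lambda>g f. \<lparr>Dom = Dom f, Cod = Cod g, Map = compose (carrier (Dom f)) (Map g) (Map f)\<rparr>)\<rparr>"

definition ext1 :: "('k, 'u) tetramodule \<Rightarrow> ('k, 'u) tetramodule \<Rightarrow> ('k, 'u) tetramodule"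
    (infixl \<open>\<boxtimes>\<^sub>1\<close> 70)
  where "M \<boxtimes>\<^sub>1 N = module.extend (M \<otimes>\<^sub>k N) (tetramodule.fields
    (\<lambda>a t. sweedler M N (M \<otimes>\<^sub>k N) t (\<lambda>m n. tens M N (lact M a m) n))
    (\<lambda>t a. sweedler M N (M \<otimes>\<^sub>k N) t (\<lambda>m n. tens M N m (ract N n a)))
    (\<lambda>t. sweedler M N (A \<otimes>\<^sub>k M \<otimes>\<^sub>k N) t (\<lambda>m n.
       sweedler A M (A \<otimes>\<^sub>k M \<otimes>\<^sub>k N) (lcoact M m) (\<lambda>a m'.
         sweedler A N (A \<otimes>\<^sub>k M \<otimes>\<^sub>k N) (lcoact N n) (\<lambda>b n'.
           tens A (M \<otimes>\<^sub>k N) (a \<otimes>\<^bsub>A\<^esub> b) (tens M N m' n')))))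
    (\<lambda>t. sweedler M N ((M \<otimes>\<^sub>k N) \<otimes>\<^sub>k A) t (\<lambda>m n.
       sweedler M A ((M \<otimes>\<^sub>k N) \<otimes>\<^sub>k A) (rcoact M m) (\<lambda>m' a.
         sweedler N A ((M \<otimes>\<^sub>k N) \<otimes>\<^sub>k A) (rcoact N n) (\<lambda>n' b.
           tens (M \<otimes>\<^sub>k N) A (tens M N m' n') (a \<otimes>\<^bsub>A\<^esub> b))))))"

definition ext2 :: "('k, 'u) tetramodule \<Rightarrow> ('k, 'u) tetramodule \<Rightarrow> ('k, 'u) tetramodule"
    (infixl \<open>\<boxtimes>\<^sub>2\<close> 70)
  where "M \<boxtimes>\<^sub>2 N = module.extend (M \<otimes>\<^sub>k N) (tetramodule.fields
    (\<lambda>a t. sweedler A A (M \<otimes>\<^sub>k N) (comult A a) (\<lambda>a1 a2.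
       sweedler M N (M \<otimes>\<^sub>k N) t (\<lambda>m n. tens M N (lact M a1 m) (lact N a2 n))))
    (\<lambda>t a. sweedler A A (M \<otimes>\<^sub>k N) (comult A a) (\<lambda>a1 a2.
       sweedler M N (M \<otimes>\<^sub>k N) t (\<lambda>m n. tens M N (ract M m a1) (ract N n a2))))
    (\<lambda>t. sweedler M N (A \<otimes>\<^sub>k M \<otimes>\<^sub>k N) t (\<lambda>m n.
       sweedler A M (A \<otimes>\<^sub>k M \<otimes>\<^sub>k N) (lcoact M m) (\<lambda>a m'.
         tens A (M \<otimes>\<^sub>k N) a (tens M N m' n))))
    (\<lambda>t. sweedler M N ((M \<otimes>\<^sub>k N) \<otimes>\<^sub>k A) t (\<lambda>m n.
       sweedler N A ((M \<otimes>\<^sub>k N) \<otimes>\<^sub>k A) (rcoact N n) (\<lambda>n' a.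
         tens (M \<otimes>\<^sub>k N) A (tens M N m n') a))))"

definition quot_tetra :: "('k, 'u) tetramodule \<Rightarrow> 'u set \<Rightarrow> ('k, 'u) tetramodule" where
  "quot_tetra B R = (let Q = quot_space B R; \<pi> = qrep B R in
     module.extend Q (tetramodule.fields
       (\<lambda>a x. \<pi> (lact B a x))
       (\<lambda>x a. \<pi> (ract B x a))
       (\<lambda>x. tmap A B A Q (\<lambda>a. a) \<pi> (lcoact B x))
       (\<lambda>x. tmap B A Q A \<pi> (\<lambda>a. a) (rcoact B x))))"

text \<open>The coactions on a subspace \<open>S\<close> of \<open>B\<close> are the lifts of those of \<open>B\<close> along the injections
  \<open>A \<otimes> S \<rightarrow> A \<otimes> B\<close> and \<open>S \<otimes> A \<rightarrow> B \<otimes> A\<close>.\<close>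

definition sub_tetra :: "('k, 'u) tetramodule \<Rightarrow> 'u set \<Rightarrow> ('k, 'u) tetramodule" where
  "sub_tetra B S = (let V = B\<lparr>carrier := S\<rparr> in
     V\<lparr>lcoact := (\<lambda>x. inv_into (carrier (A \<otimes>\<^sub>k V)) (tmap A V A B (\<lambda>a. a) (\<lambda>y. y)) (lcoact B x)),
       rcoact := (\<lambda>x. inv_into (carrier (V \<otimes>\<^sub>k A)) (tmap V A B A (\<lambda>y. y) (\<lambda>a. a)) (rcoact B x))\<rparr>)"

definition rel1 :: "('k, 'u) tetramodule \<Rightarrow> ('k, 'u) tetramodule \<Rightarrow> 'u set" where
  "rel1 M N = span_of (M \<boxtimes>\<^sub>1 N)
     {tens M N (ract M m a) n \<ominus>\<^bsub>M \<boxtimes>\<^sub>1 N\<^esub> tens M N m (lact N a n) | m a n.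
       m \<in> carrier M \<and> a \<in> carrier A \<and> n \<in> carrier N}"

definition int1 :: "('k, 'u) tetramodule \<Rightarrow> ('k, 'u) tetramodule \<Rightarrow> ('k, 'u) tetramodule"
    (infixl \<open>\<otimes>\<^sub>1\<close> 70)
  where "M \<otimes>\<^sub>1 N = quot_tetra (M \<boxtimes>\<^sub>1 N) (rel1 M N)"

definition proj1 :: "('k, 'u) tetramodule \<Rightarrow> ('k, 'u) tetramodule \<Rightarrow> 'u \<Rightarrow> 'u" where
  "proj1 M N = qrep (M \<boxtimes>\<^sub>1 N) (rel1 M N)"

definition int2 :: "('k, 'u) tetramodule \<Rightarrow> ('k, 'u) tetramodule \<Rightarrow> ('k, 'u) tetramodule"
    (infixl \<open>\<otimes>\<^sub>2\<close> 70)
  where "M \<otimes>\<^sub>2 N = sub_tetra (M \<boxtimes>\<^sub>2 N)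
    {t \<in> carrier (M \<boxtimes>\<^sub>2 N).
       tassoc M A N (tmap M N (M \<otimes>\<^sub>k A) N (rcoact M) (\<lambda>n. n) t)
       = tmap M N M (A \<otimes>\<^sub>k N) (\<lambda>m. m) (lcoact N) t}"

text \<open>In the following maps the points of \<open>M \<otimes>\<^sub>1 N\<close> are, as above, elements of \<open>M \<otimes> N\<close> representing
  their classes, and those of \<open>M \<otimes>\<^sub>2 N\<close> are elements of \<open>M \<otimes> N\<close>.\<close>

definition map1 ::
    "('k, 'u) tetramodule \<Rightarrow> ('k, 'u) tetramodule \<Rightarrow> ('k, 'u) tetramodule \<Rightarrow> ('k, 'u) tetramodule
      \<Rightarrow> ('u \<Rightarrow> 'u) \<Rightarrow> ('u \<Rightarrow> 'u) \<Rightarrow> 'u \<Rightarrow> 'u"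
  where "map1 M N M' N' f g t = proj1 M' N' (tmap M N M' N' f g t)"

definition tensor1 :: "(('k, 'u) tetramodule, ('k, 'u) tetra_mor) tensor_structure" where
  "tensor1 = \<lparr>tobj = (\<otimes>\<^sub>1),
     tmor = (\<lambda>f g. \<lparr>Dom = Dom f \<otimes>\<^sub>1 Dom g, Cod = Cod f \<otimes>\<^sub>1 Cod g,
       Map = restrict (map1 (Dom f) (Dom g) (Cod f) (Cod g) (Map f) (Map g))
               (carrier (Dom f \<otimes>\<^sub>1 Dom g))\<rparr>),
     assoc = (\<lambda>M N P. \<lparr>Dom = (M \<otimes>\<^sub>1 N) \<otimes>\<^sub>1 P, Cod = M \<otimes>\<^sub>1 (N \<otimes>\<^sub>1 P),
       Map = restrict (\<lambda>t.
           sweedler (M \<otimes>\<^sub>1 N) P (M \<otimes>\<^sub>1 (N \<otimes>\<^sub>1 P)) t (\<lambda>s p.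
             sweedler M N (M \<otimes>\<^sub>1 (N \<otimes>\<^sub>1 P)) s (\<lambda>m n.
               proj1 M (N \<otimes>\<^sub>1 P) (tens M (N \<otimes>\<^sub>1 P) m (proj1 N P (tens N P n p))))))
         (carrier ((M \<otimes>\<^sub>1 N) \<otimes>\<^sub>1 P))\<rparr>),
     lunit = (\<lambda>M. \<lparr>Dom = taut \<otimes>\<^sub>1 M, Cod = M,
       Map = restrict (\<lambda>t. sweedler A M M t (lact M)) (carrier (taut \<otimes>\<^sub>1 M))\<rparr>),
     runit = (\<lambda>M. \<lparr>Dom = M \<otimes>\<^sub>1 taut, Cod = M,
       Map = restrict (\<lambda>t. sweedler M A M t (ract M)) (carrier (M \<otimes>\<^sub>1 taut))\<rparr>)\<rparr>"

text \<open>The associativity isomorphism of \<open>\<otimes>\<^sub>2\<close> is the restriction of \<open>tassoc\<close> to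
  \<open>(M \<otimes>\<^sub>2 N) \<otimes>\<^sub>2 P \<subseteq> (M \<otimes>\<^sub>2 N) \<otimes> P \<subseteq> (M \<otimes> N) \<otimes> P\<close> and
  \<open>M \<otimes>\<^sub>2 (N \<otimes>\<^sub>2 P) \<subseteq> M \<otimes> (N \<otimes>\<^sub>2 P) \<subseteq> M \<otimes> (N \<otimes> P)\<close>; the second inclusion in each chain is an
  injection \<open>tmap\<close>.  The unit isomorphisms are the inverses of the coactions.\<close>

definition tensor2 :: "(('k, 'u) tetramodule, ('k, 'u) tetra_mor) tensor_structure" where
  "tensor2 = \<lparr>tobj = (\<otimes>\<^sub>2),
     tmor = (\<lambda>f g. \<lparr>Dom = Dom f \<otimes>\<^sub>2 Dom g, Cod = Cod f \<otimes>\<^sub>2 Cod g,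
       Map = restrict (tmap (Dom f) (Dom g) (Cod f) (Cod g) (Map f) (Map g))
               (carrier (Dom f \<otimes>\<^sub>2 Dom g))\<rparr>),
     assoc = (\<lambda>M N P. \<lparr>Dom = (M \<otimes>\<^sub>2 N) \<otimes>\<^sub>2 P, Cod = M \<otimes>\<^sub>2 (N \<otimes>\<^sub>2 P),
       Map = restrict (\<lambda>t.
           inv_into (carrier (M \<otimes>\<^sub>k (N \<otimes>\<^sub>2 P)))
             (tmap M (N \<otimes>\<^sub>2 P) M (N \<otimes>\<^sub>k P) (\<lambda>x. x) (\<lambda>y. y))
             (tassoc M N P (tmap (M \<otimes>\<^sub>2 N) P (M \<otimes>\<^sub>k N) P (\<lambda>x. x) (\<lambda>y. y) t)))
         (carrier ((M \<otimes>\<^sub>2 N) \<otimes>\<^sub>2 P))\<rparr>),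
     lunit = (\<lambda>M. \<lparr>Dom = taut \<otimes>\<^sub>2 M, Cod = M,
       Map = restrict (inv_into (carrier M) (lcoact M)) (carrier (taut \<otimes>\<^sub>2 M))\<rparr>),
     runit = (\<lambda>M. \<lparr>Dom = M \<otimes>\<^sub>2 taut, Cod = M,
       Map = restrict (inv_into (carrier M) (rcoact M)) (carrier (M \<otimes>\<^sub>2 taut))\<rparr>)\<rparr>"

definition phi0 ::
    "('k, 'u) tetramodule \<Rightarrow> ('k, 'u) tetramodule \<Rightarrow> ('k, 'u) tetramodule \<Rightarrow> ('k, 'u) tetramodule
      \<Rightarrow> 'u \<Rightarrow> 'u"
  where "phi0 M N P Q t = (let B = (M \<boxtimes>\<^sub>1 P) \<boxtimes>\<^sub>2 (N \<boxtimes>\<^sub>1 Q) in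
    sweedler (M \<boxtimes>\<^sub>2 N) (P \<boxtimes>\<^sub>2 Q) B t (\<lambda>x y.
      sweedler M N B x (\<lambda>m n.
        sweedler P Q B y (\<lambda>p q.
          tens (M \<boxtimes>\<^sub>1 P) (N \<boxtimes>\<^sub>1 Q) (tens M P m p) (tens N Q n q)))))"

text \<open>The restriction to \<open>(M \<otimes>\<^sub>2 N) \<otimes>\<^sub>1 (P \<otimes>\<^sub>2 Q)\<close> is the composition with the map
  \<open>(M \<otimes>\<^sub>2 N) \<otimes>\<^sub>1 (P \<otimes>\<^sub>2 Q) \<rightarrow> (M \<boxtimes>\<^sub>2 N) \<otimes>\<^sub>1 (P \<boxtimes>\<^sub>2 Q)\<close> induced by the inclusions, which need not be
  injective.\<close>

definition eta ::
    "('k, 'u) tetramodule \<Rightarrow> ('k, 'u) tetramodule \<Rightarrow> ('k, 'u) tetramodule \<Rightarrow> ('k, 'u) tetramodule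
      \<Rightarrow> ('k, 'u) tetra_mor"
  where "eta M N P Q = \<lparr>Dom = (M \<otimes>\<^sub>2 N) \<otimes>\<^sub>1 (P \<otimes>\<^sub>2 Q), Cod = (M \<otimes>\<^sub>1 P) \<otimes>\<^sub>2 (N \<otimes>\<^sub>1 Q),
    Map = restrict (\<lambda>t.
        tmap (M \<boxtimes>\<^sub>1 P) (N \<boxtimes>\<^sub>1 Q) (M \<otimes>\<^sub>1 P) (N \<otimes>\<^sub>1 Q) (proj1 M P) (proj1 N Q)
          (phi0 M N P Q
            (map1 (M \<otimes>\<^sub>2 N) (P \<otimes>\<^sub>2 Q) (M \<boxtimes>\<^sub>2 N) (P \<boxtimes>\<^sub>2 Q) (\<lambda>x. x) (\<lambda>y. y) t)))
      (carrier ((M \<otimes>\<^sub>2 N) \<otimes>\<^sub>1 (P \<otimes>\<^sub>2 Q)))\<rparr>"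

end

end

end

theory Submission
  imports Defs
begin

text \<open>All maps are described by \<open>sweedler\<close>, which extends a bilinear \<open>f\<close> to the tensor product, so
  that an equation between maps can be checked on pure tensors; the remaining steps are
  (co)associativity and exchanging two Sweedler sums.  The product \<open>\<otimes>\<^sub>1\<close> is spanned by the
  classes of pure tensors.  The product \<open>\<otimes>\<^sub>2\<close> is an equaliser, and since tensoring over a field
  preserves equalisers and injections, both triple products embed into \<open>M \<otimes> N \<otimes> P\<close> with the
  same image, which gives the associativity isomorphism.  On \<open>s = \<Sum> m \<otimes> n\<close> and \<open>r = \<Sum> p \<otimes> q\<close> the
  map \<open>\<eta>\<close> sends the class of \<open>s \<otimes> r\<close> to \<open>\<Sum> [m \<otimes> p] \<otimes> [n \<otimes> q]\<close>, and each axiom then compares two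
  iterated Sweedler sums that agree up to the order of summation.\<close>

section \<open>Existence of tensor products\<close>

text \<open>The tensor product is picked by choice, so nothing is known of its elements beyond the
  universal property: every computation goes through linear extensions, and existence has to be
  settled first, inside the one type \<open>'u\<close>. The two internal products call for opposite
  methods. Points of \<open>M \<otimes>\<^sub>1 N\<close> are chosen representatives, and its
  operations are not those of \<open>M \<otimes> N\<close>; a map out of it is linear only if its
  summand is balanced over \<open>A\<close>, which has to be established for each map. Points of
  \<open>M \<otimes>\<^sub>2 N\<close> are honest tensors, but its coactions are preimages under
  injections such as \<open>A \<otimes> S \<rightarrow> A \<otimes> B\<close>; that these exist and
  are unique is where the field enters, through linear retractions onto subspaces. Equations out of
  \<open>\<otimes>\<^sub>1\<close> are thus tested on classes, equations into
  \<open>\<otimes>\<^sub>2\<close> after embedding. Since \<eta> starts at a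
  \<open>\<otimes>\<^sub>1\<close> and ends in a \<open>\<otimes>\<^sub>2\<close>, each method is
  available at the end where it is wanted.\<close>

lemma inj_lists_into_infinite:
  assumes inf: "infinite (UNIV :: 'u set)"
  shows "\<exists>code :: ('u \<times> 'u) list \<Rightarrow> 'u. inj code"
proof -
  have "ordIso2 (card_of ((UNIV::'u set) \<times> (UNIV::'u set))) (card_of (UNIV::'u set))"
    using card_of_Times_same_infinite[OF inf] .
  then obtain p :: "'u \<times> 'u \<Rightarrow> 'u" where "bij_betw p (UNIV \<times> UNIV) UNIV"
    using card_of_ordIso by blast
  then have p: "p x = p y \<longleftrightarrow> x = y" for x y
    by (metis UNIV_Times_UNIV bij_is_inj inj_eq)
  obtain n :: "nat \<Rightarrow> 'u" where n: "inj n"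
    using inf infinite_countable_subset by blast
  define enc where "enc = rec_list (n 0) (\<lambda>x _ y. p (p x, y))"
  have enc: "enc [] = n 0" "enc (x # xs) = p (p x, enc xs)" for x xs
    by (simp_all add: enc_def)
  \<comment> \<open>The end marker \<open>n 0\<close> may itself be the code of a pair, so
    injectivity of \<open>enc\<close> is claimed only among lists of equal length; for this reason
    the length is paired in at the end.\<close>
  have "length xs = length ys \<Longrightarrow> enc xs = enc ys \<Longrightarrow> xs = ys" for xs ys
    by (induction xs ys rule: list_induct2) (auto simp: enc p)
  then have "inj (\<lambda>xs. p (n (length xs), enc xs))"
    by (auto simp: inj_def p inj_eq[OF n])
  then show ?thesis by blast
qed

section \<open>Linear and bilinear maps, formal sums\<close>

lemma linear_mapI:
  assumes "\<And>x. x \<in> carrier V \<Longrightarrow> f x \<in> carrier W"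
    and "\<And>x y. x \<in> carrier V \<Longrightarrow> y \<in> carrier V \<Longrightarrow> f (x \<oplus>\<^bsub>V\<^esub> y) = f x \<oplus>\<^bsub>W\<^esub> f y"
    and "\<And>c x. c \<in> carrier K \<Longrightarrow> x \<in> carrier V \<Longrightarrow> f (c \<odot>\<^bsub>V\<^esub> x) = c \<odot>\<^bsub>W\<^esub> f x"
  shows "linear_map K V W f"
  using assms by (simp add: linear_map_def)

lemma linear_mapD:
  assumes "linear_map K V W f"
  shows "x \<in> carrier V \<Longrightarrow> f x \<in> carrier W"
    and "x \<in> carrier V \<Longrightarrow> y \<in> carrier V \<Longrightarrow> f (x \<oplus>\<^bsub>V\<^esub> y) = f x \<oplus>\<^bsub>W\<^esub> f y"
    and "c \<in> carrier K \<Longrightarrow> x \<in> carrier V \<Longrightarrow> f (c \<odot>\<^bsub>V\<^esub> x) = c \<odot>\<^bsub>W\<^esub> f x"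
  using assms by (auto simp: linear_map_def)

lemma linear_map_cong:
  assumes "module K V" "linear_map K V W f" "\<And>x. x \<in> carrier V \<Longrightarrow> f x = g x"
  shows "linear_map K V W g"
proof -
  interpret V: module K V by fact
  show ?thesis using assms(2,3) by (auto simp: linear_map_def Pi_def)
qed

lemma bilinear_mapI:
  assumes "\<And>v. v \<in> carrier V \<Longrightarrow> linear_map K W P (f v)"
    and "\<And>w. w \<in> carrier W \<Longrightarrow> linear_map K V P (\<lambda>v. f v w)"
  shows "bilinear_map K V W P f"
  using assms by (simp add: bilinear_map_def)

lemma bilinear_mapD:
  assumes "bilinear_map K V W P f"
  shows "v \<in> carrier V \<Longrightarrow> linear_map K W P (f v)"
    and "w \<in> carrier W \<Longrightarrow> linear_map K V P (\<lambda>v. f v w)"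
    and "v \<in> carrier V \<Longrightarrow> w \<in> carrier W \<Longrightarrow> f v w \<in> carrier P"
  using assms by (auto simp: bilinear_map_def linear_map_def)

lemma linear_map_minus:
  assumes "module K V" "module K W" "linear_map K V W f" "x \<in> carrier V"
  shows "f (\<ominus>\<^bsub>V\<^esub> x) = \<ominus>\<^bsub>W\<^esub> f x"
proof -
  interpret V: module K V by fact
  interpret W: module K W by fact
  have "f (\<ominus>\<^bsub>V\<^esub> x) = f ((\<ominus>\<^bsub>K\<^esub> \<one>\<^bsub>K\<^esub>) \<odot>\<^bsub>V\<^esub> x)"
    using assms(4) by (simp add: V.smult_l_minus)
  also have "\<dots> = (\<ominus>\<^bsub>K\<^esub> \<one>\<^bsub>K\<^esub>) \<odot>\<^bsub>W\<^esub> f x"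
    using assms(4) linear_mapD[OF assms(3)] by simp
  finally show ?thesis
    using assms(4) linear_mapD[OF assms(3)] by (simp add: W.smult_l_minus)
qed

lemma linear_map_zero:
  assumes "module K V" "module K W" "linear_map K V W f"
  shows "f \<zero>\<^bsub>V\<^esub> = \<zero>\<^bsub>W\<^esub>"
proof -
  interpret V: module K V by fact
  interpret W: module K W by fact
  have "f (\<zero>\<^bsub>K\<^esub> \<odot>\<^bsub>V\<^esub> \<zero>\<^bsub>V\<^esub>) = \<zero>\<^bsub>K\<^esub> \<odot>\<^bsub>W\<^esub> f \<zero>\<^bsub>V\<^esub>"
    by (rule linear_mapD(3)[OF assms(3)]) auto
  then show ?thesis
    using linear_mapD(1)[OF assms(3)] by simp
qed

text \<open>A list of pairs stands for a sum of pure tensors, and this is the value that the linear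
  extension of \<open>f\<close> must take on it. Scalars are absorbed into the first entries of the
  pairs, and negatives are the scalar -1.\<close>

definition formal_sum :: "('k, 'u, 'p) module_scheme \<Rightarrow> ('u \<Rightarrow> 'u \<Rightarrow> 'u) \<Rightarrow> ('u \<times> 'u) list \<Rightarrow> 'u" where
  "formal_sum P f l = foldr (\<lambda>(v, w) y. f v w \<oplus>\<^bsub>P\<^esub> y) l \<zero>\<^bsub>P\<^esub>"

context
  fixes K V W P f
  assumes P: "module K P" and V: "module K V" and f: "bilinear_map K V W P f"
begin

interpretation P: module K P by (rule P)
interpretation V: module K V by (rule V)

lemma formal_sum_Nil [simp]: "formal_sum P f [] = \<zero>\<^bsub>P\<^esub>"
  and formal_sum_Cons [simp]: "formal_sum P f (p # l) = f (fst p) (snd p) \<oplus>\<^bsub>P\<^esub> formal_sum P f l"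
  by (auto simp: formal_sum_def split: prod.split)

lemma formal_sum_closed:
  "l \<in> lists (carrier V \<times> carrier W) \<Longrightarrow> formal_sum P f l \<in> carrier P"
  by (induction l) (auto simp: bilinear_mapD[OF f])

lemma formal_sum_append:
  "l \<in> lists (carrier V \<times> carrier W) \<Longrightarrow> l' \<in> lists (carrier V \<times> carrier W) \<Longrightarrow>
    formal_sum P f (l @ l') = formal_sum P f l \<oplus>\<^bsub>P\<^esub> formal_sum P f l'"
proof (induction l)
  case (Cons p l)
  then show ?case
    by (cases p) (simp add: P.M.a_assoc formal_sum_closed bilinear_mapD[OF f])
qed (simp add: formal_sum_closed)

lemma formal_sum_smult:
  "l \<in> lists (carrier V \<times> carrier W) \<Longrightarrow> c \<in> carrier K \<Longrightarrow>
    formal_sum P f (map (\<lambda>(v, w). (c \<odot>\<^bsub>V\<^esub> v, w)) l) = c \<odot>\<^bsub>P\<^esub> formal_sum P f l"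
proof (induction l)
  case (Cons p l)
  then show ?case
    using linear_mapD(3)[OF bilinear_mapD(2)[OF f]] bilinear_mapD(3)[OF f] formal_sum_closed[of l]
    by (auto simp: P.smult_r_distr)
qed simp

end

text \<open>Finite lists of pairs, two lists being identified if every bilinear map takes the same value on
  them; infinity of \<open>'u\<close> allows the classes to be coded in \<open>'u\<close>.\<close>

lemma tensor_exists:
  fixes K :: "('k, 'c) ring_scheme" and V :: "('k, 'u, 'v) module_scheme" and W :: "('k, 'u, 'w) module_scheme"
  assumes inf: "infinite (UNIV :: 'u set)" and V: "module K V" and W: "module K W"
  shows "\<exists>T \<tau>. is_tensor K V W T \<tau>"
proof -
  interpret V: module K V by (rule V)
  interpret W: module K W by (rule W)
  define L where "L = lists (carrier V \<times> carrier W)"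
  define sc where "sc c = map (\<lambda>(v, w). (c \<odot>\<^bsub>V\<^esub> v, w :: 'u))" for c
  define test where "test P f \<longleftrightarrow> module K P \<and> bilinear_map K V W P f" for P :: "('k, 'u) module" and f
  \<comment> \<open>The congruence is the one dictated by the universal property itself. This makes
    the existence of the linear extension immediate; the price is that the module laws for the
    quotient are verified by evaluating both lists under an arbitrary test map.\<close>
  define eqv where "eqv l l' \<longleftrightarrow> (\<forall>(P :: ('k, 'u) module) f. test P f \<longrightarrow>
    formal_sum P f l = formal_sum P f l')" for l l'
  have [simp]: "sc c l \<in> L" if "c \<in> carrier K" "l \<in> L" for c l
    using that(2) by (induction l) (auto simp: L_def sc_def that(1))
  have L [simp]: "[] \<in> L" "l \<in> L \<Longrightarrow> l' \<in> L \<Longrightarrow> l @ l' \<in> L"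
    "v \<in> carrier V \<Longrightarrow> w \<in> carrier W \<Longrightarrow> l \<in> L \<Longrightarrow> (v, w) # l \<in> L" for l l' v w
    by (auto simp: L_def)
  have fs: "formal_sum P f [] = \<zero>\<^bsub>P\<^esub>"
    "formal_sum P f (p # l) = f (fst p) (snd p) \<oplus>\<^bsub>P\<^esub> formal_sum P f l"
    "l \<in> L \<Longrightarrow> formal_sum P f l \<in> carrier P"
    "l \<in> L \<Longrightarrow> l' \<in> L \<Longrightarrow> formal_sum P f (l @ l') = formal_sum P f l \<oplus>\<^bsub>P\<^esub> formal_sum P f l'"
    "l \<in> L \<Longrightarrow> c \<in> carrier K \<Longrightarrow> formal_sum P f (sc c l) = c \<odot>\<^bsub>P\<^esub> formal_sum P f l"
    if "test P f" for P :: "('k, 'u) module" and f l l' c p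
  proof -
    have P: "module K P" and f: "bilinear_map K V W P f"
      using that by (simp_all add: test_def)
    show "formal_sum P f [] = \<zero>\<^bsub>P\<^esub>"
      "formal_sum P f (p # l) = f (fst p) (snd p) \<oplus>\<^bsub>P\<^esub> formal_sum P f l"
      "l \<in> L \<Longrightarrow> formal_sum P f l \<in> carrier P"
      "l \<in> L \<Longrightarrow> l' \<in> L \<Longrightarrow> formal_sum P f (l @ l') = formal_sum P f l \<oplus>\<^bsub>P\<^esub> formal_sum P f l'"
      "l \<in> L \<Longrightarrow> c \<in> carrier K \<Longrightarrow> formal_sum P f (sc c l) = c \<odot>\<^bsub>P\<^esub> formal_sum P f l"
      unfolding L_def sc_def
      by (rule formal_sum_Nil[OF P V f] formal_sum_Cons[OF P V f] formal_sum_closed[OF P V f]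
        formal_sum_append[OF P V f] formal_sum_smult[OF P V f]; assumption)+
  qed
  obtain code :: "('u \<times> 'u) list \<Rightarrow> 'u" where code: "inj code"
    using inj_lists_into_infinite[OF inf] by blast
  \<comment> \<open>Equivalent lists \<open>l\<close>, \<open>l'\<close> give the same predicate
    \<open>eqv l = eqv l'\<close>, so the choice returns the same representative for both;
    \<open>code\<close> then places it in \<open>'u\<close>.\<close>
  define cls where "cls l = code (SOME l'. l' \<in> L \<and> eqv l l')" for l
  have cls_eq: "cls l = cls l' \<longleftrightarrow> eqv l l'" if "l \<in> L" "l' \<in> L" for l l'
  proof
    assume "eqv l l'"
    then have "eqv l = eqv l'" by (auto simp: eqv_def fun_eq_iff)
    then show "cls l = cls l'" by (simp add: cls_def)
  next
    assume "cls l = cls l'"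
    then have "(SOME m. m \<in> L \<and> eqv l m) = (SOME m. m \<in> L \<and> eqv l' m)" (is "?a = ?b")
      using code by (auto simp: cls_def inj_def)
    moreover have "eqv l ?a"
      by (rule someI2[of _ l]) (use that in \<open>auto simp: eqv_def\<close>)
    moreover have "eqv l' ?b"
      by (rule someI2[of _ l']) (use that in \<open>auto simp: eqv_def\<close>)
    ultimately show "eqv l l'" by (simp add: eqv_def)
  qed
  define rp where "rp x = (SOME l. l \<in> L \<and> cls l = x)" for x
  have rp: "rp (cls l) \<in> L" "cls (rp (cls l)) = cls l" if "l \<in> L" for l
    using someI[of "\<lambda>m. m \<in> L \<and> cls m = cls l" l] that by (simp_all add: rp_def)
  have rp_eqv: "formal_sum P f (rp (cls l)) = formal_sum P f l" if "l \<in> L" "test P f" for P f l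
    using rp[OF that(1)] that cls_eq by (auto simp: eqv_def)
  define T :: "('k, 'u) module" where "T = \<lparr>carrier = cls ` L, mult = undefined, one = undefined,
    zero = cls [], add = (\<lambda>x y. cls (rp x @ rp y)), smult = (\<lambda>c x. cls (sc c (rp x)))\<rparr>"
  have T: "carrier T = cls ` L" "\<zero>\<^bsub>T\<^esub> = cls []" by (simp_all add: T_def)
  have T_add: "cls l \<oplus>\<^bsub>T\<^esub> cls l' = cls (l @ l')" if "l \<in> L" "l' \<in> L" for l l'
    using that by (simp add: T_def cls_eq rp) (simp add: eqv_def fs rp_eqv rp)
  have T_smult: "c \<odot>\<^bsub>T\<^esub> cls l = cls (sc c l)" if "c \<in> carrier K" "l \<in> L" for c l
    using that by (simp add: T_def cls_eq rp) (simp add: eqv_def fs rp_eqv rp)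
  have clsI: "cls l = cls l'" if "l \<in> L" "l' \<in> L"
      "\<And>(P :: ('k, 'u) module) f. test P f \<Longrightarrow> module K P \<Longrightarrow> formal_sum P f l = formal_sum P f l'" for l l'
    using that by (auto simp: cls_eq eqv_def test_def)
  have modT: "module K T"
  proof (rule moduleI)
    show "cring K" by (rule V.is_cring)
    show "abelian_group T"
    proof (rule abelian_groupI)
      fix x y z assume "x \<in> carrier T" "y \<in> carrier T" "z \<in> carrier T"
      then obtain l m n where *: "x = cls l" "y = cls m" "z = cls n" "l \<in> L" "m \<in> L" "n \<in> L"
        by (auto simp: T)
      show "x \<oplus>\<^bsub>T\<^esub> y \<oplus>\<^bsub>T\<^esub> z = x \<oplus>\<^bsub>T\<^esub> (y \<oplus>\<^bsub>T\<^esub> z)"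
        by (simp add: * T_add)
    next
      fix x y assume "x \<in> carrier T" "y \<in> carrier T"
      then obtain l m where *: "x = cls l" "y = cls m" "l \<in> L" "m \<in> L"
        by (auto simp: T)
      show "x \<oplus>\<^bsub>T\<^esub> y \<in> carrier T"
        by (simp add: * T_add) (simp add: T *)
      have "cls (l @ m) = cls (m @ l)"
      proof (rule clsI)
        fix P :: "('k, 'u) module" and f assume "test P f" "module K P"
        then interpret P: module K P by simp
        show "formal_sum P f (l @ m) = formal_sum P f (m @ l)"
          using * fs[OF \<open>test P f\<close>] P.M.a_comm by simp
      qed (use * in auto)
      then show "x \<oplus>\<^bsub>T\<^esub> y = y \<oplus>\<^bsub>T\<^esub> x"
        by (simp add: * T_add)
    next
      show "\<zero>\<^bsub>T\<^esub> \<in> carrier T" by (simp add: T)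
    next
      fix x assume "x \<in> carrier T"
      then obtain l where *: "x = cls l" "l \<in> L" by (auto simp: T)
      show "\<zero>\<^bsub>T\<^esub> \<oplus>\<^bsub>T\<^esub> x = x"
        by (simp add: * T T_add)
      \<comment> \<open>Lists have no formal negatives; the inverse of a class is obtained by
        scaling with -1.\<close>
      have "cls (sc (\<ominus>\<^bsub>K\<^esub> \<one>\<^bsub>K\<^esub>) l @ l) = cls []"
      proof (rule clsI)
        fix P :: "('k, 'u) module" and f assume "test P f" "module K P"
        then interpret P: module K P by simp
        show "formal_sum P f (sc (\<ominus>\<^bsub>K\<^esub> \<one>\<^bsub>K\<^esub>) l @ l) = formal_sum P f []"
          using * fs[OF \<open>test P f\<close>] by (simp add: P.smult_l_minus P.M.l_neg)
      qed (use * in auto)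
      then have "cls (sc (\<ominus>\<^bsub>K\<^esub> \<one>\<^bsub>K\<^esub>) l) \<oplus>\<^bsub>T\<^esub> x = \<zero>\<^bsub>T\<^esub>"
        by (simp add: * T_add T)
      then show "\<exists>y\<in>carrier T. y \<oplus>\<^bsub>T\<^esub> x = \<zero>\<^bsub>T\<^esub>"
        using * by (intro bexI[of _ "cls (sc (\<ominus>\<^bsub>K\<^esub> \<one>\<^bsub>K\<^esub>) l)"]) (auto simp: T)
    qed
  next
    fix a x assume a: "a \<in> carrier K" "x \<in> carrier T"
    then obtain l where *: "x = cls l" "l \<in> L" by (auto simp: T)
    show "a \<odot>\<^bsub>T\<^esub> x \<in> carrier T"
      using a by (simp add: * T_smult) (simp add: T *)
    fix y assume "y \<in> carrier T"
    then obtain m where m: "y = cls m" "m \<in> L" by (auto simp: T)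
    have "cls (sc a (l @ m)) = cls (sc a l @ sc a m)"
      by (simp add: sc_def)
    then show "a \<odot>\<^bsub>T\<^esub> (x \<oplus>\<^bsub>T\<^esub> y) = a \<odot>\<^bsub>T\<^esub> x \<oplus>\<^bsub>T\<^esub> a \<odot>\<^bsub>T\<^esub> y"
      using a by (simp add: * m T_add T_smult)
  next
    fix a b x assume a: "a \<in> carrier K" "b \<in> carrier K" "x \<in> carrier T"
    then obtain l where *: "x = cls l" "l \<in> L" by (auto simp: T)
    have "cls (sc (a \<oplus>\<^bsub>K\<^esub> b) l) = cls (sc a l @ sc b l)"
    proof (rule clsI)
      fix P :: "('k, 'u) module" and f assume "test P f" "module K P"
      then interpret P: module K P by simp
      show "formal_sum P f (sc (a \<oplus>\<^bsub>K\<^esub> b) l) = formal_sum P f (sc a l @ sc b l)"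
        using * a fs[OF \<open>test P f\<close>] by (simp add: P.smult_l_distr)
    qed (use * a in auto)
    then show "(a \<oplus>\<^bsub>K\<^esub> b) \<odot>\<^bsub>T\<^esub> x = a \<odot>\<^bsub>T\<^esub> x \<oplus>\<^bsub>T\<^esub> b \<odot>\<^bsub>T\<^esub> x"
      using a by (simp add: * T_add T_smult)
    have "cls (sc (a \<otimes>\<^bsub>K\<^esub> b) l) = cls (sc a (sc b l))"
    proof (rule clsI)
      fix P :: "('k, 'u) module" and f assume "test P f" "module K P"
      then interpret P: module K P by simp
      show "formal_sum P f (sc (a \<otimes>\<^bsub>K\<^esub> b) l) = formal_sum P f (sc a (sc b l))"
        using * a fs[OF \<open>test P f\<close>] by (simp add: P.smult_assoc1)
    qed (use * a in auto)
    then show "a \<otimes>\<^bsub>K\<^esub> b \<odot>\<^bsub>T\<^esub> x = a \<odot>\<^bsub>T\<^esub> (b \<odot>\<^bsub>T\<^esub> x)"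
      using a by (simp add: * T_smult)
  next
    fix x assume "x \<in> carrier T"
    then obtain l where *: "x = cls l" "l \<in> L" by (auto simp: T)
    have "cls (sc \<one>\<^bsub>K\<^esub> l) = cls l"
    proof (rule clsI)
      fix P :: "('k, 'u) module" and f assume "test P f" "module K P"
      then interpret P: module K P by simp
      show "formal_sum P f (sc \<one>\<^bsub>K\<^esub> l) = formal_sum P f l"
        using * fs[OF \<open>test P f\<close>] by simp
    qed (use * in auto)
    then show "\<one>\<^bsub>K\<^esub> \<odot>\<^bsub>T\<^esub> x = x"
      by (simp add: * T_smult)
  qed
  define \<tau> where "\<tau> v w = cls [(v, w)]" for v w
  have bil: "bilinear_map K V W T \<tau>"
  proof (intro bilinear_mapI linear_mapI)
    fix v w assume v: "v \<in> carrier V" and w: "w \<in> carrier W"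
    show "\<tau> v w \<in> carrier T" "\<tau> v w \<in> carrier T"
      using v w by (simp_all add: T \<tau>_def)
    fix c assume c: "c \<in> carrier K"
    show "\<tau> (c \<odot>\<^bsub>V\<^esub> v) w = c \<odot>\<^bsub>T\<^esub> \<tau> v w"
      using v w c by (simp add: \<tau>_def T_smult) (simp add: sc_def)
    have "cls [(v, c \<odot>\<^bsub>W\<^esub> w)] = cls (sc c [(v, w)])"
    proof (rule clsI)
      fix P :: "('k, 'u) module" and f assume "test P f" "module K P"
      then interpret P: module K P by simp
      have "bilinear_map K V W P f" using \<open>test P f\<close> by (simp add: test_def)
      note f = bilinear_mapD[OF this] linear_mapD[OF bilinear_mapD(1)[OF this]]
      show "formal_sum P f [(v, c \<odot>\<^bsub>W\<^esub> w)] = formal_sum P f (sc c [(v, w)])"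
        using v w c fs[OF \<open>test P f\<close>] by (simp add: f)
    qed (use v w c in auto)
    then show "\<tau> v (c \<odot>\<^bsub>W\<^esub> w) = c \<odot>\<^bsub>T\<^esub> \<tau> v w"
      using v w c by (simp add: \<tau>_def T_smult)
  next
    fix v w w' assume v: "v \<in> carrier V" and w: "w \<in> carrier W" "w' \<in> carrier W"
    have "cls [(v, w \<oplus>\<^bsub>W\<^esub> w')] = cls [(v, w), (v, w')]"
    proof (rule clsI)
      fix P :: "('k, 'u) module" and f assume "test P f" "module K P"
      then interpret P: module K P by simp
      have "bilinear_map K V W P f" using \<open>test P f\<close> by (simp add: test_def)
      note f = bilinear_mapD[OF this] linear_mapD[OF bilinear_mapD(1)[OF this]]
      show "formal_sum P f [(v, w \<oplus>\<^bsub>W\<^esub> w')] = formal_sum P f [(v, w), (v, w')]"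
        using v w fs[OF \<open>test P f\<close>] by (simp add: f)
    qed (use v w in auto)
    then show "\<tau> v (w \<oplus>\<^bsub>W\<^esub> w') = \<tau> v w \<oplus>\<^bsub>T\<^esub> \<tau> v w'"
      using v w by (simp add: \<tau>_def T_add)
  next
    fix v v' w assume v: "v \<in> carrier V" "v' \<in> carrier V" and w: "w \<in> carrier W"
    have "cls [(v \<oplus>\<^bsub>V\<^esub> v', w)] = cls [(v, w), (v', w)]"
    proof (rule clsI)
      fix P :: "('k, 'u) module" and f assume "test P f" "module K P"
      then interpret P: module K P by simp
      have "bilinear_map K V W P f" using \<open>test P f\<close> by (simp add: test_def)
      note f = bilinear_mapD[OF this] linear_mapD[OF bilinear_mapD(2)[OF this]]
      show "formal_sum P f [(v \<oplus>\<^bsub>V\<^esub> v', w)] = formal_sum P f [(v, w), (v', w)]"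
        using v w fs[OF \<open>test P f\<close>] by (simp add: f)
    qed (use v w in auto)
    then show "\<tau> (v \<oplus>\<^bsub>V\<^esub> v') w = \<tau> v w \<oplus>\<^bsub>T\<^esub> \<tau> v' w"
      using v w by (simp add: \<tau>_def T_add)
  qed
  have "is_tensor K V W T \<tau>"
    unfolding is_tensor_def
  proof (intro conjI modT bil allI impI)
    fix P :: "('k, 'u) module" and f assume Pf: "module K P \<and> bilinear_map K V W P f"
    then have test: "test P f" by (simp add: test_def)
    interpret P: module K P using Pf by simp
    note f = bilinear_mapD[OF conjunct2[OF Pf]]
    \<comment> \<open>The value is independent of the representative because \<open>P\<close> and
      \<open>f\<close> are among the tests that define \<open>eqv\<close>.\<close>
    define F where "F = restrict (\<lambda>x. formal_sum P f (rp x)) (carrier T)"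
    have F: "F (cls l) = formal_sum P f l" if "l \<in> L" for l
      using that by (simp add: F_def T rp_eqv[OF _ test])
    show "\<exists>!F. F \<in> extensional (carrier T) \<and> linear_map K T P F \<and>
            (\<forall>v \<in> carrier V. \<forall>w \<in> carrier W. F (\<tau> v w) = f v w)"
    proof (rule ex1I[of _ F], intro conjI ballI)
      show "F \<in> extensional (carrier T)" by (simp add: F_def)
      show "linear_map K T P F"
        by (rule linear_mapI) (auto simp: T F fs[OF test] T_add T_smult)
      show "F (\<tau> v w) = f v w" if "v \<in> carrier V" "w \<in> carrier W" for v w
        using that by (simp add: \<tau>_def F fs[OF test] f)
    next
      fix G assume G: "G \<in> extensional (carrier T) \<and> linear_map K T P G \<and>
            (\<forall>v \<in> carrier V. \<forall>w \<in> carrier W. G (\<tau> v w) = f v w)"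
      \<comment> \<open>A class is a finite sum of pure tensors, so induction on a list shows that
        \<open>G\<close> is determined by its values on them.\<close>
      have "G (cls l) = F (cls l)" if "l \<in> L" for l
        using that
      proof (induction l)
        case Nil
        have "G \<zero>\<^bsub>T\<^esub> = \<zero>\<^bsub>P\<^esub>" using linear_map_zero[OF modT] G Pf by blast
        then show ?case by (simp add: F fs[OF test] T)
      next
        case (Cons p l)
        obtain v w where p: "p = (v, w)" by force
        with Cons have l: "v \<in> carrier V" "w \<in> carrier W" "l \<in> L" by (auto simp: L_def)
        then have "G (cls (p # l)) = G (\<tau> v w \<oplus>\<^bsub>T\<^esub> cls l)"
          by (simp add: \<tau>_def T_add p)
        also have "\<dots> = f v w \<oplus>\<^bsub>P\<^esub> G (cls l)"
          using G l bilinear_mapD(3)[OF bil] by (subst linear_mapD(2)[of K T P G]) (auto simp: T)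
        finally show ?case using Cons l by (simp add: F fs[OF test] p)
      qed
      then show "G = F"
        using G by (intro extensionalityI[of _ "carrier T"]) (auto simp: F_def T)
    qed
  qed
  then show ?thesis by blast
qed

section \<open>Complements and equalisers\<close>

lemma (in abelian_group) diff_eq_zero_iff:
  assumes "x \<in> carrier G" "y \<in> carrier G"
  shows "x \<ominus> y = \<zero> \<longleftrightarrow> x = y"
proof
  assume "x \<ominus> y = \<zero>"
  then have "\<ominus> (\<ominus> y) = x"
    using assms by (intro minus_equality) (simp_all add: minus_eq)
  then show "x = y" using assms by simp
qed (use assms in \<open>simp add: minus_eq r_neg\<close>)

text \<open>Zorn's lemma gives a maximal \<open>W\<close> meeting \<open>S\<close> only in zero. If
  some \<open>v\<close> were outside \<open>S + W\<close>, adjoining the line through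
  \<open>v\<close> to \<open>W\<close> would still meet \<open>S\<close> only in zero, against
  maximality.\<close>

lemma (in module) submodule_complement:
  assumes R: "field R" and S: "submodule S R M"
  shows "\<exists>W. submodule W R M \<and> S \<inter> W = {\<zero>\<^bsub>M\<^esub>} \<and>
    (\<forall>v \<in> carrier M. \<exists>s \<in> S. \<exists>w \<in> W. v = s \<oplus>\<^bsub>M\<^esub> w)"
proof -
  interpret R: field R by fact
  note sS = submoduleE[OF S]
  define F where "F = {W. submodule W R M \<and> S \<inter> W = {\<zero>\<^bsub>M\<^esub>}}"
  have sub0: "submodule {\<zero>\<^bsub>M\<^esub>} R M"
    by (rule submoduleI) auto
  have S0: "\<zero>\<^bsub>M\<^esub> \<in> S"
    using subgroup.one_closed[OF submodule.axioms(1)[OF S]] by simp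
  have "\<exists>W\<in>F. \<forall>X\<in>F. W \<subseteq> X \<longrightarrow> X = W"
  proof (rule subset_Zorn_nonempty)
    show "F \<noteq> {}" using sub0 S0 by (auto simp: F_def)
    fix C assume C: "C \<noteq> {}" "subset.chain F C"
    have CF: "submodule X R M" "S \<inter> X = {\<zero>\<^bsub>M\<^esub>}" if "X \<in> C" for X
      using C that by (auto simp: subset.chain_def F_def)
    note CE = submoduleE[OF CF(1)]
    have "submodule (\<Union>C) R M"
    proof (rule submoduleI)
      show "\<zero>\<^bsub>M\<^esub> \<in> \<Union>C" using C(1) CF(2) by blast
      show "\<Union>C \<subseteq> carrier M" using CE(1) by blast
      show "\<ominus>\<^bsub>M\<^esub> a \<in> \<Union>C" if "a \<in> \<Union>C" for a using that CE(3) by blast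
      show "c \<odot>\<^bsub>M\<^esub> a \<in> \<Union>C" if "c \<in> carrier R" "a \<in> \<Union>C" for a c using that CE(4) by blast
      fix a b assume "a \<in> \<Union>C" "b \<in> \<Union>C"
      then obtain X Y where XY: "X \<in> C" "Y \<in> C" "a \<in> X" "b \<in> Y" by blast
      then have "X \<subseteq> Y \<or> Y \<subseteq> X"
        using C(2) by (auto simp: subset.chain_def)
      then show "a \<oplus>\<^bsub>M\<^esub> b \<in> \<Union>C" using XY CE(5) by blast
    qed
    then show "\<Union>C \<in> F" using C(1) CF(2) by (auto simp: F_def)
  qed
  then obtain W where W: "submodule W R M" "S \<inter> W = {\<zero>\<^bsub>M\<^esub>}"
    and max: "\<And>X. submodule X R M \<Longrightarrow> S \<inter> X = {\<zero>\<^bsub>M\<^esub>} \<Longrightarrow> W \<subseteq> X \<Longrightarrow> X = W"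
    by (auto simp: F_def)
  note sW = submoduleE[OF W(1)]
  have W0: "\<zero>\<^bsub>M\<^esub> \<in> W" using W(2) by blast
  have inS: "x \<in> carrier M" if "x \<in> S" for x using that sS(1) by blast
  have inW: "x \<in> carrier M" if "x \<in> W" for x using that sW(1) by blast
  have "\<exists>s \<in> S. \<exists>w \<in> W. v = s \<oplus>\<^bsub>M\<^esub> w" if v: "v \<in> carrier M" for v
  proof (rule ccontr)
    assume no: "\<not> ?thesis"
    define X where "X = {w \<oplus>\<^bsub>M\<^esub> c \<odot>\<^bsub>M\<^esub> v | w c. w \<in> W \<and> c \<in> carrier R}"
    have XI: "w \<oplus>\<^bsub>M\<^esub> c \<odot>\<^bsub>M\<^esub> v \<in> X" if "w \<in> W" "c \<in> carrier R" for w c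
      using that by (auto simp: X_def)
    have subX: "submodule X R M"
    proof (rule submoduleI)
      show "X \<subseteq> carrier M" using inW v by (auto simp: X_def)
      show "\<zero>\<^bsub>M\<^esub> \<in> X" using XI[OF W0 R.zero_closed] v by simp
      fix a assume "a \<in> X"
      then obtain w c where a: "a = w \<oplus>\<^bsub>M\<^esub> c \<odot>\<^bsub>M\<^esub> v" "w \<in> W" "c \<in> carrier R"
        by (auto simp: X_def)
      have "\<ominus>\<^bsub>M\<^esub> a = \<ominus>\<^bsub>M\<^esub> w \<oplus>\<^bsub>M\<^esub> (\<ominus>\<^bsub>R\<^esub> c) \<odot>\<^bsub>M\<^esub> v"
        using a inW v by (simp add: smult_l_minus M.minus_add)
      then show "\<ominus>\<^bsub>M\<^esub> a \<in> X" using XI[OF sW(3)] a by simp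
      { fix b assume "b \<in> X"
        then obtain w' d where b: "b = w' \<oplus>\<^bsub>M\<^esub> d \<odot>\<^bsub>M\<^esub> v" "w' \<in> W" "d \<in> carrier R"
          by (auto simp: X_def)
        have "a \<oplus>\<^bsub>M\<^esub> b = (w \<oplus>\<^bsub>M\<^esub> w') \<oplus>\<^bsub>M\<^esub> (c \<oplus>\<^bsub>R\<^esub> d) \<odot>\<^bsub>M\<^esub> v"
          using a b inW v by (simp add: smult_l_distr M.a_ac)
        then show "a \<oplus>\<^bsub>M\<^esub> b \<in> X" using XI[OF sW(5)] a b by simp }
      { fix d assume d: "d \<in> carrier R"
        have "d \<odot>\<^bsub>M\<^esub> a = d \<odot>\<^bsub>M\<^esub> w \<oplus>\<^bsub>M\<^esub> (d \<otimes>\<^bsub>R\<^esub> c) \<odot>\<^bsub>M\<^esub> v"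
          using a d inW v by (simp add: smult_r_distr smult_assoc1)
        then show "d \<odot>\<^bsub>M\<^esub> a \<in> X" using XI[OF sW(4)] a d by simp }
    qed
    have "S \<inter> X \<subseteq> {\<zero>\<^bsub>M\<^esub>}"
    proof
      fix s assume s: "s \<in> S \<inter> X"
      then obtain w c where a: "s = w \<oplus>\<^bsub>M\<^esub> c \<odot>\<^bsub>M\<^esub> v" "w \<in> W" "c \<in> carrier R"
        by (auto simp: X_def)
      \<comment> \<open>A nonzero coefficient could be inverted, and dividing by it would write
        \<open>v\<close> as an element of \<open>S\<close> plus one of \<open>W\<close>, which
        \<open>no\<close> excludes.\<close>
      have "c = \<zero>\<^bsub>R\<^esub>"
      proof (rule ccontr)
        assume "c \<noteq> \<zero>\<^bsub>R\<^esub>"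
        then have c: "inv\<^bsub>R\<^esub> c \<in> carrier R" "inv\<^bsub>R\<^esub> c \<otimes>\<^bsub>R\<^esub> c = \<one>\<^bsub>R\<^esub>"
          using a(3) by (auto simp: R.field_Units)
        have "c \<odot>\<^bsub>M\<^esub> v = s \<oplus>\<^bsub>M\<^esub> \<ominus>\<^bsub>M\<^esub> w"
          using a inW v by (simp add: M.a_ac M.r_neg2)
        then have "inv\<^bsub>R\<^esub> c \<odot>\<^bsub>M\<^esub> (c \<odot>\<^bsub>M\<^esub> v) = inv\<^bsub>R\<^esub> c \<odot>\<^bsub>M\<^esub> (s \<oplus>\<^bsub>M\<^esub> \<ominus>\<^bsub>M\<^esub> w)"
          by (rule arg_cong)
        also have "\<dots> = inv\<^bsub>R\<^esub> c \<odot>\<^bsub>M\<^esub> s \<oplus>\<^bsub>M\<^esub> inv\<^bsub>R\<^esub> c \<odot>\<^bsub>M\<^esub> (\<ominus>\<^bsub>M\<^esub> w)"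
          using c(1) inS inW s a(2) by (simp add: smult_r_distr)
        finally have "inv\<^bsub>R\<^esub> c \<odot>\<^bsub>M\<^esub> (c \<odot>\<^bsub>M\<^esub> v) = inv\<^bsub>R\<^esub> c \<odot>\<^bsub>M\<^esub> s \<oplus>\<^bsub>M\<^esub> inv\<^bsub>R\<^esub> c \<odot>\<^bsub>M\<^esub> (\<ominus>\<^bsub>M\<^esub> w)" .
        moreover have "inv\<^bsub>R\<^esub> c \<odot>\<^bsub>M\<^esub> (c \<odot>\<^bsub>M\<^esub> v) = v"
          using a c v by (simp add: smult_assoc1[symmetric])
        ultimately have "v = inv\<^bsub>R\<^esub> c \<odot>\<^bsub>M\<^esub> s \<oplus>\<^bsub>M\<^esub> inv\<^bsub>R\<^esub> c \<odot>\<^bsub>M\<^esub> (\<ominus>\<^bsub>M\<^esub> w)" by simp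
        then show False
          using no sS(4) sW(4) sW(3) c s a by blast
      qed
      then have "s \<in> W" using a v inW by simp
      then show "s \<in> {\<zero>\<^bsub>M\<^esub>}" using s W(2) by blast
    qed
    moreover have "\<zero>\<^bsub>M\<^esub> \<in> X" using XI[OF W0 R.zero_closed] v by simp
    ultimately have "S \<inter> X = {\<zero>\<^bsub>M\<^esub>}" using S0 by blast
    moreover have "W \<subseteq> X"
    proof
      fix w assume "w \<in> W"
      then show "w \<in> X" using XI[of w, OF _ R.zero_closed] v inW by simp
    qed
    ultimately have "X = W" using max subX by blast
    moreover have "v \<in> X" using XI[OF W0 R.one_closed] v by simp
    ultimately have "v \<in> W" by simp
    moreover have "v = \<zero>\<^bsub>M\<^esub> \<oplus>\<^bsub>M\<^esub> v" using v by simp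
    ultimately show False using no S0 by blast
  qed
  then show ?thesis using W by blast
qed

text \<open>The projection along a complement. Retractions of this kind are the source of all
  exactness properties of tensor products below.\<close>

lemma (in module) submodule_retraction:
  assumes R: "field R" and S: "submodule S R M"
  shows "\<exists>r. linear_map R M (M\<lparr>carrier := S\<rparr>) r \<and> (\<forall>s \<in> S. r s = s)"
proof -
  obtain W where W: "submodule W R M" "S \<inter> W = {\<zero>\<^bsub>M\<^esub>}"
    and dec: "\<And>v. v \<in> carrier M \<Longrightarrow> \<exists>s \<in> S. \<exists>w \<in> W. v = s \<oplus>\<^bsub>M\<^esub> w"
    using submodule_complement[OF assms] by blast
  note sS = submoduleE[OF S] and sW = submoduleE[OF W(1)]
  have inS: "x \<in> carrier M" if "x \<in> S" for x using that sS(1) by blast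
  have inW: "x \<in> carrier M" if "x \<in> W" for x using that sW(1) by blast
  have W0: "\<zero>\<^bsub>M\<^esub> \<in> W" using W(2) by blast
  define r where "r v = (SOME s. s \<in> S \<and> (\<exists>w\<in>W. v = s \<oplus>\<^bsub>M\<^esub> w))" for v
  have r: "r (s \<oplus>\<^bsub>M\<^esub> w) = s" if s: "s \<in> S" and w: "w \<in> W" for s w
    unfolding r_def
  proof (rule some_equality)
    fix t assume "t \<in> S \<and> (\<exists>w'\<in>W. s \<oplus>\<^bsub>M\<^esub> w = t \<oplus>\<^bsub>M\<^esub> w')"
    then obtain w' where t: "t \<in> S" "w' \<in> W" "s \<oplus>\<^bsub>M\<^esub> w = t \<oplus>\<^bsub>M\<^esub> w'" by blast
    \<comment> \<open>Two decompositions of one vector differ by an element that lies both in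
      \<open>S\<close> and in \<open>W\<close>, hence by zero; so the choice in \<open>r\<close> is
      forced.\<close>
    have "t \<oplus>\<^bsub>M\<^esub> \<ominus>\<^bsub>M\<^esub> s = (t \<oplus>\<^bsub>M\<^esub> w') \<oplus>\<^bsub>M\<^esub> (\<ominus>\<^bsub>M\<^esub> s \<oplus>\<^bsub>M\<^esub> \<ominus>\<^bsub>M\<^esub> w')"
      using t s w inS inW by (simp add: M.a_ac M.r_neg M.r_neg1)
    also have "\<dots> = (s \<oplus>\<^bsub>M\<^esub> \<ominus>\<^bsub>M\<^esub> s) \<oplus>\<^bsub>M\<^esub> (w \<oplus>\<^bsub>M\<^esub> \<ominus>\<^bsub>M\<^esub> w')"
      unfolding t(3)[symmetric] using s w t(1,2) inS inW by (simp add: M.a_ac)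
    also have "\<dots> = w \<oplus>\<^bsub>M\<^esub> \<ominus>\<^bsub>M\<^esub> w'"
      using s w t(1,2) inS inW by (simp add: M.r_neg)
    finally have "t \<oplus>\<^bsub>M\<^esub> \<ominus>\<^bsub>M\<^esub> s = w \<oplus>\<^bsub>M\<^esub> \<ominus>\<^bsub>M\<^esub> w'" .
    moreover have "t \<oplus>\<^bsub>M\<^esub> \<ominus>\<^bsub>M\<^esub> s \<in> S" "w \<oplus>\<^bsub>M\<^esub> \<ominus>\<^bsub>M\<^esub> w' \<in> W"
      by (intro sS(5) sS(3) sW(5) sW(3) s w t(1,2))+
    ultimately have "t \<oplus>\<^bsub>M\<^esub> \<ominus>\<^bsub>M\<^esub> s \<in> S \<inter> W" by simp
    then have "t \<oplus>\<^bsub>M\<^esub> \<ominus>\<^bsub>M\<^esub> s = \<zero>\<^bsub>M\<^esub>" unfolding W(2) by simp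
    then show "t = s"
      using M.diff_eq_zero_iff[of t s] t(1) s inS by (simp add: M.minus_eq)
  qed (use s w in blast)
  have "linear_map R M (M\<lparr>carrier := S\<rparr>) r"
  proof (rule linear_mapI)
    fix x assume "x \<in> carrier M"
    then obtain s w where x: "s \<in> S" "w \<in> W" "x = s \<oplus>\<^bsub>M\<^esub> w" using dec by blast
    show "r x \<in> carrier (M\<lparr>carrier := S\<rparr>)" using x r by simp
    { fix y assume "y \<in> carrier M"
      then obtain s' w' where y: "s' \<in> S" "w' \<in> W" "y = s' \<oplus>\<^bsub>M\<^esub> w'" using dec by blast
      have "x \<oplus>\<^bsub>M\<^esub> y = (s \<oplus>\<^bsub>M\<^esub> s') \<oplus>\<^bsub>M\<^esub> (w \<oplus>\<^bsub>M\<^esub> w')"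
        using x y inS inW by (simp add: M.a_ac)
      then show "r (x \<oplus>\<^bsub>M\<^esub> y) = r x \<oplus>\<^bsub>M\<lparr>carrier := S\<rparr>\<^esub> r y"
        using r x y sS(5) sW(5) by simp }
    { fix c assume c: "c \<in> carrier R"
      have "c \<odot>\<^bsub>M\<^esub> x = c \<odot>\<^bsub>M\<^esub> s \<oplus>\<^bsub>M\<^esub> c \<odot>\<^bsub>M\<^esub> w"
        using x c inS inW by (simp add: smult_r_distr)
      then show "r (c \<odot>\<^bsub>M\<^esub> x) = c \<odot>\<^bsub>M\<lparr>carrier := S\<rparr>\<^esub> r x"
        using r x c sS(4) sW(4) by simp }
  qed
  moreover have "r s = s" if "s \<in> S" for s
    using r[OF that W0] inS[OF that] by simp
  ultimately show ?thesis by blast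
qed

lemma submodule_kernel:
  assumes V: "module K V" and W: "module K W" and f: "linear_map K V W f"
  shows "submodule {v \<in> carrier V. f v = \<zero>\<^bsub>W\<^esub>} K V"
proof -
  interpret V: module K V by fact
  interpret W: module K W by fact
  show ?thesis
    by (rule V.submoduleI)
      (auto simp: linear_mapD[OF f] linear_map_zero[OF V W f] linear_map_minus[OF V W f])
qed

lemma submodule_image:
  assumes V: "module K V" and W: "module K W" and f: "linear_map K V W f"
  shows "submodule (f ` carrier V) K W"
proof -
  interpret V: module K V by fact
  interpret W: module K W by fact
  show ?thesis
  proof (rule W.submoduleI)
    show "\<zero>\<^bsub>W\<^esub> \<in> f ` carrier V"
      using linear_map_zero[OF V W f] by (metis V.M.zero_closed imageI)
    show "\<ominus>\<^bsub>W\<^esub> a \<in> f ` carrier V" if "a \<in> f ` carrier V" for a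
      using that by (auto simp: linear_map_minus[OF V W f, symmetric])
    show "a \<oplus>\<^bsub>W\<^esub> b \<in> f ` carrier V" if "a \<in> f ` carrier V" "b \<in> f ` carrier V" for a b
      using that by (auto simp: linear_mapD(2)[OF f, symmetric])
    show "c \<odot>\<^bsub>W\<^esub> b \<in> f ` carrier V" if "c \<in> carrier K" "b \<in> f ` carrier V" for c b
      using that by (auto simp: linear_mapD(3)[OF f, symmetric])
  qed (auto simp: linear_mapD(1)[OF f])
qed

text \<open>Project \<open>W\<close> onto the image of \<open>f\<close>, take a preimage, and remove
  its component in the kernel of \<open>f\<close>. One construction serves both for left inverses of
  injections and for splitting off an equaliser.\<close>

lemma linear_generalised_inverse:
  assumes K: "field K" and V: "module K V" and W: "module K W" and f: "linear_map K V W f"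
  shows "\<exists>g. linear_map K W V g \<and> (\<forall>v \<in> carrier V. f (g (f v)) = f v)"
proof -
  interpret V: module K V by fact
  interpret W: module K W by fact
  define N where "N = {v \<in> carrier V. f v = \<zero>\<^bsub>W\<^esub>}"
  obtain p where p: "linear_map K V (V\<lparr>carrier := N\<rparr>) p" "\<And>v. v \<in> N \<Longrightarrow> p v = v"
    using V.submodule_retraction[OF K submodule_kernel[OF V W f]] by (auto simp: N_def)
  obtain q where q: "linear_map K W (W\<lparr>carrier := f ` carrier V\<rparr>) q" "\<And>v. v \<in> carrier V \<Longrightarrow> q (f v) = f v"
    using W.submodule_retraction[OF K submodule_image[OF V W f]] by blast
  note fD = linear_mapD[OF f] linear_map_minus[OF V W f] and qD = linear_mapD[OF q(1), simplified]
  have p': "linear_map K V V p"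
    using p(1) by (auto simp: linear_map_def N_def)
  have pN: "p v \<in> carrier V" "f (p v) = \<zero>\<^bsub>W\<^esub>" if "v \<in> carrier V" for v
    using linear_mapD(1)[OF p(1)] that by (auto simp: N_def)
  note pD = linear_mapD(2,3)[OF p'] linear_map_minus[OF V V p']
  \<comment> \<open>Two preimages differ by an element of the kernel \<open>N\<close>, which
    \<open>p\<close> fixes; so \<open>b - p b\<close> is the same for all of them, and this
    independence makes \<open>g\<close> linear.\<close>
  define g where "g w = (let b = (SOME b. b \<in> carrier V \<and> f b = q w) in b \<ominus>\<^bsub>V\<^esub> p b)" for w
  have g: "g w = b \<ominus>\<^bsub>V\<^esub> p b" if b: "b \<in> carrier V" and w: "q w = f b" for w b
  proof -
    define b' where "b' = (SOME b. b \<in> carrier V \<and> f b = q w)"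
    have b': "b' \<in> carrier V" "f b' = f b"
      using someI[of "\<lambda>b. b \<in> carrier V \<and> f b = q w" b] that by (auto simp: b'_def)
    then have "b' \<oplus>\<^bsub>V\<^esub> \<ominus>\<^bsub>V\<^esub> b \<in> N"
      using b by (simp add: N_def fD W.r_neg)
    then have "p (b' \<oplus>\<^bsub>V\<^esub> \<ominus>\<^bsub>V\<^esub> b) = b' \<oplus>\<^bsub>V\<^esub> \<ominus>\<^bsub>V\<^esub> b" by (rule p)
    then have *: "p b' \<oplus>\<^bsub>V\<^esub> \<ominus>\<^bsub>V\<^esub> p b = b' \<oplus>\<^bsub>V\<^esub> \<ominus>\<^bsub>V\<^esub> b"
      using b b' by (simp add: pD)
    have "b' \<oplus>\<^bsub>V\<^esub> \<ominus>\<^bsub>V\<^esub> p b' = b' \<oplus>\<^bsub>V\<^esub> \<ominus>\<^bsub>V\<^esub> p b' \<oplus>\<^bsub>V\<^esub> (p b \<oplus>\<^bsub>V\<^esub> \<ominus>\<^bsub>V\<^esub> p b)"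
      using b b' pN by (simp add: V.M.r_neg)
    also have "\<dots> = b' \<oplus>\<^bsub>V\<^esub> \<ominus>\<^bsub>V\<^esub> p b \<oplus>\<^bsub>V\<^esub> \<ominus>\<^bsub>V\<^esub> (p b' \<oplus>\<^bsub>V\<^esub> \<ominus>\<^bsub>V\<^esub> p b)"
      using b b' pN by (simp add: V.M.minus_add V.M.a_ac)
    also have "\<dots> = (b' \<oplus>\<^bsub>V\<^esub> \<ominus>\<^bsub>V\<^esub> b') \<oplus>\<^bsub>V\<^esub> (b \<oplus>\<^bsub>V\<^esub> \<ominus>\<^bsub>V\<^esub> p b)"
      unfolding * using b b'(1) pN by (simp add: V.M.minus_add V.M.a_ac)
    also have "\<dots> = b \<oplus>\<^bsub>V\<^esub> \<ominus>\<^bsub>V\<^esub> p b"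
      using b b' pN by (simp add: V.M.r_neg)
    finally show ?thesis
      by (simp add: g_def b'_def[symmetric] V.M.minus_eq)
  qed
  have dec: "\<exists>b \<in> carrier V. q w = f b" if "w \<in> carrier W" for w
    using qD(1)[OF that] by auto
  have "linear_map K W V g"
  proof (rule linear_mapI)
    fix x assume x: "x \<in> carrier W"
    then obtain b where b: "b \<in> carrier V" "q x = f b" using dec by blast
    note gx = g[OF b]
    show "g x \<in> carrier V" using b(1) pN by (simp add: gx)
    { fix y assume y: "y \<in> carrier W"
      then obtain c where c: "c \<in> carrier V" "q y = f c" using dec by blast
      have "q (x \<oplus>\<^bsub>W\<^esub> y) = f (b \<oplus>\<^bsub>V\<^esub> c)" using b c x y by (simp add: qD fD)
      then show "g (x \<oplus>\<^bsub>W\<^esub> y) = g x \<oplus>\<^bsub>V\<^esub> g y"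
        using b(1) c(1) pN
        by (simp add: gx g[OF c] g[of "b \<oplus>\<^bsub>V\<^esub> c" "x \<oplus>\<^bsub>W\<^esub> y"] V.M.minus_eq pD V.M.minus_add V.M.a_ac) }
    { fix k assume k: "k \<in> carrier K"
      have "q (k \<odot>\<^bsub>W\<^esub> x) = f (k \<odot>\<^bsub>V\<^esub> b)" using b x k by (simp add: qD fD)
      then show "g (k \<odot>\<^bsub>W\<^esub> x) = k \<odot>\<^bsub>V\<^esub> g x"
        using b(1) k pN
        by (simp add: gx g[of "k \<odot>\<^bsub>V\<^esub> b" "k \<odot>\<^bsub>W\<^esub> x"] V.M.minus_eq pD V.smult_r_distr V.smult_r_minus) }
  qed
  moreover have "f (g (f v)) = f v" if "v \<in> carrier V" for v
  proof -
    have "f (g (f v)) = f (v \<oplus>\<^bsub>V\<^esub> \<ominus>\<^bsub>V\<^esub> p v)"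
      using g[OF that q(2)[OF that]] by (simp add: V.M.minus_eq)
    also have "\<dots> = f v \<oplus>\<^bsub>W\<^esub> \<ominus>\<^bsub>W\<^esub> \<zero>\<^bsub>W\<^esub>"
      using that pN by (simp add: fD)
    finally show ?thesis using that fD(1) by simp
  qed
  ultimately show ?thesis by blast
qed

lemma linear_map_add:
  assumes W: "module K W" and f: "linear_map K V W f" and g: "linear_map K V W g"
  shows "linear_map K V W (\<lambda>x. f x \<oplus>\<^bsub>W\<^esub> g x)"
proof -
  interpret W: module K W by fact
  show ?thesis
    by (rule linear_mapI) (auto simp: linear_mapD[OF f] linear_mapD[OF g] W.smult_r_distr W.M.a_ac)
qed

lemma linear_map_diff:
  assumes W: "module K W" and f: "linear_map K V W f" and g: "linear_map K V W g"
  shows "linear_map K V W (\<lambda>x. f x \<ominus>\<^bsub>W\<^esub> g x)"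
proof -
  interpret W: module K W by fact
  show ?thesis
    by (rule linear_mapI)
      (auto simp: linear_mapD[OF f] linear_mapD[OF g] W.M.minus_eq W.M.minus_add W.smult_r_distr W.smult_r_minus W.M.a_ac)
qed

lemma submodule_equaliser:
  assumes V: "module K V" and W: "module K W" and f: "linear_map K V W f" and g: "linear_map K V W g"
  shows "submodule {v \<in> carrier V. f v = g v} K V"
proof -
  interpret V: module K V by fact
  interpret W: module K W by fact
  have "{v \<in> carrier V. f v = g v} = {v \<in> carrier V. f v \<ominus>\<^bsub>W\<^esub> g v = \<zero>\<^bsub>W\<^esub>}"
    using W.M.diff_eq_zero_iff[OF linear_mapD(1)[OF f] linear_mapD(1)[OF g]] by auto
  then show ?thesis using submodule_kernel[OF V W linear_map_diff[OF W f g]] by simp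
qed

text \<open>Put \<open>d = f - g\<close> and let \<open>h\<close> satisfy \<open>d h d = d\<close>;
  then \<open>1 - h d\<close> takes values in the kernel of \<open>d\<close>. The result is an
  identity between linear maps and therefore survives tensoring with any space.\<close>

lemma equaliser_decomposition:
  assumes K: "field K" and V: "module K V" and W: "module K W"
    and f: "linear_map K V W f" and g: "linear_map K V W g"
  shows "\<exists>p h. linear_map K V (V\<lparr>carrier := {v \<in> carrier V. f v = g v}\<rparr>) p \<and> linear_map K W V h \<and>
    (\<forall>v \<in> carrier V. v = p v \<oplus>\<^bsub>V\<^esub> (h (f v) \<ominus>\<^bsub>V\<^esub> h (g v)))"
proof -
  interpret V: module K V by fact
  interpret W: module K W by fact
  define d where "d x = f x \<ominus>\<^bsub>W\<^esub> g x" for x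
  have d: "linear_map K V W d"
    unfolding d_def by (rule linear_map_diff[OF W f g])
  obtain h where h: "linear_map K W V h" "\<And>v. v \<in> carrier V \<Longrightarrow> d (h (d v)) = d v"
    using linear_generalised_inverse[OF K V W d] by blast
  note fD = linear_mapD[OF f] and gD = linear_mapD[OF g] and dD = linear_mapD[OF d]
    and hD = linear_mapD[OF h(1)]
  define p where "p v = v \<ominus>\<^bsub>V\<^esub> h (d v)" for v
  have hd: "linear_map K V V (\<lambda>v. h (d v))"
    by (rule linear_mapI) (auto simp: dD hD)
  have id: "linear_map K V V (\<lambda>v. v)"
    by (rule linear_mapI) auto
  have "linear_map K V V p"
    unfolding p_def by (rule linear_map_diff[OF V id hd])
  moreover have "f (p v) = g (p v)" if v: "v \<in> carrier V" for v
  proof -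
    have "d (p v) = \<zero>\<^bsub>W\<^esub>"
      using v by (simp add: p_def V.M.minus_eq dD linear_map_minus[OF V W d] hD h W.M.r_neg)
    then show ?thesis
      using v linear_mapD(1)[OF calculation] fD(1) gD(1) W.M.diff_eq_zero_iff by (simp add: d_def[of "p v"])
  qed
  ultimately have "linear_map K V (V\<lparr>carrier := {v \<in> carrier V. f v = g v}\<rparr>) p"
    by (auto simp: linear_map_def)
  moreover have "v = p v \<oplus>\<^bsub>V\<^esub> (h (f v) \<ominus>\<^bsub>V\<^esub> h (g v))" if v: "v \<in> carrier V" for v
  proof -
    have "h (f v) \<ominus>\<^bsub>V\<^esub> h (g v) = h (d v)"
      using v by (simp add: d_def V.M.minus_eq W.M.minus_eq fD gD hD linear_map_minus[OF W V h(1)])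
    then show ?thesis
      using v by (simp add: p_def V.M.minus_eq V.M.a_ac hD dD V.M.r_neg)
  qed
  ultimately show ?thesis using h(1) by blast
qed

section \<open>Spaces and the calculus of Sweedler sums\<close>

text \<open>Record fields beyond those of a module do not matter for linear algebra: for instance,
  \<open>taut A\<close> and \<open>A\<close> are interchangeable as spaces, though different records.\<close>

definition same_space :: "('k, 'u, 'v) module_scheme \<Rightarrow> ('k, 'u, 'w) module_scheme \<Rightarrow> bool" where
  "same_space V W \<longleftrightarrow> carrier V = carrier W \<and> add V = add W \<and> zero V = zero W \<and> smult V = smult W"

lemma is_tensor_same_space:
  assumes "same_space V V'" "same_space W W'"
  shows "is_tensor K V W T \<tau> = is_tensor K V' W' T \<tau>"
  using assms by (simp add: same_space_def is_tensor_def bilinear_map_def linear_map_def)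

lemma same_space_refl: "same_space V V"
  by (simp add: same_space_def)

lemma module_same_space_imp:
  assumes "module K V" "same_space V V'"
  shows "module K V'"
proof -
  interpret module K V by fact
  have "abelian_group V'"
    by (rule abelian_groupI)
      (use assms(2) M.a_closed M.zero_closed M.l_zero M.a_assoc M.a_comm M.add.l_inv_ex in \<open>auto simp: same_space_def\<close>)
  then show ?thesis
    by (rule moduleI[OF is_cring])
      (use assms(2) smult_closed smult_one smult_l_distr smult_r_distr smult_assoc1 in \<open>auto simp: same_space_def\<close>)
qed

lemma module_same_space:
  assumes "same_space V V'"
  shows "module K V = module K V'"
proof -
  have "same_space V' V" using assms by (simp add: same_space_def)
  with assms show ?thesis
    by (intro iffI) (erule module_same_space_imp, assumption)+
qed

lemma same_spaceD:
  assumes "same_space V V'"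
  shows "carrier V = carrier V'" "add V = add V'" "zero V = zero V'" "smult V = smult V'"
    and "module K V = module K V'"
    and "linear_map K V W f = linear_map K V' W f"
    and "linear_map K W V f = linear_map K W V' f"
    and "tensor K V W = tensor K V' W"
    and "tensor K W V = tensor K W V'"
    and "tens K V W = tens K V' W"
    and "tens K W V = tens K W V'"
    and "sweedler K V W P t h = sweedler K V' W P t h"
    and "sweedler K W V P t h = sweedler K W V' P t h"
    and "sweedler K W X V t h = sweedler K W X V' t h"
proof -
  \<comment> \<open>The tensor product is a choice among the pairs satisfying
    \<open>is_tensor\<close>; for records with the same underlying space the predicate is literally
    the same, so the choices coincide.\<close>
  have t: "tensor_pair K V Z = tensor_pair K V' Z" "tensor_pair K Z V = tensor_pair K Z V'" for Z
    by (simp_all add: tensor_pair_def is_tensor_same_space[OF assms same_space_refl]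
      is_tensor_same_space[OF same_space_refl assms])
  show "carrier V = carrier V'" "add V = add V'" "zero V = zero V'" "smult V = smult V'"
    using assms by (simp_all add: same_space_def)
  then have l: "linear_map K V Y f = linear_map K V' Y f" "linear_map K Y V f = linear_map K Y V' f"
    for Y f
    by (simp_all add: linear_map_def)
  show "module K V = module K V'" by (rule module_same_space[OF assms])
  show "linear_map K V W f = linear_map K V' W f" "linear_map K W V f = linear_map K W V' f" by (rule l)+
  show "tensor K V W = tensor K V' W" "tensor K W V = tensor K W V'"
    "tens K V W = tens K V' W" "tens K W V = tens K W V'"
    by (simp_all add: tensor_def tens_def t)
  then show "sweedler K V W P t h = sweedler K V' W P t h"
    "sweedler K W V P t h = sweedler K W V' P t h"
    using \<open>carrier V = carrier V'\<close> by (simp_all add: sweedler_def)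
  show "sweedler K W X V t h = sweedler K W X V' t h"
    by (simp add: sweedler_def l)
qed

text \<open>Keeps the simplifier from rewriting the function, on whose shape the linearity rules match.\<close>

lemma linear_map_weak_cong [cong]:
  "V = V' \<Longrightarrow> W = W' \<Longrightarrow> linear_map K V W f = linear_map K V' W' f"
  by simp

text \<open>Makes membership of the bound variables in their carriers available while a summand is
  rewritten. The rules for actions and coactions are conditional on such membership and have to work
  under the binders of iterated sums.\<close>

lemma sweedler_cong [cong]:
  assumes "V = V'" "W = W'" "P = P'" "t = t'"
    and "\<And>v w. v \<in> carrier V' \<Longrightarrow> w \<in> carrier W' \<Longrightarrow> f v w = g v w"
  shows "sweedler K V W P t f = sweedler K V' W' P' t' g"
  using assms by (simp add: sweedler_def cong: conj_cong ball_cong)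

lemma linear_map_id [simp]: "linear_map K V V (\<lambda>x. x)"
  by (simp add: linear_map_def)

lemma linear_map_comp:
  assumes "linear_map K V W g" "linear_map K X V e"
  shows "linear_map K X W (\<lambda>x. g (e x))"
  by (rule linear_mapI) (simp_all add: linear_mapD[OF assms(1)] linear_mapD[OF assms(2)])

lemma linear_map_smult:
  assumes P: "module K P" and c: "c \<in> carrier K" and e: "linear_map K X P e"
  shows "linear_map K X P (\<lambda>x. c \<odot>\<^bsub>P\<^esub> e x)"
proof -
  interpret P: module K P by fact
  show ?thesis
    by (rule linear_mapI)
      (use c in \<open>simp_all add: linear_mapD[OF e] P.smult_r_distr P.smult_assoc1[symmetric] P.m_comm\<close>)
qed

section \<open>The universal property and the rules for Sweedler sums\<close>

locale linear_setting =
  fixes K :: "('k, 'c) ring_scheme" and U :: "'u itself"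
  assumes field_K: "field K" and infinite_type: "infinite (UNIV :: 'u set)"
begin

abbreviation tensor_space ::
    "('k, 'u, 'v) module_scheme \<Rightarrow> ('k, 'u, 'w) module_scheme \<Rightarrow> ('k, 'u) module" (infixr \<open>\<otimes>\<^sub>k\<close> 70)
  where "V \<otimes>\<^sub>k W \<equiv> tensor K V W"

abbreviation lin :: "('k, 'u, 'v) module_scheme \<Rightarrow> ('k, 'u, 'w) module_scheme \<Rightarrow> ('u \<Rightarrow> 'u) \<Rightarrow> bool"
  where "lin \<equiv> linear_map K"

abbreviation sw :: "('k, 'u, 'v) module_scheme \<Rightarrow> ('k, 'u, 'w) module_scheme \<Rightarrow>
    ('k, 'u, 'p) module_scheme \<Rightarrow> 'u \<Rightarrow> ('u \<Rightarrow> 'u \<Rightarrow> 'u) \<Rightarrow> 'u"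
  where "sw \<equiv> sweedler K"

abbreviation tn :: "('k, 'u, 'v) module_scheme \<Rightarrow> ('k, 'u, 'w) module_scheme \<Rightarrow> 'u \<Rightarrow> 'u \<Rightarrow> 'u"
  where "tn \<equiv> tens K"

lemma tensor_is_tensor:
  fixes V :: "('k, 'u, 'v) module_scheme" and W :: "('k, 'u, 'w) module_scheme"
  assumes "module K V" "module K W"
  shows "is_tensor K V W (V \<otimes>\<^sub>k W) (tn V W)"
proof -
  have "\<exists>x. case x of (T, \<tau>) \<Rightarrow> is_tensor K V W T \<tau>"
    using tensor_exists[OF infinite_type assms] by auto
  then have "case tensor_pair K V W of (T, \<tau>) \<Rightarrow> is_tensor K V W T \<tau>"
    unfolding tensor_pair_def by (rule someI_ex)
  then show ?thesis by (simp add: tensor_def tens_def split: prod.splits)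
qed

context
  fixes V :: "('k, 'u, 'v) module_scheme" and W :: "('k, 'u, 'w) module_scheme"
  assumes V: "module K V" and W: "module K W"
begin

lemma module_tensor [simp]: "module K (V \<otimes>\<^sub>k W)"
  using tensor_is_tensor[OF V W] by (simp add: is_tensor_def)

lemma tens_bilinear: "bilinear_map K V W (V \<otimes>\<^sub>k W) (tn V W)"
  using tensor_is_tensor[OF V W] by (simp add: is_tensor_def)

lemma tens_closed [simp]: "v \<in> carrier V \<Longrightarrow> w \<in> carrier W \<Longrightarrow> tn V W v w \<in> carrier (V \<otimes>\<^sub>k W)"
  using tens_bilinear by (rule bilinear_mapD)

text \<open>Stated with an arbitrary linear \<open>e\<close> in the slot, as are the other linearity
  rules, so that linearity of a nested expression is decided by descending through it.\<close>

lemma linear_tens_left [simp]: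
  "w \<in> carrier W \<Longrightarrow> lin X V e \<Longrightarrow> lin X (V \<otimes>\<^sub>k W) (\<lambda>x. tn V W (e x) w)"
  using bilinear_mapD(2)[OF tens_bilinear] by (rule linear_map_comp)

lemma linear_tens_right [simp]:
  "v \<in> carrier V \<Longrightarrow> lin X W e \<Longrightarrow> lin X (V \<otimes>\<^sub>k W) (\<lambda>x. tn V W v (e x))"
  using bilinear_mapD(1)[OF tens_bilinear] by (rule linear_map_comp)

context
  fixes P :: "('k, 'u, 'p) module_scheme" and f :: "'u \<Rightarrow> 'u \<Rightarrow> 'u"
  assumes P: "module K P"
    and f1: "\<And>v. v \<in> carrier V \<Longrightarrow> lin W P (\<lambda>w. f v w)"
    and f2: "\<And>w. w \<in> carrier W \<Longrightarrow> lin V P (\<lambda>v. f v w)"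
begin

lemma sweedler_ex1:
  "\<exists>!F. F \<in> extensional (carrier (V \<otimes>\<^sub>k W)) \<and> lin (V \<otimes>\<^sub>k W) P F \<and>
    (\<forall>v \<in> carrier V. \<forall>w \<in> carrier W. F (tn V W v w) = f v w)"
proof -
  \<comment> \<open>The universal property in \<open>is_tensor\<close> is about plain module
    records; truncation drops the further fields of \<open>P\<close> and leaves the same
    space.\<close>
  define Q where "Q = module.truncate P"
  have "same_space P Q" by (simp add: same_space_def Q_def module.defs)
  note Q = same_spaceD[OF this]
  have "module K Q \<and> bilinear_map K V W Q f"
    using P f1 f2 by (simp add: bilinear_map_def Q)
  then show ?thesis
    using tensor_is_tensor[OF V W] unfolding is_tensor_def Q(7) by blast
qed

lemma sweedler_props:
  defines "F \<equiv> \<lambda>t. sw V W P t f"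
  shows "F \<in> extensional (carrier (V \<otimes>\<^sub>k W))" and "lin (V \<otimes>\<^sub>k W) P F"
    and "v \<in> carrier V \<Longrightarrow> w \<in> carrier W \<Longrightarrow> F (tn V W v w) = f v w"
proof -
  have "F \<in> extensional (carrier (V \<otimes>\<^sub>k W)) \<and> lin (V \<otimes>\<^sub>k W) P F \<and>
    (\<forall>v \<in> carrier V. \<forall>w \<in> carrier W. F (tn V W v w) = f v w)"
    unfolding F_def sweedler_def by (rule theI'[OF sweedler_ex1])
  then show "F \<in> extensional (carrier (V \<otimes>\<^sub>k W))" "lin (V \<otimes>\<^sub>k W) P F"
    "v \<in> carrier V \<Longrightarrow> w \<in> carrier W \<Longrightarrow> F (tn V W v w) = f v w" by auto
qed

lemma sweedler_tens [simp]:
  "v \<in> carrier V \<Longrightarrow> w \<in> carrier W \<Longrightarrow> sw V W P (tn V W v w) f = f v w"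
  by (rule sweedler_props)

lemma linear_sweedler_arg [simp]:
  "lin X (V \<otimes>\<^sub>k W) e \<Longrightarrow> lin X P (\<lambda>x. sw V W P (e x) f)"
  using sweedler_props(2) by (rule linear_map_comp)

lemma sweedler_closed [simp]: "t \<in> carrier (V \<otimes>\<^sub>k W) \<Longrightarrow> sw V W P t f \<in> carrier P"
  using sweedler_props(2) by (rule linear_mapD)

end

text \<open>Uniqueness in the universal property. It is asserted there for extensional functions,
  hence the passage to restrictions in the proof.\<close>

lemma tensor_eqI:
  assumes P: "module K P" and F: "lin (V \<otimes>\<^sub>k W) P F" and G: "lin (V \<otimes>\<^sub>k W) P G"
    and t: "t \<in> carrier (V \<otimes>\<^sub>k W)"
    and eq: "\<And>v w. v \<in> carrier V \<Longrightarrow> w \<in> carrier W \<Longrightarrow> F (tn V W v w) = G (tn V W v w)"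
  shows "F t = G t"
proof -
  let ?f = "\<lambda>v w. F (tn V W v w)"
  let ?T = "carrier (V \<otimes>\<^sub>k W)"
  have ex: "\<exists>!F'. F' \<in> extensional ?T \<and> lin (V \<otimes>\<^sub>k W) P F' \<and>
      (\<forall>v \<in> carrier V. \<forall>w \<in> carrier W. F' (tn V W v w) = ?f v w)"
    by (rule sweedler_ex1[OF P]) (simp_all add: linear_map_comp[OF F])
  have "lin (V \<otimes>\<^sub>k W) P (restrict F ?T)" "lin (V \<otimes>\<^sub>k W) P (restrict G ?T)"
    using F G by (auto intro: linear_map_cong[OF module_tensor])
  then have "restrict F ?T = restrict G ?T"
    by (intro trans[OF the1_equality[OF ex, symmetric] the1_equality[OF ex]]) (simp_all add: eq)
  then show ?thesis using t by (metis restrict_apply')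
qed

lemma sweedler_tens_id: "t \<in> carrier (V \<otimes>\<^sub>k W) \<Longrightarrow> sw V W (V \<otimes>\<^sub>k W) t (tn V W) = t"
  by (rule tensor_eqI[of "V \<otimes>\<^sub>k W" "\<lambda>t. sw V W (V \<otimes>\<^sub>k W) t (tn V W)" "\<lambda>t. t"]) (simp_all add: V W)

text \<open>Both sides are linear in \<open>t\<close> and agree on pure tensors. The rules that move
  a particular map under a sum are instances of this one.\<close>

lemma sweedler_linear:
  assumes "module K P" "module K Q" "lin P Q g"
    and "\<And>v. v \<in> carrier V \<Longrightarrow> lin W P (\<lambda>w. f v w)"
    and "\<And>w. w \<in> carrier W \<Longrightarrow> lin V P (\<lambda>v. f v w)"
    and "t \<in> carrier (V \<otimes>\<^sub>k W)"
  shows "g (sw V W P t f) = sw V W Q t (\<lambda>v w. g (f v w))"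
  by (rule tensor_eqI[of Q "\<lambda>t. g (sw V W P t f)"])
    (simp_all add: assms V W linear_map_comp[OF assms(3)])

text \<open>Here the summand varies and the tensor is fixed. For given \<open>x\<close> and
  \<open>y\<close> each law is an equation between linear functions of \<open>t\<close>, so it may
  be tested on pure tensors, where it is the linearity of \<open>f\<close> in its parameter.\<close>

lemma linear_sweedler_fun [simp]:
  assumes X: "module K X" and P: "module K P" and t: "t \<in> carrier (V \<otimes>\<^sub>k W)"
    and f: "\<And>x v. x \<in> carrier X \<Longrightarrow> v \<in> carrier V \<Longrightarrow> lin W P (\<lambda>w. f x v w)"
      "\<And>x w. x \<in> carrier X \<Longrightarrow> w \<in> carrier W \<Longrightarrow> lin V P (\<lambda>v. f x v w)"
      "\<And>v w. v \<in> carrier V \<Longrightarrow> w \<in> carrier W \<Longrightarrow> lin X P (\<lambda>x. f x v w)"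
  shows "lin X P (\<lambda>x. sw V W P t (f x))"
proof -
  interpret X: module K X by fact
  interpret P: module K P by fact
  have sw: "lin (V \<otimes>\<^sub>k W) P (\<lambda>t. sw V W P t (f x))" if "x \<in> carrier X" for x
    using that f by (simp add: V W P)
  show ?thesis
  proof (rule linear_mapI)
    fix x assume x: "x \<in> carrier X"
    show "sw V W P t (f x) \<in> carrier P" using sw[OF x] t by (rule linear_mapD)
    { fix y assume y: "y \<in> carrier X"
      show "sw V W P t (f (x \<oplus>\<^bsub>X\<^esub> y)) = sw V W P t (f x) \<oplus>\<^bsub>P\<^esub> sw V W P t (f y)"
        by (rule tensor_eqI[of P "\<lambda>t. sw V W P t (f (x \<oplus>\<^bsub>X\<^esub> y))"])
          (use x y t in \<open>simp_all add: P sw linear_map_add f linear_mapD(2)[OF f(3)]\<close>) }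
    { fix c assume c: "c \<in> carrier K"
      have "lin (V \<otimes>\<^sub>k W) P (\<lambda>t. c \<odot>\<^bsub>P\<^esub> sw V W P t (f x))"
        by (rule linear_map_smult[OF P c sw[OF x]])
      then show "sw V W P t (f (c \<odot>\<^bsub>X\<^esub> x)) = c \<odot>\<^bsub>P\<^esub> sw V W P t (f x)"
        by (rule tensor_eqI[OF P, rotated])
          (use x c t in \<open>simp_all add: P sw f linear_map_smult linear_mapD(3)[OF f(3)]\<close>) }
  qed
qed

end

text \<open>Flattens a sum over a sum into an iterated sum. Repeated use leaves sums over given
  elements and over their coproducts and coactions only.\<close>

lemma sweedler_sweedler [simp]:
  assumes "module K V" "module K W" "module K V'" "module K W'" "module K Q"
    and "t \<in> carrier (V \<otimes>\<^sub>k W)"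
    and "\<And>v. v \<in> carrier V \<Longrightarrow> lin W (V' \<otimes>\<^sub>k W') (\<lambda>w. f v w)"
    and "\<And>w. w \<in> carrier W \<Longrightarrow> lin V (V' \<otimes>\<^sub>k W') (\<lambda>v. f v w)"
    and "\<And>v. v \<in> carrier V' \<Longrightarrow> lin W' Q (\<lambda>w. g v w)"
    and "\<And>w. w \<in> carrier W' \<Longrightarrow> lin V' Q (\<lambda>v. g v w)"
  shows "sw V' W' Q (sw V W (V' \<otimes>\<^sub>k W') t f) g = sw V W Q t (\<lambda>v w. sw V' W' Q (f v w) g)"
  using assms by (intro sweedler_linear[where g = "\<lambda>x. sw V' W' Q x g"]) simp_all

lemma tens_sweedler_left [simp]:
  assumes "module K V" "module K W" "module K P" "module K X"
    and "t \<in> carrier (V \<otimes>\<^sub>k W)" "x \<in> carrier X"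
    and "\<And>v. v \<in> carrier V \<Longrightarrow> lin W P (\<lambda>w. f v w)"
    and "\<And>w. w \<in> carrier W \<Longrightarrow> lin V P (\<lambda>v. f v w)"
  shows "tn P X (sw V W P t f) x = sw V W (P \<otimes>\<^sub>k X) t (\<lambda>v w. tn P X (f v w) x)"
  using assms by (intro sweedler_linear[where g = "\<lambda>y. tn P X y x"]) simp_all

lemma tens_sweedler_right [simp]:
  assumes "module K V" "module K W" "module K P" "module K X"
    and "t \<in> carrier (V \<otimes>\<^sub>k W)" "x \<in> carrier X"
    and "\<And>v. v \<in> carrier V \<Longrightarrow> lin W P (\<lambda>w. f v w)"
    and "\<And>w. w \<in> carrier W \<Longrightarrow> lin V P (\<lambda>v. f v w)"
  shows "tn X P x (sw V W P t f) = sw V W (X \<otimes>\<^sub>k P) t (\<lambda>v w. tn X P x (f v w))"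
  using assms by (intro sweedler_linear[where g = "tn X P x"]) simp_all

text \<open>Both sides are linear in \<open>s\<close>, and on a pure tensor the outer sum
  disappears. As a rewrite rule the general exchange would not terminate; a few instances with a
  fixed direction become rules below, the others are applied where needed.\<close>

lemma sweedler_swap:
  assumes m: "module K V" "module K W" "module K X" "module K Y" "module K P"
    and s: "s \<in> carrier (V \<otimes>\<^sub>k W)" and t: "t \<in> carrier (X \<otimes>\<^sub>k Y)"
    and f: "\<And>w x y. w \<in> carrier W \<Longrightarrow> x \<in> carrier X \<Longrightarrow> y \<in> carrier Y \<Longrightarrow> lin V P (\<lambda>v. f v w x y)"
      "\<And>v x y. v \<in> carrier V \<Longrightarrow> x \<in> carrier X \<Longrightarrow> y \<in> carrier Y \<Longrightarrow> lin W P (\<lambda>w. f v w x y)"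
      "\<And>v w y. v \<in> carrier V \<Longrightarrow> w \<in> carrier W \<Longrightarrow> y \<in> carrier Y \<Longrightarrow> lin X P (\<lambda>x. f v w x y)"
      "\<And>v w x. v \<in> carrier V \<Longrightarrow> w \<in> carrier W \<Longrightarrow> x \<in> carrier X \<Longrightarrow> lin Y P (\<lambda>y. f v w x y)"
  shows "sw V W P s (\<lambda>v w. sw X Y P t (\<lambda>x y. f v w x y)) =
    sw X Y P t (\<lambda>x y. sw V W P s (\<lambda>v w. f v w x y))"
  by (rule tensor_eqI[OF m(1) m(2) m(5) _ _ s]) (use t in \<open>simp_all add: m f\<close>)

section \<open>Injections and equalisers under tensor products\<close>

lemma linear_left_inverse:
  assumes X: "module K X" and Z: "module K Z" and e: "lin X Z e" and inj: "inj_on e (carrier X)"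
  shows "\<exists>h. lin Z X h \<and> (\<forall>x \<in> carrier X. h (e x) = x)"
proof -
  obtain h where h: "lin Z X h" "\<And>v. v \<in> carrier X \<Longrightarrow> e (h (e v)) = e v"
    using linear_generalised_inverse[OF field_K X Z e] by blast
  have "h (e v) = v" if "v \<in> carrier X" for v
    using inj_onD[OF inj h(2)[OF that]] that linear_mapD(1)[OF e] linear_mapD(1)[OF h(1)] by simp
  then show ?thesis using h(1) by blast
qed

text \<open>Over a field both injections have linear left inverses, and the tensor product of these
  is a left inverse of the tensor product map. This is the way to prove an equation in a tensor
  product with a subspace: compare the images in the larger space.\<close>

lemma tens_injD:
  assumes m: "module K V" "module K W" "module K V'" "module K W'"
    and f: "lin V V' f" "inj_on f (carrier V)" and g: "lin W W' g" "inj_on g (carrier W)"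
    and t: "t \<in> carrier (V \<otimes>\<^sub>k W)" and t': "t' \<in> carrier (V \<otimes>\<^sub>k W)"
    and eq: "sw V W (V' \<otimes>\<^sub>k W') t (\<lambda>v w. tn V' W' (f v) (g w)) =
      sw V W (V' \<otimes>\<^sub>k W') t' (\<lambda>v w. tn V' W' (f v) (g w))"
  shows "t = t'"
proof -
  obtain f' where f': "lin V' V f'" "\<And>v. v \<in> carrier V \<Longrightarrow> f' (f v) = v"
    using linear_left_inverse[OF m(1,3) f] by blast
  obtain g' where g': "lin W' W g'" "\<And>v. v \<in> carrier W \<Longrightarrow> g' (g v) = v"
    using linear_left_inverse[OF m(2,4) g] by blast
  note c = linear_map_comp[OF f(1)] linear_map_comp[OF g(1)] linear_map_comp[OF f'(1)] linear_map_comp[OF g'(1)]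
    linear_mapD(1)[OF f(1)] linear_mapD(1)[OF g(1)] linear_mapD(1)[OF f'(1)] linear_mapD(1)[OF g'(1)]
  have "sw V' W' (V \<otimes>\<^sub>k W) (sw V W (V' \<otimes>\<^sub>k W') t (\<lambda>v w. tn V' W' (f v) (g w))) (\<lambda>v w. tn V W (f' v) (g' w)) = t"
    if "t \<in> carrier (V \<otimes>\<^sub>k W)" for t
    using that m by (simp add: c f' g' f g sweedler_tens_id)
  then show ?thesis using eq t t' by metis
qed

context
  fixes X :: "('k, 'u, 'x) module_scheme" and V :: "('k, 'u, 'v) module_scheme"
    and W :: "('k, 'u, 'w) module_scheme" and S :: "('k, 'u, 's) module_scheme" and f g
  assumes m: "module K X" "module K V" "module K W"
    and f: "lin V W f" and g: "lin V W g"
    and S: "same_space S (V\<lparr>carrier := {v \<in> carrier V. f v = g v}\<rparr>)"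
begin

text \<open>Tensor the decomposition \<open>v = p v + (h (f v) - h (g v))\<close> of \<open>equaliser_decomposition\<close>: the
  second part vanishes on \<open>u\<close>.\<close>

lemma tensor_equaliser:
  shows "\<lbrakk>u \<in> carrier (X \<otimes>\<^sub>k V);
      sw X V (X \<otimes>\<^sub>k W) u (\<lambda>x v. tn X W x (f v)) = sw X V (X \<otimes>\<^sub>k W) u (\<lambda>x v. tn X W x (g v))\<rbrakk>
      \<Longrightarrow> \<exists>u' \<in> carrier (X \<otimes>\<^sub>k S). sw X S (X \<otimes>\<^sub>k V) u' (tn X V) = u"
    and "\<lbrakk>u \<in> carrier (V \<otimes>\<^sub>k X);
      sw V X (W \<otimes>\<^sub>k X) u (\<lambda>v x. tn W X (f v) x) = sw V X (W \<otimes>\<^sub>k X) u (\<lambda>v x. tn W X (g v) x)\<rbrakk>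
      \<Longrightarrow> \<exists>u' \<in> carrier (S \<otimes>\<^sub>k X). sw S X (V \<otimes>\<^sub>k X) u' (tn V X) = u"
proof -
  interpret X: module K X by (rule m)
  interpret V: module K V by (rule m)
  obtain p h where p: "lin V (V\<lparr>carrier := {v \<in> carrier V. f v = g v}\<rparr>) p" and h: "lin W V h"
    and dec: "\<And>v. v \<in> carrier V \<Longrightarrow> v = p v \<oplus>\<^bsub>V\<^esub> (h (f v) \<ominus>\<^bsub>V\<^esub> h (g v))"
    using equaliser_decomposition[OF field_K m(2,3) f g] by blast
  have pS: "lin V S p" using p by (simp add: same_spaceD(7)[OF S])
  have S_carr: "carrier S = {v \<in> carrier V. f v = g v}" using S by (simp add: same_space_def)
  have mS: "module K S"
    unfolding same_spaceD(5)[OF S]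
    by (rule submodule.submodule_is_module[OF submodule_equaliser[OF m(2,3) f g] m(2)])
  have SV: "lin S V (\<lambda>x. x)"
    using V.module_axioms unfolding same_spaceD(6)[OF S] by (simp add: linear_map_def)
  note c = linear_map_comp[OF f] linear_map_comp[OF g] linear_map_comp[OF h] linear_map_comp[OF pS]
    linear_map_comp[OF SV] linear_map_comp[OF SV, OF linear_map_comp[OF pS]]
    linear_mapD(1)[OF f] linear_mapD(1)[OF g] linear_mapD(1)[OF h] linear_mapD(1)[OF pS]
    linear_mapD(1)[OF SV] linear_mapD(1)[OF SV, OF linear_mapD(1)[OF pS]]
  { assume u: "u \<in> carrier (X \<otimes>\<^sub>k V)" and eq: "sw X V (X \<otimes>\<^sub>k W) u (\<lambda>x v. tn X W x (f v)) =
      sw X V (X \<otimes>\<^sub>k W) u (\<lambda>x v. tn X W x (g v))"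
    let ?T = "X \<otimes>\<^sub>k V"
    interpret T: module K ?T by (simp add: m)
    \<comment> \<open>Applying \<open>1 \<otimes> h\<close> to the hypothesis on \<open>u\<close>
      shows that the two correction terms are equal, so only the part coming from \<open>p\<close>
      is left.\<close>
    have hf: "sw X V ?T u (\<lambda>x v. tn X V x (h (f v))) = sw X V ?T u (\<lambda>x v. tn X V x (h (g v)))"
      using arg_cong[OF eq, of "\<lambda>y. sw X W ?T y (\<lambda>x w. tn X V x (h w))"] u by (simp add: m c)
    have "u = sw X V ?T u (\<lambda>x v. tn X V x (p v)) \<oplus>\<^bsub>?T\<^esub>
        (sw X V ?T u (\<lambda>x v. tn X V x (h (f v))) \<ominus>\<^bsub>?T\<^esub> sw X V ?T u (\<lambda>x v. tn X V x (h (g v))))"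
    proof (rule tensor_eqI[OF m(1,2) T.module_axioms _ _ u, of "\<lambda>u. u"])
      fix x v assume x: "x \<in> carrier X" and v: "v \<in> carrier V"
      have l: "lin V ?T (tn X V x)" using x by (simp add: m)
      have "tn X V x v = tn X V x (p v \<oplus>\<^bsub>V\<^esub> (h (f v) \<ominus>\<^bsub>V\<^esub> h (g v)))"
        using dec[OF v] by simp
      also have "\<dots> = tn X V x (p v) \<oplus>\<^bsub>?T\<^esub> (tn X V x (h (f v)) \<ominus>\<^bsub>?T\<^esub> tn X V x (h (g v)))"
        using x v by (simp add: V.M.minus_eq T.M.minus_eq linear_mapD(2)[OF l] linear_map_minus[OF _ _ l] c m)
      finally show "tn X V x v = sw X V ?T (tn X V x v) (\<lambda>x v. tn X V x (p v)) \<oplus>\<^bsub>?T\<^esub>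
        (sw X V ?T (tn X V x v) (\<lambda>x v. tn X V x (h (f v))) \<ominus>\<^bsub>?T\<^esub> sw X V ?T (tn X V x v) (\<lambda>x v. tn X V x (h (g v))))"
        by (rule trans) (use x v in \<open>simp add: c m\<close>)
    qed (simp_all add: linear_map_add linear_map_diff c m)
    also have "\<dots> = sw X V ?T u (\<lambda>x v. tn X V x (p v))"
      using u by (simp add: hf T.M.minus_eq T.M.r_neg c m)
    also have "\<dots> = sw X S ?T (sw X V (X \<otimes>\<^sub>k S) u (\<lambda>x v. tn X S x (p v))) (tn X V)"
      using u by (simp add: c m mS)
    finally show "\<exists>u' \<in> carrier (X \<otimes>\<^sub>k S). sw X S (X \<otimes>\<^sub>k V) u' (tn X V) = u"
      using u by (intro bexI[of _ "sw X V (X \<otimes>\<^sub>k S) u (\<lambda>x v. tn X S x (p v))"]) (simp_all add: c m mS) }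
  { assume u: "u \<in> carrier (V \<otimes>\<^sub>k X)" and eq: "sw V X (W \<otimes>\<^sub>k X) u (\<lambda>v x. tn W X (f v) x) =
      sw V X (W \<otimes>\<^sub>k X) u (\<lambda>v x. tn W X (g v) x)"
    let ?T = "V \<otimes>\<^sub>k X"
    interpret T: module K ?T by (simp add: m)
    have hf: "sw V X ?T u (\<lambda>v x. tn V X (h (f v)) x) = sw V X ?T u (\<lambda>v x. tn V X (h (g v)) x)"
      using arg_cong[OF eq, of "\<lambda>y. sw W X ?T y (\<lambda>w x. tn V X (h w) x)"] u by (simp add: m c)
    have "u = sw V X ?T u (\<lambda>v x. tn V X (p v) x) \<oplus>\<^bsub>?T\<^esub>
        (sw V X ?T u (\<lambda>v x. tn V X (h (f v)) x) \<ominus>\<^bsub>?T\<^esub> sw V X ?T u (\<lambda>v x. tn V X (h (g v)) x))"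
    proof (rule tensor_eqI[OF m(2,1) T.module_axioms _ _ u, of "\<lambda>u. u"])
      fix x v assume x: "x \<in> carrier X" and v: "v \<in> carrier V"
      have l: "lin V ?T (\<lambda>v. tn V X v x)" using x by (simp add: m)
      have "tn V X v x = tn V X (p v \<oplus>\<^bsub>V\<^esub> (h (f v) \<ominus>\<^bsub>V\<^esub> h (g v))) x"
        using dec[OF v] by simp
      also have "\<dots> = tn V X (p v) x \<oplus>\<^bsub>?T\<^esub> (tn V X (h (f v)) x \<ominus>\<^bsub>?T\<^esub> tn V X (h (g v)) x)"
        using x v by (simp add: V.M.minus_eq T.M.minus_eq linear_mapD(2)[OF l] linear_map_minus[OF _ _ l] c m)
      finally show "tn V X v x = sw V X ?T (tn V X v x) (\<lambda>v x. tn V X (p v) x) \<oplus>\<^bsub>?T\<^esub>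
        (sw V X ?T (tn V X v x) (\<lambda>v x. tn V X (h (f v)) x) \<ominus>\<^bsub>?T\<^esub> sw V X ?T (tn V X v x) (\<lambda>v x. tn V X (h (g v)) x))"
        by (rule trans) (use x v in \<open>simp add: c m\<close>)
    qed (simp_all add: linear_map_add linear_map_diff c m)
    also have "\<dots> = sw V X ?T u (\<lambda>v x. tn V X (p v) x)"
      using u by (simp add: hf T.M.minus_eq T.M.r_neg c m)
    also have "\<dots> = sw S X ?T (sw V X (S \<otimes>\<^sub>k X) u (\<lambda>v x. tn S X (p v) x)) (tn V X)"
      using u by (simp add: c m mS)
    finally show "\<exists>u' \<in> carrier (S \<otimes>\<^sub>k X). sw S X (V \<otimes>\<^sub>k X) u' (tn V X) = u"
      using u by (intro bexI[of _ "sw V X (S \<otimes>\<^sub>k X) u (\<lambda>v x. tn S X (p v) x)"]) (simp_all add: c m mS) }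
qed

end

end

section \<open>Tetramodules\<close>

locale bialgebra_setting = linear_setting K "TYPE('u)"
  for K :: "('k, 'c) ring_scheme" and A :: "('k, 'u) bialgebra" +
  assumes bialgebra_A: "bialgebra K A"
begin

abbreviation amult :: "'u \<Rightarrow> 'u \<Rightarrow> 'u" (infixl \<open>\<cdot>\<^sub>A\<close> 70) where "amult \<equiv> mult A"
abbreviation "\<Delta> \<equiv> comult A"
abbreviation "\<epsilon> \<equiv> counit A"

lemma ring_A: "ring A" and module_A [simp]: "module K A"
  using bialgebra_A by (simp_all add: bialgebra_def)

interpretation A: ring A by (rule ring_A)

lemma mult_A [simp]:
  "a \<in> carrier A \<Longrightarrow> b \<in> carrier A \<Longrightarrow> a \<cdot>\<^sub>A b \<in> carrier A"
  "a \<in> carrier A \<Longrightarrow> b \<in> carrier A \<Longrightarrow> c \<in> carrier A \<Longrightarrow> (a \<cdot>\<^sub>A b) \<cdot>\<^sub>A c = a \<cdot>\<^sub>A (b \<cdot>\<^sub>A c)"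
  "\<one>\<^bsub>A\<^esub> \<in> carrier A"
  "a \<in> carrier A \<Longrightarrow> \<one>\<^bsub>A\<^esub> \<cdot>\<^sub>A a = a"
  "a \<in> carrier A \<Longrightarrow> a \<cdot>\<^sub>A \<one>\<^bsub>A\<^esub> = a"
  by (simp_all add: A.m_assoc)

lemma mult_A_bilinear: "bilinear_map K A A A (mult A)"
  using bialgebra_A by (simp add: bialgebra_def)

lemma linear_mult_A [simp]:
  "b \<in> carrier A \<Longrightarrow> lin X A e \<Longrightarrow> lin X A (\<lambda>x. e x \<cdot>\<^sub>A b)"
  "a \<in> carrier A \<Longrightarrow> lin X A e \<Longrightarrow> lin X A (\<lambda>x. a \<cdot>\<^sub>A e x)"
  "a \<in> carrier A \<Longrightarrow> lin A A (mult A a)"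
  by (simp_all add: linear_map_comp[OF bilinear_mapD(1)[OF mult_A_bilinear]]
    linear_map_comp[OF bilinear_mapD(2)[OF mult_A_bilinear]] bilinear_mapD[OF mult_A_bilinear])

lemma linear_comult: "lin A (A \<otimes>\<^sub>k A) \<Delta>"
  using bialgebra_A by (simp add: bialgebra_def)

lemma comult_linear [simp]:
  "lin X A e \<Longrightarrow> lin X (A \<otimes>\<^sub>k A) (\<lambda>x. \<Delta> (e x))" "lin A (A \<otimes>\<^sub>k A) \<Delta>"
  "a \<in> carrier A \<Longrightarrow> \<Delta> a \<in> carrier (A \<otimes>\<^sub>k A)"
  by (simp_all add: linear_map_comp[OF linear_comult] linear_comult linear_mapD(1)[OF linear_comult])

lemma counit_closed [simp]: "a \<in> carrier A \<Longrightarrow> \<epsilon> a \<in> carrier K"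
  using bialgebra_A by (auto simp: bialgebra_def)

text \<open>The values of \<epsilon> are scalars and not points of a space inside \<open>'u\<close>,
  so \<open>lin\<close> cannot be said of \<epsilon> itself; its linearity is expressed through
  multiples of a fixed vector.\<close>

lemma counit_linear [simp]:
  assumes P: "module K P" and p: "p \<in> carrier P" and e: "lin X A e"
  shows "lin X P (\<lambda>x. \<epsilon> (e x) \<odot>\<^bsub>P\<^esub> p)"
proof -
  interpret P: module K P by fact
  have "a \<in> carrier A \<Longrightarrow> b \<in> carrier A \<Longrightarrow> \<epsilon> (a \<oplus>\<^bsub>A\<^esub> b) = \<epsilon> a \<oplus>\<^bsub>K\<^esub> \<epsilon> b"
    "a \<in> carrier A \<Longrightarrow> c \<in> carrier K \<Longrightarrow> \<epsilon> (c \<odot>\<^bsub>A\<^esub> a) = c \<otimes>\<^bsub>K\<^esub> \<epsilon> a" for a b c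
    using bialgebra_A by (simp_all add: bialgebra_def)
  then show ?thesis
    by (intro linear_mapI) (simp_all add: linear_mapD[OF e] p P.smult_l_distr P.smult_assoc1)
qed

lemma counit_linear_smult [simp]:
  assumes P: "module K P" and a: "a \<in> carrier A" and e: "lin X P e"
  shows "lin X P (\<lambda>x. \<epsilon> a \<odot>\<^bsub>P\<^esub> e x)"
  by (rule linear_map_smult[OF P _ e]) (simp add: a)

lemma counit_smult_closed [simp]:
  assumes P: "module K P" and a: "a \<in> carrier A" and p: "p \<in> carrier P"
  shows "\<epsilon> a \<odot>\<^bsub>P\<^esub> p \<in> carrier P"
  using module.smult_closed[OF P] a p by simp

lemma counit_mult [simp]:
  "module K P \<Longrightarrow> p \<in> carrier P \<Longrightarrow> a \<in> carrier A \<Longrightarrow> b \<in> carrier A \<Longrightarrow>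
    \<epsilon> (a \<cdot>\<^sub>A b) \<odot>\<^bsub>P\<^esub> p = \<epsilon> a \<odot>\<^bsub>P\<^esub> (\<epsilon> b \<odot>\<^bsub>P\<^esub> p)"
  using bialgebra_A module.smult_assoc1[of K P] by (auto simp: bialgebra_def)

lemma comult_one [simp]: "\<Delta> \<one>\<^bsub>A\<^esub> = tn A A \<one>\<^bsub>A\<^esub> \<one>\<^bsub>A\<^esub>"
  using bialgebra_A by (simp add: bialgebra_def)

text \<open>Follows by applying \<open>f\<close> to the counit law of \<open>A\<close>. With an
  arbitrary linear \<open>f\<close> in the summand the law can be used inside longer sums.\<close>

lemma sweedler_counit_left [simp]:
  assumes a: "a \<in> carrier A" and P: "module K P" and f: "lin A P f"
  shows "sw A A P (\<Delta> a) (\<lambda>a1 a2. \<epsilon> a1 \<odot>\<^bsub>P\<^esub> f a2) = f a"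
proof -
  have "f (sw A A A (\<Delta> a) (\<lambda>a1 a2. \<epsilon> a1 \<odot>\<^bsub>A\<^esub> a2)) = f a"
    using bialgebra_A a by (simp add: bialgebra_def)
  then show ?thesis
    using a P by (simp add: sweedler_linear[OF _ _ _ P f] linear_mapD(3)[OF f])
qed

lemma sweedler_counit_right [simp]:
  assumes a: "a \<in> carrier A" and P: "module K P" and f: "lin A P f"
  shows "sw A A P (\<Delta> a) (\<lambda>a1 a2. \<epsilon> a2 \<odot>\<^bsub>P\<^esub> f a1) = f a"
proof -
  have "f (sw A A A (\<Delta> a) (\<lambda>a1 a2. \<epsilon> a2 \<odot>\<^bsub>A\<^esub> a1)) = f a"
    using bialgebra_A a by (simp add: bialgebra_def)
  then show ?thesis
    using a P by (simp add: sweedler_linear[OF _ _ _ P f] linear_mapD(3)[OF f])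
qed

lemma comult_mult [simp]:
  "a \<in> carrier A \<Longrightarrow> b \<in> carrier A \<Longrightarrow> \<Delta> (a \<cdot>\<^sub>A b) = sw A A (A \<otimes>\<^sub>k A) (\<Delta> a) (\<lambda>a1 a2.
      sw A A (A \<otimes>\<^sub>k A) (\<Delta> b) (\<lambda>b1 b2. tn A A (a1 \<cdot>\<^sub>A b1) (a2 \<cdot>\<^sub>A b2)))"
  using bialgebra_A by (simp add: bialgebra_def)

text \<open>Writes the coproduct as the sum of its own pure tensors, but only where it stands inside
  another tensor; there the result no longer contains the pattern, while unrestricted expansion of a
  coproduct would go on for ever.\<close>

lemma tens_comult [simp]:
  assumes "module K V" "v \<in> carrier V" "a \<in> carrier A"
  shows "tn V (A \<otimes>\<^sub>k A) v (\<Delta> a) = sw A A (V \<otimes>\<^sub>k A \<otimes>\<^sub>k A) (\<Delta> a) (\<lambda>b c. tn V (A \<otimes>\<^sub>k A) v (tn A A b c))"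
    and "tn (A \<otimes>\<^sub>k A) V (\<Delta> a) v = sw A A ((A \<otimes>\<^sub>k A) \<otimes>\<^sub>k V) (\<Delta> a) (\<lambda>b c. tn (A \<otimes>\<^sub>k A) V (tn A A b c) v)"
proof -
  have "sw A A (A \<otimes>\<^sub>k A) (\<Delta> a) (tn A A) = \<Delta> a" using assms by (simp add: sweedler_tens_id)
  then show "tn V (A \<otimes>\<^sub>k A) v (\<Delta> a) = sw A A (V \<otimes>\<^sub>k A \<otimes>\<^sub>k A) (\<Delta> a) (\<lambda>b c. tn V (A \<otimes>\<^sub>k A) v (tn A A b c))"
    "tn (A \<otimes>\<^sub>k A) V (\<Delta> a) v = sw A A ((A \<otimes>\<^sub>k A) \<otimes>\<^sub>k V) (\<Delta> a) (\<lambda>b c. tn (A \<otimes>\<^sub>k A) V (tn A A b c) v)"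
    using assms tens_sweedler_left[of A A "A \<otimes>\<^sub>k A" V "\<Delta> a" v "tn A A"]
      tens_sweedler_right[of A A "A \<otimes>\<^sub>k A" V "\<Delta> a" v "tn A A"] by simp_all
qed

text \<open>The trilinear \<open>f\<close> induces a linear map on
  \<open>A \<otimes> A \<otimes> A\<close>; this map is applied to the coassociativity law. The
  orientation makes every repeated coproduct split the second leg.\<close>

lemma sweedler_coassoc_A [simp]:
  assumes a: "a \<in> carrier A" and P: "module K P"
    and f: "\<And>u v. u \<in> carrier A \<Longrightarrow> v \<in> carrier A \<Longrightarrow> lin A P (\<lambda>w. f u v w)"
      "\<And>u w. u \<in> carrier A \<Longrightarrow> w \<in> carrier A \<Longrightarrow> lin A P (\<lambda>v. f u v w)"
      "\<And>v w. v \<in> carrier A \<Longrightarrow> w \<in> carrier A \<Longrightarrow> lin A P (\<lambda>u. f u v w)"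
  shows "sw A A P (\<Delta> a) (\<lambda>a1 a2. sw A A P (\<Delta> a1) (\<lambda>b1 b2. f b1 b2 a2)) =
    sw A A P (\<Delta> a) (\<lambda>a1 a2. sw A A P (\<Delta> a2) (\<lambda>b1 b2. f a1 b1 b2))"
proof -
  have coassoc: "tassoc K A A A (tmap K A A (A \<otimes>\<^sub>k A) A \<Delta> (\<lambda>b. b) (\<Delta> a))
       = tmap K A A A (A \<otimes>\<^sub>k A) (\<lambda>b. b) \<Delta> (\<Delta> a)"
    using bialgebra_A a by (simp add: bialgebra_def)
  show ?thesis
    using a P f arg_cong[OF coassoc, of "\<lambda>z. sw A (A \<otimes>\<^sub>k A) P z (\<lambda>u w. sw A A P w (\<lambda>v w. f u v w))"]
    by (simp add: tassoc_def tmap_def)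
qed

section \<open>Rules for a single tetramodule\<close>

abbreviation "tetra \<equiv> tetramodule K A"

context
  fixes M :: "('k, 'u) tetramodule"
  assumes M: "tetra M"
begin

lemma tetra_module [simp]: "module K M"
  using M by (simp add: tetramodule_def bimodule_def)

lemma lact_bilinear: "bilinear_map K A M M (lact M)" and ract_bilinear: "bilinear_map K M A M (ract M)"
  using M by (simp_all add: tetramodule_def bimodule_def)

lemma linear_lact [simp]:
  "m \<in> carrier M \<Longrightarrow> lin X A e \<Longrightarrow> lin X M (\<lambda>x. lact M (e x) m)"
  "a \<in> carrier A \<Longrightarrow> lin X M f \<Longrightarrow> lin X M (\<lambda>x. lact M a (f x))"
  "a \<in> carrier A \<Longrightarrow> lin M M (lact M a)"
  "a \<in> carrier A \<Longrightarrow> m \<in> carrier M \<Longrightarrow> lact M a m \<in> carrier M"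
  by (simp_all add: linear_map_comp[OF bilinear_mapD(1)[OF lact_bilinear]]
    linear_map_comp[OF bilinear_mapD(2)[OF lact_bilinear]] bilinear_mapD[OF lact_bilinear])

lemma linear_ract [simp]:
  "a \<in> carrier A \<Longrightarrow> lin X M f \<Longrightarrow> lin X M (\<lambda>x. ract M (f x) a)"
  "m \<in> carrier M \<Longrightarrow> lin X A e \<Longrightarrow> lin X M (\<lambda>x. ract M m (e x))"
  "m \<in> carrier M \<Longrightarrow> lin A M (ract M m)"
  "a \<in> carrier A \<Longrightarrow> m \<in> carrier M \<Longrightarrow> ract M m a \<in> carrier M"
  by (simp_all add: linear_map_comp[OF bilinear_mapD(1)[OF ract_bilinear]]
    linear_map_comp[OF bilinear_mapD(2)[OF ract_bilinear]] bilinear_mapD[OF ract_bilinear])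

lemma act_simps [simp]:
  "a \<in> carrier A \<Longrightarrow> b \<in> carrier A \<Longrightarrow> m \<in> carrier M \<Longrightarrow> lact M (a \<cdot>\<^sub>A b) m = lact M a (lact M b m)"
  "a \<in> carrier A \<Longrightarrow> b \<in> carrier A \<Longrightarrow> m \<in> carrier M \<Longrightarrow> ract M m (a \<cdot>\<^sub>A b) = ract M (ract M m a) b"
  "a \<in> carrier A \<Longrightarrow> b \<in> carrier A \<Longrightarrow> m \<in> carrier M \<Longrightarrow> ract M (lact M a m) b = lact M a (ract M m b)"
  "m \<in> carrier M \<Longrightarrow> lact M \<one>\<^bsub>A\<^esub> m = m"
  "m \<in> carrier M \<Longrightarrow> ract M m \<one>\<^bsub>A\<^esub> = m"
  using M by (simp_all add: tetramodule_def bimodule_def)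

lemma linear_lcoact: "lin M (A \<otimes>\<^sub>k M) (lcoact M)" and linear_rcoact: "lin M (M \<otimes>\<^sub>k A) (rcoact M)"
  using M by (simp_all add: tetramodule_def bicomodule_def)

lemma coact_linear [simp]:
  "lin X M f \<Longrightarrow> lin X (A \<otimes>\<^sub>k M) (\<lambda>x. lcoact M (f x))" "lin M (A \<otimes>\<^sub>k M) (lcoact M)"
  "lin X M f \<Longrightarrow> lin X (M \<otimes>\<^sub>k A) (\<lambda>x. rcoact M (f x))" "lin M (M \<otimes>\<^sub>k A) (rcoact M)"
  "m \<in> carrier M \<Longrightarrow> lcoact M m \<in> carrier (A \<otimes>\<^sub>k M)"
  "m \<in> carrier M \<Longrightarrow> rcoact M m \<in> carrier (M \<otimes>\<^sub>k A)"
  by (simp_all add: linear_map_comp[OF linear_lcoact] linear_lcoact linear_mapD(1)[OF linear_lcoact]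
    linear_map_comp[OF linear_rcoact] linear_rcoact linear_mapD(1)[OF linear_rcoact])

lemma lcoact_sweedler [simp]:
  assumes "module K V" "module K W" "t \<in> carrier (V \<otimes>\<^sub>k W)"
    and "\<And>v. v \<in> carrier V \<Longrightarrow> lin W M (\<lambda>w. f v w)" "\<And>w. w \<in> carrier W \<Longrightarrow> lin V M (\<lambda>v. f v w)"
  shows "lcoact M (sw V W M t f) = sw V W (A \<otimes>\<^sub>k M) t (\<lambda>v w. lcoact M (f v w))"
  using assms by (intro sweedler_linear[where g = "lcoact M"]) simp_all

lemma rcoact_sweedler [simp]:
  assumes "module K V" "module K W" "t \<in> carrier (V \<otimes>\<^sub>k W)"
    and "\<And>v. v \<in> carrier V \<Longrightarrow> lin W M (\<lambda>w. f v w)" "\<And>w. w \<in> carrier W \<Longrightarrow> lin V M (\<lambda>v. f v w)"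
  shows "rcoact M (sw V W M t f) = sw V W (M \<otimes>\<^sub>k A) t (\<lambda>v w. rcoact M (f v w))"
  using assms by (intro sweedler_linear[where g = "rcoact M"]) simp_all

lemma sweedler_counit_lcoact [simp]:
  assumes m: "m \<in> carrier M" and P: "module K P" and f: "lin M P f"
  shows "sw A M P (lcoact M m) (\<lambda>a x. \<epsilon> a \<odot>\<^bsub>P\<^esub> f x) = f m"
proof -
  have "f (sw A M M (lcoact M m) (\<lambda>a x. \<epsilon> a \<odot>\<^bsub>M\<^esub> x)) = f m"
    using M m by (simp add: tetramodule_def bicomodule_def)
  then show ?thesis
    using m P by (simp add: sweedler_linear[OF _ _ _ P f] linear_mapD(3)[OF f])
qed

lemma sweedler_counit_rcoact [simp]:
  assumes m: "m \<in> carrier M" and P: "module K P" and f: "lin M P f"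
  shows "sw M A P (rcoact M m) (\<lambda>x a. \<epsilon> a \<odot>\<^bsub>P\<^esub> f x) = f m"
proof -
  have "f (sw M A M (rcoact M m) (\<lambda>x a. \<epsilon> a \<odot>\<^bsub>M\<^esub> x)) = f m"
    using M m by (simp add: tetramodule_def bicomodule_def)
  then show ?thesis
    using m P by (simp add: sweedler_linear[OF _ _ _ P f] linear_mapD(3)[OF f])
qed

text \<open>Coassociativity, tested against a trilinear \<open>f\<close>. A coproduct of the leg in
  \<open>A\<close> is traded for a second coaction; the law for the right coaction is oriented in
  the same way, so that repeated coactions have one normal form.\<close>

lemma sweedler_coassoc_left [simp]:
  assumes m: "m \<in> carrier M" and P: "module K P"
    and f: "\<And>a b. a \<in> carrier A \<Longrightarrow> b \<in> carrier A \<Longrightarrow> lin M P (\<lambda>x. f a b x)"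
      "\<And>a x. a \<in> carrier A \<Longrightarrow> x \<in> carrier M \<Longrightarrow> lin A P (\<lambda>b. f a b x)"
      "\<And>b x. b \<in> carrier A \<Longrightarrow> x \<in> carrier M \<Longrightarrow> lin A P (\<lambda>a. f a b x)"
  shows "sw A M P (lcoact M m) (\<lambda>a x. sw A A P (\<Delta> a) (\<lambda>a1 a2. f a1 a2 x)) =
    sw A M P (lcoact M m) (\<lambda>a x. sw A M P (lcoact M x) (\<lambda>b y. f a b y))"
proof -
  have coassoc: "tassoc K A A M (tmap K A M (A \<otimes>\<^sub>k A) M \<Delta> (\<lambda>x. x) (lcoact M m))
       = tmap K A M A (A \<otimes>\<^sub>k M) (\<lambda>b. b) (lcoact M) (lcoact M m)"
    using M m by (simp add: tetramodule_def bicomodule_def)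
  show ?thesis
    using m P f arg_cong[OF coassoc, of "\<lambda>z. sw A (A \<otimes>\<^sub>k M) P z (\<lambda>u w. sw A M P w (\<lambda>v w. f u v w))"]
    by (simp add: tassoc_def tmap_def)
qed

lemma sweedler_coassoc_right [simp]:
  assumes m: "m \<in> carrier M" and P: "module K P"
    and f: "\<And>a b. a \<in> carrier A \<Longrightarrow> b \<in> carrier A \<Longrightarrow> lin M P (\<lambda>x. f x a b)"
      "\<And>a x. a \<in> carrier A \<Longrightarrow> x \<in> carrier M \<Longrightarrow> lin A P (\<lambda>b. f x a b)"
      "\<And>b x. b \<in> carrier A \<Longrightarrow> x \<in> carrier M \<Longrightarrow> lin A P (\<lambda>a. f x a b)"
  shows "sw M A P (rcoact M m) (\<lambda>x a. sw A A P (\<Delta> a) (\<lambda>a1 a2. f x a1 a2)) =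
    sw M A P (rcoact M m) (\<lambda>x b. sw M A P (rcoact M x) (\<lambda>y a. f y a b))"
proof -
  have coassoc: "tassoc K M A A (tmap K M A (M \<otimes>\<^sub>k A) A (rcoact M) (\<lambda>a. a) (rcoact M m))
         = tmap K M A M (A \<otimes>\<^sub>k A) (\<lambda>x. x) \<Delta> (rcoact M m)"
    using M m by (simp add: tetramodule_def bicomodule_def)
  show ?thesis
    using m P f arg_cong[OF coassoc, of "\<lambda>z. sw M (A \<otimes>\<^sub>k A) P z (\<lambda>u w. sw A A P w (\<lambda>v w. f u v w))"]
    by (simp add: tassoc_def tmap_def)
qed

text \<open>The commutation of the two coactions, again tested against a trilinear \<open>f\<close>.
  In normal form the left coaction is taken first and the right one inside it.\<close>

lemma sweedler_coassoc_mid [simp]: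
  assumes m: "m \<in> carrier M" and P: "module K P"
    and f: "\<And>a b. a \<in> carrier A \<Longrightarrow> b \<in> carrier A \<Longrightarrow> lin M P (\<lambda>x. f a x b)"
      "\<And>a x. a \<in> carrier A \<Longrightarrow> x \<in> carrier M \<Longrightarrow> lin A P (\<lambda>b. f a x b)"
      "\<And>b x. b \<in> carrier A \<Longrightarrow> x \<in> carrier M \<Longrightarrow> lin A P (\<lambda>a. f a x b)"
  shows "sw M A P (rcoact M m) (\<lambda>x a. sw A M P (lcoact M x) (\<lambda>b y. f b y a)) =
    sw A M P (lcoact M m) (\<lambda>b x. sw M A P (rcoact M x) (\<lambda>y a. f b y a))"
proof -
  have coassoc: "tassoc K A M A (tmap K M A (A \<otimes>\<^sub>k M) A (lcoact M) (\<lambda>a. a) (rcoact M m))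
         = tmap K A M A (M \<otimes>\<^sub>k A) (\<lambda>a. a) (rcoact M) (lcoact M m)"
    using M m by (simp add: tetramodule_def bicomodule_def)
  show ?thesis
    using m P f arg_cong[OF coassoc, of "\<lambda>z. sw A (M \<otimes>\<^sub>k A) P z (\<lambda>u w. sw M A P w (\<lambda>v w. f u v w))"]
    by (simp add: tassoc_def tmap_def)
qed

lemma tens_coact [simp]:
  assumes "module K V" "v \<in> carrier V" "m \<in> carrier M"
  shows "tn V (A \<otimes>\<^sub>k M) v (lcoact M m) =
      sw A M (V \<otimes>\<^sub>k A \<otimes>\<^sub>k M) (lcoact M m) (\<lambda>b c. tn V (A \<otimes>\<^sub>k M) v (tn A M b c))"
    and "tn (A \<otimes>\<^sub>k M) V (lcoact M m) v =
      sw A M ((A \<otimes>\<^sub>k M) \<otimes>\<^sub>k V) (lcoact M m) (\<lambda>b c. tn (A \<otimes>\<^sub>k M) V (tn A M b c) v)"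
    and "tn V (M \<otimes>\<^sub>k A) v (rcoact M m) =
      sw M A (V \<otimes>\<^sub>k M \<otimes>\<^sub>k A) (rcoact M m) (\<lambda>b c. tn V (M \<otimes>\<^sub>k A) v (tn M A b c))"
    and "tn (M \<otimes>\<^sub>k A) V (rcoact M m) v =
      sw M A ((M \<otimes>\<^sub>k A) \<otimes>\<^sub>k V) (rcoact M m) (\<lambda>b c. tn (M \<otimes>\<^sub>k A) V (tn M A b c) v)"
proof -
  have l: "sw A M (A \<otimes>\<^sub>k M) (lcoact M m) (tn A M) = lcoact M m"
    and r: "sw M A (M \<otimes>\<^sub>k A) (rcoact M m) (tn M A) = rcoact M m"
    using assms by (simp_all add: sweedler_tens_id)
  show "tn V (A \<otimes>\<^sub>k M) v (lcoact M m) =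
      sw A M (V \<otimes>\<^sub>k A \<otimes>\<^sub>k M) (lcoact M m) (\<lambda>b c. tn V (A \<otimes>\<^sub>k M) v (tn A M b c))"
    "tn (A \<otimes>\<^sub>k M) V (lcoact M m) v =
      sw A M ((A \<otimes>\<^sub>k M) \<otimes>\<^sub>k V) (lcoact M m) (\<lambda>b c. tn (A \<otimes>\<^sub>k M) V (tn A M b c) v)"
    using assms tens_sweedler_left[of A M "A \<otimes>\<^sub>k M" V "lcoact M m" v "tn A M"]
      tens_sweedler_right[of A M "A \<otimes>\<^sub>k M" V "lcoact M m" v "tn A M"] by (simp_all add: l)
  show "tn V (M \<otimes>\<^sub>k A) v (rcoact M m) =
      sw M A (V \<otimes>\<^sub>k M \<otimes>\<^sub>k A) (rcoact M m) (\<lambda>b c. tn V (M \<otimes>\<^sub>k A) v (tn M A b c))"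
    "tn (M \<otimes>\<^sub>k A) V (rcoact M m) v =
      sw M A ((M \<otimes>\<^sub>k A) \<otimes>\<^sub>k V) (rcoact M m) (\<lambda>b c. tn (M \<otimes>\<^sub>k A) V (tn M A b c) v)"
    using assms tens_sweedler_left[of M A "M \<otimes>\<^sub>k A" V "rcoact M m" v "tn M A"]
      tens_sweedler_right[of M A "M \<otimes>\<^sub>k A" V "rcoact M m" v "tn M A"] by (simp_all add: r)
qed

context
  fixes a m
  assumes a: "a \<in> carrier A" and m: "m \<in> carrier M"
begin

lemma coact_act [simp]:
  "lcoact M (lact M a m) = sw A A (A \<otimes>\<^sub>k M) (\<Delta> a) (\<lambda>a1 a2.
    sw A M (A \<otimes>\<^sub>k M) (lcoact M m) (\<lambda>b x. tn A M (a1 \<cdot>\<^sub>A b) (lact M a2 x)))"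
  "lcoact M (ract M m a) = sw A A (A \<otimes>\<^sub>k M) (\<Delta> a) (\<lambda>a1 a2.
    sw A M (A \<otimes>\<^sub>k M) (lcoact M m) (\<lambda>b x. tn A M (b \<cdot>\<^sub>A a1) (ract M x a2)))"
  "rcoact M (lact M a m) = sw A A (M \<otimes>\<^sub>k A) (\<Delta> a) (\<lambda>a1 a2.
    sw M A (M \<otimes>\<^sub>k A) (rcoact M m) (\<lambda>x b. tn M A (lact M a1 x) (a2 \<cdot>\<^sub>A b)))"
  "rcoact M (ract M m a) = sw A A (M \<otimes>\<^sub>k A) (\<Delta> a) (\<lambda>a1 a2.
    sw M A (M \<otimes>\<^sub>k A) (rcoact M m) (\<lambda>x b. tn M A (ract M x a1) (b \<cdot>\<^sub>A a2)))"
  using M a m unfolding tetramodule_def by blast+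

end

end

section \<open>Morphisms of tetramodules\<close>

text \<open>Together with the next two rules this fixes an order for independent sums: coproducts of
  elements of \<open>A\<close> outermost, then left coactions, then right coactions.\<close>

lemma swap_lcoact_comult [simp]:
  assumes "tetra M" "m \<in> carrier M" "a \<in> carrier A" "module K P"
    and "\<And>x c d. x \<in> carrier M \<Longrightarrow> c \<in> carrier A \<Longrightarrow> d \<in> carrier A \<Longrightarrow> lin A P (\<lambda>b. f b x c d)"
      "\<And>b c d. b \<in> carrier A \<Longrightarrow> c \<in> carrier A \<Longrightarrow> d \<in> carrier A \<Longrightarrow> lin M P (\<lambda>x. f b x c d)"
      "\<And>b x d. b \<in> carrier A \<Longrightarrow> x \<in> carrier M \<Longrightarrow> d \<in> carrier A \<Longrightarrow> lin A P (\<lambda>c. f b x c d)"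
      "\<And>b x c. b \<in> carrier A \<Longrightarrow> x \<in> carrier M \<Longrightarrow> c \<in> carrier A \<Longrightarrow> lin A P (\<lambda>d. f b x c d)"
  shows "sw A M P (lcoact M m) (\<lambda>b x. sw A A P (\<Delta> a) (\<lambda>c d. f b x c d)) =
    sw A A P (\<Delta> a) (\<lambda>c d. sw A M P (lcoact M m) (\<lambda>b x. f b x c d))"
  by (rule sweedler_swap) (use assms in simp_all)

lemma swap_rcoact_comult [simp]:
  assumes "tetra M" "m \<in> carrier M" "a \<in> carrier A" "module K P"
    and "\<And>x c d. x \<in> carrier M \<Longrightarrow> c \<in> carrier A \<Longrightarrow> d \<in> carrier A \<Longrightarrow> lin A P (\<lambda>b. f x b c d)"
      "\<And>b c d. b \<in> carrier A \<Longrightarrow> c \<in> carrier A \<Longrightarrow> d \<in> carrier A \<Longrightarrow> lin M P (\<lambda>x. f x b c d)"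
      "\<And>b x d. b \<in> carrier A \<Longrightarrow> x \<in> carrier M \<Longrightarrow> d \<in> carrier A \<Longrightarrow> lin A P (\<lambda>c. f x b c d)"
      "\<And>b x c. b \<in> carrier A \<Longrightarrow> x \<in> carrier M \<Longrightarrow> c \<in> carrier A \<Longrightarrow> lin A P (\<lambda>d. f x b c d)"
  shows "sw M A P (rcoact M m) (\<lambda>x b. sw A A P (\<Delta> a) (\<lambda>c d. f x b c d)) =
    sw A A P (\<Delta> a) (\<lambda>c d. sw M A P (rcoact M m) (\<lambda>x b. f x b c d))"
  by (rule sweedler_swap) (use assms in simp_all)

lemma swap_rcoact_lcoact [simp]:
  assumes "tetra M" "tetra N" "m \<in> carrier M" "n \<in> carrier N" "module K P"
    and "\<And>x c d. x \<in> carrier M \<Longrightarrow> c \<in> carrier A \<Longrightarrow> d \<in> carrier N \<Longrightarrow> lin A P (\<lambda>b. f x b c d)"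
      "\<And>b c d. b \<in> carrier A \<Longrightarrow> c \<in> carrier A \<Longrightarrow> d \<in> carrier N \<Longrightarrow> lin M P (\<lambda>x. f x b c d)"
      "\<And>b x d. b \<in> carrier A \<Longrightarrow> x \<in> carrier M \<Longrightarrow> d \<in> carrier N \<Longrightarrow> lin A P (\<lambda>c. f x b c d)"
      "\<And>b x c. b \<in> carrier A \<Longrightarrow> x \<in> carrier M \<Longrightarrow> c \<in> carrier A \<Longrightarrow> lin N P (\<lambda>d. f x b c d)"
  shows "sw M A P (rcoact M m) (\<lambda>x b. sw A N P (lcoact N n) (\<lambda>c d. f x b c d)) =
    sw A N P (lcoact N n) (\<lambda>c d. sw M A P (rcoact M m) (\<lambda>x b. f x b c d))"
  by (rule sweedler_swap) (use assms in simp_all)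

text \<open>Two coproducts are sums of the same kind, so no order between them is preferred and the
  exchange is applied by hand.\<close>

lemma comult_swap:
  assumes "a \<in> carrier A" "b \<in> carrier A" "module K P"
    and "\<And>x c d. x \<in> carrier A \<Longrightarrow> c \<in> carrier A \<Longrightarrow> d \<in> carrier A \<Longrightarrow> lin A P (\<lambda>b. f x b c d)"
      "\<And>b c d. b \<in> carrier A \<Longrightarrow> c \<in> carrier A \<Longrightarrow> d \<in> carrier A \<Longrightarrow> lin A P (\<lambda>x. f x b c d)"
      "\<And>b x d. b \<in> carrier A \<Longrightarrow> x \<in> carrier A \<Longrightarrow> d \<in> carrier A \<Longrightarrow> lin A P (\<lambda>c. f x b c d)"
      "\<And>b x c. b \<in> carrier A \<Longrightarrow> x \<in> carrier A \<Longrightarrow> c \<in> carrier A \<Longrightarrow> lin A P (\<lambda>d. f x b c d)"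
  shows "sw A A P (\<Delta> a) (\<lambda>x y. sw A A P (\<Delta> b) (\<lambda>c d. f x y c d)) =
    sw A A P (\<Delta> b) (\<lambda>c d. sw A A P (\<Delta> a) (\<lambda>x y. f x y c d))"
  by (rule sweedler_swap) (use assms in simp_all)

section \<open>The tautological tetramodule and the external product
  \<open>\<boxtimes>\<^sub>2\<close>\<close>

lemmas tetra_defs = tetramodule_def bimodule_def bicomodule_def bilinear_map_def tassoc_def tmap_def

lemma same_space_taut: "same_space (taut A) A"
  by (simp add: same_space_def taut_def module.defs tetramodule.defs)

lemmas taut_space [simp] = same_spaceD[OF same_space_taut]

lemma taut_ops [simp]:
  "lact (taut A) = mult A" "ract (taut A) = mult A" "lcoact (taut A) = \<Delta>" "rcoact (taut A) = \<Delta>"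
  by (simp_all add: taut_def module.defs tetramodule.defs)

lemma tetra_taut [simp]: "tetra (taut A)"
  unfolding tetra_defs taut_space taut_ops
  \<comment> \<open>What is left concerns multiplication from the right: there the coproduct of the
    product sums over \<open>m\<close> first and the tetramodule law over \<open>a\<close>
    first.\<close>
  by (intro conjI ballI; simp) (rule comult_swap; simp)+

lemma same_space_ext2: "same_space (ext2 K A M N) (M \<otimes>\<^sub>k N)"
  by (simp add: same_space_def ext2_def module.defs tetramodule.defs)

lemmas ext2_space [simp] = same_spaceD[OF same_space_ext2]

lemma ext2_ops:
  "lact (ext2 K A M N) a t = sw A A (M \<otimes>\<^sub>k N) (\<Delta> a) (\<lambda>a1 a2.
       sw M N (M \<otimes>\<^sub>k N) t (\<lambda>m n. tn M N (lact M a1 m) (lact N a2 n)))"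
  "ract (ext2 K A M N) t a = sw A A (M \<otimes>\<^sub>k N) (\<Delta> a) (\<lambda>a1 a2.
       sw M N (M \<otimes>\<^sub>k N) t (\<lambda>m n. tn M N (ract M m a1) (ract N n a2)))"
  "lcoact (ext2 K A M N) t = sw M N (A \<otimes>\<^sub>k M \<otimes>\<^sub>k N) t (\<lambda>m n.
       sw A M (A \<otimes>\<^sub>k M \<otimes>\<^sub>k N) (lcoact M m) (\<lambda>a m'. tn A (M \<otimes>\<^sub>k N) a (tn M N m' n)))"
  "rcoact (ext2 K A M N) t = sw M N ((M \<otimes>\<^sub>k N) \<otimes>\<^sub>k A) t (\<lambda>m n.
       sw N A ((M \<otimes>\<^sub>k N) \<otimes>\<^sub>k A) (rcoact N n) (\<lambda>n' a. tn (M \<otimes>\<^sub>k N) A (tn M N m n') a))"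
  by (simp_all add: ext2_def module.defs tetramodule.defs)

lemma tetra_ext2:
  assumes M: "tetra M" and N: "tetra N"
  shows "tetra (ext2 K A M N)"
proof -
  note e = tensor_eqI[OF tetra_module[OF M] tetra_module[OF N]]
  have [simp]: "tetra M" "tetra N" by fact+
  show ?thesis
    unfolding tetra_defs ext2_space ext2_ops
    apply (intro conjI ballI; simp?)
    \<comment> \<open>Two successive diagonal actions of which one is from the right produce the
      sums over the two coproducts in opposite orders.\<close>
    apply (rule comult_swap; simp)+
    apply (simp_all add: sweedler_tens_id)
    \<comment> \<open>The four compatibilities between actions and coactions remain; each is linear
      in \<open>t\<close>.\<close>
    subgoal premises t for a t by (rule e[where P = "A \<otimes>\<^sub>k M \<otimes>\<^sub>k N", OF _ _ _ t(2)]) (use t(1) in simp_all)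
    subgoal premises t for a t by (rule e[where P = "A \<otimes>\<^sub>k M \<otimes>\<^sub>k N", OF _ _ _ t(2)]) (use t(1) in simp_all)
    subgoal premises t for a t by (rule e[where P = "(M \<otimes>\<^sub>k N) \<otimes>\<^sub>k A", OF _ _ _ t(2)]) (use t(1) in simp_all)
    subgoal premises t for a t by (rule e[where P = "(M \<otimes>\<^sub>k N) \<otimes>\<^sub>k A", OF _ _ _ t(2)]) (use t(1) in simp_all)
    done
qed

section \<open>Morphisms, identities and composition\<close>

lemma tetra_mapI:
  assumes "f \<in> extensional (carrier M)" "lin M N f"
    and "\<And>a m. a \<in> carrier A \<Longrightarrow> m \<in> carrier M \<Longrightarrow> f (lact M a m) = lact N a (f m)"
    and "\<And>a m. a \<in> carrier A \<Longrightarrow> m \<in> carrier M \<Longrightarrow> f (ract M m a) = ract N (f m) a"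
    and "\<And>m. m \<in> carrier M \<Longrightarrow> lcoact N (f m) = sw A M (A \<otimes>\<^sub>k N) (lcoact M m) (\<lambda>a x. tn A N a (f x))"
    and "\<And>m. m \<in> carrier M \<Longrightarrow> rcoact N (f m) = sw M A (N \<otimes>\<^sub>k A) (rcoact M m) (\<lambda>x a. tn N A (f x) a)"
  shows "tetra_map K A M N f"
  using assms by (simp add: tetra_map_def tmap_def)

context
  fixes M N :: "('k, 'u) tetramodule" and f
  assumes f: "tetra_map K A M N f"
begin

lemma tetra_map_linear: "lin M N f"
  using f by (simp add: tetra_map_def)

lemma tetra_map_simps:
  "lin M N f"
  "lin X M e \<Longrightarrow> lin X N (\<lambda>x. f (e x))"
  "m \<in> carrier M \<Longrightarrow> f m \<in> carrier N"
  "a \<in> carrier A \<Longrightarrow> m \<in> carrier M \<Longrightarrow> f (lact M a m) = lact N a (f m)"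
  "a \<in> carrier A \<Longrightarrow> m \<in> carrier M \<Longrightarrow> f (ract M m a) = ract N (f m) a"
  "m \<in> carrier M \<Longrightarrow> lcoact N (f m) = sw A M (A \<otimes>\<^sub>k N) (lcoact M m) (\<lambda>a x. tn A N a (f x))"
  "m \<in> carrier M \<Longrightarrow> rcoact N (f m) = sw M A (N \<otimes>\<^sub>k A) (rcoact M m) (\<lambda>x a. tn N A (f x) a)"
  using f linear_map_comp[OF tetra_map_linear] linear_mapD(1)[OF tetra_map_linear]
  by (simp_all add: tetra_map_def tmap_def)

lemma tetra_map_sweedler:
  assumes "module K V" "module K W" "module K M" "module K N" "t \<in> carrier (V \<otimes>\<^sub>k W)"
    and "\<And>v. v \<in> carrier V \<Longrightarrow> lin W M (\<lambda>w. g v w)" "\<And>w. w \<in> carrier W \<Longrightarrow> lin V M (\<lambda>v. g v w)"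
  shows "f (sw V W M t g) = sw V W N t (\<lambda>v w. f (g v w))"
  using assms by (intro sweedler_linear tetra_map_linear)

end

lemmas tetra_map_rules = tetra_map_simps tetra_map_sweedler

lemma lin_restrict: "module K V \<Longrightarrow> lin V W (restrict f (carrier V)) = lin V W f"
  using linear_map_cong[of K V W f "restrict f (carrier V)"]
    linear_map_cong[of K V W "restrict f (carrier V)" f] by auto

lemma tetra_map_comp:
  assumes "tetra M" "tetra N" "tetra P" "tetra_map K A M N f" "tetra_map K A N P g"
  shows "tetra_map K A M P (compose (carrier M) g f)"
proof -
  note r = tetra_map_rules[OF assms(4)] tetra_map_rules[OF assms(5)]
  show ?thesis
    unfolding compose_def
    by (rule tetra_mapI) (use assms(1-3) in \<open>simp_all add: lin_restrict r\<close>)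
qed

lemma tetra_map_id:
  assumes "tetra M"
  shows "tetra_map K A M M (restrict (\<lambda>x. x) (carrier M))"
  by (rule tetra_mapI) (use assms in \<open>simp_all add: lin_restrict sweedler_tens_id\<close>)

section \<open>The internal product \<open>\<otimes>\<^sub>2\<close>\<close>

context
  fixes S E :: "('k, 'u) tetramodule"
  assumes E: "tetra E" and C: "submodule (carrier S) K E"
    and sub_space: "add S = add E" "zero S = zero E" "smult S = smult E"
    and lact: "\<And>a m. a \<in> carrier A \<Longrightarrow> m \<in> carrier S \<Longrightarrow> lact E a m \<in> carrier S"
      "\<And>a m. a \<in> carrier A \<Longrightarrow> m \<in> carrier S \<Longrightarrow> lact S a m = lact E a m"
    and ract: "\<And>a m. a \<in> carrier A \<Longrightarrow> m \<in> carrier S \<Longrightarrow> ract E m a \<in> carrier S"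
      "\<And>a m. a \<in> carrier A \<Longrightarrow> m \<in> carrier S \<Longrightarrow> ract S m a = ract E m a"
    and lcoact: "\<And>m. m \<in> carrier S \<Longrightarrow> lcoact S m \<in> carrier (A \<otimes>\<^sub>k S)"
      "\<And>m. m \<in> carrier S \<Longrightarrow> sw A S (A \<otimes>\<^sub>k E) (lcoact S m) (tn A E) = lcoact E m"
    and rcoact: "\<And>m. m \<in> carrier S \<Longrightarrow> rcoact S m \<in> carrier (S \<otimes>\<^sub>k A)"
      "\<And>m. m \<in> carrier S \<Longrightarrow> sw S A (E \<otimes>\<^sub>k A) (rcoact S m) (tn E A) = rcoact E m"
begin

lemma same_space_sub: "same_space S (E\<lparr>carrier := carrier S\<rparr>)"
  by (simp add: same_space_def sub_space)

lemma sub_mem: "m \<in> carrier S \<Longrightarrow> m \<in> carrier E"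
  using module.submoduleE(1)[OF tetra_module[OF E] C] by blast

lemma module_sub: "module K S"
  unfolding same_spaceD(5)[OF same_space_sub]
  by (rule submodule.submodule_is_module[OF C tetra_module[OF E]])

lemma linear_sub_from: "lin E P g \<Longrightarrow> lin S P g"
  by (auto simp: linear_map_def sub_space sub_mem)

lemma linear_sub_incl: "lin S E (\<lambda>x. x)"
  by (rule linear_sub_from) simp

lemma linear_sub_to: "lin X E g \<Longrightarrow> (\<And>x. x \<in> carrier X \<Longrightarrow> g x \<in> carrier S) \<Longrightarrow> lin X S g"
  by (auto simp: linear_map_def sub_space)

text \<open>The lifted coaction is mapped to that of \<open>E\<close> by the inclusion. A summand
  defined and linear on all of \<open>E\<close> therefore does not notice whether the sum is taken
  in \<open>A \<otimes> S\<close> or in \<open>A \<otimes> E\<close>.\<close>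

lemma sweedler_lcoact_sub:
  assumes m: "m \<in> carrier S" and P: "module K P"
    and g: "\<And>a. a \<in> carrier A \<Longrightarrow> lin E P (\<lambda>x. g a x)" "\<And>x. x \<in> carrier E \<Longrightarrow> lin A P (\<lambda>a. g a x)"
  shows "sw A S P (lcoact S m) g = sw A E P (lcoact E m) g"
  unfolding lcoact(2)[OF m, symmetric]
  using assms lcoact(1)[OF m] E
  by (simp add: module_sub linear_sub_from sub_space sub_mem linear_map_comp[OF linear_sub_incl])

lemma sweedler_rcoact_sub:
  assumes m: "m \<in> carrier S" and P: "module K P"
    and g: "\<And>a. a \<in> carrier A \<Longrightarrow> lin E P (\<lambda>x. g x a)" "\<And>x. x \<in> carrier E \<Longrightarrow> lin A P (\<lambda>a. g x a)"
  shows "sw S A P (rcoact S m) g = sw E A P (rcoact E m) g"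
  unfolding rcoact(2)[OF m, symmetric]
  using assms rcoact(1)[OF m] E
  by (simp add: module_sub linear_sub_from sub_space sub_mem linear_map_comp[OF linear_sub_incl])

lemma sub_inj_left:
  assumes "t \<in> carrier (A \<otimes>\<^sub>k S)" "t' \<in> carrier (A \<otimes>\<^sub>k S)"
    "sw A S (A \<otimes>\<^sub>k E) t (tn A E) = sw A S (A \<otimes>\<^sub>k E) t' (tn A E)"
  shows "t = t'"
  by (rule tens_injD[where f = "\<lambda>x. x" and g = "\<lambda>x. x" and V' = A and W' = E])
    (use assms E linear_sub_incl module_sub in \<open>simp_all add: inj_on_def\<close>)

lemma sub_inj_right:
  assumes "t \<in> carrier (S \<otimes>\<^sub>k A)" "t' \<in> carrier (S \<otimes>\<^sub>k A)"
    "sw S A (E \<otimes>\<^sub>k A) t (tn E A) = sw S A (E \<otimes>\<^sub>k A) t' (tn E A)"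
  shows "t = t'"
  by (rule tens_injD[where f = "\<lambda>x. x" and g = "\<lambda>x. x" and V' = E and W' = A])
    (use assms E linear_sub_incl module_sub in \<open>simp_all add: inj_on_def\<close>)

text \<open>The lift is known only through its image in \<open>A \<otimes> E\<close>. The laws hold
  there because the coaction of \<open>E\<close> is linear, and they descend because
  \<open>A \<otimes> S \<rightarrow> A \<otimes> E\<close> is injective.\<close>

lemma linear_lcoact_sub: "lin S (A \<otimes>\<^sub>k S) (lcoact S)"
proof -
  note s = E module_sub linear_sub_from sub_space sub_mem linear_map_comp[OF linear_sub_incl]
    linear_sub_incl lcoact
  interpret S: module K S by (rule module_sub)
  interpret T: module K "A \<otimes>\<^sub>k S" by (simp add: module_sub)
  have j: "lin (A \<otimes>\<^sub>k S) (A \<otimes>\<^sub>k E) (\<lambda>z. sw A S (A \<otimes>\<^sub>k E) z (tn A E))" by (simp add: s)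
  show ?thesis
  proof (rule linear_mapI)
    fix x y c assume x: "x \<in> carrier S"
    show "lcoact S x \<in> carrier (A \<otimes>\<^sub>k S)" using x by (simp add: s)
    { assume y: "y \<in> carrier S"
      show "lcoact S (x \<oplus>\<^bsub>S\<^esub> y) = lcoact S x \<oplus>\<^bsub>A \<otimes>\<^sub>k S\<^esub> lcoact S y"
        by (rule sub_inj_left) (use x y S.M.a_closed[of x y] in
          \<open>simp_all add: s linear_mapD(2)[OF j] linear_mapD(2)[OF linear_lcoact]\<close>) }
    { assume c: "c \<in> carrier K"
      show "lcoact S (c \<odot>\<^bsub>S\<^esub> x) = c \<odot>\<^bsub>A \<otimes>\<^sub>k S\<^esub> lcoact S x"
        by (rule sub_inj_left) (use x c S.smult_closed[of c x] in
          \<open>simp_all add: s linear_mapD(3)[OF j] linear_mapD(3)[OF linear_lcoact]\<close>) }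
  qed
qed

lemma linear_rcoact_sub: "lin S (S \<otimes>\<^sub>k A) (rcoact S)"
proof -
  note s = E module_sub linear_sub_from sub_space sub_mem linear_map_comp[OF linear_sub_incl]
    linear_sub_incl rcoact
  interpret S: module K S by (rule module_sub)
  interpret T: module K "S \<otimes>\<^sub>k A" by (simp add: module_sub)
  have j: "lin (S \<otimes>\<^sub>k A) (E \<otimes>\<^sub>k A) (\<lambda>z. sw S A (E \<otimes>\<^sub>k A) z (tn E A))" by (simp add: s)
  show ?thesis
  proof (rule linear_mapI)
    fix x y c assume x: "x \<in> carrier S"
    show "rcoact S x \<in> carrier (S \<otimes>\<^sub>k A)" using x by (simp add: s)
    { assume y: "y \<in> carrier S"
      show "rcoact S (x \<oplus>\<^bsub>S\<^esub> y) = rcoact S x \<oplus>\<^bsub>S \<otimes>\<^sub>k A\<^esub> rcoact S y"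
        by (rule sub_inj_right) (use x y S.M.a_closed[of x y] in
          \<open>simp_all add: s linear_mapD(2)[OF j] linear_mapD(2)[OF linear_rcoact]\<close>) }
    { assume c: "c \<in> carrier K"
      show "rcoact S (c \<odot>\<^bsub>S\<^esub> x) = c \<odot>\<^bsub>S \<otimes>\<^sub>k A\<^esub> rcoact S x"
        by (rule sub_inj_right) (use x c S.smult_closed[of c x] in
          \<open>simp_all add: s linear_mapD(3)[OF j] linear_mapD(3)[OF linear_rcoact]\<close>) }
  qed
qed

text \<open>Every law for \<open>S\<close> becomes the corresponding law for \<open>E\<close> under
  the inclusion, tensored as often as the law requires; these tensored inclusions are injective, so
  the law holds in \<open>S\<close>.\<close>

lemma tetra_sub: "tetra S"
  and tetra_map_incl: "tetra_map K A S E (restrict (\<lambda>x. x) (carrier S))"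
proof -
  have [simp]: "tetra E" by (rule E)
  note [simp] = module_sub linear_sub_incl linear_sub_from sub_mem lact ract lcoact rcoact
    linear_map_comp[OF linear_lcoact_sub] linear_map_comp[OF linear_rcoact_sub]
    linear_lcoact_sub linear_rcoact_sub sweedler_lcoact_sub sweedler_rcoact_sub
  have [simp]: "lin S S (\<lambda>m. lact E a m)" "lin S S (\<lambda>m. ract E m a)" if "a \<in> carrier A" for a
    by (rule linear_sub_to; simp add: that)+
  have [simp]: "lin A S (\<lambda>a. lact E a m)" "lin A S (\<lambda>a. ract E m a)" if "m \<in> carrier S" for m
    by (rule linear_sub_to; simp add: that)+
  have [simp]: "lin S S (\<lambda>m. lact S a m)" "lin S S (\<lambda>m. ract S m a)" if "a \<in> carrier A" for a
    by (rule linear_map_cong[of K S S "\<lambda>m. lact E a m"] linear_map_cong[of K S S "\<lambda>m. ract E m a"]; simp add: that)+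
  have [simp]: "lin A S (\<lambda>a. lact S a m)" "lin A S (\<lambda>a. ract S m a)" if "m \<in> carrier S" for m
    by (rule linear_map_cong[of K A S "\<lambda>a. lact E a m"] linear_map_cong[of K A S "\<lambda>a. ract E m a"]; simp add: that)+
  have [simp]: "inj_on (\<lambda>y. sw A S (A \<otimes>\<^sub>k E) y (tn A E)) (carrier (A \<otimes>\<^sub>k S))"
    "inj_on (\<lambda>y. sw S A (E \<otimes>\<^sub>k A) y (tn E A)) (carrier (S \<otimes>\<^sub>k A))"
    by (rule inj_onI, erule (2) sub_inj_left sub_inj_right)+
  show "tetra S"
    unfolding tetra_defs
    apply (intro conjI ballI; simp?)
    \<comment> \<open>The three laws on repeated coactions. The codomain contains \<open>S\<close>
      inside a double tensor product, so an injection is tensored once more with the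
      identity.\<close>
    subgoal
      by (rule tens_injD[where f = "\<lambda>x. x" and g = "\<lambda>y. sw A S (A \<otimes>\<^sub>k E) y (tn A E)"
          and V = A and W = "A \<otimes>\<^sub>k S" and V' = A and W' = "A \<otimes>\<^sub>k E"]) simp_all
    subgoal
      by (rule tens_injD[where f = "\<lambda>x. x" and g = "\<lambda>x. x"
          and V = S and W = "A \<otimes>\<^sub>k A" and V' = E and W' = "A \<otimes>\<^sub>k A"]) simp_all
    subgoal
      by (rule tens_injD[where f = "\<lambda>x. x" and g = "\<lambda>y. sw S A (E \<otimes>\<^sub>k A) y (tn E A)"
          and V = A and W = "S \<otimes>\<^sub>k A" and V' = A and W' = "E \<otimes>\<^sub>k A"]) simp_all
    \<comment> \<open>The counit laws take values in \<open>S\<close> itself; the inclusion is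
      pushed through the sum to reach the law of \<open>E\<close>.\<close>
    subgoal for m
      using sweedler_linear[OF _ _ _ _ linear_sub_incl, where V = A and W = S and t = "lcoact S m"
          and f = "\<lambda>a x. \<epsilon> a \<odot>\<^bsub>S\<^esub> x"]
      by (simp add: sub_space)
    subgoal for m
      using sweedler_linear[OF _ _ _ _ linear_sub_incl, where V = S and W = A and t = "rcoact S m"
          and f = "\<lambda>x a. \<epsilon> a \<odot>\<^bsub>S\<^esub> x"]
      by (simp add: sub_space)
    subgoal by (rule sub_inj_left; simp)
    subgoal by (rule sub_inj_left; simp)
    subgoal by (rule sub_inj_right; simp)
    subgoal by (rule sub_inj_right; simp)
    done
  show "tetra_map K A S E (restrict (\<lambda>x. x) (carrier S))"
    by (rule tetra_mapI) (simp_all add: lin_restrict sweedler_tens_id)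
qed

end

text \<open>Each property of \<open>F\<close> holds after applying the injective morphism
  \<open>i\<close>; for the coactions the injectivity of \<open>1 \<otimes> i\<close> and of
  \<open>i \<otimes> 1\<close> is used. Since \<open>F\<close> is just a function here, the lemma
  covers maps obtained by choice, such as inverses, and maps into an equaliser.\<close>

lemma tetra_map_lift:
  assumes X: "tetra X" and Y: "tetra Y" and E: "tetra E"
    and i: "tetra_map K A Y E i" "inj_on i (carrier Y)"
    and F: "F \<in> extensional (carrier X)" "\<And>x. x \<in> carrier X \<Longrightarrow> F x \<in> carrier Y"
    and iF: "tetra_map K A X E (restrict (\<lambda>x. i (F x)) (carrier X))"
  shows "tetra_map K A X Y F"
proof -
  interpret X: module K X using X by simp
  interpret Y: module K Y using Y by simp
  have [simp]: "tetra X" "tetra Y" "tetra E" by fact+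
  note [simp] = F(2) tetra_map_rules[OF i(1)]
  have iF': "lin X E (\<lambda>x. i (F x))"
    using iF by (simp add: tetra_map_def lin_restrict)
  have eqI: "x = y" if "i x = i y" "x \<in> carrier Y" "y \<in> carrier Y" for x y
    using that i(2) by (simp add: inj_on_def)
  have iF_act: "i (F (lact X a m)) = lact E a (i (F m))" "i (F (ract X m a)) = ract E (i (F m)) a"
    if "a \<in> carrier A" "m \<in> carrier X" for a m
    using tetra_map_simps(4,5)[OF iF that] that by simp_all
  have iF_coact: "lcoact E (i (F m)) = sw A X (A \<otimes>\<^sub>k E) (lcoact X m) (\<lambda>a x. tn A E a (i (F x)))"
    "rcoact E (i (F m)) = sw X A (E \<otimes>\<^sub>k A) (rcoact X m) (\<lambda>x a. tn E A (i (F x)) a)"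
    if "m \<in> carrier X" for m
    using tetra_map_simps(6,7)[OF iF that] that by simp_all
  have [simp]: "lin X Y F"
  proof (rule linear_mapI)
    show "F (x \<oplus>\<^bsub>X\<^esub> y) = F x \<oplus>\<^bsub>Y\<^esub> F y" if "x \<in> carrier X" "y \<in> carrier X" for x y
      by (rule eqI) (use that in \<open>simp_all add: linear_mapD(2)[OF iF'] linear_mapD(2)[OF tetra_map_linear[OF i(1)]]\<close>)
    show "F (c \<odot>\<^bsub>X\<^esub> x) = c \<odot>\<^bsub>Y\<^esub> F x" if "c \<in> carrier K" "x \<in> carrier X" for c x
      by (rule eqI) (use that in \<open>simp_all add: linear_mapD(3)[OF iF'] linear_mapD(3)[OF tetra_map_linear[OF i(1)]]\<close>)
  qed simp
  note [simp] = linear_map_comp[OF this]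
  show ?thesis
  proof (rule tetra_mapI)
    fix m assume m [simp]: "m \<in> carrier X"
    show "lcoact Y (F m) = sw A X (A \<otimes>\<^sub>k Y) (lcoact X m) (\<lambda>a x. tn A Y a (F x))"
      by (rule tens_injD[where f = "\<lambda>x. x" and g = i and V = A and W = Y and V' = A and W' = E])
        (simp_all add: i(2) tetra_map_simps(6)[OF i(1), symmetric] iF_coact del: tetra_map_rules[OF i(1)]
          add: tetra_map_simps(1-3)[OF i(1)])
    show "rcoact Y (F m) = sw X A (Y \<otimes>\<^sub>k A) (rcoact X m) (\<lambda>x a. tn Y A (F x) a)"
      by (rule tens_injD[where f = i and g = "\<lambda>x. x" and V = Y and W = A and V' = E and W' = A])
        (simp_all add: i(2) tetra_map_simps(7)[OF i(1), symmetric] iF_coact del: tetra_map_rules[OF i(1)]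
          add: tetra_map_simps(1-3)[OF i(1)])
    fix a assume a [simp]: "a \<in> carrier A"
    show "F (lact X a m) = lact Y a (F m)" "F (ract X m a) = ract Y (F m) a"
      by (rule eqI; simp add: iF_act)+
  qed (simp_all add: F(1))
qed

text \<open>The set-theoretic inverse \<open>g\<close> satisfies \<open>f g = id\<close>, so it is a
  morphism by lifting the identity along \<open>f\<close>.\<close>

lemma Iso_Tetra:
  assumes M: "tetra M" and N: "tetra N" and f: "tetra_map K A M N f"
    and bij: "bij_betw f (carrier M) (carrier N)"
  shows "\<lparr>Dom = M, Cod = N, Map = f\<rparr> \<in> Iso (Tetra K A) M N"
proof -
  define g where "g = restrict (inv_into (carrier M) f) (carrier N)"
  have g: "g y \<in> carrier M" "f (g y) = y" if "y \<in> carrier N" for y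
    using that bij by (auto simp: g_def bij_betw_def inv_into_into f_inv_into_f)
  have gf: "g (f x) = x" if "x \<in> carrier M" for x
    using that bij by (auto simp: g_def bij_betw_def)
  have "restrict (\<lambda>x. f (g x)) (carrier N) = restrict (\<lambda>x. x) (carrier N)"
    using g by (auto simp: restrict_def)
  then have "tetra_map K A N M g"
    using tetra_map_id[OF N] bij
    by (intro tetra_map_lift[OF N M N f]) (simp_all add: g, simp_all add: bij_betw_def g_def)
  then have "\<lparr>Dom = N, Cod = M, Map = g\<rparr> \<in> Hom (Tetra K A) N M"
    by (simp add: Tetra_def)
  moreover have "compose (carrier M) g f = restrict (\<lambda>x. x) (carrier M)"
    "compose (carrier N) f g = restrict (\<lambda>x. x) (carrier N)"
    by (auto simp: compose_def restrict_def gf g)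
  ultimately show ?thesis
    using f by (auto simp: Iso_def Tetra_def intro!: exI[of _ g])
qed

text \<open>The inclusion of images makes every value of \<open>f\<close> a value of
  \<open>g\<close>, hence \<open>g h = f\<close> and the lifting lemma applies. The map is written
  with \<open>inv_into\<close> because the associativity isomorphism of
  \<open>\<otimes>\<^sub>2\<close> is defined in this way.\<close>

lemma tetra_map_factor:
  assumes X: "tetra X" and Y: "tetra Y" and E: "tetra E"
    and f: "tetra_map K A X E f" and g: "tetra_map K A Y E g" "inj_on g (carrier Y)"
    and sub: "f ` carrier X \<subseteq> g ` carrier Y"
  defines "h \<equiv> restrict (\<lambda>x. inv_into (carrier Y) g (f x)) (carrier X)"
  shows "tetra_map K A X Y h" and "x \<in> carrier X \<Longrightarrow> h x \<in> carrier Y" and "x \<in> carrier X \<Longrightarrow> g (h x) = f x"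
proof -
  show h: "x \<in> carrier X \<Longrightarrow> h x \<in> carrier Y" "x \<in> carrier X \<Longrightarrow> g (h x) = f x" for x
    using sub by (auto simp: h_def inv_into_into f_inv_into_f)
  have "restrict (\<lambda>x. g (h x)) (carrier X) = f"
    using f h by (auto simp: restrict_def tetra_map_def extensional_def)
  then show "tetra_map K A X Y h"
    using f by (intro tetra_map_lift[OF X Y E g]) (simp_all add: h, simp add: h_def)
qed

text \<open>With equal images \<open>f\<close> followed by the inverse of \<open>g\<close> is a
  composition of bijections, and the factorisation is a morphism.\<close>

lemma Iso_factor:
  assumes X: "tetra X" and Y: "tetra Y" and E: "tetra E"
    and f: "tetra_map K A X E f" "inj_on f (carrier X)" and g: "tetra_map K A Y E g" "inj_on g (carrier Y)"
    and im: "f ` carrier X = g ` carrier Y"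
  shows "\<lparr>Dom = X, Cod = Y, Map = restrict (\<lambda>x. inv_into (carrier Y) g (f x)) (carrier X)\<rparr> \<in> Iso (Tetra K A) X Y"
proof (rule Iso_Tetra[OF X Y])
  show "tetra_map K A X Y (restrict (\<lambda>x. inv_into (carrier Y) g (f x)) (carrier X))"
    by (rule tetra_map_factor[OF X Y E f(1) g]) (simp add: im)
  have "bij_betw (inv_into (carrier Y) g) (g ` carrier Y) (carrier Y)"
    using bij_betw_inv_into[of g "carrier Y" "g ` carrier Y"] g(2) by (simp add: bij_betw_def)
  moreover have "bij_betw f (carrier X) (g ` carrier Y)"
    using f(2) im by (simp add: bij_betw_def)
  ultimately show "bij_betw (restrict (\<lambda>x. inv_into (carrier Y) g (f x)) (carrier X)) (carrier X) (carrier Y)"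
    using bij_betw_trans[of f "carrier X" "g ` carrier Y" "inv_into (carrier Y) g" "carrier Y"]
      bij_betw_cong[of "carrier X" "restrict (\<lambda>x. inv_into (carrier Y) g (f x)) (carrier X)" "inv_into (carrier Y) g \<circ> f"]
    by (simp only: comp_apply restrict_apply')
qed

section \<open>The equaliser inside \<open>M \<boxtimes>\<^sub>2 N\<close>\<close>

lemma int2_carrier:
  assumes "tetra M" "tetra N"
  shows "carrier (int2 K A M N) = {t \<in> carrier (M \<otimes>\<^sub>k N).
    sw M N (M \<otimes>\<^sub>k A \<otimes>\<^sub>k N) t (\<lambda>m n. sw M A (M \<otimes>\<^sub>k A \<otimes>\<^sub>k N) (rcoact M m) (\<lambda>x a. tn M (A \<otimes>\<^sub>k N) x (tn A N a n))) =
    sw M N (M \<otimes>\<^sub>k A \<otimes>\<^sub>k N) t (\<lambda>m n. sw A N (M \<otimes>\<^sub>k A \<otimes>\<^sub>k N) (lcoact N n) (\<lambda>a y. tn M (A \<otimes>\<^sub>k N) m (tn A N a y)))}"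
  using assms by (auto simp: int2_def sub_tetra_def Let_def tassoc_def tmap_def)

lemma int2_ops:
  "add (int2 K A M N) = add (M \<otimes>\<^sub>k N)" "zero (int2 K A M N) = zero (M \<otimes>\<^sub>k N)"
  "smult (int2 K A M N) = smult (M \<otimes>\<^sub>k N)"
  "lact (int2 K A M N) = lact (ext2 K A M N)" "ract (int2 K A M N) = ract (ext2 K A M N)"
  by (simp_all add: int2_def sub_tetra_def Let_def)

context
  fixes M N :: "('k, 'u) tetramodule"
  assumes M: "tetra M" and N: "tetra N"
begin

lemma int2_mem: "t \<in> carrier (int2 K A M N) \<Longrightarrow> t \<in> carrier (M \<otimes>\<^sub>k N)"
  using M N by (simp add: int2_carrier)

text \<open>The linear extension of the trilinear \<open>f\<close> is applied to the defining
  equation of the equaliser. The resulting exchange of a right coaction on the first factor for a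
  left coaction on the second is dual to the balancing relation of
  \<open>\<otimes>\<^sub>1\<close>.\<close>

lemma int2_balanced:
  assumes t: "t \<in> carrier (int2 K A M N)" and P: "module K P"
    and f: "\<And>a n. a \<in> carrier A \<Longrightarrow> n \<in> carrier N \<Longrightarrow> lin M P (\<lambda>m. f m a n)"
      "\<And>m n. m \<in> carrier M \<Longrightarrow> n \<in> carrier N \<Longrightarrow> lin A P (\<lambda>a. f m a n)"
      "\<And>m a. m \<in> carrier M \<Longrightarrow> a \<in> carrier A \<Longrightarrow> lin N P (\<lambda>n. f m a n)"
  shows "sw M N P t (\<lambda>m n. sw M A P (rcoact M m) (\<lambda>x a. f x a n)) =
    sw M N P t (\<lambda>m n. sw A N P (lcoact N n) (\<lambda>a y. f m a y))"
proof -
  have "sw M N (M \<otimes>\<^sub>k A \<otimes>\<^sub>k N) t (\<lambda>m n. sw M A (M \<otimes>\<^sub>k A \<otimes>\<^sub>k N) (rcoact M m) (\<lambda>x a. tn M (A \<otimes>\<^sub>k N) x (tn A N a n))) =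
    sw M N (M \<otimes>\<^sub>k A \<otimes>\<^sub>k N) t (\<lambda>m n. sw A N (M \<otimes>\<^sub>k A \<otimes>\<^sub>k N) (lcoact N n) (\<lambda>a y. tn M (A \<otimes>\<^sub>k N) m (tn A N a y)))"
    using t M N by (simp add: int2_carrier)
  from arg_cong[OF this, of "\<lambda>z. sw M (A \<otimes>\<^sub>k N) P z (\<lambda>m s. sw A N P s (\<lambda>a n. f m a n))"]
  show ?thesis
    using int2_mem[OF t] M N P f by simp
qed

lemma swap_comult_out:
  assumes t: "t \<in> carrier (M \<otimes>\<^sub>k N)" and a: "a \<in> carrier A" and P: "module K P"
    and f: "\<And>x c d. x \<in> carrier N \<Longrightarrow> c \<in> carrier A \<Longrightarrow> d \<in> carrier A \<Longrightarrow> lin M P (\<lambda>b. f b x c d)"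
      "\<And>b c d. b \<in> carrier M \<Longrightarrow> c \<in> carrier A \<Longrightarrow> d \<in> carrier A \<Longrightarrow> lin N P (\<lambda>x. f b x c d)"
      "\<And>b x d. b \<in> carrier M \<Longrightarrow> x \<in> carrier N \<Longrightarrow> d \<in> carrier A \<Longrightarrow> lin A P (\<lambda>c. f b x c d)"
      "\<And>b x c. b \<in> carrier M \<Longrightarrow> x \<in> carrier N \<Longrightarrow> c \<in> carrier A \<Longrightarrow> lin A P (\<lambda>d. f b x c d)"
  shows "sw M N P t (\<lambda>m n. sw A A P (\<Delta> a) (\<lambda>c d. f m n c d)) =
    sw A A P (\<Delta> a) (\<lambda>c d. sw M N P t (\<lambda>m n. f m n c d))"
  by (rule sweedler_swap) (use assms M N in simp_all)

text \<open>Coacting after the diagonal action produces, on either side of the condition, the three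
  legs of the iterated coproduct of \<open>a\<close>: the outer two act on the factors and the
  middle one multiplies the new leg in \<open>A\<close>. What remains is the balance of
  \<open>t\<close>.\<close>

lemma int2_act_closed:
  assumes t: "t \<in> carrier (int2 K A M N)" and a: "a \<in> carrier A"
  shows "lact (ext2 K A M N) a t \<in> carrier (int2 K A M N)"
    and "ract (ext2 K A M N) t a \<in> carrier (int2 K A M N)"
  unfolding int2_carrier[OF M N] mem_Collect_eq ext2_ops
  using M N a int2_mem[OF t] by (simp_all add: swap_comult_out[of t] int2_balanced[OF t])

lemma submodule_int2_ext2: "submodule (carrier (int2 K A M N)) K (ext2 K A M N)"
  unfolding int2_carrier[OF M N]
  by (rule submodule_equaliser[where V = "ext2 K A M N" and W = "M \<otimes>\<^sub>k A \<otimes>\<^sub>k N", unfolded ext2_space(1)])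
    (use M N in simp_all)

text \<open>\<open>A \<otimes> (M \<otimes>\<^sub>2 N)\<close> is the equaliser of the two coaction
  maps tensored with \<open>A\<close>, so it is enough that these two agree on the coaction of
  \<open>t\<close>.\<close>

lemma int2_lcoact_image:
  assumes t: "t \<in> carrier (int2 K A M N)"
  shows "\<exists>u \<in> carrier (A \<otimes>\<^sub>k int2 K A M N).
    sw A (int2 K A M N) (A \<otimes>\<^sub>k M \<otimes>\<^sub>k N) u (tn A (M \<otimes>\<^sub>k N)) = lcoact (ext2 K A M N) t"
proof (rule tensor_equaliser(1))
  note [simp] = M N int2_mem[OF t]
  let ?P = "A \<otimes>\<^sub>k M \<otimes>\<^sub>k A \<otimes>\<^sub>k N" and ?W = "M \<otimes>\<^sub>k A \<otimes>\<^sub>k N"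
  let ?f = "\<lambda>t. sw M N ?W t (\<lambda>m n. sw M A ?W (rcoact M m) (\<lambda>x a. tn M (A \<otimes>\<^sub>k N) x (tn A N a n)))"
  let ?g = "\<lambda>t. sw M N ?W t (\<lambda>m n. sw A N ?W (lcoact N n) (\<lambda>a y. tn M (A \<otimes>\<^sub>k N) m (tn A N a y)))"
  show "same_space (int2 K A M N) ((M \<otimes>\<^sub>k N)\<lparr>carrier := {t \<in> carrier (M \<otimes>\<^sub>k N). ?f t = ?g t}\<rparr>)"
    by (simp add: same_space_def int2_ops int2_carrier)
  \<comment> \<open>The two coactions of \<open>M\<close> commute, so the right one may be taken
    first; it then stands directly under the sum over \<open>t\<close>, where the balance can be
    used.\<close>
  have "sw A (M \<otimes>\<^sub>k N) ?P (lcoact (ext2 K A M N) t) (\<lambda>a s. tn A ?W a (?f s)) =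
    sw M N ?P t (\<lambda>m n. sw M A ?P (rcoact M m) (\<lambda>x b.
      sw A M ?P (lcoact M x) (\<lambda>a y. tn A ?W a (tn M (A \<otimes>\<^sub>k N) y (tn A N b n)))))"
    by (simp add: ext2_ops)
  also have "\<dots> = sw M N ?P t (\<lambda>m n. sw A N ?P (lcoact N n) (\<lambda>b n.
      sw A M ?P (lcoact M m) (\<lambda>a y. tn A ?W a (tn M (A \<otimes>\<^sub>k N) y (tn A N b n)))))"
    by (rule int2_balanced[OF t]) simp_all
  also have "\<dots> = sw M N ?P t (\<lambda>m n. sw A M ?P (lcoact M m) (\<lambda>a y.
      sw A N ?P (lcoact N n) (\<lambda>b n. tn A ?W a (tn M (A \<otimes>\<^sub>k N) y (tn A N b n)))))"
    by (intro sweedler_cong refl sweedler_swap) simp_all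
  also have "\<dots> = sw A (M \<otimes>\<^sub>k N) ?P (lcoact (ext2 K A M N) t) (\<lambda>a s. tn A ?W a (?g s))"
    by (simp add: ext2_ops)
  finally show "sw A (M \<otimes>\<^sub>k N) ?P (lcoact (ext2 K A M N) t) (\<lambda>a s. tn A ?W a (?f s)) =
    sw A (M \<otimes>\<^sub>k N) ?P (lcoact (ext2 K A M N) t) (\<lambda>a s. tn A ?W a (?g s))" .
qed (use M N int2_mem[OF t] in \<open>simp_all add: ext2_ops\<close>)

text \<open>The mirror image, in the opposite order: the coactions of the two factors are exchanged
  first, then the balance of \<open>t\<close> applies, and the commutation of the two coactions of
  \<open>N\<close> comes last.\<close>

lemma int2_rcoact_image:
  assumes t: "t \<in> carrier (int2 K A M N)"
  shows "\<exists>u \<in> carrier (int2 K A M N \<otimes>\<^sub>k A).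
    sw (int2 K A M N) A ((M \<otimes>\<^sub>k N) \<otimes>\<^sub>k A) u (tn (M \<otimes>\<^sub>k N) A) = rcoact (ext2 K A M N) t"
proof (rule tensor_equaliser(2))
  note [simp] = M N int2_mem[OF t]
  let ?W = "M \<otimes>\<^sub>k A \<otimes>\<^sub>k N"
  let ?P = "?W \<otimes>\<^sub>k A"
  let ?f = "\<lambda>t. sw M N ?W t (\<lambda>m n. sw M A ?W (rcoact M m) (\<lambda>x a. tn M (A \<otimes>\<^sub>k N) x (tn A N a n)))"
  let ?g = "\<lambda>t. sw M N ?W t (\<lambda>m n. sw A N ?W (lcoact N n) (\<lambda>a y. tn M (A \<otimes>\<^sub>k N) m (tn A N a y)))"
  show "same_space (int2 K A M N) ((M \<otimes>\<^sub>k N)\<lparr>carrier := {t \<in> carrier (M \<otimes>\<^sub>k N). ?f t = ?g t}\<rparr>)"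
    by (simp add: same_space_def int2_ops int2_carrier)
  have "sw (M \<otimes>\<^sub>k N) A ?P (rcoact (ext2 K A M N) t) (\<lambda>s a. tn ?W A (?f s) a) =
    sw M N ?P t (\<lambda>m n. sw N A ?P (rcoact N n) (\<lambda>n a.
      sw M A ?P (rcoact M m) (\<lambda>x b. tn ?W A (tn M (A \<otimes>\<^sub>k N) x (tn A N b n)) a)))"
    by (simp add: ext2_ops)
  also have "\<dots> = sw M N ?P t (\<lambda>m n. sw M A ?P (rcoact M m) (\<lambda>x b.
      sw N A ?P (rcoact N n) (\<lambda>n a. tn ?W A (tn M (A \<otimes>\<^sub>k N) x (tn A N b n)) a)))"
    by (intro sweedler_cong refl sweedler_swap) simp_all
  also have "\<dots> = sw M N ?P t (\<lambda>m n. sw A N ?P (lcoact N n) (\<lambda>b n.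
      sw N A ?P (rcoact N n) (\<lambda>n a. tn ?W A (tn M (A \<otimes>\<^sub>k N) m (tn A N b n)) a)))"
    by (rule int2_balanced[OF t]) simp_all
  also have "\<dots> = sw (M \<otimes>\<^sub>k N) A ?P (rcoact (ext2 K A M N) t) (\<lambda>s a. tn ?W A (?g s) a)"
    by (simp add: ext2_ops)
  finally show "sw (M \<otimes>\<^sub>k N) A ?P (rcoact (ext2 K A M N) t) (\<lambda>s a. tn ?W A (?f s) a) =
    sw (M \<otimes>\<^sub>k N) A ?P (rcoact (ext2 K A M N) t) (\<lambda>s a. tn ?W A (?g s) a)" .
qed (use M N int2_mem[OF t] in \<open>simp_all add: ext2_ops\<close>)

text \<open>The preceding image lemma turns the \<open>inv_into\<close> in \<open>sub_tetra\<close>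
  into a genuine preimage. There the coaction is computed with the external product whose carrier
  has been replaced, which is another record than \<open>int2 K A M N\<close> but the same
  space.\<close>

lemma int2_lcoact:
  assumes t: "t \<in> carrier (int2 K A M N)"
  shows "lcoact (int2 K A M N) t \<in> carrier (A \<otimes>\<^sub>k int2 K A M N)"
    and "sw A (int2 K A M N) (A \<otimes>\<^sub>k ext2 K A M N) (lcoact (int2 K A M N) t) (tn A (ext2 K A M N)) =
      lcoact (ext2 K A M N) t"
proof -
  let ?j = "\<lambda>t. sw A (int2 K A M N) (A \<otimes>\<^sub>k M \<otimes>\<^sub>k N) t (tn A (M \<otimes>\<^sub>k N))"
  let ?V = "(ext2 K A M N)\<lparr>carrier := carrier (int2 K A M N)\<rparr>"
  have "same_space ?V (int2 K A M N)"
    by (simp add: same_space_def int2_ops)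
  note V = same_spaceD[OF this]
  have *: "lcoact (int2 K A M N) t = inv_into (carrier (A \<otimes>\<^sub>k int2 K A M N)) ?j (lcoact (ext2 K A M N) t)"
    unfolding V(9)[symmetric] V(13)[symmetric]
    by (simp add: int2_def sub_tetra_def Let_def tmap_def[abs_def])
  have "lcoact (ext2 K A M N) t \<in> ?j ` carrier (A \<otimes>\<^sub>k int2 K A M N)"
    using int2_lcoact_image[OF t] by force
  then show "lcoact (int2 K A M N) t \<in> carrier (A \<otimes>\<^sub>k int2 K A M N)"
    "sw A (int2 K A M N) (A \<otimes>\<^sub>k ext2 K A M N) (lcoact (int2 K A M N) t) (tn A (ext2 K A M N)) =
      lcoact (ext2 K A M N) t"
    unfolding * using f_inv_into_f[of _ ?j] by (simp_all add: inv_into_into)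
qed

lemma int2_rcoact:
  assumes t: "t \<in> carrier (int2 K A M N)"
  shows "rcoact (int2 K A M N) t \<in> carrier (int2 K A M N \<otimes>\<^sub>k A)"
    and "sw (int2 K A M N) A (ext2 K A M N \<otimes>\<^sub>k A) (rcoact (int2 K A M N) t) (tn (ext2 K A M N) A) =
      rcoact (ext2 K A M N) t"
proof -
  let ?j = "\<lambda>t. sw (int2 K A M N) A ((M \<otimes>\<^sub>k N) \<otimes>\<^sub>k A) t (tn (M \<otimes>\<^sub>k N) A)"
  let ?V = "(ext2 K A M N)\<lparr>carrier := carrier (int2 K A M N)\<rparr>"
  have "same_space ?V (int2 K A M N)"
    by (simp add: same_space_def int2_ops)
  note V = same_spaceD[OF this]
  have *: "rcoact (int2 K A M N) t = inv_into (carrier (int2 K A M N \<otimes>\<^sub>k A)) ?j (rcoact (ext2 K A M N) t)"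
    unfolding V(8)[symmetric] V(12)[symmetric]
    by (simp add: int2_def sub_tetra_def Let_def tmap_def[abs_def])
  have "rcoact (ext2 K A M N) t \<in> ?j ` carrier (int2 K A M N \<otimes>\<^sub>k A)"
    using int2_rcoact_image[OF t] by force
  then show "rcoact (int2 K A M N) t \<in> carrier (int2 K A M N \<otimes>\<^sub>k A)"
    "sw (int2 K A M N) A (ext2 K A M N \<otimes>\<^sub>k A) (rcoact (int2 K A M N) t) (tn (ext2 K A M N) A) =
      rcoact (ext2 K A M N) t"
    unfolding * using f_inv_into_f[of _ ?j] by (simp_all add: inv_into_into)
qed

lemma tetra_int2: "tetra (int2 K A M N)"
  and tetra_map_int2_incl: "tetra_map K A (int2 K A M N) (ext2 K A M N) (restrict (\<lambda>x. x) (carrier (int2 K A M N)))"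
proof -
  note * = tetra_ext2[OF M N] _ _ _ _ int2_act_closed(1) _ int2_act_closed(2) _ int2_lcoact int2_rcoact
  show "tetra (int2 K A M N)"
    by (rule tetra_sub[OF *]) (simp_all add: int2_ops submodule_int2_ext2)
  show "tetra_map K A (int2 K A M N) (ext2 K A M N) (restrict (\<lambda>x. x) (carrier (int2 K A M N)))"
    by (rule tetra_map_incl[OF *]) (simp_all add: int2_ops submodule_int2_ext2)
qed

end

end

section \<open>The internal product \<open>\<otimes>\<^sub>1\<close>\<close>

context
  fixes K :: "('k, 'c) ring_scheme" and V :: "('k, 'u, 'v) module_scheme" and R
  assumes V: "module K V" and R: "submodule R K V"
begin

interpretation V: module K V by (rule V)

lemma submodule_subset: "x \<in> R \<Longrightarrow> x \<in> carrier V"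
  using V.submoduleE(1)[OF R] by blast

lemma qrep_in: "x \<in> carrier V \<Longrightarrow> \<exists>r \<in> R. qrep V R x = r \<oplus>\<^bsub>V\<^esub> x"
proof -
  assume x: "x \<in> carrier V"
  have "\<zero>\<^bsub>V\<^esub> \<in> R"
    using subgroup.one_closed[OF submodule.axioms(1)[OF R]] by simp
  then have "x \<in> R +>\<^bsub>V\<^esub> x"
    using x by (force simp: a_r_coset_def')
  then have "qrep V R x \<in> R +>\<^bsub>V\<^esub> x"
    unfolding qrep_def by (rule someI)
  then show ?thesis by (auto simp: a_r_coset_def')
qed

lemma qrep_closed [simp]: "x \<in> carrier V \<Longrightarrow> qrep V R x \<in> carrier V"
  using qrep_in[of x] submodule_subset by auto

text \<open>The representative is chosen from the coset alone, and adding an element of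
  \<open>R\<close> does not change the coset.\<close>

lemma qrep_add: "x \<in> carrier V \<Longrightarrow> r \<in> R \<Longrightarrow> qrep V R (r \<oplus>\<^bsub>V\<^esub> x) = qrep V R x"
proof -
  assume x: "x \<in> carrier V" and r: "r \<in> R"
  note rV = submodule_subset
  have "R +>\<^bsub>V\<^esub> (r \<oplus>\<^bsub>V\<^esub> x) = R +>\<^bsub>V\<^esub> x"
  proof (intro equalityI subsetI)
    fix y assume "y \<in> R +>\<^bsub>V\<^esub> (r \<oplus>\<^bsub>V\<^esub> x)"
    then obtain s where s: "s \<in> R" "y = s \<oplus>\<^bsub>V\<^esub> (r \<oplus>\<^bsub>V\<^esub> x)" by (auto simp: a_r_coset_def')
    then have "y = (s \<oplus>\<^bsub>V\<^esub> r) \<oplus>\<^bsub>V\<^esub> x" using rV[OF r] rV[OF s(1)] x by (simp add: V.M.a_assoc)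
    then show "y \<in> R +>\<^bsub>V\<^esub> x"
      using V.submoduleE(5)[OF R s(1) r] by (auto simp: a_r_coset_def')
  next
    fix y assume "y \<in> R +>\<^bsub>V\<^esub> x"
    then obtain s where s: "s \<in> R" "y = s \<oplus>\<^bsub>V\<^esub> x" by (auto simp: a_r_coset_def')
    then have "y = (s \<oplus>\<^bsub>V\<^esub> \<ominus>\<^bsub>V\<^esub> r) \<oplus>\<^bsub>V\<^esub> (r \<oplus>\<^bsub>V\<^esub> x)"
      using rV[OF r] rV[OF s(1)] x by (simp add: V.M.a_assoc V.M.r_neg1)
    then show "y \<in> R +>\<^bsub>V\<^esub> (r \<oplus>\<^bsub>V\<^esub> x)"
      using V.submoduleE(5)[OF R s(1) V.submoduleE(3)[OF R r]] by (auto simp: a_r_coset_def')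
  qed
  then show ?thesis by (simp add: qrep_def)
qed

lemma qrep_eq:
  assumes "x \<in> carrier V" "r \<in> R" "y = r \<oplus>\<^bsub>V\<^esub> x"
  shows "qrep V R y = qrep V R x"
  using qrep_add assms by simp

text \<open>A representative differs from the given vector by an element of \<open>R\<close>. This
  justifies the convention that a map induced on the quotient is the same function.\<close>

lemma qrep_linear_eq:
  assumes P: "module K P" and F: "linear_map K V P F" and kill: "\<And>r. r \<in> R \<Longrightarrow> F r = \<zero>\<^bsub>P\<^esub>"
    and x: "x \<in> carrier V"
  shows "F (qrep V R x) = F x"
proof -
  interpret P: module K P by fact
  obtain r where r: "r \<in> R" "qrep V R x = r \<oplus>\<^bsub>V\<^esub> x" using qrep_in[OF x] by blast
  then show ?thesis
    using linear_mapD[OF F] submodule_subset[OF r(1)] x kill[OF r(1)] by simp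
qed

lemma quot_space_simps:
  "carrier (quot_space V R) = qrep V R ` carrier V"
  "add (quot_space V R) x y = qrep V R (x \<oplus>\<^bsub>V\<^esub> y)"
  "smult (quot_space V R) c x = qrep V R (c \<odot>\<^bsub>V\<^esub> x)"
  "zero (quot_space V R) = qrep V R \<zero>\<^bsub>V\<^esub>"
  by (simp_all add: quot_space_def)

lemma qrep_linear: "linear_map K V (quot_space V R) (qrep V R)"
proof (rule linear_mapI)
  fix x assume x: "x \<in> carrier V"
  then obtain r where r: "r \<in> R" "qrep V R x = r \<oplus>\<^bsub>V\<^esub> x" using qrep_in by blast
  note rV = submodule_subset[OF r(1)]
  show "qrep V R x \<in> carrier (quot_space V R)" using x by (simp add: quot_space_simps)
  { fix y assume y: "y \<in> carrier V"
    then obtain s where s: "s \<in> R" "qrep V R y = s \<oplus>\<^bsub>V\<^esub> y" using qrep_in by blast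
    note sV = submodule_subset[OF s(1)]
    have "qrep V R x \<oplus>\<^bsub>V\<^esub> qrep V R y = (r \<oplus>\<^bsub>V\<^esub> s) \<oplus>\<^bsub>V\<^esub> (x \<oplus>\<^bsub>V\<^esub> y)"
      using r(2) s(2) rV sV x y by (simp add: V.M.a_ac)
    then show "qrep V R (x \<oplus>\<^bsub>V\<^esub> y) = qrep V R x \<oplus>\<^bsub>quot_space V R\<^esub> qrep V R y"
      using qrep_eq[OF _ V.submoduleE(5)[OF R r(1) s(1)]] x y by (simp add: quot_space_simps) }
  { fix c assume c: "c \<in> carrier K"
    have "c \<odot>\<^bsub>V\<^esub> qrep V R x = c \<odot>\<^bsub>V\<^esub> r \<oplus>\<^bsub>V\<^esub> c \<odot>\<^bsub>V\<^esub> x"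
      using r(2) rV x c by (simp add: V.smult_r_distr)
    then show "qrep V R (c \<odot>\<^bsub>V\<^esub> x) = c \<odot>\<^bsub>quot_space V R\<^esub> qrep V R x"
      using qrep_eq[OF _ V.submoduleE(4)[OF R c r(1)]] x c by (simp add: quot_space_simps) }
qed

lemma module_quot_space: "module K (quot_space V R)"
proof -
  let ?Q = "quot_space V R" and ?q = "qrep V R"
  note q = linear_mapD[OF qrep_linear]
  have Q: "x \<in> carrier ?Q \<longleftrightarrow> (\<exists>v \<in> carrier V. x = ?q v)" for x
    by (auto simp: quot_space_simps)
  have q0: "\<zero>\<^bsub>?Q\<^esub> = ?q \<zero>\<^bsub>V\<^esub>" by (simp add: quot_space_simps)
  have "abelian_group ?Q"
  proof (rule abelian_groupI)
    fix x assume "x \<in> carrier ?Q"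
    then obtain v where v: "v \<in> carrier V" "x = ?q v" by (auto simp: Q)
    show "\<exists>y\<in>carrier ?Q. y \<oplus>\<^bsub>?Q\<^esub> x = \<zero>\<^bsub>?Q\<^esub>"
      using v q(1)[of "\<ominus>\<^bsub>V\<^esub> v"] by (intro bexI[of _ "?q (\<ominus>\<^bsub>V\<^esub> v)"]) (auto simp: q(2)[symmetric] V.M.l_neg q0)
  qed (auto simp: Q q(2)[symmetric] q0 V.M.a_ac)
  then show ?thesis
    by (rule moduleI[OF V.is_cring])
      (auto simp: Q q(2,3)[symmetric] V.smult_l_distr V.smult_r_distr V.smult_assoc1)
qed

text \<open>The operations of the quotient are those of \<open>V\<close> followed by a change of
  representative, which a map vanishing on \<open>R\<close> does not notice.\<close>

lemma quot_space_linear: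
  assumes P: "module K P" and F: "linear_map K V P F" and kill: "\<And>r. r \<in> R \<Longrightarrow> F r = \<zero>\<^bsub>P\<^esub>"
  shows "linear_map K (quot_space V R) P F"
proof -
  note e = qrep_linear_eq[OF P F kill]
  show ?thesis
    by (rule linear_mapI) (auto simp: quot_space_simps e linear_mapD[OF F])
qed

end

lemma span_of_submodule:
  assumes V: "module K V" and S: "S \<subseteq> carrier V"
  shows "submodule (span_of K V S) K V"
proof -
  interpret V: module K V by fact
  let ?F = "{H. submodule H K V \<and> S \<subseteq> H}"
  have "carrier V \<in> ?F" using V.carrier_is_submodule S by simp
  then have sub: "\<Inter>?F \<subseteq> carrier V" by blast
  have H: "H \<in> ?F \<Longrightarrow> submodule H K V" for H by simp
  show ?thesis
    unfolding span_of_def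
  proof (rule V.submoduleI[OF sub])
    show "\<zero>\<^bsub>V\<^esub> \<in> \<Inter>?F"
      using subgroup.one_closed[OF submodule.axioms(1)[OF H]] by (auto simp del: mem_Collect_eq)
    show "\<ominus>\<^bsub>V\<^esub> a \<in> \<Inter>?F" if "a \<in> \<Inter>?F" for a
      using that V.submoduleE(3)[OF H] by (blast del: CollectE)
    show "a \<oplus>\<^bsub>V\<^esub> b \<in> \<Inter>?F" if "a \<in> \<Inter>?F" "b \<in> \<Inter>?F" for a b
      using that V.submoduleE(5)[OF H] by (blast del: CollectE)
    show "c \<odot>\<^bsub>V\<^esub> b \<in> \<Inter>?F" if "c \<in> carrier K" "b \<in> \<Inter>?F" for c b
      using that V.submoduleE(4)[OF H] by (blast del: CollectE)
  qed
qed

text \<open>The kernel of \<open>F\<close> is one of the submodules over which the intersection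
  defining the span is taken.\<close>

lemma span_of_kill:
  assumes V: "module K V" and S: "S \<subseteq> carrier V" and P: "module K P" and F: "linear_map K V P F"
    and kill: "\<And>s. s \<in> S \<Longrightarrow> F s = \<zero>\<^bsub>P\<^esub>" and r: "r \<in> span_of K V S"
  shows "F r = \<zero>\<^bsub>P\<^esub>"
proof -
  have "submodule {v \<in> carrier V. F v = \<zero>\<^bsub>P\<^esub>} K V"
    by (rule submodule_kernel[OF V P F])
  then have "r \<in> {v \<in> carrier V. F v = \<zero>\<^bsub>P\<^esub>}"
    using r S kill unfolding span_of_def by blast
  then show ?thesis by simp
qed

section \<open>The balanced quotient of \<open>M \<boxtimes>\<^sub>1 N\<close>\<close>

context bialgebra_setting
begin

lemma sweedler_counit_smult [simp]:
  assumes "module K V" "module K W" "module K P" "t \<in> carrier (V \<otimes>\<^sub>k W)" "a \<in> carrier A"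
    and "\<And>v. v \<in> carrier V \<Longrightarrow> lin W P (\<lambda>w. f v w)" "\<And>w. w \<in> carrier W \<Longrightarrow> lin V P (\<lambda>v. f v w)"
  shows "sw V W P t (\<lambda>v w. \<epsilon> a \<odot>\<^bsub>P\<^esub> f v w) = \<epsilon> a \<odot>\<^bsub>P\<^esub> sw V W P t f"
  using assms by (intro sweedler_linear[where g = "\<lambda>y. \<epsilon> a \<odot>\<^bsub>P\<^esub> y", symmetric]) simp_all

lemma same_space_ext1: "same_space (ext1 K A M N) (M \<otimes>\<^sub>k N)"
  by (simp add: same_space_def ext1_def module.defs tetramodule.defs)

lemmas ext1_space [simp] = same_spaceD[OF same_space_ext1]

lemma ext1_ops:
  "lact (ext1 K A M N) a t = sw M N (M \<otimes>\<^sub>k N) t (\<lambda>m n. tn M N (lact M a m) n)"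
  "ract (ext1 K A M N) t a = sw M N (M \<otimes>\<^sub>k N) t (\<lambda>m n. tn M N m (ract N n a))"
  "lcoact (ext1 K A M N) t = sw M N (A \<otimes>\<^sub>k M \<otimes>\<^sub>k N) t (\<lambda>m n.
     sw A M (A \<otimes>\<^sub>k M \<otimes>\<^sub>k N) (lcoact M m) (\<lambda>a m'.
       sw A N (A \<otimes>\<^sub>k M \<otimes>\<^sub>k N) (lcoact N n) (\<lambda>b n'. tn A (M \<otimes>\<^sub>k N) (a \<cdot>\<^sub>A b) (tn M N m' n'))))"
  "rcoact (ext1 K A M N) t = sw M N ((M \<otimes>\<^sub>k N) \<otimes>\<^sub>k A) t (\<lambda>m n.
     sw M A ((M \<otimes>\<^sub>k N) \<otimes>\<^sub>k A) (rcoact M m) (\<lambda>m' a.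
       sw N A ((M \<otimes>\<^sub>k N) \<otimes>\<^sub>k A) (rcoact N n) (\<lambda>n' b. tn (M \<otimes>\<^sub>k N) A (tn M N m' n') (a \<cdot>\<^sub>A b))))"
  by (simp_all add: ext1_def module.defs tetramodule.defs)

text \<open>The class of a pure tensor. Having its own name it is not mistaken for a pure tensor of
  \<open>M \<otimes> N\<close>, although as a point of \<open>'u\<close> it is again an element of
  that space.\<close>

definition bal :: "('k, 'u) tetramodule \<Rightarrow> ('k, 'u) tetramodule \<Rightarrow> 'u \<Rightarrow> 'u \<Rightarrow> 'u" where
  "bal M N m n = proj1 K A M N (tn M N m n)"

lemma same_space_int1: "same_space (int1 K A M N) (quot_space (ext1 K A M N) (rel1 K A M N))"
  by (simp add: same_space_def int1_def quot_tetra_def Let_def module.defs tetramodule.defs quot_space_def)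

context
  fixes M N :: "('k, 'u) tetramodule"
  assumes M: "tetra M" and N: "tetra N"
begin

abbreviation (input) "MN \<equiv> int1 K A M N"

lemma module_ext1: "module K (ext1 K A M N)"
  using M N by simp

lemma rel1_gens: "{tn M N (ract M m a) n \<ominus>\<^bsub>ext1 K A M N\<^esub> tn M N m (lact N a n) | m a n.
       m \<in> carrier M \<and> a \<in> carrier A \<and> n \<in> carrier N} \<subseteq> carrier (ext1 K A M N)"
proof -
  interpret B: module K "ext1 K A M N" by (rule module_ext1)
  show ?thesis using M N B.M.minus_closed by (auto simp del: ext1_space simp: ext1_space(1))
qed

lemma submodule_rel1: "submodule (rel1 K A M N) K (ext1 K A M N)"
  unfolding rel1_def by (rule span_of_submodule[OF module_ext1 rel1_gens])

lemma module_int1 [simp]: "module K MN"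
  unfolding same_spaceD(5)[OF same_space_int1] by (rule module_quot_space[OF module_ext1 submodule_rel1])

lemma linear_proj1: "lin (M \<otimes>\<^sub>k N) MN (proj1 K A M N)"
  unfolding proj1_def[abs_def]
  using qrep_linear[OF module_ext1 submodule_rel1] by (simp add: same_spaceD(7)[OF same_space_int1])

lemma proj1_simps [simp]:
  "lin X (M \<otimes>\<^sub>k N) e \<Longrightarrow> lin X MN (\<lambda>x. proj1 K A M N (e x))"
  "lin (M \<otimes>\<^sub>k N) MN (proj1 K A M N)"
  "t \<in> carrier (M \<otimes>\<^sub>k N) \<Longrightarrow> proj1 K A M N t \<in> carrier MN"
  "proj1 K A M N (tn M N m n) = bal M N m n"
  by (simp_all add: linear_map_comp[OF linear_proj1] linear_proj1 linear_mapD(1)[OF linear_proj1] bal_def)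

lemma proj1_sweedler [simp]:
  assumes "module K V" "module K W" "t \<in> carrier (V \<otimes>\<^sub>k W)"
    and "\<And>v. v \<in> carrier V \<Longrightarrow> lin W (M \<otimes>\<^sub>k N) (\<lambda>w. g v w)" "\<And>w. w \<in> carrier W \<Longrightarrow> lin V (M \<otimes>\<^sub>k N) (\<lambda>v. g v w)"
  shows "proj1 K A M N (sw V W (M \<otimes>\<^sub>k N) t g) = sw V W MN t (\<lambda>v w. proj1 K A M N (g v w))"
  using assms M N by (intro sweedler_linear) simp_all

lemma bal_linear [simp]:
  "n \<in> carrier N \<Longrightarrow> lin X M e \<Longrightarrow> lin X MN (\<lambda>x. bal M N (e x) n)"
  "m \<in> carrier M \<Longrightarrow> lin X N e \<Longrightarrow> lin X MN (\<lambda>x. bal M N m (e x))"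
  "m \<in> carrier M \<Longrightarrow> lin N MN (bal M N m)"
  "m \<in> carrier M \<Longrightarrow> n \<in> carrier N \<Longrightarrow> bal M N m n \<in> carrier MN"
  unfolding bal_def[abs_def] using M N
  by (simp_all add: linear_map_comp[OF linear_proj1] linear_mapD(1)[OF linear_proj1] del: proj1_simps)

text \<open>Points of the quotient are representatives, so Sweedler sums over
  \<open>M \<otimes> N\<close> may be taken over them directly; such sums are meaningful for classes
  as soon as the summand is balanced.\<close>

lemma int1_mem: "t \<in> carrier MN \<Longrightarrow> t \<in> carrier (M \<otimes>\<^sub>k N)"
  using qrep_closed[OF module_ext1 submodule_rel1]
  by (auto simp: same_spaceD(1)[OF same_space_int1] quot_space_def)

lemma int1_proj1: "t \<in> carrier MN \<Longrightarrow> \<exists>s \<in> carrier (M \<otimes>\<^sub>k N). t = proj1 K A M N s"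
  by (auto simp: same_spaceD(1)[OF same_space_int1] quot_space_def proj1_def)

lemma int1_eqI:
  assumes P: "module K P" and F: "lin MN P F" and G: "lin MN P G" and t: "t \<in> carrier MN"
    and eq: "\<And>m n. m \<in> carrier M \<Longrightarrow> n \<in> carrier N \<Longrightarrow> F (bal M N m n) = G (bal M N m n)"
  shows "F t = G t"
proof -
  obtain s where s: "s \<in> carrier (M \<otimes>\<^sub>k N)" "t = proj1 K A M N s" using int1_proj1[OF t] by blast
  have "F (proj1 K A M N s) = G (proj1 K A M N s)"
    by (rule tensor_eqI[OF tetra_module[OF M] tetra_module[OF N] P _ _ s(1)])
      (simp_all add: linear_map_comp[OF F] linear_map_comp[OF G] eq)
  then show ?thesis using s by simp
qed

text \<open>By \<open>span_of_kill\<close> only the generators matter, and on a generator the two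
  values of a balanced \<open>f\<close> cancel.\<close>

lemma rel1_killI:
  assumes P: "module K P"
    and f: "\<And>m. m \<in> carrier M \<Longrightarrow> lin N P (\<lambda>n. f m n)" "\<And>n. n \<in> carrier N \<Longrightarrow> lin M P (\<lambda>m. f m n)"
    and b: "\<And>m a n. m \<in> carrier M \<Longrightarrow> a \<in> carrier A \<Longrightarrow> n \<in> carrier N \<Longrightarrow> f (ract M m a) n = f m (lact N a n)"
    and r: "r \<in> rel1 K A M N"
  shows "sw M N P r f = \<zero>\<^bsub>P\<^esub>"
proof (rule span_of_kill[OF module_ext1 rel1_gens P _ _ r[unfolded rel1_def]])
  show F: "lin (ext1 K A M N) P (\<lambda>r. sw M N P r f)" using M N P f by simp
  interpret B: module K "ext1 K A M N" by (rule module_ext1)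
  interpret P: module K P by fact
  fix s assume "s \<in> {tn M N (ract M m a) n \<ominus>\<^bsub>ext1 K A M N\<^esub> tn M N m (lact N a n) | m a n.
       m \<in> carrier M \<and> a \<in> carrier A \<and> n \<in> carrier N}"
  then obtain m a n where s: "s = tn M N (ract M m a) n \<ominus>\<^bsub>ext1 K A M N\<^esub> tn M N m (lact N a n)"
    and m: "m \<in> carrier M" "a \<in> carrier A" "n \<in> carrier N" by blast
  have c: "tn M N (ract M m a) n \<in> carrier (ext1 K A M N)" "tn M N m (lact N a n) \<in> carrier (ext1 K A M N)"
    using m M N by simp_all
  have "sw M N P s f = sw M N P (tn M N (ract M m a) n) f \<oplus>\<^bsub>P\<^esub> \<ominus>\<^bsub>P\<^esub> sw M N P (tn M N m (lact N a n)) f"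
    unfolding s B.M.minus_eq
    using linear_mapD(2)[OF F c(1) B.M.a_inv_closed[OF c(2)]] linear_map_minus[OF module_ext1 P F c(2)] by simp
  also have "\<dots> = \<zero>\<^bsub>P\<^esub>"
    using m M N f b P linear_mapD(1)[OF f(1)] by (simp add: P.M.r_neg)
  finally show "sw M N P s f = \<zero>\<^bsub>P\<^esub>" .
qed

context
  fixes P :: "('k, 'u, 'p) module_scheme" and f
  assumes P: "module K P"
    and f: "\<And>m. m \<in> carrier M \<Longrightarrow> lin N P (\<lambda>n. f m n)" "\<And>n. n \<in> carrier N \<Longrightarrow> lin M P (\<lambda>m. f m n)"
    and b: "\<And>m a n. m \<in> carrier M \<Longrightarrow> a \<in> carrier A \<Longrightarrow> n \<in> carrier N \<Longrightarrow> f (ract M m a) n = f m (lact N a n)"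
begin

text \<open>A balanced summand vanishes on the relations and hence does not depend on the
  representative that the projection selects.\<close>

lemma sweedler_proj1 [simp]:
  assumes t: "t \<in> carrier (M \<otimes>\<^sub>k N)"
  shows "sw M N P (proj1 K A M N t) f = sw M N P t f"
  unfolding proj1_def
  by (rule qrep_linear_eq[OF module_ext1 submodule_rel1 P _ rel1_killI]) (use M N P f b t in simp_all)

lemma sweedler_bal [simp]:
  "m \<in> carrier M \<Longrightarrow> n \<in> carrier N \<Longrightarrow> sw M N P (bal M N m n) f = f m n"
  using M N P f by (simp add: bal_def del: proj1_simps)

lemma linear_sweedler_int1 [simp]:
  assumes e: "lin X MN e"
  shows "lin X P (\<lambda>x. sw M N P (e x) f)"
proof -
  have "lin MN P (\<lambda>x. sw M N P x f)"
    unfolding same_spaceD(6)[OF same_space_int1]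
    by (rule quot_space_linear[OF module_ext1 submodule_rel1 P _ rel1_killI]) (use M N P f b in simp_all)
  then show ?thesis using e by (rule linear_map_comp)
qed

end

lemma bal_balanced [simp]:
  assumes "m \<in> carrier M" "a \<in> carrier A" "n \<in> carrier N"
  shows "bal M N (ract M m a) n = bal M N m (lact N a n)"
proof -
  interpret B: module K "ext1 K A M N" by (rule module_ext1)
  have c: "tn M N (ract M m a) n \<in> carrier (ext1 K A M N)" "tn M N m (lact N a n) \<in> carrier (ext1 K A M N)"
    using assms M N by simp_all
  have "tn M N (ract M m a) n \<ominus>\<^bsub>ext1 K A M N\<^esub> tn M N m (lact N a n) \<in> rel1 K A M N"
    unfolding rel1_def span_of_def using assms by blast
  then show ?thesis
    unfolding bal_def proj1_def
    by (rule qrep_eq[OF module_ext1 submodule_rel1 c(2)])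
      (use c in \<open>simp only: B.M.minus_eq B.M.a_assoc B.M.a_inv_closed B.M.l_neg B.M.r_zero\<close>)
qed

text \<open>In normal form a left action stands outside a right one, which hides the pattern of
  \<open>bal_balanced\<close>; this variant recovers it.\<close>

lemma bal_balanced_lact [simp]:
  assumes "m \<in> carrier M" "a \<in> carrier A" "b \<in> carrier A" "n \<in> carrier N"
  shows "bal M N (lact M b (ract M m a)) n = bal M N (lact M b m) (lact N a n)"
  using assms bal_balanced[of "lact M b m" a n] M by simp

lemma int1_ops:
  assumes t: "t \<in> carrier MN"
  shows "a \<in> carrier A \<Longrightarrow> lact MN a t = sw M N MN t (\<lambda>m n. bal M N (lact M a m) n)"
    and "a \<in> carrier A \<Longrightarrow> ract MN t a = sw M N MN t (\<lambda>m n. bal M N m (ract N n a))"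
    and "lcoact MN t = sw M N (A \<otimes>\<^sub>k MN) t (\<lambda>m n. sw A M (A \<otimes>\<^sub>k MN) (lcoact M m) (\<lambda>a m'.
       sw A N (A \<otimes>\<^sub>k MN) (lcoact N n) (\<lambda>b n'. tn A MN (a \<cdot>\<^sub>A b) (bal M N m' n'))))"
    and "rcoact MN t = sw M N (MN \<otimes>\<^sub>k A) t (\<lambda>m n. sw M A (MN \<otimes>\<^sub>k A) (rcoact M m) (\<lambda>m' a.
       sw N A (MN \<otimes>\<^sub>k A) (rcoact N n) (\<lambda>n' b. tn MN A (bal M N m' n') (a \<cdot>\<^sub>A b))))"
proof -
  note s = same_spaceD[OF same_space_int1[of M N]]
  have *: "lact MN a t = proj1 K A M N (lact (ext1 K A M N) a t)"
    "ract MN t a = proj1 K A M N (ract (ext1 K A M N) t a)"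
    "lcoact MN t = sw A (M \<otimes>\<^sub>k N) (A \<otimes>\<^sub>k MN) (lcoact (ext1 K A M N) t) (\<lambda>a y. tn A MN a (proj1 K A M N y))"
    "rcoact MN t = sw (M \<otimes>\<^sub>k N) A (MN \<otimes>\<^sub>k A) (rcoact (ext1 K A M N) t) (\<lambda>y a. tn MN A (proj1 K A M N y) a)"
    for a
    unfolding s by (simp_all add: int1_def quot_tetra_def Let_def module.defs tetramodule.defs proj1_def tmap_def)
  show "a \<in> carrier A \<Longrightarrow> lact MN a t = sw M N MN t (\<lambda>m n. bal M N (lact M a m) n)"
    "a \<in> carrier A \<Longrightarrow> ract MN t a = sw M N MN t (\<lambda>m n. bal M N m (ract N n a))"
    "lcoact MN t = sw M N (A \<otimes>\<^sub>k MN) t (\<lambda>m n. sw A M (A \<otimes>\<^sub>k MN) (lcoact M m) (\<lambda>a m'.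
       sw A N (A \<otimes>\<^sub>k MN) (lcoact N n) (\<lambda>b n'. tn A MN (a \<cdot>\<^sub>A b) (bal M N m' n'))))"
    "rcoact MN t = sw M N (MN \<otimes>\<^sub>k A) t (\<lambda>m n. sw M A (MN \<otimes>\<^sub>k A) (rcoact M m) (\<lambda>m' a.
       sw N A (MN \<otimes>\<^sub>k A) (rcoact N n) (\<lambda>n' b. tn MN A (bal M N m' n') (a \<cdot>\<^sub>A b))))"
    unfolding * ext1_ops using M N int1_mem[OF t] by simp_all
qed

lemma int1_ops_bal [simp]:
  assumes "m \<in> carrier M" "n \<in> carrier N"
  shows "a \<in> carrier A \<Longrightarrow> lact MN a (bal M N m n) = bal M N (lact M a m) n"
    and "a \<in> carrier A \<Longrightarrow> ract MN (bal M N m n) a = bal M N m (ract N n a)"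
    and "lcoact MN (bal M N m n) = sw A M (A \<otimes>\<^sub>k MN) (lcoact M m) (\<lambda>a m'.
       sw A N (A \<otimes>\<^sub>k MN) (lcoact N n) (\<lambda>b n'. tn A MN (a \<cdot>\<^sub>A b) (bal M N m' n')))"
    and "rcoact MN (bal M N m n) = sw M A (MN \<otimes>\<^sub>k A) (rcoact M m) (\<lambda>m' a.
       sw N A (MN \<otimes>\<^sub>k A) (rcoact N n) (\<lambda>n' b. tn MN A (bal M N m' n') (a \<cdot>\<^sub>A b)))"
  using assms M N by (simp_all add: int1_ops)

text \<open>The summands in \<open>int1_ops\<close> are balanced: for the actions by associativity,
  for the coactions because both sides acquire the legs of the coproduct of \<open>a\<close>. Hence
  these formulas are linear on the quotient, and they agree there with the operations.\<close>

lemma int1_linear [simp]: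
  "a \<in> carrier A \<Longrightarrow> lin X MN e \<Longrightarrow> lin X MN (\<lambda>x. lact MN a (e x))"
  "t \<in> carrier MN \<Longrightarrow> lin A MN (\<lambda>a. lact MN a t)"
  "a \<in> carrier A \<Longrightarrow> lin X MN e \<Longrightarrow> lin X MN (\<lambda>x. ract MN (e x) a)"
  "t \<in> carrier MN \<Longrightarrow> lin A MN (\<lambda>a. ract MN t a)"
  "lin X MN e \<Longrightarrow> lin X (A \<otimes>\<^sub>k MN) (\<lambda>x. lcoact MN (e x))"
  "lin X MN e \<Longrightarrow> lin X (MN \<otimes>\<^sub>k A) (\<lambda>x. rcoact MN (e x))"
proof -
  note [simp] = M N
  have l: "lin MN MN (\<lambda>t. sw M N MN t (\<lambda>m n. bal M N (lact M a m) n))"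
    "lin MN MN (\<lambda>t. sw M N MN t (\<lambda>m n. bal M N m (ract N n a)))" if "a \<in> carrier A" for a
    using that by simp_all
  have l': "lin A MN (\<lambda>a. sw M N MN t (\<lambda>m n. bal M N (lact M a m) n))"
    "lin A MN (\<lambda>a. sw M N MN t (\<lambda>m n. bal M N m (ract N n a)))" if "t \<in> carrier MN" for t
    using int1_mem[OF that] by simp_all
  have c: "lin MN (A \<otimes>\<^sub>k MN) (\<lambda>t. sw M N (A \<otimes>\<^sub>k MN) t (\<lambda>m n. sw A M (A \<otimes>\<^sub>k MN) (lcoact M m) (\<lambda>a m'.
       sw A N (A \<otimes>\<^sub>k MN) (lcoact N n) (\<lambda>b n'. tn A MN (a \<cdot>\<^sub>A b) (bal M N m' n')))))"
    "lin MN (MN \<otimes>\<^sub>k A) (\<lambda>t. sw M N (MN \<otimes>\<^sub>k A) t (\<lambda>m n. sw M A (MN \<otimes>\<^sub>k A) (rcoact M m) (\<lambda>m' a.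
       sw N A (MN \<otimes>\<^sub>k A) (rcoact N n) (\<lambda>n' b. tn MN A (bal M N m' n') (a \<cdot>\<^sub>A b)))))"
    by simp_all
  note cong = linear_map_cong[OF module_int1] linear_map_cong[OF module_A]
  show "a \<in> carrier A \<Longrightarrow> lin X MN e \<Longrightarrow> lin X MN (\<lambda>x. lact MN a (e x))"
    "a \<in> carrier A \<Longrightarrow> lin X MN e \<Longrightarrow> lin X MN (\<lambda>x. ract MN (e x) a)"
    by (rule linear_map_comp[OF linear_map_cong[OF module_int1 l(1)]] linear_map_comp[OF linear_map_cong[OF module_int1 l(2)]];
      simp add: int1_ops)+
  show "t \<in> carrier MN \<Longrightarrow> lin A MN (\<lambda>a. lact MN a t)" "t \<in> carrier MN \<Longrightarrow> lin A MN (\<lambda>a. ract MN t a)"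
    by (rule linear_map_cong[OF module_A l'(1)] linear_map_cong[OF module_A l'(2)]; simp add: int1_ops)+
  show "lin X MN e \<Longrightarrow> lin X (A \<otimes>\<^sub>k MN) (\<lambda>x. lcoact MN (e x))"
    "lin X MN e \<Longrightarrow> lin X (MN \<otimes>\<^sub>k A) (\<lambda>x. rcoact MN (e x))"
    by (rule linear_map_comp[OF linear_map_cong[OF module_int1 c(1)]] linear_map_comp[OF linear_map_cong[OF module_int1 c(2)]];
      simp add: int1_ops)+
qed

text \<open>Every law is an equation between linear maps on the quotient, so classes of pure tensors
  suffice, on which all operations are explicit.\<close>

lemma tetra_int1: "tetra MN"
proof -
  note [simp] = M N
  note [simp] = int1_linear(1)[where e = "\<lambda>x. x"] int1_linear(3)[where e = "\<lambda>x. x"]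
    int1_linear(5)[where e = "\<lambda>x. x"] int1_linear(6)[where e = "\<lambda>x. x"]
  have [simp]: "lcoact MN t \<in> carrier (A \<otimes>\<^sub>k MN)" "rcoact MN t \<in> carrier (MN \<otimes>\<^sub>k A)"
    "a \<in> carrier A \<Longrightarrow> lact MN a t \<in> carrier MN" "a \<in> carrier A \<Longrightarrow> ract MN t a \<in> carrier MN"
    if "t \<in> carrier MN" for t a
    by (rule linear_mapD(1)[OF int1_linear(5)[OF linear_map_id] that]
      linear_mapD(1)[OF int1_linear(6)[OF linear_map_id] that]
      linear_mapD(1)[OF int1_linear(1)[OF _ linear_map_id] that]
      linear_mapD(1)[OF int1_linear(3)[OF _ linear_map_id] that]; assumption)+
  show ?thesis
    unfolding tetra_defs
    apply (intro conjI ballI; simp?)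
    subgoal premises p for a b m by (rule int1_eqI[where P = MN, OF _ _ _ p(3)]) (use p in simp_all)
    subgoal premises p for a b m by (rule int1_eqI[where P = MN, OF _ _ _ p(3)]) (use p in simp_all)
    subgoal premises p for a b m by (rule int1_eqI[where P = MN, OF _ _ _ p(3)]) (use p in simp_all)
    subgoal premises p for m by (rule int1_eqI[where P = MN, OF _ _ _ p(1)]) (use p in simp_all)
    subgoal premises p for m by (rule int1_eqI[where P = MN, OF _ _ _ p(1)]) (use p in simp_all)
    \<comment> \<open>Coacting twice takes the coactions of \<open>m\<close> and of \<open>n\<close>
      alternately, while the coproduct of the product leg takes both coactions of \<open>m\<close>
      first; one exchange reconciles the two orders.\<close>
    subgoal premises p for m
      by (rule int1_eqI[where P = "A \<otimes>\<^sub>k A \<otimes>\<^sub>k MN", OF _ _ _ p(1)])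
        (simp_all, rule sweedler_cong[OF refl refl refl refl], (rule sweedler_swap; simp))
    subgoal premises p for m
      by (rule int1_eqI[where P = "MN \<otimes>\<^sub>k A \<otimes>\<^sub>k A", OF _ _ _ p(1)])
        (simp_all, rule sweedler_cong[OF refl refl refl refl], (rule sweedler_swap; simp))
    subgoal premises p for m by (rule int1_eqI[where P = "A \<otimes>\<^sub>k MN \<otimes>\<^sub>k A", OF _ _ _ p(1)]) (simp_all)
    subgoal premises p for m by (rule int1_eqI[where P = MN, OF _ _ _ p(1)]) (simp_all)
    subgoal premises p for m by (rule int1_eqI[where P = MN, OF _ _ _ p(1)]) (simp_all)
    subgoal premises p for a m by (rule int1_eqI[where P = "A \<otimes>\<^sub>k MN", OF _ _ _ p(2)]) (use p(1) in simp_all)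
    subgoal premises p for a m by (rule int1_eqI[where P = "A \<otimes>\<^sub>k MN", OF _ _ _ p(2)]) (use p(1) in simp_all)
    subgoal premises p for a m by (rule int1_eqI[where P = "MN \<otimes>\<^sub>k A", OF _ _ _ p(2)]) (use p(1) in simp_all)
    subgoal premises p for a m by (rule int1_eqI[where P = "MN \<otimes>\<^sub>k A", OF _ _ _ p(2)]) (use p(1) in simp_all)
    done
qed

end

section \<open>The monoidal structure of \<open>\<otimes>\<^sub>1\<close>\<close>

lemmas [simp] = tetra_int1 tetra_int2 tetra_ext2

lemma tetra_map_int1I:
  assumes M: "tetra M" and N: "tetra N" and P: "tetra P"
    and F: "F \<in> extensional (carrier (int1 K A M N))" "lin (int1 K A M N) P F"
    and act: "\<And>a m n. a \<in> carrier A \<Longrightarrow> m \<in> carrier M \<Longrightarrow> n \<in> carrier N \<Longrightarrow>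
        F (bal M N (lact M a m) n) = lact P a (F (bal M N m n))"
      "\<And>a m n. a \<in> carrier A \<Longrightarrow> m \<in> carrier M \<Longrightarrow> n \<in> carrier N \<Longrightarrow>
        F (bal M N m (ract N n a)) = ract P (F (bal M N m n)) a"
    and coact: "\<And>m n. m \<in> carrier M \<Longrightarrow> n \<in> carrier N \<Longrightarrow> lcoact P (F (bal M N m n)) =
        sw A M (A \<otimes>\<^sub>k P) (lcoact M m) (\<lambda>a x. sw A N (A \<otimes>\<^sub>k P) (lcoact N n) (\<lambda>b y. tn A P (a \<cdot>\<^sub>A b) (F (bal M N x y))))"
      "\<And>m n. m \<in> carrier M \<Longrightarrow> n \<in> carrier N \<Longrightarrow> rcoact P (F (bal M N m n)) =
        sw M A (P \<otimes>\<^sub>k A) (rcoact M m) (\<lambda>x a. sw N A (P \<otimes>\<^sub>k A) (rcoact N n) (\<lambda>y b. tn P A (F (bal M N x y)) (a \<cdot>\<^sub>A b)))"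
  shows "tetra_map K A (int1 K A M N) P F"
proof (rule tetra_mapI[OF F])
  note [simp] = M N P F(2) linear_map_comp[OF F(2)] linear_mapD(1)[OF F(2)] act coact
  fix m assume m: "m \<in> carrier (int1 K A M N)"
  show "lcoact P (F m) = sw A (int1 K A M N) (A \<otimes>\<^sub>k P) (lcoact (int1 K A M N) m) (\<lambda>a x. tn A P a (F x))"
    by (rule int1_eqI[OF M N _ _ _ m, where P = "A \<otimes>\<^sub>k P"]) simp_all
  show "rcoact P (F m) = sw (int1 K A M N) A (P \<otimes>\<^sub>k A) (rcoact (int1 K A M N) m) (\<lambda>x a. tn P A (F x) a)"
    by (rule int1_eqI[OF M N _ _ _ m, where P = "P \<otimes>\<^sub>k A"]) simp_all
  fix a assume [simp]: "a \<in> carrier A"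
  show "F (lact (int1 K A M N) a m) = lact P a (F m)"
    by (rule int1_eqI[OF M N _ _ _ m, where P = "P"]) simp_all
  show "F (ract (int1 K A M N) m a) = ract P (F m) a"
    by (rule int1_eqI[OF M N _ _ _ m, where P = "P"]) simp_all
qed

definition tmap1 where
  "tmap1 M N M' N' f g = restrict (map1 K A M N M' N' f g) (carrier (int1 K A M N))"

definition assoc1 where
  "assoc1 M N P = restrict (\<lambda>t.
     sw (int1 K A M N) P (int1 K A M (int1 K A N P)) t (\<lambda>s p.
       sw M N (int1 K A M (int1 K A N P)) s (\<lambda>m n. bal M (int1 K A N P) m (bal N P n p))))
     (carrier (int1 K A (int1 K A M N) P))"

text \<open>The inverse of \<open>assoc1\<close>, given explicitly so that both composites can be
  evaluated on classes of pure tensors.\<close>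

definition assoc1_inv where
  "assoc1_inv M N P = restrict (\<lambda>t.
     sw M (int1 K A N P) (int1 K A (int1 K A M N) P) t (\<lambda>m s.
       sw N P (int1 K A (int1 K A M N) P) s (\<lambda>n p. bal (int1 K A M N) P (bal M N m n) p)))
     (carrier (int1 K A M (int1 K A N P)))"

definition lunit1 where
  "lunit1 M = restrict (\<lambda>t. sw A M M t (lact M)) (carrier (int1 K A (taut A) M))"

definition runit1 where
  "runit1 M = restrict (\<lambda>t. sw M A M t (ract M)) (carrier (int1 K A M (taut A)))"

lemma tensor1_simps:
  "tobj (tensor1 K A) = int1 K A"
  "tmor (tensor1 K A) f g = \<lparr>Dom = int1 K A (Dom f) (Dom g), Cod = int1 K A (Cod f) (Cod g),
     Map = tmap1 (Dom f) (Dom g) (Cod f) (Cod g) (Map f) (Map g)\<rparr>"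
  "assoc (tensor1 K A) M N P = \<lparr>Dom = int1 K A (int1 K A M N) P, Cod = int1 K A M (int1 K A N P),
     Map = assoc1 M N P\<rparr>"
  "lunit (tensor1 K A) M = \<lparr>Dom = int1 K A (taut A) M, Cod = M, Map = lunit1 M\<rparr>"
  "runit (tensor1 K A) M = \<lparr>Dom = int1 K A M (taut A), Cod = M, Map = runit1 M\<rparr>"
  by (simp_all add: tensor1_def tmap1_def assoc1_def lunit1_def runit1_def bal_def)

context
  fixes M N M' N' :: "('k, 'u) tetramodule" and f g
  assumes M: "tetra M" and N: "tetra N" and M': "tetra M'" and N': "tetra N'"
    and f: "tetra_map K A M M' f" and g: "tetra_map K A N N' g"
begin

lemma map1_eq:
  assumes t: "t \<in> carrier (M \<otimes>\<^sub>k N)"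
  shows "map1 K A M N M' N' f g t = sw M N (int1 K A M' N') t (\<lambda>m n. bal M' N' (f m) (g n))"
  unfolding map1_def tmap_def
  using M N M' N' t tetra_map_rules[OF f] tetra_map_rules[OF g] by simp

lemma tmap1_bal:
  "m \<in> carrier M \<Longrightarrow> n \<in> carrier N \<Longrightarrow> tmap1 M N M' N' f g (bal M N m n) = bal M' N' (f m) (g n)"
  using M N M' N' int1_mem[OF M N, of "bal M N m n"] tetra_map_rules[OF f] tetra_map_rules[OF g]
  by (simp add: tmap1_def map1_eq)

lemma tetra_map_tmap1: "tetra_map K A (int1 K A M N) (int1 K A M' N') (tmap1 M N M' N' f g)"
proof (rule tetra_map_int1I)
  note [simp] = M N M' N' tetra_map_rules[OF f] tetra_map_rules[OF g] tmap1_bal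
  show "lin (int1 K A M N) (int1 K A M' N') (tmap1 M N M' N' f g)"
    unfolding tmap1_def
    by (rule linear_map_cong[of _ _ _ "\<lambda>t. sw M N (int1 K A M' N') t (\<lambda>m n. bal M' N' (f m) (g n))"])
      (simp_all add: map1_eq int1_mem[OF M N])
qed (use M N M' N' in \<open>simp_all add: tmap1_bal tetra_map_rules[OF f] tetra_map_rules[OF g], simp add: tmap1_def\<close>)

end

section \<open>The associativity isomorphism of \<open>\<otimes>\<^sub>1\<close>\<close>

context
  fixes M N P :: "('k, 'u) tetramodule"
  assumes M: "tetra M" and N: "tetra N" and P: "tetra P"
begin

lemma int1_eqI_left:
  assumes X: "module K X" and F: "lin (int1 K A (int1 K A M N) P) X F" and G: "lin (int1 K A (int1 K A M N) P) X G"
    and t: "t \<in> carrier (int1 K A (int1 K A M N) P)"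
    and eq: "\<And>m n p. m \<in> carrier M \<Longrightarrow> n \<in> carrier N \<Longrightarrow> p \<in> carrier P \<Longrightarrow>
      F (bal (int1 K A M N) P (bal M N m n) p) = G (bal (int1 K A M N) P (bal M N m n) p)"
  shows "F t = G t"
proof (rule int1_eqI[OF _ P X F G t])
  show "tetra (int1 K A M N)" using M N by simp
  fix s p assume s: "s \<in> carrier (int1 K A M N)" and p: "p \<in> carrier P"
  show "F (bal (int1 K A M N) P s p) = G (bal (int1 K A M N) P s p)"
    by (rule int1_eqI[OF M N X _ _ s])
      (use p M N P eq in \<open>simp_all add: linear_map_comp[OF F] linear_map_comp[OF G]\<close>)
qed

lemma int1_eqI_right:
  assumes X: "module K X" and F: "lin (int1 K A M (int1 K A N P)) X F" and G: "lin (int1 K A M (int1 K A N P)) X G"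
    and t: "t \<in> carrier (int1 K A M (int1 K A N P))"
    and eq: "\<And>m n p. m \<in> carrier M \<Longrightarrow> n \<in> carrier N \<Longrightarrow> p \<in> carrier P \<Longrightarrow>
      F (bal M (int1 K A N P) m (bal N P n p)) = G (bal M (int1 K A N P) m (bal N P n p))"
  shows "F t = G t"
proof (rule int1_eqI[OF M _ X F G t])
  show "tetra (int1 K A N P)" using N P by simp
  fix m s assume s: "s \<in> carrier (int1 K A N P)" and m: "m \<in> carrier M"
  show "F (bal M (int1 K A N P) m s) = G (bal M (int1 K A N P) m s)"
    by (rule int1_eqI[OF N P X _ _ s])
      (use m M N P eq in \<open>simp_all add: linear_map_comp[OF F] linear_map_comp[OF G]\<close>)
qed

lemma assoc1_facts:
  shows assoc1_bal: "m \<in> carrier M \<Longrightarrow> n \<in> carrier N \<Longrightarrow> p \<in> carrier P \<Longrightarrow>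
      assoc1 M N P (bal (int1 K A M N) P (bal M N m n) p) = bal M (int1 K A N P) m (bal N P n p)"
    and assoc1_linear: "lin (int1 K A (int1 K A M N) P) (int1 K A M (int1 K A N P)) (assoc1 M N P)"
proof -
  let ?X = "int1 K A M (int1 K A N P)"
  note [simp] = M N P
  let ?f = "\<lambda>s p. sw M N ?X s (\<lambda>m n. bal M (int1 K A N P) m (bal N P n p))"
  \<comment> \<open>The balance needed for the outer product. The inner sum depends only on the
    class \<open>s\<close> and is linear in it, so \<open>s\<close> may be taken to be the class of
    a pure tensor.\<close>
  have [simp]: "?f (ract (int1 K A M N) s a) p = ?f s (lact P a p)"
    if [simp]: "a \<in> carrier A" "p \<in> carrier P" and s: "s \<in> carrier (int1 K A M N)" for s a p
    by (rule int1_eqI[OF M N _ _ _ s, where P = ?X]) simp_all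
  note [simp] = int1_mem[OF M N]
  show "lin (int1 K A (int1 K A M N) P) ?X (assoc1 M N P)"
    unfolding assoc1_def by (subst lin_restrict) simp_all
  show "m \<in> carrier M \<Longrightarrow> n \<in> carrier N \<Longrightarrow> p \<in> carrier P \<Longrightarrow>
      assoc1 M N P (bal (int1 K A M N) P (bal M N m n) p) = bal M (int1 K A N P) m (bal N P n p)"
    by (simp add: assoc1_def)
qed

lemma assoc1_inv_facts:
  shows assoc1_inv_bal: "m \<in> carrier M \<Longrightarrow> n \<in> carrier N \<Longrightarrow> p \<in> carrier P \<Longrightarrow>
      assoc1_inv M N P (bal M (int1 K A N P) m (bal N P n p)) = bal (int1 K A M N) P (bal M N m n) p"
    and assoc1_inv_linear: "lin (int1 K A M (int1 K A N P)) (int1 K A (int1 K A M N) P) (assoc1_inv M N P)"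
proof -
  let ?X = "int1 K A (int1 K A M N) P"
  note [simp] = M N P
  let ?f = "\<lambda>m s. sw N P ?X s (\<lambda>n p. bal (int1 K A M N) P (bal M N m n) p)"
  \<comment> \<open>A right action on the class of \<open>m\<close> and \<open>n\<close> is
    rewritten as one on \<open>n\<close>, so the balance of the outer product is restated in that
    form.\<close>
  have b [simp]: "bal (int1 K A M N) P (bal M N m (ract N n a)) p = bal (int1 K A M N) P (bal M N m n) (lact P a p)"
    if [simp]: "m \<in> carrier M" "a \<in> carrier A" "n \<in> carrier N" "p \<in> carrier P" for m a n p
    using bal_balanced[of "int1 K A M N" P "bal M N m n" a p] by simp
  \<comment> \<open>The same with a further left action on \<open>n\<close>, which the normal form
    places outside the right one.\<close>
  have b' [simp]: "bal (int1 K A M N) P (bal M N m (lact N b (ract N n a))) p = bal (int1 K A M N) P (bal M N m (lact N b n)) (lact P a p)"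
    if [simp]: "m \<in> carrier M" "a \<in> carrier A" "b \<in> carrier A" "n \<in> carrier N" "p \<in> carrier P" for m a b n p
    using b[of m a "lact N b n" p] by simp
  have [simp]: "?f m (lact (int1 K A N P) a s) =
      sw N P ?X s (\<lambda>n p. bal (int1 K A M N) P (bal M N m (lact N a n)) p)"
    if [simp]: "a \<in> carrier A" "m \<in> carrier M" and s: "s \<in> carrier (int1 K A N P)" for s a m
    by (rule int1_eqI[OF N P _ _ _ s, where P = ?X]) simp_all
  note [simp] = int1_mem[OF N P]
  show "lin (int1 K A M (int1 K A N P)) ?X (assoc1_inv M N P)"
    unfolding assoc1_inv_def by (subst lin_restrict) simp_all
  show "m \<in> carrier M \<Longrightarrow> n \<in> carrier N \<Longrightarrow> p \<in> carrier P \<Longrightarrow>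
      assoc1_inv M N P (bal M (int1 K A N P) m (bal N P n p)) = bal (int1 K A M N) P (bal M N m n) p"
    by (simp add: assoc1_inv_def)
qed

lemma tetra_map_assoc1: "tetra_map K A (int1 K A (int1 K A M N) P) (int1 K A M (int1 K A N P)) (assoc1 M N P)"
proof (rule tetra_map_int1I)
  note [simp] = M N P assoc1_linear linear_map_comp[OF assoc1_linear] linear_mapD(1)[OF assoc1_linear] assoc1_bal
  let ?S = "int1 K A M N" and ?X = "int1 K A M (int1 K A N P)"
  fix s p assume s: "s \<in> carrier ?S" and [simp]: "p \<in> carrier P"
  show "lcoact ?X (assoc1 M N P (bal ?S P s p)) = sw A ?S (A \<otimes>\<^sub>k ?X) (lcoact ?S s) (\<lambda>a x.
      sw A P (A \<otimes>\<^sub>k ?X) (lcoact P p) (\<lambda>b y. tn A ?X (a \<cdot>\<^sub>A b) (assoc1 M N P (bal ?S P x y))))"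
    by (rule int1_eqI[OF M N _ _ _ s, where P = "A \<otimes>\<^sub>k ?X"]) simp_all
  show "rcoact ?X (assoc1 M N P (bal ?S P s p)) = sw ?S A (?X \<otimes>\<^sub>k A) (rcoact ?S s) (\<lambda>x a.
      sw P A (?X \<otimes>\<^sub>k A) (rcoact P p) (\<lambda>y b. tn ?X A (assoc1 M N P (bal ?S P x y)) (a \<cdot>\<^sub>A b)))"
    by (rule int1_eqI[OF M N _ _ _ s, where P = "?X \<otimes>\<^sub>k A"]) simp_all
  fix a assume [simp]: "a \<in> carrier A"
  show "assoc1 M N P (bal ?S P (lact ?S a s) p) = lact ?X a (assoc1 M N P (bal ?S P s p))"
    by (rule int1_eqI[OF M N _ _ _ s, where P = ?X]) simp_all
  show "assoc1 M N P (bal ?S P s (ract P p a)) = ract ?X (assoc1 M N P (bal ?S P s p)) a"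
    by (rule int1_eqI[OF M N _ _ _ s, where P = ?X]) simp_all
qed (use M N P in \<open>simp_all add: assoc1_linear, simp add: assoc1_def\<close>)

lemma assoc1_Iso: "\<lparr>Dom = int1 K A (int1 K A M N) P, Cod = int1 K A M (int1 K A N P), Map = assoc1 M N P\<rparr>
    \<in> Iso (Tetra K A) (int1 K A (int1 K A M N) P) (int1 K A M (int1 K A N P))"
proof (rule Iso_Tetra[OF _ _ tetra_map_assoc1])
  note [simp] = M N P assoc1_linear linear_map_comp[OF assoc1_linear] linear_mapD(1)[OF assoc1_linear] assoc1_bal
    assoc1_inv_linear linear_map_comp[OF assoc1_inv_linear] linear_mapD(1)[OF assoc1_inv_linear] assoc1_inv_bal
  have 1: "assoc1_inv M N P (assoc1 M N P t) = t" if t: "t \<in> carrier (int1 K A (int1 K A M N) P)" for t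
    by (rule int1_eqI_left[OF _ _ _ t, where X = "int1 K A (int1 K A M N) P"]) simp_all
  have 2: "assoc1 M N P (assoc1_inv M N P t) = t" if t: "t \<in> carrier (int1 K A M (int1 K A N P))" for t
    by (rule int1_eqI_right[OF _ _ _ t, where X = "int1 K A M (int1 K A N P)"]) simp_all
  show "bij_betw (assoc1 M N P) (carrier (int1 K A (int1 K A M N) P)) (carrier (int1 K A M (int1 K A N P)))"
    by (rule bij_betw_byWitness[where f' = "assoc1_inv M N P"]) (use 1 2 in auto)
qed (use M N P in simp_all)

end

section \<open>The unit isomorphisms of \<open>\<otimes>\<^sub>1\<close>\<close>

context
  fixes M :: "('k, 'u) tetramodule"
  assumes M: "tetra M"
begin

lemma lunit1_facts:
  shows lunit1_bal: "a \<in> carrier A \<Longrightarrow> m \<in> carrier M \<Longrightarrow> lunit1 M (bal (taut A) M a m) = lact M a m"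
    and runit1_bal: "a \<in> carrier A \<Longrightarrow> m \<in> carrier M \<Longrightarrow> runit1 M (bal M (taut A) m a) = ract M m a"
    and lunit1_linear: "lin (int1 K A (taut A) M) M (lunit1 M)"
    and runit1_linear: "lin (int1 K A M (taut A)) M (runit1 M)"
proof -
  note [simp] = M
  \<comment> \<open>The unit maps are defined by sums over \<open>A\<close>, whereas the rules for
    balanced quotients speak of \<open>taut A\<close>; as spaces the two are the same.\<close>
  have l: "sw A M M t (lact M) = sw (taut A) M M t (lact M)" "sw M A M t (ract M) = sw M (taut A) M t (ract M)" for t
    by simp_all
  have b: "sw (taut A) M M (bal (taut A) M a m) (lact M) = lact M a m"
    "sw M (taut A) M (bal M (taut A) m a) (ract M) = ract M m a" if "a \<in> carrier A" "m \<in> carrier M" for a m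
    by (rule sweedler_bal; use that in simp)+
  show "lin (int1 K A (taut A) M) M (lunit1 M)" "lin (int1 K A M (taut A)) M (runit1 M)"
    unfolding lunit1_def runit1_def lin_restrict[OF module_int1[OF tetra_taut M]] lin_restrict[OF module_int1[OF M tetra_taut]] l
    by (rule linear_sweedler_int1; simp)+
  show "a \<in> carrier A \<Longrightarrow> m \<in> carrier M \<Longrightarrow> lunit1 M (bal (taut A) M a m) = lact M a m"
    "a \<in> carrier A \<Longrightarrow> m \<in> carrier M \<Longrightarrow> runit1 M (bal M (taut A) m a) = ract M m a"
    unfolding lunit1_def runit1_def l using b by (simp_all del: taut_space(12,13))
qed

text \<open>Balancing across the unit, as in \<open>a = 1 a\<close>. It shows that inserting the
  unit of \<open>A\<close> inverts the unit isomorphisms.\<close>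

lemma bal_taut_unit:
  "a \<in> carrier A \<Longrightarrow> m \<in> carrier M \<Longrightarrow> bal (taut A) M a m = bal (taut A) M \<one>\<^bsub>A\<^esub> (lact M a m)"
  "a \<in> carrier A \<Longrightarrow> m \<in> carrier M \<Longrightarrow> bal M (taut A) m a = bal M (taut A) (ract M m a) \<one>\<^bsub>A\<^esub>"
  using bal_balanced[of "taut A" M "\<one>\<^bsub>A\<^esub>" a m] bal_balanced[of M "taut A" m a "\<one>\<^bsub>A\<^esub>"] M by simp_all

lemma tetra_map_lunit1: "tetra_map K A (int1 K A (taut A) M) M (lunit1 M)"
  by (rule tetra_map_int1I)
    (use M in \<open>simp_all add: lunit1_bal lunit1_linear\<close>, simp add: lunit1_def)

lemma tetra_map_runit1: "tetra_map K A (int1 K A M (taut A)) M (runit1 M)"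
  by (rule tetra_map_int1I)
    (use M in \<open>simp_all add: runit1_bal runit1_linear\<close>, simp add: runit1_def)

lemma lunit1_Iso: "\<lparr>Dom = int1 K A (taut A) M, Cod = M, Map = lunit1 M\<rparr> \<in> Iso (Tetra K A) (int1 K A (taut A) M) M"
proof (rule Iso_Tetra[OF _ _ tetra_map_lunit1])
  note [simp] = M lunit1_linear linear_map_comp[OF lunit1_linear] linear_mapD(1)[OF lunit1_linear] lunit1_bal
  have 1: "bal (taut A) M \<one>\<^bsub>A\<^esub> (lunit1 M t) = t" if t: "t \<in> carrier (int1 K A (taut A) M)" for t
    by (rule int1_eqI[OF _ _ _ _ _ t, where P = "int1 K A (taut A) M"])
      (simp_all add: bal_taut_unit(1)[symmetric])
  show "bij_betw (lunit1 M) (carrier (int1 K A (taut A) M)) (carrier M)"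
    by (rule bij_betw_byWitness[where f' = "bal (taut A) M \<one>\<^bsub>A\<^esub>"]) (use 1 in auto)
qed (use M in simp_all)

lemma runit1_Iso: "\<lparr>Dom = int1 K A M (taut A), Cod = M, Map = runit1 M\<rparr> \<in> Iso (Tetra K A) (int1 K A M (taut A)) M"
proof (rule Iso_Tetra[OF _ _ tetra_map_runit1])
  note [simp] = M runit1_linear linear_map_comp[OF runit1_linear] linear_mapD(1)[OF runit1_linear] runit1_bal
  have 1: "bal M (taut A) (runit1 M t) \<one>\<^bsub>A\<^esub> = t" if t: "t \<in> carrier (int1 K A M (taut A))" for t
    by (rule int1_eqI[OF _ _ _ _ _ t, where P = "int1 K A M (taut A)"])
      (simp_all add: bal_taut_unit(2)[symmetric])
  show "bij_betw (runit1 M) (carrier (int1 K A M (taut A))) (carrier M)"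
    by (rule bij_betw_byWitness[where f' = "\<lambda>m. bal M (taut A) m \<one>\<^bsub>A\<^esub>"]) (use 1 in auto)
qed (use M in simp_all)

end

section \<open>The category of tetramodules and the axioms for
  \<open>\<otimes>\<^sub>1\<close>\<close>

lemma Tetra_simps:
  "Ob (Tetra K A) = {M. tetra M}"
  "\<lparr>Dom = M, Cod = N, Map = f\<rparr> \<in> Hom (Tetra K A) M N \<longleftrightarrow> tetra_map K A M N f"
  "Id (Tetra K A) M = \<lparr>Dom = M, Cod = M, Map = restrict (\<lambda>x. x) (carrier M)\<rparr>"
  "Comp (Tetra K A) G F = \<lparr>Dom = Dom F, Cod = Cod G, Map = compose (carrier (Dom F)) (Map G) (Map F)\<rparr>"
  by (simp_all add: Tetra_def)

lemma HomE:
  assumes "F \<in> Hom (Tetra K A) M N"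
  obtains f where "F = \<lparr>Dom = M, Cod = N, Map = f\<rparr>" "tetra_map K A M N f"
  using assms by (auto simp: Tetra_def)

lemma category_Tetra: "category (Tetra K A)"
proof
  fix W X Y Z F G H
  assume "F \<in> Hom (Tetra K A) W X" "G \<in> Hom (Tetra K A) X Y" "H \<in> Hom (Tetra K A) Y Z"
  then show "Comp (Tetra K A) (Comp (Tetra K A) H G) F = Comp (Tetra K A) H (Comp (Tetra K A) G F)"
    by (elim HomE) (auto simp: Tetra_simps compose_def restrict_def fun_eq_iff dest!: tetra_map_simps(3))
qed (elim HomE | auto simp: Tetra_simps tetra_map_id intro: tetra_map_comp elim!: HomE;
    auto simp: compose_def restrict_def fun_eq_iff tetra_map_def extensional_def dest: linear_mapD(1))+

lemma compose_eqI:
  "(\<And>x. x \<in> C \<Longrightarrow> f (g x) = f' (g' x)) \<Longrightarrow> compose C f g = compose C f' g'"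
  by (simp add: compose_def restrict_def fun_eq_iff)

lemma tetra_map_eqI:
  "tetra_map K A M N f \<Longrightarrow> tetra_map K A M N g \<Longrightarrow> (\<And>x. x \<in> carrier M \<Longrightarrow> f x = g x) \<Longrightarrow> f = g"
  by (rule extensionalityI[of _ "carrier M"]) (simp_all add: tetra_map_def)

lemma compose_eqI':
  assumes "tetra M" "tetra N" "tetra P" "tetra_map K A M N f" "tetra_map K A N P g" "tetra_map K A M P h"
    and "\<And>x. x \<in> carrier M \<Longrightarrow> g (f x) = h x"
  shows "compose (carrier M) g f = h"
  by (rule tetra_map_eqI[OF tetra_map_comp[OF assms(1-5)] assms(6)]) (simp add: compose_eq assms(7))

text \<open>Keeps linearity and closure only. Without the rules on actions and coactions the
  structure maps are evaluated on classes of pure tensors and otherwise left intact.\<close>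

lemma opaque_tetra_map:
  assumes "tetra_map K A M N f"
  shows "lin M N f" "lin X M e \<Longrightarrow> lin X N (\<lambda>x. f (e x))" "m \<in> carrier M \<Longrightarrow> f m \<in> carrier N"
  by (rule tetra_map_simps[OF assms]; assumption)+

declare restrict_apply [simp del] restrict_apply' [simp]

lemmas tensor1_maps = tetra_map_tmap1 tetra_map_assoc1 tetra_map_lunit1 tetra_map_runit1

lemmas tensor1_rules = tensor1_maps tmap1_bal assoc1_bal lunit1_bal runit1_bal tetra_map_id tetra_map_id[OF tetra_taut, unfolded taut_space(1)]
  opaque_tetra_map[OF tetra_map_tmap1] opaque_tetra_map[OF tetra_map_assoc1]
  opaque_tetra_map[OF tetra_map_lunit1] opaque_tetra_map[OF tetra_map_runit1]

lemma monoidal_Tetra1: "monoidal_category (Tetra K A) (taut A) (tensor1 K A)"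
proof (intro monoidal_category.intro category_Tetra monoidal_category_axioms.intro)
  let ?C = "Tetra K A" and ?T = "tensor1 K A"
  note s = tensor1_simps Tetra_simps
  note [simp] = tensor1_rules
  show "taut A \<in> Ob ?C" by (simp add: s)
  fix X Y assume "X \<in> Ob ?C" "Y \<in> Ob ?C"
  then have [simp]: "tetra X" "tetra Y" by (simp_all add: s)
  show "tobj ?T X Y \<in> Ob ?C" by (simp add: s)
  show "lunit ?T X \<in> Iso ?C (tobj ?T (taut A) X) X" "runit ?T X \<in> Iso ?C (tobj ?T X (taut A)) X"
    by (simp_all add: s lunit1_Iso runit1_Iso)
  show "tmor ?T (Id ?C X) (Id ?C Y) = Id ?C (tobj ?T X Y)"
    unfolding s tetra_mor.select_convs
    apply simp
    apply (rule tetra_map_eqI[where M = "int1 K A X Y" and N = "int1 K A X Y"])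
    apply simp_all
    subgoal premises t for t by (rule int1_eqI[OF _ _ _ _ _ t, where P = "int1 K A X Y"]) simp_all
    done
  show "Comp ?C (tmor ?T (Id ?C X) (lunit ?T Y)) (assoc ?T X (taut A) Y) = tmor ?T (runit ?T X) (Id ?C Y)"
    unfolding s tetra_mor.select_convs
    apply simp
    apply (rule compose_eqI'[where N = "int1 K A X (int1 K A (taut A) Y)" and P = "int1 K A X Y"]; simp?)
    subgoal premises t for t by (rule int1_eqI_left[OF _ _ _ _ _ _ t, where X = "int1 K A X Y"]) simp_all
    done
  {
    fix X' F assume "X' \<in> Ob ?C" "F \<in> Hom ?C X X'"
    then obtain f where F: "F = \<lparr>Dom = X, Cod = X', Map = f\<rparr>" and f: "tetra_map K A X X' f" and [simp]: "tetra X'"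
      by (auto simp: s elim: HomE)
    note [simp] = f tetra_map_rules[OF f]
    show "Comp ?C (lunit ?T X') (tmor ?T (Id ?C (taut A)) F) = Comp ?C F (lunit ?T X)"
      unfolding s F tetra_mor.select_convs
      apply simp
      apply (rule compose_eqI)
      subgoal premises t for t by (rule int1_eqI[OF _ _ _ _ _ t, where P = X']) simp_all
      done
    show "Comp ?C (runit ?T X') (tmor ?T F (Id ?C (taut A))) = Comp ?C F (runit ?T X)"
      unfolding s F tetra_mor.select_convs
      apply simp
      apply (rule compose_eqI)
      subgoal premises t for t by (rule int1_eqI[OF _ _ _ _ _ t, where P = X']) simp_all
      done
    fix Y' G assume "Y' \<in> Ob ?C" "G \<in> Hom ?C Y Y'"
    then obtain g where G: "G = \<lparr>Dom = Y, Cod = Y', Map = g\<rparr>" and g: "tetra_map K A Y Y' g" and [simp]: "tetra Y'"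
      by (auto simp: s elim: HomE)
    note [simp] = g tetra_map_rules[OF g]
    show "tmor ?T F G \<in> Hom ?C (tobj ?T X Y) (tobj ?T X' Y')"
      by (simp add: s F G)
    { fix X'' F' assume "X'' \<in> Ob ?C" "F' \<in> Hom ?C X' X''"
      then obtain f' where F': "F' = \<lparr>Dom = X', Cod = X'', Map = f'\<rparr>" and f': "tetra_map K A X' X'' f'" and [simp]: "tetra X''"
        by (auto simp: s elim: HomE)
      fix Y'' G' assume "Y'' \<in> Ob ?C" "G' \<in> Hom ?C Y' Y''"
      then obtain g' where G': "G' = \<lparr>Dom = Y', Cod = Y'', Map = g'\<rparr>" and g': "tetra_map K A Y' Y'' g'" and [simp]: "tetra Y''"
        by (auto simp: s elim: HomE)
      note [simp] = f' g' tetra_map_rules[OF f'] tetra_map_rules[OF g']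
      have [simp]: "tetra_map K A X X'' (compose (carrier X) f' f)" "tetra_map K A Y Y'' (compose (carrier Y) g' g)"
        by (rule tetra_map_comp[of _ X'] tetra_map_comp[of _ Y']; simp)+
      show "tmor ?T (Comp ?C F' F) (Comp ?C G' G) = Comp ?C (tmor ?T F' G') (tmor ?T F G)"
        unfolding s F G F' G' tetra_mor.select_convs
        apply simp
        apply (rule compose_eqI'[symmetric, where N = "int1 K A X' Y'" and P = "int1 K A X'' Y''"]; simp?)
        subgoal premises t for t by (rule int1_eqI[OF _ _ _ _ _ t, where P = "int1 K A X'' Y''"]) (simp_all add: compose_eq)
        done
    }
    fix Z Z' H assume "Z \<in> Ob ?C" "Z' \<in> Ob ?C" "H \<in> Hom ?C Z Z'"
    then obtain h where H: "H = \<lparr>Dom = Z, Cod = Z', Map = h\<rparr>" and h: "tetra_map K A Z Z' h" and [simp]: "tetra Z" "tetra Z'"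
      by (auto simp: s elim: HomE)
    note [simp] = h tetra_map_rules[OF h]
    show "Comp ?C (assoc ?T X' Y' Z') (tmor ?T (tmor ?T F G) H) = Comp ?C (tmor ?T F (tmor ?T G H)) (assoc ?T X Y Z)"
      unfolding s F G H tetra_mor.select_convs
      apply simp
      apply (rule compose_eqI)
      subgoal premises t for t by (rule int1_eqI_left[OF _ _ _ _ _ _ t, where X = "int1 K A X' (int1 K A Y' Z')"]) simp_all
      done
  }
  fix Z assume "Z \<in> Ob ?C"
  then have [simp]: "tetra Z" by (simp add: s)
  show "assoc ?T X Y Z \<in> Iso ?C (tobj ?T (tobj ?T X Y) Z) (tobj ?T X (tobj ?T Y Z))"
    by (simp add: s assoc1_Iso)
  fix W assume "W \<in> Ob ?C"
  then have [simp]: "tetra W" by (simp add: s)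
  show "Comp ?C (assoc ?T W X (tobj ?T Y Z)) (assoc ?T (tobj ?T W X) Y Z) =
    Comp ?C (tmor ?T (Id ?C W) (assoc ?T X Y Z)) (Comp ?C (assoc ?T W (tobj ?T X Y) Z) (tmor ?T (assoc ?T W X Y) (Id ?C Z)))"
    unfolding s tetra_mor.select_convs
    apply simp
    apply (rule compose_eqI)
    apply (simp add: compose_eq)
    subgoal premises t for t
    \<comment> \<open>In a fourfold product this rule leaves the innermost factor \<open>s\<close>
      an arbitrary class in \<open>W \<otimes>\<^sub>1 X\<close>; one more reduction makes it the
      class of a pure tensor.\<close>
    proof (rule int1_eqI_left[OF _ _ _ _ _ _ t, where X = "int1 K A W (int1 K A X (int1 K A Y Z))"])
      fix s y z assume r: "s \<in> carrier (int1 K A W X)" and [simp]: "y \<in> carrier Y" "z \<in> carrier Z"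
      show "assoc1 W X (int1 K A Y Z) (assoc1 (int1 K A W X) Y Z (bal (int1 K A (int1 K A W X) Y) Z (bal (int1 K A W X) Y s y) z)) =
        tmap1 W (int1 K A (int1 K A X Y) Z) W (int1 K A X (int1 K A Y Z)) (restrict (\<lambda>x. x) (carrier W)) (assoc1 X Y Z)
          (assoc1 W (int1 K A X Y) Z (tmap1 (int1 K A (int1 K A W X) Y) Z (int1 K A W (int1 K A X Y)) Z
            (assoc1 W X Y) (restrict (\<lambda>x. x) (carrier Z)) (bal (int1 K A (int1 K A W X) Y) Z (bal (int1 K A W X) Y s y) z)))"
        by (rule int1_eqI[OF _ _ _ _ _ r, where P = "int1 K A W (int1 K A X (int1 K A Y Z))"]) simp_all
    qed simp_all
    done
qed

section \<open>The monoidal structure of \<open>\<otimes>\<^sub>2\<close>\<close>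

context
  fixes M N :: "('k, 'u) tetramodule"
  assumes M: "tetra M" and N: "tetra N"
begin

lemma linear_int2_from: "lin (M \<otimes>\<^sub>k N) P g \<Longrightarrow> lin (int2 K A M N) P g"
  by (auto simp: linear_map_def int2_ops int2_mem[OF M N])

lemma linear_int2_incl: "lin X (int2 K A M N) g \<Longrightarrow> lin X (M \<otimes>\<^sub>k N) g"
  by (auto simp: linear_map_def int2_ops Pi_iff int2_mem[OF M N])

text \<open>The coaction of \<open>M \<otimes>\<^sub>2 N\<close> is a lift of that of the external
  product, which concerns the first factor only. A summand linear on all of
  \<open>M \<otimes> N\<close> cannot tell the lift from its image, so the lift disappears from the
  computation.\<close>

lemma sweedler_int2_lcoact:
  assumes t: "t \<in> carrier (int2 K A M N)" and P: "module K P"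
    and g: "\<And>a. a \<in> carrier A \<Longrightarrow> lin (M \<otimes>\<^sub>k N) P (\<lambda>x. g a x)"
      "\<And>x. x \<in> carrier (M \<otimes>\<^sub>k N) \<Longrightarrow> lin A P (\<lambda>a. g a x)"
  shows "sw A (int2 K A M N) P (lcoact (int2 K A M N) t) g =
    sw M N P t (\<lambda>m n. sw A M P (lcoact M m) (\<lambda>a x. g a (tn M N x n)))"
proof -
  have "sw A (int2 K A M N) P (lcoact (int2 K A M N) t) g =
      sw A (M \<otimes>\<^sub>k N) P (sw A (int2 K A M N) (A \<otimes>\<^sub>k M \<otimes>\<^sub>k N) (lcoact (int2 K A M N) t) (tn A (M \<otimes>\<^sub>k N))) g"
    using M N P g int2_lcoact(1)[OF M N t] by (simp add: linear_int2_from linear_int2_incl int2_mem[OF M N] linear_map_comp[OF g(1)])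
  also have "\<dots> = sw A (M \<otimes>\<^sub>k N) P (lcoact (ext2 K A M N) t) g"
    using int2_lcoact(2)[OF M N t] by simp
  finally show ?thesis
    using M N P g int2_mem[OF M N t] by (simp add: ext2_ops linear_map_comp[OF g(1)])
qed

lemma sweedler_int2_rcoact:
  assumes t: "t \<in> carrier (int2 K A M N)" and P: "module K P"
    and g: "\<And>a. a \<in> carrier A \<Longrightarrow> lin (M \<otimes>\<^sub>k N) P (\<lambda>x. g x a)"
      "\<And>x. x \<in> carrier (M \<otimes>\<^sub>k N) \<Longrightarrow> lin A P (\<lambda>a. g x a)"
  shows "sw (int2 K A M N) A P (rcoact (int2 K A M N) t) g =
    sw M N P t (\<lambda>m n. sw N A P (rcoact N n) (\<lambda>y a. g (tn M N m y) a))"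
proof -
  have "sw (int2 K A M N) A P (rcoact (int2 K A M N) t) g =
      sw (M \<otimes>\<^sub>k N) A P (sw (int2 K A M N) A ((M \<otimes>\<^sub>k N) \<otimes>\<^sub>k A) (rcoact (int2 K A M N) t) (tn (M \<otimes>\<^sub>k N) A)) g"
    using M N P g int2_rcoact(1)[OF M N t] by (simp add: linear_int2_from linear_int2_incl int2_mem[OF M N] linear_map_comp[OF g(1)])
  also have "\<dots> = sw (M \<otimes>\<^sub>k N) A P (rcoact (ext2 K A M N) t) g"
    using int2_rcoact(2)[OF M N t] by simp
  finally show ?thesis
    using M N P g int2_mem[OF M N t] by (simp add: ext2_ops linear_map_comp[OF g(1)])
qed

end

definition tmap2 where
  "tmap2 M N M' N' f g = restrict (tmap K M N M' N' f g) (carrier (int2 K A M N))"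

definition assoc2 where
  "assoc2 M N P = restrict (\<lambda>t.
     inv_into (carrier (M \<otimes>\<^sub>k int2 K A N P)) (tmap K M (int2 K A N P) M (N \<otimes>\<^sub>k P) (\<lambda>x. x) (\<lambda>y. y))
       (tassoc K M N P (tmap K (int2 K A M N) P (M \<otimes>\<^sub>k N) P (\<lambda>x. x) (\<lambda>y. y) t)))
     (carrier (int2 K A (int2 K A M N) P))"

definition lunit2 where
  "lunit2 M = restrict (inv_into (carrier M) (lcoact M)) (carrier (int2 K A (taut A) M))"

definition runit2 where
  "runit2 M = restrict (inv_into (carrier M) (rcoact M)) (carrier (int2 K A M (taut A)))"

lemma tensor2_simps:
  "tobj (tensor2 K A) = int2 K A"
  "tmor (tensor2 K A) f g = \<lparr>Dom = int2 K A (Dom f) (Dom g), Cod = int2 K A (Cod f) (Cod g),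
     Map = tmap2 (Dom f) (Dom g) (Cod f) (Cod g) (Map f) (Map g)\<rparr>"
  "assoc (tensor2 K A) M N P = \<lparr>Dom = int2 K A (int2 K A M N) P, Cod = int2 K A M (int2 K A N P),
     Map = assoc2 M N P\<rparr>"
  "lunit (tensor2 K A) M = \<lparr>Dom = int2 K A (taut A) M, Cod = M, Map = lunit2 M\<rparr>"
  "runit (tensor2 K A) M = \<lparr>Dom = int2 K A M (taut A), Cod = M, Map = runit2 M\<rparr>"
  by (simp_all add: tensor2_def tmap2_def assoc2_def lunit2_def runit2_def)

context
  fixes M N M' N' :: "('k, 'u) tetramodule" and f g
  assumes M: "tetra M" and N: "tetra N" and M': "tetra M'" and N': "tetra N'"
    and f: "tetra_map K A M M' f" and g: "tetra_map K A N N' g"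
begin

lemma tetra_map_ext2:
  "tetra_map K A (ext2 K A M N) (ext2 K A M' N')
    (restrict (\<lambda>t. sw M N (M' \<otimes>\<^sub>k N') t (\<lambda>m n. tn M' N' (f m) (g n))) (carrier (ext2 K A M N)))"
proof (rule tetra_mapI)
  note [simp] = M N M' N' tetra_map_rules[OF f] tetra_map_rules[OF g]
  show "lin (ext2 K A M N) (ext2 K A M' N')
    (restrict (\<lambda>t. sw M N (M' \<otimes>\<^sub>k N') t (\<lambda>m n. tn M' N' (f m) (g n))) (carrier (ext2 K A M N)))"
    by (subst lin_restrict) simp_all
  show "restrict (\<lambda>t. sw M N (M' \<otimes>\<^sub>k N') t (\<lambda>m n. tn M' N' (f m) (g n))) (carrier (ext2 K A M N))
    \<in> extensional (carrier (ext2 K A M N))" by simp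
  fix t assume "t \<in> carrier (ext2 K A M N)"
  then have [simp]: "t \<in> carrier (M \<otimes>\<^sub>k N)" by simp
  let ?F = "restrict (\<lambda>t. sw M N (M' \<otimes>\<^sub>k N') t (\<lambda>m n. tn M' N' (f m) (g n))) (carrier (ext2 K A M N))"
  show "lcoact (ext2 K A M' N') (?F t) = sw A (ext2 K A M N) (A \<otimes>\<^sub>k ext2 K A M' N') (lcoact (ext2 K A M N) t)
      (\<lambda>a x. tn A (ext2 K A M' N') a (?F x))"
    by (simp add: ext2_ops)
  show "rcoact (ext2 K A M' N') (?F t) = sw (ext2 K A M N) A (ext2 K A M' N' \<otimes>\<^sub>k A) (rcoact (ext2 K A M N) t)
      (\<lambda>x a. tn (ext2 K A M' N') A (?F x) a)"
    by (simp add: ext2_ops)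
  fix a assume [simp]: "a \<in> carrier A"
  show "?F (lact (ext2 K A M N) a t) = lact (ext2 K A M' N') a (?F t)"
    "?F (ract (ext2 K A M N) t a) = ract (ext2 K A M' N') (?F t) a"
    by (simp_all add: ext2_ops)
qed

lemma tmap2_eq:
  "t \<in> carrier (int2 K A M N) \<Longrightarrow> tmap2 M N M' N' f g t = sw M N (M' \<otimes>\<^sub>k N') t (\<lambda>m n. tn M' N' (f m) (g n))"
  by (simp add: tmap2_def tmap_def)

text \<open>Morphisms commute with coactions, so the equaliser condition for the image is the
  balance of \<open>t\<close> with \<open>f\<close> and \<open>g\<close> applied to the
  summand.\<close>

lemma tmap2_closed: "t \<in> carrier (int2 K A M N) \<Longrightarrow> tmap2 M N M' N' f g t \<in> carrier (int2 K A M' N')"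
  unfolding int2_carrier[OF M' N'] mem_Collect_eq
  using M N M' N' by (simp add: tmap2_eq tetra_map_rules[OF f] tetra_map_rules[OF g] int2_mem[OF M N] int2_balanced[OF M N])

text \<open>Followed by the inclusion it is the restriction of a morphism of external products, and
  the inclusion is injective; hence it lifts.\<close>

lemma tetra_map_tmap2: "tetra_map K A (int2 K A M N) (int2 K A M' N') (tmap2 M N M' N' f g)"
proof (rule tetra_map_lift[OF _ _ _ tetra_map_int2_incl[OF M' N']])
  have "restrict (\<lambda>x. restrict (\<lambda>x. x) (carrier (int2 K A M' N')) (tmap2 M N M' N' f g x)) (carrier (int2 K A M N)) =
    compose (carrier (int2 K A M N)) (restrict (\<lambda>t. sw M N (M' \<otimes>\<^sub>k N') t (\<lambda>m n. tn M' N' (f m) (g n))) (carrier (ext2 K A M N)))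
      (restrict (\<lambda>x. x) (carrier (int2 K A M N)))"
    unfolding compose_def
    by (rule restrict_ext) (simp add: tmap2_closed int2_mem[OF M N], simp add: tmap2_eq)
  then show "tetra_map K A (int2 K A M N) (ext2 K A M' N')
      (restrict (\<lambda>x. restrict (\<lambda>x. x) (carrier (int2 K A M' N')) (tmap2 M N M' N' f g x)) (carrier (int2 K A M N)))"
    using tetra_map_comp[OF _ _ _ tetra_map_int2_incl[OF M N] tetra_map_ext2] M N M' N' by simp
qed (use M N M' N' tmap2_closed in \<open>simp_all add: inj_on_def\<close>, simp add: tmap2_def)

lemma sweedler_tmap2:
  assumes "t \<in> carrier (int2 K A M N)" "module K P"
    and "\<And>v. v \<in> carrier M' \<Longrightarrow> lin N' P (\<lambda>w. h v w)" "\<And>w. w \<in> carrier N' \<Longrightarrow> lin M' P (\<lambda>v. h v w)"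
  shows "sw M' N' P (tmap2 M N M' N' f g t) h = sw M N P t (\<lambda>m n. h (f m) (g n))"
  using assms M N M' N' by (simp add: tmap2_eq tetra_map_rules[OF f] tetra_map_rules[OF g] int2_mem[OF M N])

end

section \<open>The unit isomorphisms of \<open>\<otimes>\<^sub>2\<close>\<close>

context
  fixes M :: "('k, 'u) tetramodule"
  assumes M: "tetra M"
begin

text \<open>When one factor is \<open>A\<close>, the equaliser condition on a coaction is its
  coassociativity.\<close>

lemma lcoact_closed_int2: "m \<in> carrier M \<Longrightarrow> lcoact M m \<in> carrier (int2 K A (taut A) M)"
  and rcoact_closed_int2: "m \<in> carrier M \<Longrightarrow> rcoact M m \<in> carrier (int2 K A M (taut A))"
  unfolding int2_carrier[OF tetra_taut M] int2_carrier[OF M tetra_taut] mem_Collect_eq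
  using M by simp_all

text \<open>The inverse of the left coaction applies the counit to the leg in \<open>A\<close>. That
  it undoes the coaction is the counit law; the other composite needs the balance of
  \<open>t\<close>.\<close>

lemma lunit2_eq:
  assumes t: "t \<in> carrier (int2 K A (taut A) M)"
  shows "lunit2 M t = sw A M M t (\<lambda>a m. \<epsilon> a \<odot>\<^bsub>M\<^esub> m)" (is "_ = ?r")
    and "lcoact M (sw A M M t (\<lambda>a m. \<epsilon> a \<odot>\<^bsub>M\<^esub> m)) = t"
proof -
  have [simp]: "t \<in> carrier (A \<otimes>\<^sub>k M)" using int2_mem[OF tetra_taut M t] by simp
  note [simp] = M
  have l: "lin M (A \<otimes>\<^sub>k M) (lcoact M)" by simp
  have "lcoact M ?r = sw A M (A \<otimes>\<^sub>k M) t (\<lambda>a m. sw A M (A \<otimes>\<^sub>k M) (lcoact M m) (\<lambda>b x. \<epsilon> a \<odot>\<^bsub>A \<otimes>\<^sub>k M\<^esub> tn A M b x))"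
    by (simp add: linear_mapD(3)[OF l] sweedler_tens_id)
  \<comment> \<open>The balance of \<open>t\<close> moves the coaction from \<open>m\<close> to a
    coproduct of \<open>a\<close>, after which \<epsilon> meets the first leg of that coproduct and
    the counit law of \<open>A\<close> applies.\<close>
  also have "\<dots> = sw A M (A \<otimes>\<^sub>k M) t (\<lambda>a m. sw A A (A \<otimes>\<^sub>k M) (\<Delta> a) (\<lambda>b c. \<epsilon> b \<odot>\<^bsub>A \<otimes>\<^sub>k M\<^esub> tn A M c m))"
    by (rule int2_balanced[OF tetra_taut M t, where P = "A \<otimes>\<^sub>k M" and f = "\<lambda>b c m. \<epsilon> b \<odot>\<^bsub>A \<otimes>\<^sub>k M\<^esub> tn A M c m",
      unfolded taut_space taut_ops, symmetric]) simp_all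
  also have "\<dots> = t" by (simp add: sweedler_tens_id)
  finally show r: "lcoact M ?r = t" .
  have "inj_on (lcoact M) (carrier M)"
  proof (rule inj_on_inverseI[where g = "\<lambda>t. sw A M M t (\<lambda>a m. \<epsilon> a \<odot>\<^bsub>M\<^esub> m)"])
    fix m assume "m \<in> carrier M"
    then show "sw A M M (lcoact M m) (\<lambda>a m. \<epsilon> a \<odot>\<^bsub>M\<^esub> m) = m"
      using sweedler_counit_lcoact[OF M, of m M "\<lambda>x. x"] by simp
  qed
  then show "lunit2 M t = ?r"
    using t inv_into_f_f[of "lcoact M" "carrier M" ?r] r by (simp add: lunit2_def)
qed

lemma runit2_eq:
  assumes t: "t \<in> carrier (int2 K A M (taut A))"
  shows "runit2 M t = sw M A M t (\<lambda>m a. \<epsilon> a \<odot>\<^bsub>M\<^esub> m)" (is "_ = ?r")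
    and "rcoact M (sw M A M t (\<lambda>m a. \<epsilon> a \<odot>\<^bsub>M\<^esub> m)) = t"
proof -
  have [simp]: "t \<in> carrier (M \<otimes>\<^sub>k A)" using int2_mem[OF M tetra_taut t] by simp
  note [simp] = M
  have l: "lin M (M \<otimes>\<^sub>k A) (rcoact M)" by simp
  have "rcoact M ?r = sw M A (M \<otimes>\<^sub>k A) t (\<lambda>m a. sw M A (M \<otimes>\<^sub>k A) (rcoact M m) (\<lambda>x b. \<epsilon> a \<odot>\<^bsub>M \<otimes>\<^sub>k A\<^esub> tn M A x b))"
    by (simp add: linear_mapD(3)[OF l] sweedler_tens_id)
  also have "\<dots> = sw M A (M \<otimes>\<^sub>k A) t (\<lambda>m a. sw A A (M \<otimes>\<^sub>k A) (\<Delta> a) (\<lambda>b c. \<epsilon> c \<odot>\<^bsub>M \<otimes>\<^sub>k A\<^esub> tn M A m b))"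
    by (rule int2_balanced[OF M tetra_taut t, where P = "M \<otimes>\<^sub>k A" and f = "\<lambda>m b c. \<epsilon> c \<odot>\<^bsub>M \<otimes>\<^sub>k A\<^esub> tn M A m b",
      unfolded taut_space taut_ops]) simp_all
  also have "\<dots> = t" by (simp add: sweedler_tens_id)
  finally show r: "rcoact M ?r = t" .
  have "inj_on (rcoact M) (carrier M)"
  proof (rule inj_on_inverseI[where g = "\<lambda>t. sw M A M t (\<lambda>m a. \<epsilon> a \<odot>\<^bsub>M\<^esub> m)"])
    fix m assume "m \<in> carrier M"
    then show "sw M A M (rcoact M m) (\<lambda>m a. \<epsilon> a \<odot>\<^bsub>M\<^esub> m) = m"
      using sweedler_counit_rcoact[OF M, of m M "\<lambda>x. x"] by simp
  qed
  then show "runit2 M t = ?r"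
    using t inv_into_f_f[of "rcoact M" "carrier M" ?r] r by (simp add: runit2_def)
qed

lemma lunit2_props:
  "t \<in> carrier (int2 K A (taut A) M) \<Longrightarrow> lunit2 M t \<in> carrier M"
  "t \<in> carrier (int2 K A (taut A) M) \<Longrightarrow> lcoact M (lunit2 M t) = t"
  "m \<in> carrier M \<Longrightarrow> lunit2 M (lcoact M m) = m"
  using M int2_mem[OF tetra_taut M, of t] sweedler_counit_lcoact[OF M, of m M "\<lambda>x. x"] lunit2_eq(2)[of t]
  by (simp_all add: lunit2_eq(1) lcoact_closed_int2)

lemma runit2_props:
  "t \<in> carrier (int2 K A M (taut A)) \<Longrightarrow> runit2 M t \<in> carrier M"
  "t \<in> carrier (int2 K A M (taut A)) \<Longrightarrow> rcoact M (runit2 M t) = t"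
  "m \<in> carrier M \<Longrightarrow> runit2 M (rcoact M m) = m"
  using M int2_mem[OF M tetra_taut, of t] sweedler_counit_rcoact[OF M, of m M "\<lambda>x. x"] runit2_eq(2)[of t]
  by (simp_all add: runit2_eq(1) rcoact_closed_int2)

lemma tetra_map_lcoact: "tetra_map K A M (ext2 K A (taut A) M) (restrict (lcoact M) (carrier M))"
  and tetra_map_rcoact: "tetra_map K A M (ext2 K A M (taut A)) (restrict (rcoact M) (carrier M))"
  by (rule tetra_mapI; use M in \<open>simp add: ext2_ops lin_restrict\<close>)+

text \<open>Composed with the injective morphism given by the coaction of \<open>M\<close>, the map
  becomes the inclusion of the equaliser; hence it lifts.\<close>

lemma tetra_map_lunit2: "tetra_map K A (int2 K A (taut A) M) M (lunit2 M)"
proof (rule tetra_map_lift[OF _ M _ tetra_map_lcoact])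
  have "restrict (\<lambda>x. restrict (lcoact M) (carrier M) (lunit2 M x)) (carrier (int2 K A (taut A) M)) =
      restrict (\<lambda>x. x) (carrier (int2 K A (taut A) M))"
    by (rule restrict_ext) (simp add: lunit2_props)
  then show "tetra_map K A (int2 K A (taut A) M) (ext2 K A (taut A) M)
      (restrict (\<lambda>x. restrict (lcoact M) (carrier M) (lunit2 M x)) (carrier (int2 K A (taut A) M)))"
    using tetra_map_int2_incl[OF tetra_taut M] by simp
  show "inj_on (restrict (lcoact M) (carrier M)) (carrier M)"
    by (rule inj_on_inverseI[where g = "lunit2 M"]) (simp add: lunit2_props)
qed (use M lunit2_props in simp_all, simp add: lunit2_def)

lemma tetra_map_runit2: "tetra_map K A (int2 K A M (taut A)) M (runit2 M)"
proof (rule tetra_map_lift[OF _ M _ tetra_map_rcoact])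
  have "restrict (\<lambda>x. restrict (rcoact M) (carrier M) (runit2 M x)) (carrier (int2 K A M (taut A))) =
      restrict (\<lambda>x. x) (carrier (int2 K A M (taut A)))"
    by (rule restrict_ext) (simp add: runit2_props)
  then show "tetra_map K A (int2 K A M (taut A)) (ext2 K A M (taut A))
      (restrict (\<lambda>x. restrict (rcoact M) (carrier M) (runit2 M x)) (carrier (int2 K A M (taut A))))"
    using tetra_map_int2_incl[OF M tetra_taut] by simp
  show "inj_on (restrict (rcoact M) (carrier M)) (carrier M)"
    by (rule inj_on_inverseI[where g = "runit2 M"]) (simp add: runit2_props)
qed (use M runit2_props in simp_all, simp add: runit2_def)

lemma lunit2_Iso: "\<lparr>Dom = int2 K A (taut A) M, Cod = M, Map = lunit2 M\<rparr> \<in> Iso (Tetra K A) (int2 K A (taut A) M) M"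
proof (rule Iso_Tetra[OF _ _ tetra_map_lunit2])
  show "bij_betw (lunit2 M) (carrier (int2 K A (taut A) M)) (carrier M)"
    by (rule bij_betw_byWitness[where f' = "lcoact M"]) (auto simp: lunit2_props lcoact_closed_int2)
qed (use M in simp_all)

lemma runit2_Iso: "\<lparr>Dom = int2 K A M (taut A), Cod = M, Map = runit2 M\<rparr> \<in> Iso (Tetra K A) (int2 K A M (taut A)) M"
proof (rule Iso_Tetra[OF _ _ tetra_map_runit2])
  show "bij_betw (runit2 M) (carrier (int2 K A M (taut A))) (carrier M)"
    by (rule bij_betw_byWitness[where f' = "rcoact M"]) (auto simp: runit2_props rcoact_closed_int2)
qed (use M in simp_all)

end

lemma same_space_int2:
  assumes "tetra M" "tetra N"
  shows "same_space (int2 K A M N) ((M \<otimes>\<^sub>k N)\<lparr>carrier := {t \<in> carrier (M \<otimes>\<^sub>k N).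
    sw M N (M \<otimes>\<^sub>k A \<otimes>\<^sub>k N) t (\<lambda>m n. sw M A (M \<otimes>\<^sub>k A \<otimes>\<^sub>k N) (rcoact M m) (\<lambda>x a. tn M (A \<otimes>\<^sub>k N) x (tn A N a n))) =
    sw M N (M \<otimes>\<^sub>k A \<otimes>\<^sub>k N) t (\<lambda>m n. sw A N (M \<otimes>\<^sub>k A \<otimes>\<^sub>k N) (lcoact N n) (\<lambda>a y. tn M (A \<otimes>\<^sub>k N) m (tn A N a y)))}\<rparr>)"
  using assms by (simp add: same_space_def int2_ops int2_carrier)

lemma sweedler_int2_act:
  assumes M: "tetra M" and N: "tetra N" and t: "t \<in> carrier (int2 K A M N)" and a: "a \<in> carrier A" and P: "module K P"
    and h: "\<And>v. v \<in> carrier M \<Longrightarrow> lin N P (\<lambda>w. h v w)" "\<And>w. w \<in> carrier N \<Longrightarrow> lin M P (\<lambda>v. h v w)"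
  shows "sw M N P (lact (int2 K A M N) a t) h =
      sw A A P (\<Delta> a) (\<lambda>a1 a2. sw M N P t (\<lambda>m n. h (lact M a1 m) (lact N a2 n)))"
    and "sw M N P (ract (int2 K A M N) t a) h =
      sw A A P (\<Delta> a) (\<lambda>a1 a2. sw M N P t (\<lambda>m n. h (ract M m a1) (ract N n a2)))"
  using assms int2_mem[OF M N t] by (simp_all add: int2_ops ext2_ops)

lemmas int2_rules = linear_int2_from linear_int2_incl int2_mem sweedler_int2_lcoact sweedler_int2_rcoact
  int2_balanced

section \<open>The associativity isomorphism of \<open>\<otimes>\<^sub>2\<close>\<close>

context
  fixes M N P :: "('k, 'u) tetramodule"
  assumes M: "tetra M" and N: "tetra N" and P: "tetra P"
begin

text \<open>The embeddings of \<open>(M \<otimes>\<^sub>2 N) \<otimes>\<^sub>2 P\<close> and \<open>M \<otimes>\<^sub>2 (N \<otimes>\<^sub>2 P)\<close> into \<open>M \<otimes> N \<otimes> P\<close>.\<close>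

definition emb_left where
  "emb_left t = sw (int2 K A M N) P (M \<otimes>\<^sub>k N \<otimes>\<^sub>k P) t (\<lambda>s p.
    sw M N (M \<otimes>\<^sub>k N \<otimes>\<^sub>k P) s (\<lambda>m n. tn M (N \<otimes>\<^sub>k P) m (tn N P n p)))"

definition emb_right where
  "emb_right u = sw M (int2 K A N P) (M \<otimes>\<^sub>k N \<otimes>\<^sub>k P) u (tn M (N \<otimes>\<^sub>k P))"

text \<open>Changing the brackets back to \<open>(M \<otimes> N) \<otimes> P\<close> turns the
  embedding into the inclusion of \<open>M \<otimes>\<^sub>2 N\<close> tensored with
  \<open>P\<close>, which is injective over a field.\<close>

lemma emb_left_inj:
  assumes t: "t \<in> carrier (int2 K A M N \<otimes>\<^sub>k P)" and t': "t' \<in> carrier (int2 K A M N \<otimes>\<^sub>k P)"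
    and eq: "emb_left t = emb_left t'"
  shows "t = t'"
proof -
  note [simp] = M N P int2_rules t t'
  have "sw (int2 K A M N) P ((M \<otimes>\<^sub>k N) \<otimes>\<^sub>k P) t (tn (M \<otimes>\<^sub>k N) P) =
    sw M (N \<otimes>\<^sub>k P) ((M \<otimes>\<^sub>k N) \<otimes>\<^sub>k P) (emb_left t) (\<lambda>m s. sw N P ((M \<otimes>\<^sub>k N) \<otimes>\<^sub>k P) s (\<lambda>n p. tn (M \<otimes>\<^sub>k N) P (tn M N m n) p))"
    if [simp]: "t \<in> carrier (int2 K A M N \<otimes>\<^sub>k P)" for t
  proof -
    have "sw (int2 K A M N) P ((M \<otimes>\<^sub>k N) \<otimes>\<^sub>k P) t (tn (M \<otimes>\<^sub>k N) P) =
      sw (int2 K A M N) P ((M \<otimes>\<^sub>k N) \<otimes>\<^sub>k P) t (\<lambda>s p. tn (M \<otimes>\<^sub>k N) P (sw M N (M \<otimes>\<^sub>k N) s (tn M N)) p)"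
      by (rule sweedler_cong) (simp_all add: sweedler_tens_id del: tens_sweedler_left)
    then show ?thesis by (simp add: emb_left_def)
  qed
  then have *: "sw (int2 K A M N) P ((M \<otimes>\<^sub>k N) \<otimes>\<^sub>k P) t (tn (M \<otimes>\<^sub>k N) P) =
    sw (int2 K A M N) P ((M \<otimes>\<^sub>k N) \<otimes>\<^sub>k P) t' (tn (M \<otimes>\<^sub>k N) P)"
    using eq by simp
  show ?thesis
    by (rule tens_injD[where f = "\<lambda>x. x" and g = "\<lambda>x. x" and V = "int2 K A M N" and W = P and V' = "M \<otimes>\<^sub>k N" and W' = P])
      (simp_all add: inj_on_def *)
qed

lemma emb_right_inj:
  assumes "t \<in> carrier (M \<otimes>\<^sub>k int2 K A N P)" "t' \<in> carrier (M \<otimes>\<^sub>k int2 K A N P)" "emb_right t = emb_right t'"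
  shows "t = t'"
  by (rule tens_injD[where f = "\<lambda>x. x" and g = "\<lambda>x. x" and V = M and W = "int2 K A N P" and V' = M and W' = "N \<otimes>\<^sub>k P"])
    (use assms M N P in \<open>simp_all add: inj_on_def int2_rules emb_right_def\<close>)

text \<open>Both sides are the value of the linear extension of \<open>h\<close> at the common image
  of \<open>u\<close> and \<open>t\<close> in \<open>M \<otimes> N \<otimes> P\<close>.\<close>

lemma emb_transfer:
  assumes t: "t \<in> carrier (int2 K A M N \<otimes>\<^sub>k P)" and u: "u \<in> carrier (M \<otimes>\<^sub>k int2 K A N P)"
    and eq: "emb_right u = emb_left t" and X: "module K X"
    and h: "\<And>n p. n \<in> carrier N \<Longrightarrow> p \<in> carrier P \<Longrightarrow> lin M X (\<lambda>m. h m n p)"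
      "\<And>m p. m \<in> carrier M \<Longrightarrow> p \<in> carrier P \<Longrightarrow> lin N X (\<lambda>n. h m n p)"
      "\<And>m n. m \<in> carrier M \<Longrightarrow> n \<in> carrier N \<Longrightarrow> lin P X (\<lambda>p. h m n p)"
  shows "sw M (int2 K A N P) X u (\<lambda>m s. sw N P X s (\<lambda>n p. h m n p)) =
    sw (int2 K A M N) P X t (\<lambda>s p. sw M N X s (\<lambda>m n. h m n p))"
proof -
  have "sw M (N \<otimes>\<^sub>k P) X (emb_right u) (\<lambda>m s. sw N P X s (\<lambda>n p. h m n p)) =
    sw M (N \<otimes>\<^sub>k P) X (emb_left t) (\<lambda>m s. sw N P X s (\<lambda>n p. h m n p))"
    by (simp add: eq)
  then show ?thesis
    using assms(1,2) X h M N P by (simp add: int2_rules emb_right_def emb_left_def)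
qed

lemma emb_left_closed: "t \<in> carrier (int2 K A M N \<otimes>\<^sub>k P) \<Longrightarrow> emb_left t \<in> carrier (M \<otimes>\<^sub>k N \<otimes>\<^sub>k P)"
  and emb_right_closed: "u \<in> carrier (M \<otimes>\<^sub>k int2 K A N P) \<Longrightarrow> emb_right u \<in> carrier (M \<otimes>\<^sub>k N \<otimes>\<^sub>k P)"
  using M N P by (simp_all add: int2_rules emb_left_def emb_right_def)

lemma linear_emb_right: "lin (int2 K A M (int2 K A N P)) (M \<otimes>\<^sub>k N \<otimes>\<^sub>k P) emb_right"
  unfolding emb_right_def[abs_def] using M N P by (simp add: int2_rules(1-3))

text \<open>Two conditions separate a point of \<open>M \<otimes> (N \<otimes> P)\<close> from
  \<open>M \<otimes>\<^sub>2 (N \<otimes>\<^sub>2 P)\<close>: balance between \<open>N\<close> and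
  \<open>P\<close>, and balance between \<open>M\<close> and the rest. The outer balance of
  \<open>t\<close> supplies the first, the inner one the second.\<close>

lemma emb_left_image:
  assumes t: "t \<in> carrier (int2 K A (int2 K A M N) P)"
  shows "\<exists>u \<in> carrier (int2 K A M (int2 K A N P)). emb_right u = emb_left t"
proof -
  note [simp] = M N P int2_rules(1-5) t
  have t' [simp]: "t \<in> carrier (int2 K A M N \<otimes>\<^sub>k P)" by simp
  let ?W = "N \<otimes>\<^sub>k A \<otimes>\<^sub>k P"
  let ?Q = "M \<otimes>\<^sub>k ?W"
  let ?f = "\<lambda>t. sw N P ?W t (\<lambda>m n. sw N A ?W (rcoact N m) (\<lambda>x a. tn N (A \<otimes>\<^sub>k P) x (tn A P a n)))"
  let ?g = "\<lambda>t. sw N P ?W t (\<lambda>m n. sw A P ?W (lcoact P n) (\<lambda>a y. tn N (A \<otimes>\<^sub>k P) m (tn A P a y)))"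
  \<comment> \<open>First condition: \<open>N \<otimes>\<^sub>2 P\<close> is an equaliser and stays
    one after tensoring with \<open>M\<close>, so the image of \<open>t\<close> comes from some
    \<open>u\<close> in \<open>M \<otimes> (N \<otimes>\<^sub>2 P)\<close>.\<close>
  have "\<exists>u \<in> carrier (M \<otimes>\<^sub>k int2 K A N P). sw M (int2 K A N P) (M \<otimes>\<^sub>k N \<otimes>\<^sub>k P) u (tn M (N \<otimes>\<^sub>k P)) = emb_left t"
  proof (rule tensor_equaliser(1))
    show "same_space (int2 K A N P) ((N \<otimes>\<^sub>k P)\<lparr>carrier := {t \<in> carrier (N \<otimes>\<^sub>k P). ?f t = ?g t}\<rparr>)"
      by (rule same_space_int2) simp_all
    have "sw M (N \<otimes>\<^sub>k P) ?Q (emb_left t) (\<lambda>m s. tn M ?W m (?f s)) =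
      sw (int2 K A M N) P ?Q t (\<lambda>s p. sw (int2 K A M N) A ?Q (rcoact (int2 K A M N) s) (\<lambda>s a.
        sw M N ?Q s (\<lambda>m n. tn M ?W m (tn N (A \<otimes>\<^sub>k P) n (tn A P a p)))))"
      by (simp add: emb_left_def)
    \<comment> \<open>The right coaction of \<open>M \<otimes>\<^sub>2 N\<close> concerns
      \<open>n\<close> only, so the outer balance of \<open>t\<close> is a statement about
      \<open>n\<close> and \<open>p\<close>.\<close>
    also have "\<dots> = sw (int2 K A M N) P ?Q t (\<lambda>s p. sw A P ?Q (lcoact P p) (\<lambda>a p.
        sw M N ?Q s (\<lambda>m n. tn M ?W m (tn N (A \<otimes>\<^sub>k P) n (tn A P a p)))))"
      by (rule int2_balanced[OF _ P t]) simp_all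
    also have "\<dots> = sw (int2 K A M N) P ?Q t (\<lambda>s p. sw M N ?Q s (\<lambda>m n. sw A P ?Q (lcoact P p) (\<lambda>a p.
        tn M ?W m (tn N (A \<otimes>\<^sub>k P) n (tn A P a p)))))"
      by (rule sweedler_cong[OF refl refl refl refl], rule sweedler_swap) simp_all
    also have "\<dots> = sw M (N \<otimes>\<^sub>k P) ?Q (emb_left t) (\<lambda>m s. tn M ?W m (?g s))"
      by (simp add: emb_left_def)
    finally show "sw M (N \<otimes>\<^sub>k P) ?Q (emb_left t) (\<lambda>m s. tn M ?W m (?f s)) =
      sw M (N \<otimes>\<^sub>k P) ?Q (emb_left t) (\<lambda>m s. tn M ?W m (?g s))" .
  qed (simp_all add: emb_left_closed)
  then obtain u where u [simp]: "u \<in> carrier (M \<otimes>\<^sub>k int2 K A N P)" and eq: "emb_right u = emb_left t"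
    by (auto simp: emb_right_def)
  let ?S = "int2 K A N P"
  let ?T = "M \<otimes>\<^sub>k A \<otimes>\<^sub>k N \<otimes>\<^sub>k P"
  \<comment> \<open>Second condition: \<open>?l\<close> and \<open>?r\<close> are the two sides of
    the balance of \<open>u\<close>. They are compared in
    \<open>M \<otimes> A \<otimes> N \<otimes> P\<close>, into which their space embeds.\<close>
  let ?l = "sw M ?S (M \<otimes>\<^sub>k A \<otimes>\<^sub>k ?S) u (\<lambda>m n. sw M A (M \<otimes>\<^sub>k A \<otimes>\<^sub>k ?S) (rcoact M m) (\<lambda>x a. tn M (A \<otimes>\<^sub>k ?S) x (tn A ?S a n)))"
  let ?r = "sw M ?S (M \<otimes>\<^sub>k A \<otimes>\<^sub>k ?S) u (\<lambda>m n. sw A ?S (M \<otimes>\<^sub>k A \<otimes>\<^sub>k ?S) (lcoact ?S n) (\<lambda>a y. tn M (A \<otimes>\<^sub>k ?S) m (tn A ?S a y)))"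
  let ?j = "\<lambda>y. sw A ?S (A \<otimes>\<^sub>k N \<otimes>\<^sub>k P) y (tn A (N \<otimes>\<^sub>k P))"
  have inj: "inj_on ?j (carrier (A \<otimes>\<^sub>k ?S))"
  proof (rule inj_onI)
    fix x y assume "x \<in> carrier (A \<otimes>\<^sub>k ?S)" "y \<in> carrier (A \<otimes>\<^sub>k ?S)" "?j x = ?j y"
    note * = this
    show "x = y"
      by (rule tens_injD[where f = "\<lambda>x. x" and g = "\<lambda>x. x" and V = A and W = ?S and V' = A and W' = "N \<otimes>\<^sub>k P"])
        (simp_all add: inj_on_def *)
  qed
  note tr = emb_transfer[OF t' u eq]
  have "sw M (A \<otimes>\<^sub>k ?S) ?T ?l (\<lambda>m y. tn M (A \<otimes>\<^sub>k N \<otimes>\<^sub>k P) m (?j y)) =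
      sw M ?S ?T u (\<lambda>m s. sw M A ?T (rcoact M m) (\<lambda>x a. tn M (A \<otimes>\<^sub>k N \<otimes>\<^sub>k P) x (tn A (N \<otimes>\<^sub>k P) a (sw N P (N \<otimes>\<^sub>k P) s (tn N P)))))"
    by (simp add: sweedler_tens_id del: tens_sweedler_left tens_sweedler_right)
  also have "\<dots> = sw M ?S ?T u (\<lambda>m s. sw M A ?T (rcoact M m) (\<lambda>x a. sw N P ?T s (\<lambda>n p. tn M (A \<otimes>\<^sub>k N \<otimes>\<^sub>k P) x (tn A (N \<otimes>\<^sub>k P) a (tn N P n p)))))"
    by simp
  also have "\<dots> = sw M ?S ?T u (\<lambda>m s. sw N P ?T s (\<lambda>n p. sw M A ?T (rcoact M m) (\<lambda>x a. tn M (A \<otimes>\<^sub>k N \<otimes>\<^sub>k P) x (tn A (N \<otimes>\<^sub>k P) a (tn N P n p)))))"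
    by (rule sweedler_cong[OF refl refl refl refl], rule sweedler_swap) simp_all
  \<comment> \<open>Passing from \<open>u\<close> to \<open>t\<close> makes the inner sum run over
    points of \<open>M \<otimes>\<^sub>2 N\<close>, and these are balanced between \<open>m\<close>
    and \<open>n\<close>; afterwards the same passage leads back to \<open>u\<close>.\<close>
  also have "\<dots> = sw (int2 K A M N) P ?T t (\<lambda>s p. sw M N ?T s (\<lambda>m n. sw M A ?T (rcoact M m) (\<lambda>x a. tn M (A \<otimes>\<^sub>k N \<otimes>\<^sub>k P) x (tn A (N \<otimes>\<^sub>k P) a (tn N P n p)))))"
    by (rule tr) simp_all
  also have "\<dots> = sw (int2 K A M N) P ?T t (\<lambda>s p. sw M N ?T s (\<lambda>m n. sw A N ?T (lcoact N n) (\<lambda>a y. tn M (A \<otimes>\<^sub>k N \<otimes>\<^sub>k P) m (tn A (N \<otimes>\<^sub>k P) a (tn N P y p)))))"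
    by (rule sweedler_cong[OF refl refl refl refl], rule int2_balanced[OF M N]) simp_all
  also have "\<dots> = sw M ?S ?T u (\<lambda>m s. sw N P ?T s (\<lambda>n p. sw A N ?T (lcoact N n) (\<lambda>a y. tn M (A \<otimes>\<^sub>k N \<otimes>\<^sub>k P) m (tn A (N \<otimes>\<^sub>k P) a (tn N P y p)))))"
    by (rule tr[symmetric]) simp_all
  also have "\<dots> = sw M (A \<otimes>\<^sub>k ?S) ?T ?r (\<lambda>m y. tn M (A \<otimes>\<^sub>k N \<otimes>\<^sub>k P) m (?j y))"
    by (simp add: int2_lcoact)
  finally have *: "sw M (A \<otimes>\<^sub>k ?S) ?T ?l (\<lambda>m y. tn M (A \<otimes>\<^sub>k N \<otimes>\<^sub>k P) m (?j y)) =
      sw M (A \<otimes>\<^sub>k ?S) ?T ?r (\<lambda>m y. tn M (A \<otimes>\<^sub>k N \<otimes>\<^sub>k P) m (?j y))" .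
  have "?l = ?r"
    by (rule tens_injD[where f = "\<lambda>x. x" and g = ?j and V = M and W = "A \<otimes>\<^sub>k ?S" and V' = M and W' = "A \<otimes>\<^sub>k N \<otimes>\<^sub>k P"])
      (simp_all only: * inj, simp_all add: inj_on_def)
  then have "u \<in> carrier (int2 K A M ?S)"
    unfolding int2_carrier[OF M tetra_int2[OF N P]] by simp
  then show ?thesis using eq by blast
qed

text \<open>The mirror image: the outer balance of \<open>u\<close> places it in the first equaliser
  tensored with \<open>P\<close>, and the balance of the points of
  \<open>N \<otimes>\<^sub>2 P\<close> yields the remaining condition.\<close>

lemma emb_right_image:
  assumes u: "u \<in> carrier (int2 K A M (int2 K A N P))"
  shows "\<exists>t \<in> carrier (int2 K A (int2 K A M N) P). emb_left t = emb_right u"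
proof -
  note [simp] = M N P int2_rules(1-5) u
  have u' [simp]: "u \<in> carrier (M \<otimes>\<^sub>k int2 K A N P)" by simp
  let ?W = "M \<otimes>\<^sub>k A \<otimes>\<^sub>k N"
  let ?Q = "?W \<otimes>\<^sub>k P"
  let ?f = "\<lambda>t. sw M N ?W t (\<lambda>m n. sw M A ?W (rcoact M m) (\<lambda>x a. tn M (A \<otimes>\<^sub>k N) x (tn A N a n)))"
  let ?g = "\<lambda>t. sw M N ?W t (\<lambda>m n. sw A N ?W (lcoact N n) (\<lambda>a y. tn M (A \<otimes>\<^sub>k N) m (tn A N a y)))"
  \<comment> \<open>The point \<open>u\<close> with brackets moved to the left, because
    \<open>(M \<otimes>\<^sub>2 N) \<otimes> P\<close> sits inside
    \<open>(M \<otimes> N) \<otimes> P\<close>.\<close>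
  let ?w = "sw M (int2 K A N P) ((M \<otimes>\<^sub>k N) \<otimes>\<^sub>k P) u (\<lambda>m s. sw N P ((M \<otimes>\<^sub>k N) \<otimes>\<^sub>k P) s (\<lambda>n p. tn (M \<otimes>\<^sub>k N) P (tn M N m n) p))"
  have "\<exists>t \<in> carrier (int2 K A M N \<otimes>\<^sub>k P). sw (int2 K A M N) P ((M \<otimes>\<^sub>k N) \<otimes>\<^sub>k P) t (tn (M \<otimes>\<^sub>k N) P) = ?w"
  proof (rule tensor_equaliser(2))
    show "same_space (int2 K A M N) ((M \<otimes>\<^sub>k N)\<lparr>carrier := {t \<in> carrier (M \<otimes>\<^sub>k N). ?f t = ?g t}\<rparr>)"
      by (rule same_space_int2) simp_all
    have "sw (M \<otimes>\<^sub>k N) P ?Q ?w (\<lambda>s p. tn ?W P (?f s) p) =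
      sw M (int2 K A N P) ?Q u (\<lambda>m s. sw N P ?Q s (\<lambda>n p. sw M A ?Q (rcoact M m) (\<lambda>x a.
        tn ?W P (tn M (A \<otimes>\<^sub>k N) x (tn A N a n)) p)))"
      by simp
    also have "\<dots> = sw M (int2 K A N P) ?Q u (\<lambda>m s. sw M A ?Q (rcoact M m) (\<lambda>x a. sw N P ?Q s (\<lambda>n p.
        tn ?W P (tn M (A \<otimes>\<^sub>k N) x (tn A N a n)) p)))"
      by (rule sweedler_cong[OF refl refl refl refl], rule sweedler_swap) simp_all
    also have "\<dots> = sw M (int2 K A N P) ?Q u (\<lambda>m s. sw A (int2 K A N P) ?Q (lcoact (int2 K A N P) s) (\<lambda>a s.
        sw N P ?Q s (\<lambda>n p. tn ?W P (tn M (A \<otimes>\<^sub>k N) m (tn A N a n)) p)))"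
      by (rule int2_balanced[OF M _ u]) simp_all
    also have "\<dots> = sw (M \<otimes>\<^sub>k N) P ?Q ?w (\<lambda>s p. tn ?W P (?g s) p)"
      by simp
    finally show "sw (M \<otimes>\<^sub>k N) P ?Q ?w (\<lambda>s p. tn ?W P (?f s) p) =
      sw (M \<otimes>\<^sub>k N) P ?Q ?w (\<lambda>s p. tn ?W P (?g s) p)" .
  qed simp_all
  then obtain t where t [simp]: "t \<in> carrier (int2 K A M N \<otimes>\<^sub>k P)"
    and w: "sw (int2 K A M N) P ((M \<otimes>\<^sub>k N) \<otimes>\<^sub>k P) t (tn (M \<otimes>\<^sub>k N) P) = ?w" by blast
  have "emb_left t = sw M (int2 K A N P) (M \<otimes>\<^sub>k N \<otimes>\<^sub>k P) u (\<lambda>m s. sw N P (M \<otimes>\<^sub>k N \<otimes>\<^sub>k P) s (\<lambda>n p. tn M (N \<otimes>\<^sub>k P) m (tn N P n p)))"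
    using arg_cong[OF w, of "\<lambda>w. sw (M \<otimes>\<^sub>k N) P (M \<otimes>\<^sub>k N \<otimes>\<^sub>k P) w (\<lambda>s p. sw M N (M \<otimes>\<^sub>k N \<otimes>\<^sub>k P) s (\<lambda>m n. tn M (N \<otimes>\<^sub>k P) m (tn N P n p)))"]
    by (simp add: emb_left_def)
  also have "\<dots> = sw M (int2 K A N P) (M \<otimes>\<^sub>k N \<otimes>\<^sub>k P) u (\<lambda>m s. tn M (N \<otimes>\<^sub>k P) m (sw N P (N \<otimes>\<^sub>k P) s (tn N P)))"
    by simp
  also have "\<dots> = emb_right u"
    by (simp add: sweedler_tens_id emb_right_def del: tens_sweedler_left tens_sweedler_right)
  finally have eq: "emb_left t = emb_right u" .
  let ?S = "int2 K A M N"
  let ?T = "(M \<otimes>\<^sub>k N) \<otimes>\<^sub>k A \<otimes>\<^sub>k P"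
  let ?l = "sw ?S P (?S \<otimes>\<^sub>k A \<otimes>\<^sub>k P) t (\<lambda>m n. sw ?S A (?S \<otimes>\<^sub>k A \<otimes>\<^sub>k P) (rcoact ?S m) (\<lambda>x a. tn ?S (A \<otimes>\<^sub>k P) x (tn A P a n)))"
  let ?r = "sw ?S P (?S \<otimes>\<^sub>k A \<otimes>\<^sub>k P) t (\<lambda>m n. sw A P (?S \<otimes>\<^sub>k A \<otimes>\<^sub>k P) (lcoact P n) (\<lambda>a y. tn ?S (A \<otimes>\<^sub>k P) m (tn A P a y)))"
  note tr = emb_transfer[OF t u' eq[symmetric]]
  have "sw ?S (A \<otimes>\<^sub>k P) ?T ?l (tn (M \<otimes>\<^sub>k N) (A \<otimes>\<^sub>k P)) =
      sw ?S P ?T t (\<lambda>s p. sw M N ?T s (\<lambda>m n. sw N A ?T (rcoact N n) (\<lambda>y a. tn (M \<otimes>\<^sub>k N) (A \<otimes>\<^sub>k P) (tn M N m y) (tn A P a p))))"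
    by simp
  also have "\<dots> = sw M (int2 K A N P) ?T u (\<lambda>m s. sw N P ?T s (\<lambda>n p. sw N A ?T (rcoact N n) (\<lambda>y a. tn (M \<otimes>\<^sub>k N) (A \<otimes>\<^sub>k P) (tn M N m y) (tn A P a p))))"
    by (rule tr[symmetric]) simp_all
  also have "\<dots> = sw M (int2 K A N P) ?T u (\<lambda>m s. sw N P ?T s (\<lambda>n p. sw A P ?T (lcoact P p) (\<lambda>a q. tn (M \<otimes>\<^sub>k N) (A \<otimes>\<^sub>k P) (tn M N m n) (tn A P a q))))"
    by (rule sweedler_cong[OF refl refl refl refl], rule int2_balanced[OF N P]) simp_all
  also have "\<dots> = sw ?S P ?T t (\<lambda>s p. sw M N ?T s (\<lambda>m n. sw A P ?T (lcoact P p) (\<lambda>a q. tn (M \<otimes>\<^sub>k N) (A \<otimes>\<^sub>k P) (tn M N m n) (tn A P a q))))"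
    by (rule tr) simp_all
  also have "\<dots> = sw ?S P ?T t (\<lambda>s p. sw A P ?T (lcoact P p) (\<lambda>a q. sw M N ?T s (\<lambda>m n. tn (M \<otimes>\<^sub>k N) (A \<otimes>\<^sub>k P) (tn M N m n) (tn A P a q))))"
    by (rule sweedler_cong[OF refl refl refl refl], rule sweedler_swap) simp_all
  also have "\<dots> = sw ?S P ?T t (\<lambda>s p. sw A P ?T (lcoact P p) (\<lambda>a q. tn (M \<otimes>\<^sub>k N) (A \<otimes>\<^sub>k P) (sw M N (M \<otimes>\<^sub>k N) s (tn M N)) (tn A P a q)))"
    by simp
  also have "\<dots> = sw ?S (A \<otimes>\<^sub>k P) ?T ?r (tn (M \<otimes>\<^sub>k N) (A \<otimes>\<^sub>k P))"
    by (simp add: sweedler_tens_id del: tens_sweedler_left tens_sweedler_right)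
  finally have *: "sw ?S (A \<otimes>\<^sub>k P) ?T ?l (tn (M \<otimes>\<^sub>k N) (A \<otimes>\<^sub>k P)) =
      sw ?S (A \<otimes>\<^sub>k P) ?T ?r (tn (M \<otimes>\<^sub>k N) (A \<otimes>\<^sub>k P))" .
  have "?l = ?r"
    by (rule tens_injD[where f = "\<lambda>x. x" and g = "\<lambda>x. x" and V = ?S and W = "A \<otimes>\<^sub>k P" and V' = "M \<otimes>\<^sub>k N" and W' = "A \<otimes>\<^sub>k P"])
      (simp_all only: *, simp_all add: inj_on_def)
  then have "t \<in> carrier (int2 K A ?S P)"
    unfolding int2_carrier[OF tetra_int2[OF M N] P] by simp
  then show ?thesis using eq by blast
qed

text \<open>The iterated external product is the tetramodule with space
  \<open>M \<otimes> N \<otimes> P\<close> that serves as the common target in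
  \<open>Iso_factor\<close>.\<close>

lemma tetra_map_emb_left: "tetra_map K A (int2 K A (int2 K A M N) P) (ext2 K A M (ext2 K A N P))
    (restrict emb_left (carrier (int2 K A (int2 K A M N) P)))"
proof (rule tetra_mapI)
  let ?S = "int2 K A M N" and ?E = "ext2 K A M (ext2 K A N P)"
  let ?X = "int2 K A ?S P"
  note [simp] = M N P int2_rules(1-5) emb_left_closed
  note l = int2_ops(4,5)[of ?S P]
  have "lin ?X (M \<otimes>\<^sub>k N \<otimes>\<^sub>k P) emb_left"
    unfolding emb_left_def[abs_def] by simp
  then show "lin ?X ?E (restrict emb_left (carrier ?X))"
    by (simp add: lin_restrict)
  fix t assume t [simp]: "t \<in> carrier ?X"
  show "lcoact ?E (restrict emb_left (carrier ?X) t) =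
      sw A ?X (A \<otimes>\<^sub>k ?E) (lcoact ?X t) (\<lambda>a x. tn A ?E a (restrict emb_left (carrier ?X) x))"
    by (simp add: emb_left_def ext2_ops)
  have "rcoact ?E (emb_left t) = sw ?X A (?E \<otimes>\<^sub>k A) (rcoact ?X t) (\<lambda>x a. tn ?E A (emb_left x) a)"
    unfolding ext2_ops emb_left_def
    by (simp, rule sweedler_cong[OF refl refl refl refl], rule sweedler_swap[symmetric]) simp_all
  then show "rcoact ?E (restrict emb_left (carrier ?X) t) =
      sw ?X A (?E \<otimes>\<^sub>k A) (rcoact ?X t) (\<lambda>x a. tn ?E A (restrict emb_left (carrier ?X) x) a)"
    by simp
  fix a assume a [simp]: "a \<in> carrier A"
  have "emb_left (lact (ext2 K A ?S P) a t) = lact ?E a (emb_left t)"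
    "emb_left (ract (ext2 K A ?S P) t a) = ract ?E (emb_left t) a"
    unfolding emb_left_def ext2_ops(1,2)[of ?S P] ext2_ops(1,2)[of M "ext2 K A N P"] ext2_ops(1,2)[of N P]
    by (simp_all add: sweedler_int2_act[OF M N] swap_comult_out[OF M N] swap_comult_out[OF tetra_int2[OF M N] P])
  then show "restrict emb_left (carrier ?X) (lact ?X a t) = lact ?E a (restrict emb_left (carrier ?X) t)"
    "restrict emb_left (carrier ?X) (ract ?X t a) = ract ?E (restrict emb_left (carrier ?X) t) a"
    using int2_act_closed[OF tetra_int2[OF M N] P t a] by (simp_all add: l)
qed simp

lemma tetra_map_emb_right: "tetra_map K A (int2 K A M (int2 K A N P)) (ext2 K A M (ext2 K A N P))
    (restrict emb_right (carrier (int2 K A M (int2 K A N P))))"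
proof (rule tetra_mapI)
  let ?S = "int2 K A N P" and ?E = "ext2 K A M (ext2 K A N P)"
  let ?X = "int2 K A M ?S"
  note [simp] = M N P int2_rules(1-5) emb_right_closed
  note l = int2_ops(4,5)[of M ?S]
  show "lin ?X ?E (restrict emb_right (carrier ?X))"
    using linear_emb_right by (simp add: lin_restrict)
  fix t assume t [simp]: "t \<in> carrier ?X"
  show "lcoact ?E (restrict emb_right (carrier ?X) t) =
      sw A ?X (A \<otimes>\<^sub>k ?E) (lcoact ?X t) (\<lambda>a x. tn A ?E a (restrict emb_right (carrier ?X) x))"
    by (simp add: emb_right_def ext2_ops)
  show "rcoact ?E (restrict emb_right (carrier ?X) t) =
      sw ?X A (?E \<otimes>\<^sub>k A) (rcoact ?X t) (\<lambda>x a. tn ?E A (restrict emb_right (carrier ?X) x) a)"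
    by (simp add: emb_right_def ext2_ops)
  fix a assume a [simp]: "a \<in> carrier A"
  have "emb_right (lact (ext2 K A M ?S) a t) = lact ?E a (emb_right t)"
    "emb_right (ract (ext2 K A M ?S) t a) = ract ?E (emb_right t) a"
    unfolding emb_right_def ext2_ops(1,2)[of M ?S] ext2_ops(1,2)[of M "ext2 K A N P"] int2_ops(4,5)[of N P, symmetric]
    by (simp_all, simp_all add: int2_ops ext2_ops)
  then show "restrict emb_right (carrier ?X) (lact ?X a t) = lact ?E a (restrict emb_right (carrier ?X) t)"
    "restrict emb_right (carrier ?X) (ract ?X t a) = ract ?E (restrict emb_right (carrier ?X) t) a"
    using int2_act_closed[OF M tetra_int2[OF N P] t a] by (simp_all add: l)
qed simp

text \<open>The definition inverts the inclusion on all of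
  \<open>M \<otimes> (N \<otimes>\<^sub>2 P)\<close>. The preimage is unique there and lies in the
  smaller \<open>M \<otimes>\<^sub>2 (N \<otimes>\<^sub>2 P)\<close>, so inverting on the latter
  gives the same point, in the form required by \<open>Iso_factor\<close>.\<close>

lemma assoc2_eq: "assoc2 M N P = restrict (\<lambda>t. inv_into (carrier (int2 K A M (int2 K A N P)))
    (restrict emb_right (carrier (int2 K A M (int2 K A N P)))) (restrict emb_left (carrier (int2 K A (int2 K A M N) P)) t))
    (carrier (int2 K A (int2 K A M N) P))"
  unfolding assoc2_def
proof (rule restrict_ext)
  let ?Y = "int2 K A M (int2 K A N P)"
  fix t assume t: "t \<in> carrier (int2 K A (int2 K A M N) P)"
  note [simp] = M N P int2_rules(1-5)
  have 1: "tassoc K M N P (tmap K (int2 K A M N) P (M \<otimes>\<^sub>k N) P (\<lambda>x. x) (\<lambda>y. y) t) = emb_left t"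
    using t by (simp add: tassoc_def tmap_def emb_left_def)
  have 2: "tmap K M (int2 K A N P) M (N \<otimes>\<^sub>k P) (\<lambda>x. x) (\<lambda>y. y) = emb_right"
    by (simp add: tmap_def[abs_def] emb_right_def[abs_def])
  obtain u where u: "u \<in> carrier ?Y" "emb_right u = emb_left t"
    using emb_left_image[OF t] by blast
  have "inv_into (carrier (M \<otimes>\<^sub>k int2 K A N P)) emb_right (emb_left t) = u"
    by (rule inv_into_f_eq) (use u emb_right_inj in \<open>auto simp: inj_on_def\<close>)
  moreover have "inv_into (carrier ?Y) (restrict emb_right (carrier ?Y)) (emb_left t) = u"
    by (rule inv_into_f_eq) (use u emb_right_inj in \<open>auto simp: inj_on_def\<close>)
  ultimately show "inv_into (carrier (M \<otimes>\<^sub>k int2 K A N P)) (tmap K M (int2 K A N P) M (N \<otimes>\<^sub>k P) (\<lambda>x. x) (\<lambda>y. y))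
      (tassoc K M N P (tmap K (int2 K A M N) P (M \<otimes>\<^sub>k N) P (\<lambda>x. x) (\<lambda>y. y) t)) =
    inv_into (carrier ?Y) (restrict emb_right (carrier ?Y)) (restrict emb_left (carrier (int2 K A (int2 K A M N) P)) t)"
    using t unfolding 1 2 by simp
qed

lemma assoc2_Iso: "\<lparr>Dom = int2 K A (int2 K A M N) P, Cod = int2 K A M (int2 K A N P), Map = assoc2 M N P\<rparr>
    \<in> Iso (Tetra K A) (int2 K A (int2 K A M N) P) (int2 K A M (int2 K A N P))"
  and tetra_map_assoc2: "tetra_map K A (int2 K A (int2 K A M N) P) (int2 K A M (int2 K A N P)) (assoc2 M N P)"
  and emb_right_assoc2: "t \<in> carrier (int2 K A (int2 K A M N) P) \<Longrightarrow> emb_right (assoc2 M N P t) = emb_left t"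
proof -
  let ?X = "int2 K A (int2 K A M N) P" and ?Y = "int2 K A M (int2 K A N P)"
  have tX: "tetra ?X" and tY: "tetra ?Y" and tE: "tetra (ext2 K A M (ext2 K A N P))"
    using M N P by simp_all
  have memX: "t \<in> carrier ?X \<Longrightarrow> t \<in> carrier (int2 K A M N \<otimes>\<^sub>k P)"
    and memY: "t \<in> carrier ?Y \<Longrightarrow> t \<in> carrier (M \<otimes>\<^sub>k int2 K A N P)" for t
    using M N P by (simp_all add: int2_mem)
  have injX: "inj_on (restrict emb_left (carrier ?X)) (carrier ?X)"
    by (rule inj_onI) (use emb_left_inj memX in simp)
  have injY: "inj_on (restrict emb_right (carrier ?Y)) (carrier ?Y)"
    by (rule inj_onI) (use emb_right_inj memY in simp)
  have im: "restrict emb_left (carrier ?X) ` carrier ?X = restrict emb_right (carrier ?Y) ` carrier ?Y"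
    using emb_left_image emb_right_image by (auto simp: image_iff) metis+
  show "\<lparr>Dom = ?X, Cod = ?Y, Map = assoc2 M N P\<rparr> \<in> Iso (Tetra K A) ?X ?Y"
    unfolding assoc2_eq by (rule Iso_factor[OF tX tY tE tetra_map_emb_left injX tetra_map_emb_right injY im])
  note f = tetra_map_factor[OF tX tY tE tetra_map_emb_left tetra_map_emb_right injY equalityD1[OF im]]
  show "tetra_map K A ?X ?Y (assoc2 M N P)"
    unfolding assoc2_eq by (rule f(1))
  show "emb_right (assoc2 M N P t) = emb_left t" if t: "t \<in> carrier ?X" for t
    using f(2,3)[OF t] t unfolding assoc2_eq[symmetric] by simp
qed

text \<open>The working form of the isomorphism: under any trilinear summand it only regroups an
  iterated sum. The coherence laws are derived from this without returning to
  \<open>inv_into\<close>.\<close>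

lemma sweedler_assoc2:
  assumes t: "t \<in> carrier (int2 K A (int2 K A M N) P)" and X: "module K X"
    and h: "\<And>n p. n \<in> carrier N \<Longrightarrow> p \<in> carrier P \<Longrightarrow> lin M X (\<lambda>m. h m n p)"
      "\<And>m p. m \<in> carrier M \<Longrightarrow> p \<in> carrier P \<Longrightarrow> lin N X (\<lambda>n. h m n p)"
      "\<And>m n. m \<in> carrier M \<Longrightarrow> n \<in> carrier N \<Longrightarrow> lin P X (\<lambda>p. h m n p)"
  shows "sw M (int2 K A N P) X (assoc2 M N P t) (\<lambda>m s. sw N P X s (\<lambda>n p. h m n p)) =
    sw (int2 K A M N) P X t (\<lambda>s p. sw M N X s (\<lambda>m n. h m n p))"
proof (rule emb_transfer[OF _ _ emb_right_assoc2[OF t] X])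
  show "t \<in> carrier (int2 K A M N \<otimes>\<^sub>k P)" "assoc2 M N P t \<in> carrier (M \<otimes>\<^sub>k int2 K A N P)"
    using t tetra_map_simps(3)[OF tetra_map_assoc2 t] M N P by (simp_all add: int2_mem)
qed (use h in simp_all)

end

lemma tens_counit:
  assumes "module K V" "module K W" "v \<in> carrier V" "w \<in> carrier W" "a \<in> carrier A"
  shows "tn V W v (\<epsilon> a \<odot>\<^bsub>W\<^esub> w) = \<epsilon> a \<odot>\<^bsub>V \<otimes>\<^sub>k W\<^esub> tn V W v w"
    and "tn V W (\<epsilon> a \<odot>\<^bsub>V\<^esub> v) w = \<epsilon> a \<odot>\<^bsub>V \<otimes>\<^sub>k W\<^esub> tn V W v w"
  using assms by (simp_all add: linear_mapD(3)[OF bilinear_mapD(1)[OF tens_bilinear]]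
    linear_mapD(3)[OF bilinear_mapD(2)[OF tens_bilinear]])

lemma emb_right_expand:
  assumes "tetra M" "tetra N" "tetra P" "u \<in> carrier (M \<otimes>\<^sub>k int2 K A N P)"
  shows "emb_right M N P u = sw M (int2 K A N P) (M \<otimes>\<^sub>k N \<otimes>\<^sub>k P) u (\<lambda>m s.
    sw N P (M \<otimes>\<^sub>k N \<otimes>\<^sub>k P) s (\<lambda>n p. tn M (N \<otimes>\<^sub>k P) m (tn N P n p)))"
proof -
  note [simp] = assms int2_rules(1-3)
  have "emb_right M N P u = sw M (int2 K A N P) (M \<otimes>\<^sub>k N \<otimes>\<^sub>k P) u (\<lambda>m s.
    tn M (N \<otimes>\<^sub>k P) m (sw N P (N \<otimes>\<^sub>k P) s (tn N P)))"
    by (simp add: sweedler_tens_id emb_right_def del: tens_sweedler_left tens_sweedler_right)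
  then show ?thesis by simp
qed

lemma int2_right_eqI:
  assumes "tetra M" "tetra N" "tetra P" "u \<in> carrier (int2 K A M (int2 K A N P))" "v \<in> carrier (int2 K A M (int2 K A N P))"
    and "sw M (int2 K A N P) (M \<otimes>\<^sub>k N \<otimes>\<^sub>k P) u (\<lambda>m s. sw N P (M \<otimes>\<^sub>k N \<otimes>\<^sub>k P) s (\<lambda>n p. tn M (N \<otimes>\<^sub>k P) m (tn N P n p))) =
      sw M (int2 K A N P) (M \<otimes>\<^sub>k N \<otimes>\<^sub>k P) v (\<lambda>m s. sw N P (M \<otimes>\<^sub>k N \<otimes>\<^sub>k P) s (\<lambda>n p. tn M (N \<otimes>\<^sub>k P) m (tn N P n p)))"
  shows "u = v"
  by (rule emb_right_inj[OF assms(1-3)]) (use assms in \<open>simp_all add: emb_right_expand int2_mem\<close>)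

text \<open>For the pentagon: the embedding of the inner triple product, tensored with
  \<open>W\<close>, is injective, so points of the fourfold product are determined by their image in
  the fourfold tensor product.\<close>

lemma int2_right4_eqI:
  assumes t: "tetra W" "tetra X" "tetra Y" "tetra Z"
    and u: "u \<in> carrier (int2 K A W (int2 K A X (int2 K A Y Z)))"
    and v: "v \<in> carrier (int2 K A W (int2 K A X (int2 K A Y Z)))"
  defines "D \<equiv> W \<otimes>\<^sub>k X \<otimes>\<^sub>k Y \<otimes>\<^sub>k Z"
  defines "k \<equiv> \<lambda>w x y z. tn W (X \<otimes>\<^sub>k Y \<otimes>\<^sub>k Z) w (tn X (Y \<otimes>\<^sub>k Z) x (tn Y Z y z))"
  assumes eq: "sw W (int2 K A X (int2 K A Y Z)) D u (\<lambda>w s. sw X (int2 K A Y Z) D s (\<lambda>x r. sw Y Z D r (\<lambda>y z. k w x y z))) =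
      sw W (int2 K A X (int2 K A Y Z)) D v (\<lambda>w s. sw X (int2 K A Y Z) D s (\<lambda>x r. sw Y Z D r (\<lambda>y z. k w x y z)))"
  shows "u = v"
proof -
  let ?S = "int2 K A X (int2 K A Y Z)"
  note [simp] = t int2_rules(1-3) u v emb_right_closed
  have lin: "lin ?S (X \<otimes>\<^sub>k Y \<otimes>\<^sub>k Z) (emb_right X Y Z)"
    by (rule linear_emb_right) simp_all
  have J: "sw W ?S D u (\<lambda>w s. tn W (X \<otimes>\<^sub>k Y \<otimes>\<^sub>k Z) w (emb_right X Y Z s)) =
      sw W ?S D u (\<lambda>w s. sw X (int2 K A Y Z) D s (\<lambda>x r. sw Y Z D r (\<lambda>y z. k w x y z)))"
    if [simp]: "u \<in> carrier (int2 K A W ?S)" for u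
    unfolding k_def D_def by (rule sweedler_cong) (simp_all add: emb_right_expand)
  show ?thesis
    by (rule tens_injD[where f = "\<lambda>x. x" and g = "emb_right X Y Z" and V = W and W = ?S and V' = W and W' = "X \<otimes>\<^sub>k Y \<otimes>\<^sub>k Z"])
      (use J eq emb_right_inj[OF t(2-4)] in \<open>simp_all add: inj_on_def lin D_def\<close>)
qed

lemmas tensor2_maps = tetra_map_tmap2 tetra_map_assoc2 tetra_map_lunit2 tetra_map_runit2

lemmas tensor2_rules = tensor2_maps sweedler_tmap2 sweedler_assoc2 lunit2_eq(1) runit2_eq(1)
  tetra_map_id tetra_map_id[OF tetra_taut, unfolded taut_space(1)]
  sweedler_tmap2[OF tetra_taut _ tetra_taut, unfolded taut_space]
  sweedler_tmap2[OF _ tetra_taut _ tetra_taut, unfolded taut_space]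
  sweedler_assoc2[OF _ tetra_taut, unfolded taut_space]
  opaque_tetra_map[OF tetra_map_tmap2] opaque_tetra_map[OF tetra_map_assoc2]
  opaque_tetra_map[OF tetra_map_lunit2] opaque_tetra_map[OF tetra_map_runit2]
  linear_int2_from linear_int2_incl int2_mem

text \<open>As a space \<open>taut A\<close> is rewritten to \<open>A\<close>, and the membership
  and linearity rules are restated in the form that results.\<close>

lemma int2_mem_taut:
  assumes "tetra M"
  shows "t \<in> carrier (int2 K A (taut A) M) \<Longrightarrow> t \<in> carrier (A \<otimes>\<^sub>k M)"
    and "t \<in> carrier (int2 K A M (taut A)) \<Longrightarrow> t \<in> carrier (M \<otimes>\<^sub>k A)"
    and "lin (A \<otimes>\<^sub>k M) P g \<Longrightarrow> lin (int2 K A (taut A) M) P g"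
    and "lin (M \<otimes>\<^sub>k A) P g \<Longrightarrow> lin (int2 K A M (taut A)) P g"
    and "lin X (int2 K A (taut A) M) g \<Longrightarrow> lin X (A \<otimes>\<^sub>k M) g"
    and "lin X (int2 K A M (taut A)) g \<Longrightarrow> lin X (M \<otimes>\<^sub>k A) g"
  using int2_mem[OF tetra_taut assms] int2_mem[OF assms tetra_taut]
    linear_int2_from[OF tetra_taut assms] linear_int2_from[OF assms tetra_taut]
    linear_int2_incl[OF tetra_taut assms] linear_int2_incl[OF assms tetra_taut] by simp_all

lemma monoidal_Tetra2: "monoidal_category (Tetra K A) (taut A) (tensor2 K A)"
proof (intro monoidal_category.intro category_Tetra monoidal_category_axioms.intro)
  let ?C = "Tetra K A" and ?T = "tensor2 K A"
  note s = tensor2_simps Tetra_simps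
  note [simp] = tensor2_rules int2_mem_taut
  show "taut A \<in> Ob ?C" by (simp add: s)
  fix X Y assume "X \<in> Ob ?C" "Y \<in> Ob ?C"
  then have [simp]: "tetra X" "tetra Y" by (simp_all add: s)
  show "tobj ?T X Y \<in> Ob ?C" by (simp add: s)
  show "lunit ?T X \<in> Iso ?C (tobj ?T (taut A) X) X" "runit ?T X \<in> Iso ?C (tobj ?T X (taut A)) X"
    by (simp_all add: s lunit2_Iso runit2_Iso)
  show "tmor ?T (Id ?C X) (Id ?C Y) = Id ?C (tobj ?T X Y)"
    unfolding s tetra_mor.select_convs
    apply simp
    apply (rule tetra_map_eqI[where M = "int2 K A X Y" and N = "int2 K A X Y"])
    apply (simp_all add: tmap2_eq sweedler_tens_id)
    done
  show "Comp ?C (tmor ?T (Id ?C X) (lunit ?T Y)) (assoc ?T X (taut A) Y) = tmor ?T (runit ?T X) (Id ?C Y)"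
    unfolding s tetra_mor.select_convs
    apply simp
    apply (rule compose_eqI'[where N = "int2 K A X (int2 K A (taut A) Y)" and P = "int2 K A X Y"]; simp?)
    \<comment> \<open>Both sides of the triangle are the sum of the multiples of
      \<open>x \<otimes> y\<close> by \<epsilon> of the middle leg; one attaches the scalar to
      \<open>y\<close>, the other to \<open>x\<close>.\<close>
    apply (simp add: tmap2_eq tens_counit)
    done
  {
    fix X' F assume "X' \<in> Ob ?C" "F \<in> Hom ?C X X'"
    then obtain f where F: "F = \<lparr>Dom = X, Cod = X', Map = f\<rparr>" and f: "tetra_map K A X X' f" and [simp]: "tetra X'"
      by (auto simp: s elim: HomE)
    have lf: "f (\<epsilon> a \<odot>\<^bsub>X\<^esub> x) = \<epsilon> a \<odot>\<^bsub>X'\<^esub> f x" if "a \<in> carrier A" "x \<in> carrier X" for a x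
      using linear_mapD(3)[OF tetra_map_linear[OF f]] that by simp
    note [simp] = f tetra_map_rules[OF f]
    show "Comp ?C (lunit ?T X') (tmor ?T (Id ?C (taut A)) F) = Comp ?C F (lunit ?T X)"
      unfolding s F tetra_mor.select_convs
      apply simp
      apply (rule compose_eqI)
      apply (simp add: lf)
      done
    show "Comp ?C (runit ?T X') (tmor ?T F (Id ?C (taut A))) = Comp ?C F (runit ?T X)"
      unfolding s F tetra_mor.select_convs
      apply simp
      apply (rule compose_eqI)
      apply (simp add: lf)
      done
    fix Y' G assume "Y' \<in> Ob ?C" "G \<in> Hom ?C Y Y'"
    then obtain g where G: "G = \<lparr>Dom = Y, Cod = Y', Map = g\<rparr>" and g: "tetra_map K A Y Y' g" and [simp]: "tetra Y'"
      by (auto simp: s elim: HomE)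
    note [simp] = g tetra_map_rules[OF g]
    show "tmor ?T F G \<in> Hom ?C (tobj ?T X Y) (tobj ?T X' Y')"
      by (simp add: s F G)
    { fix X'' F' assume "X'' \<in> Ob ?C" "F' \<in> Hom ?C X' X''"
      then obtain f' where F': "F' = \<lparr>Dom = X', Cod = X'', Map = f'\<rparr>" and f': "tetra_map K A X' X'' f'" and [simp]: "tetra X''"
        by (auto simp: s elim: HomE)
      fix Y'' G' assume "Y'' \<in> Ob ?C" "G' \<in> Hom ?C Y' Y''"
      then obtain g' where G': "G' = \<lparr>Dom = Y', Cod = Y'', Map = g'\<rparr>" and g': "tetra_map K A Y' Y'' g'" and [simp]: "tetra Y''"
        by (auto simp: s elim: HomE)
      note [simp] = f' g' tetra_map_rules[OF f'] tetra_map_rules[OF g']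
      have [simp]: "tetra_map K A X X'' (compose (carrier X) f' f)" "tetra_map K A Y Y'' (compose (carrier Y) g' g)"
        by (rule tetra_map_comp[of _ X'] tetra_map_comp[of _ Y']; simp)+
      show "tmor ?T (Comp ?C F' F) (Comp ?C G' G) = Comp ?C (tmor ?T F' G') (tmor ?T F G)"
        unfolding s F G F' G' tetra_mor.select_convs
        apply simp
        apply (rule compose_eqI'[symmetric, where N = "int2 K A X' Y'" and P = "int2 K A X'' Y''"]; simp?)
        apply (simp add: tmap2_eq[of X' Y' X'' Y''] tmap2_eq[of X Y X'' Y''] compose_eq)
        done
    }
    fix Z Z' H assume "Z \<in> Ob ?C" "Z' \<in> Ob ?C" "H \<in> Hom ?C Z Z'"
    then obtain h where H: "H = \<lparr>Dom = Z, Cod = Z', Map = h\<rparr>" and h: "tetra_map K A Z Z' h" and [simp]: "tetra Z" "tetra Z'"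
      by (auto simp: s elim: HomE)
    note [simp] = h tetra_map_rules[OF h]
    show "Comp ?C (assoc ?T X' Y' Z') (tmor ?T (tmor ?T F G) H) = Comp ?C (tmor ?T F (tmor ?T G H)) (assoc ?T X Y Z)"
      unfolding s F G H tetra_mor.select_convs
      apply simp
      apply (rule compose_eqI)
      apply (rule int2_right_eqI[of X' Y' Z']; simp)
      done
  }
  fix Z assume "Z \<in> Ob ?C"
  then have [simp]: "tetra Z" by (simp add: s)
  show "assoc ?T X Y Z \<in> Iso ?C (tobj ?T (tobj ?T X Y) Z) (tobj ?T X (tobj ?T Y Z))"
    by (simp add: s assoc2_Iso)
  fix W assume "W \<in> Ob ?C"
  then have [simp]: "tetra W" by (simp add: s)
  let ?Q = "W \<otimes>\<^sub>k X \<otimes>\<^sub>k Y \<otimes>\<^sub>k Z"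
  \<comment> \<open>One path of the pentagon passes through an object with two bracketed pairs; the
    sums over these pairs are independent and arise in the two possible orders.\<close>
  have swap: "sw (int2 K A W X) (int2 K A Y Z) ?Q t (\<lambda>s r. sw W X ?Q s (\<lambda>w x. sw Y Z ?Q r (\<lambda>y z.
        tn W (X \<otimes>\<^sub>k Y \<otimes>\<^sub>k Z) w (tn X (Y \<otimes>\<^sub>k Z) x (tn Y Z y z))))) =
    sw (int2 K A W X) (int2 K A Y Z) ?Q t (\<lambda>s r. sw Y Z ?Q r (\<lambda>y z. sw W X ?Q s (\<lambda>w x.
        tn W (X \<otimes>\<^sub>k Y \<otimes>\<^sub>k Z) w (tn X (Y \<otimes>\<^sub>k Z) x (tn Y Z y z)))))" for t
    by (rule sweedler_cong[OF refl refl refl refl], rule sweedler_swap) simp_all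
  show "Comp ?C (assoc ?T W X (tobj ?T Y Z)) (assoc ?T (tobj ?T W X) Y Z) =
    Comp ?C (tmor ?T (Id ?C W) (assoc ?T X Y Z)) (Comp ?C (assoc ?T W (tobj ?T X Y) Z) (tmor ?T (assoc ?T W X Y) (Id ?C Z)))"
    unfolding s tetra_mor.select_convs
    apply simp
    apply (rule compose_eqI)
    apply (simp add: compose_eq)
    apply (rule int2_right4_eqI[of W X Y Z]; simp add: swap)
    done
qed

section \<open>The interchange map \<open>\<eta>\<close>\<close>

text \<open>A formula for \<eta> that does not pass through the external products;
  \<open>eta_eq\<close> identifies it with the defined map.\<close>

definition eta_map where
  "eta_map M N P Q = (let D = int1 K A M P \<otimes>\<^sub>k int1 K A N Q in
     restrict (\<lambda>t. sw (int2 K A M N) (int2 K A P Q) D t (\<lambda>s r.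
       sw M N D s (\<lambda>m n. sw P Q D r (\<lambda>p q. tn (int1 K A M P) (int1 K A N Q) (bal M P m p) (bal N Q n q)))))
     (carrier (int1 K A (int2 K A M N) (int2 K A P Q))))"

context
  fixes M N P Q :: "('k, 'u) tetramodule"
  assumes t: "tetra M" "tetra N" "tetra P" "tetra Q"
begin

abbreviation (input) "etaD \<equiv> int1 K A M P \<otimes>\<^sub>k int1 K A N Q"
abbreviation (input) "etaF s r \<equiv>
  sw M N etaD s (\<lambda>m n. sw P Q etaD r (\<lambda>p q. tn (int1 K A M P) (int1 K A N Q) (bal M P m p) (bal N Q n q)))"

text \<open>Both actions are diagonal: the two legs of the coproduct of \<open>a\<close> cross
  separately, one from \<open>m\<close> to \<open>p\<close> and one from \<open>n\<close> to
  \<open>q\<close>, each by the balance of its own \<open>\<otimes>\<^sub>1\<close>.\<close>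

lemma eta_balanced:
  assumes "s \<in> carrier (int2 K A M N)" "r \<in> carrier (int2 K A P Q)" "a \<in> carrier A"
  shows "etaF (ract (int2 K A M N) s a) r = etaF s (lact (int2 K A P Q) a r)"
  using assms t by (simp add: sweedler_int2_act swap_comult_out int2_mem)

lemma eta_map_linear: "lin (int1 K A (int2 K A M N) (int2 K A P Q)) etaD (eta_map M N P Q)"
proof -
  note [simp] = t eta_balanced int2_rules(1-3)
  show ?thesis
    unfolding eta_map_def Let_def by (subst lin_restrict) simp_all
qed

lemma eta_map_bal:
  "s \<in> carrier (int2 K A M N) \<Longrightarrow> r \<in> carrier (int2 K A P Q) \<Longrightarrow>
    eta_map M N P Q (bal (int2 K A M N) (int2 K A P Q) s r) = etaF s r"
  using t by (simp add: eta_map_def Let_def eta_balanced int2_rules(1-3))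

text \<open>In the coaction of a class in \<open>\<otimes>\<^sub>1\<close> the leg in
  \<open>A\<close> is a product of one leg from \<open>s\<close> and one from \<open>r\<close>. The
  balance of \<open>r\<close> moves the second leg to the other side, then that of \<open>s\<close>
  moves the first; exchanges before and after bring each coaction next to the sum to which it
  belongs.\<close>

lemma eta_bal_closed:
  assumes s: "s \<in> carrier (int2 K A M N)" and r: "r \<in> carrier (int2 K A P Q)"
  shows "etaF s r \<in> carrier (int2 K A (int1 K A M P) (int1 K A N Q))"
proof -
  let ?C = "int1 K A M P" and ?D = "int1 K A N Q"
  let ?W = "?C \<otimes>\<^sub>k A \<otimes>\<^sub>k ?D"
  note [simp] = t int2_mem[OF t(1,2) s] int2_mem[OF t(3,4) r]
  have "sw ?C ?D ?W (etaF s r) (\<lambda>m n. sw ?C A ?W (rcoact ?C m) (\<lambda>x a. tn ?C (A \<otimes>\<^sub>k ?D) x (tn A ?D a n))) =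
    sw M N ?W s (\<lambda>m n. sw P Q ?W r (\<lambda>p q. sw M A ?W (rcoact M m) (\<lambda>m a. sw P A ?W (rcoact P p) (\<lambda>p b.
      tn ?C (A \<otimes>\<^sub>k ?D) (bal M P m p) (tn A ?D (a \<cdot>\<^sub>A b) (bal N Q n q))))))"
    by simp
  also have "\<dots> = sw M N ?W s (\<lambda>m n. sw M A ?W (rcoact M m) (\<lambda>m a. sw P Q ?W r (\<lambda>p q. sw P A ?W (rcoact P p) (\<lambda>p b.
      tn ?C (A \<otimes>\<^sub>k ?D) (bal M P m p) (tn A ?D (a \<cdot>\<^sub>A b) (bal N Q n q))))))"
    by (rule sweedler_cong[OF refl refl refl refl], rule sweedler_swap) simp_all
  also have "\<dots> = sw M N ?W s (\<lambda>m n. sw M A ?W (rcoact M m) (\<lambda>m a. sw P Q ?W r (\<lambda>p q. sw A Q ?W (lcoact Q q) (\<lambda>b q.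
      tn ?C (A \<otimes>\<^sub>k ?D) (bal M P m p) (tn A ?D (a \<cdot>\<^sub>A b) (bal N Q n q))))))"
    by (rule sweedler_cong[OF refl refl refl refl], rule sweedler_cong[OF refl refl refl refl], rule int2_balanced[OF t(3,4) r]) simp_all
  also have "\<dots> = sw M N ?W s (\<lambda>m n. sw A N ?W (lcoact N n) (\<lambda>a n. sw P Q ?W r (\<lambda>p q. sw A Q ?W (lcoact Q q) (\<lambda>b q.
      tn ?C (A \<otimes>\<^sub>k ?D) (bal M P m p) (tn A ?D (a \<cdot>\<^sub>A b) (bal N Q n q))))))"
    by (rule int2_balanced[OF t(1,2) s]) simp_all
  also have "\<dots> = sw M N ?W s (\<lambda>m n. sw P Q ?W r (\<lambda>p q. sw A N ?W (lcoact N n) (\<lambda>a n. sw A Q ?W (lcoact Q q) (\<lambda>b q.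
      tn ?C (A \<otimes>\<^sub>k ?D) (bal M P m p) (tn A ?D (a \<cdot>\<^sub>A b) (bal N Q n q))))))"
    by (rule sweedler_cong[OF refl refl refl refl], rule sweedler_swap) simp_all
  also have "\<dots> = sw ?C ?D ?W (etaF s r) (\<lambda>m n. sw A ?D ?W (lcoact ?D n) (\<lambda>a y. tn ?C (A \<otimes>\<^sub>k ?D) m (tn A ?D a y)))"
    by simp
  finally show ?thesis
    unfolding int2_carrier[OF tetra_int1[OF t(1,3)] tetra_int1[OF t(2,4)]] by simp
qed

lemma eta_map_closed:
  assumes x: "x \<in> carrier (int1 K A (int2 K A M N) (int2 K A P Q))"
  shows "eta_map M N P Q x \<in> carrier (int2 K A (int1 K A M P) (int1 K A N Q))"
proof -
  let ?C = "int1 K A M P" and ?D = "int1 K A N Q"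
  let ?W = "?C \<otimes>\<^sub>k A \<otimes>\<^sub>k ?D"
  note [simp] = t eta_map_linear linear_map_comp[OF eta_map_linear] linear_mapD(1)[OF eta_map_linear]
  have "sw ?C ?D ?W (eta_map M N P Q x) (\<lambda>m n. sw ?C A ?W (rcoact ?C m) (\<lambda>x a. tn ?C (A \<otimes>\<^sub>k ?D) x (tn A ?D a n))) =
    sw ?C ?D ?W (eta_map M N P Q x) (\<lambda>m n. sw A ?D ?W (lcoact ?D n) (\<lambda>a y. tn ?C (A \<otimes>\<^sub>k ?D) m (tn A ?D a y)))"
  proof (rule int1_eqI[OF _ _ _ _ _ x, where P = ?W])
    fix s r assume sr: "s \<in> carrier (int2 K A M N)" "r \<in> carrier (int2 K A P Q)"
    show "sw ?C ?D ?W (eta_map M N P Q (bal (int2 K A M N) (int2 K A P Q) s r)) (\<lambda>m n. sw ?C A ?W (rcoact ?C m) (\<lambda>x a. tn ?C (A \<otimes>\<^sub>k ?D) x (tn A ?D a n))) =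
      sw ?C ?D ?W (eta_map M N P Q (bal (int2 K A M N) (int2 K A P Q) s r)) (\<lambda>m n. sw A ?D ?W (lcoact ?D n) (\<lambda>a y. tn ?C (A \<otimes>\<^sub>k ?D) m (tn A ?D a y)))"
      using eta_bal_closed[OF sr] unfolding eta_map_bal[OF sr] int2_carrier[OF tetra_int1[OF t(1,3)] tetra_int1[OF t(2,4)]] by blast
  qed simp_all
  then show ?thesis
    unfolding int2_carrier[OF tetra_int1[OF t(1,3)] tetra_int1[OF t(2,4)]] using x by simp
qed

text \<open>Verified first in the external product, whose operations are explicit sums; the closure
  result then allows a lift into the equaliser.\<close>

lemma tetra_map_eta_ext2:
  "tetra_map K A (int1 K A (int2 K A M N) (int2 K A P Q)) (ext2 K A (int1 K A M P) (int1 K A N Q)) (eta_map M N P Q)"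
proof (rule tetra_map_int1I)
  let ?S = "int2 K A M N" and ?R = "int2 K A P Q" and ?E = "ext2 K A (int1 K A M P) (int1 K A N Q)"
  note [simp] = t eta_map_bal
  show "tetra ?S" "tetra ?R" "tetra ?E" by simp_all
  show "lin (int1 K A ?S ?R) ?E (eta_map M N P Q)" using eta_map_linear by simp
  show "eta_map M N P Q \<in> extensional (carrier (int1 K A ?S ?R))" by (simp add: eta_map_def Let_def)
  fix s r assume s [simp]: "s \<in> carrier ?S" and r [simp]: "r \<in> carrier ?R"
  note [simp] = int2_rules(1-5)
  show "lcoact ?E (eta_map M N P Q (bal ?S ?R s r)) = sw A ?S (A \<otimes>\<^sub>k ?E) (lcoact ?S s) (\<lambda>a x.
      sw A ?R (A \<otimes>\<^sub>k ?E) (lcoact ?R r) (\<lambda>b y. tn A ?E (a \<cdot>\<^sub>A b) (eta_map M N P Q (bal ?S ?R x y))))"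
    by (simp add: ext2_ops, rule sweedler_cong[OF refl refl refl refl], rule sweedler_swap) simp_all
  show "rcoact ?E (eta_map M N P Q (bal ?S ?R s r)) = sw ?S A (?E \<otimes>\<^sub>k A) (rcoact ?S s) (\<lambda>x a.
      sw ?R A (?E \<otimes>\<^sub>k A) (rcoact ?R r) (\<lambda>y b. tn ?E A (eta_map M N P Q (bal ?S ?R x y)) (a \<cdot>\<^sub>A b)))"
    by (simp add: ext2_ops, rule sweedler_cong[OF refl refl refl refl], rule sweedler_swap) simp_all
  fix a assume [simp]: "a \<in> carrier A"
  show "eta_map M N P Q (bal ?S ?R (lact ?S a s) r) = lact ?E a (eta_map M N P Q (bal ?S ?R s r))"
    "eta_map M N P Q (bal ?S ?R s (ract ?R r a)) = ract ?E (eta_map M N P Q (bal ?S ?R s r)) a"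
    by (simp_all add: sweedler_int2_act swap_comult_out[OF t(1,2)] ext2_ops(1,2)[of "int1 K A M P" "int1 K A N Q"])
qed

lemma tetra_map_eta: "tetra_map K A (int1 K A (int2 K A M N) (int2 K A P Q)) (int2 K A (int1 K A M P) (int1 K A N Q)) (eta_map M N P Q)"
proof (rule tetra_map_lift[OF _ _ _ tetra_map_int2_incl])
  let ?i = "restrict (\<lambda>x. x) (carrier (int2 K A (int1 K A M P) (int1 K A N Q)))"
  have "restrict (\<lambda>x. ?i (eta_map M N P Q x)) (carrier (int1 K A (int2 K A M N) (int2 K A P Q))) = eta_map M N P Q"
    by (rule extensionalityI[of _ "carrier (int1 K A (int2 K A M N) (int2 K A P Q))"])
      (simp_all add: eta_map_closed, simp add: eta_map_def Let_def)
  then show "tetra_map K A (int1 K A (int2 K A M N) (int2 K A P Q)) (ext2 K A (int1 K A M P) (int1 K A N Q))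
      (restrict (\<lambda>x. ?i (eta_map M N P Q x)) (carrier (int1 K A (int2 K A M N) (int2 K A P Q))))"
    using tetra_map_eta_ext2 by simp
qed (use t in \<open>simp_all add: eta_map_closed inj_on_def\<close>, simp add: eta_map_def Let_def)

text \<open>The defined map passes to a representative of the class in the
  \<open>\<otimes>\<^sub>1\<close> of the external products, in general another tensor. The value is
  unaffected, since the summand is balanced for these larger tetramodules too.\<close>

lemma eta_eq: "eta K A M N P Q = \<lparr>Dom = int1 K A (int2 K A M N) (int2 K A P Q),
    Cod = int2 K A (int1 K A M P) (int1 K A N Q), Map = eta_map M N P Q\<rparr>"
proof -
  let ?S = "int2 K A M N" and ?R = "int2 K A P Q"
  let ?C = "int1 K A M P" and ?D = "int1 K A N Q"
  let ?E1 = "ext2 K A M N" and ?E2 = "ext2 K A P Q"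
  note [simp] = t
  have "tmap K (ext1 K A M P) (ext1 K A N Q) ?C ?D (proj1 K A M P) (proj1 K A N Q)
      (phi0 K A M N P Q (map1 K A ?S ?R ?E1 ?E2 (\<lambda>x. x) (\<lambda>y. y) x)) =
    sw ?S ?R etaD x etaF" if x: "x \<in> carrier (int1 K A ?S ?R)" for x
  proof -
    let ?z = "sw ?S ?R ((M \<otimes>\<^sub>k N) \<otimes>\<^sub>k P \<otimes>\<^sub>k Q) x (tn (M \<otimes>\<^sub>k N) (P \<otimes>\<^sub>k Q))"
    have [simp]: "x \<in> carrier (?S \<otimes>\<^sub>k ?R)" by (rule int1_mem[OF _ _ x]) simp_all
    have z [simp]: "?z \<in> carrier ((M \<otimes>\<^sub>k N) \<otimes>\<^sub>k P \<otimes>\<^sub>k Q)" by (simp add: int2_rules(1-3))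
    have pz [simp]: "proj1 K A ?E1 ?E2 ?z \<in> carrier ((M \<otimes>\<^sub>k N) \<otimes>\<^sub>k P \<otimes>\<^sub>k Q)"
      using int1_mem[of ?E1 ?E2 "proj1 K A ?E1 ?E2 ?z"] proj1_simps(3)[of ?E1 ?E2 ?z] z by (simp del: proj1_sweedler)
    \<comment> \<open>The balance for arbitrary tensors \<open>s\<close> and \<open>r\<close>;
      neither has to lie in the respective equaliser.\<close>
    have b: "etaF (ract ?E1 s a) r = etaF s (lact ?E2 a r)"
      if [simp]: "s \<in> carrier (M \<otimes>\<^sub>k N)" "r \<in> carrier (P \<otimes>\<^sub>k Q)" "a \<in> carrier A" for s r a
      by (simp add: ext2_ops swap_comult_out)
    have "tmap K (ext1 K A M P) (ext1 K A N Q) ?C ?D (proj1 K A M P) (proj1 K A N Q)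
        (phi0 K A M N P Q (proj1 K A ?E1 ?E2 ?z)) = sw (M \<otimes>\<^sub>k N) (P \<otimes>\<^sub>k Q) etaD (proj1 K A ?E1 ?E2 ?z) etaF"
      by (simp add: tmap_def phi0_def Let_def del: proj1_sweedler)
    also have "\<dots> = sw ?E1 ?E2 etaD (proj1 K A ?E1 ?E2 ?z) etaF" by simp
    also have "\<dots> = sw ?E1 ?E2 etaD ?z etaF"
      by (rule sweedler_proj1) (simp_all add: b del: ext2_space(8-13), simp_all add: b)
    also have "\<dots> = sw ?S ?R etaD x etaF"
      by (simp add: int2_rules(1-3))
    finally show ?thesis by (simp add: map1_def tmap_def del: proj1_sweedler)
  qed
  then show ?thesis
    by (simp add: eta_def eta_map_def Let_def cong: restrict_cong)
qed

end

section \<open>The axioms for \<eta>\<close>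

lemmas eta_rules = tetra_map_eta opaque_tetra_map[OF tetra_map_eta]

text \<open>That the value of \<eta> lies in the equaliser is apparent only before it is expanded
  into a sum, so evaluating \<eta> and applying \<open>f\<close> and \<open>g\<close> are combined
  in one rule.\<close>

lemma tmap2_eta_bal:
  assumes [simp]: "tetra M" "tetra N" "tetra P" "tetra Q" "tetra M'" "tetra N'"
    and f: "tetra_map K A (int1 K A M P) M' f" and g: "tetra_map K A (int1 K A N Q) N' g"
    and s: "s \<in> carrier (int2 K A M N)" and r: "r \<in> carrier (int2 K A P Q)"
  shows "tmap2 (int1 K A M P) (int1 K A N Q) M' N' f g (eta_map M N P Q (bal (int2 K A M N) (int2 K A P Q) s r)) =
    sw M N (M' \<otimes>\<^sub>k N') s (\<lambda>m n. sw P Q (M' \<otimes>\<^sub>k N') r (\<lambda>p q. tn M' N' (f (bal M P m p)) (g (bal N Q n q))))"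
proof -
  note [simp] = s r tetra_map_rules[OF f] tetra_map_rules[OF g] int2_rules(1-3) eta_rules
  have c: "eta_map M N P Q (bal (int2 K A M N) (int2 K A P Q) s r) \<in> carrier (int2 K A (int1 K A M P) (int1 K A N Q))"
    by simp
  show ?thesis
    using tmap2_eq[OF _ _ _ _ f g c] by (simp add: eta_map_bal)
qed

lemma eta_Tetra_natural:
  assumes [simp]: "tetra M" "tetra M'" "tetra N" "tetra N'" "tetra P" "tetra P'" "tetra Q" "tetra Q'"
    and f: "tetra_map K A M M' f" and g: "tetra_map K A N N' g" and h: "tetra_map K A P P' h" and j: "tetra_map K A Q Q' j"
    and t: "t \<in> carrier (int1 K A (int2 K A M N) (int2 K A P Q))"
  shows "eta_map M' N' P' Q' (tmap1 (int2 K A M N) (int2 K A P Q) (int2 K A M' N') (int2 K A P' Q')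
      (tmap2 M N M' N' f g) (tmap2 P Q P' Q' h j) t) =
    tmap2 (int1 K A M P) (int1 K A N Q) (int1 K A M' P') (int1 K A N' Q')
      (tmap1 M P M' P' f h) (tmap1 N Q N' Q' g j) (eta_map M N P Q t)"
proof -
  note [simp] = f g h j tetra_map_rules[OF f] tetra_map_rules[OF g] tetra_map_rules[OF h] tetra_map_rules[OF j]
    tensor1_rules tensor2_rules eta_rules
  show ?thesis
    by (rule int1_eqI[OF _ _ _ _ _ t, where P = "int1 K A M' P' \<otimes>\<^sub>k int1 K A N' Q'"])
      (simp_all add: tmap2_eta_bal, simp add: eta_map_bal)
qed

lemma eta_Tetra_assoc1:
  assumes [simp]: "tetra U" "tetra V" "tetra W" "tetra X" "tetra Y" "tetra Z"
    and t: "t \<in> carrier (int1 K A (int1 K A (int2 K A U V) (int2 K A W X)) (int2 K A Y Z))"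
  shows "tmap2 (int1 K A (int1 K A U W) Y) (int1 K A (int1 K A V X) Z) (int1 K A U (int1 K A W Y)) (int1 K A V (int1 K A X Z))
      (assoc1 U W Y) (assoc1 V X Z) (eta_map (int1 K A U W) (int1 K A V X) Y Z
        (tmap1 (int1 K A (int2 K A U V) (int2 K A W X)) (int2 K A Y Z) (int2 K A (int1 K A U W) (int1 K A V X)) (int2 K A Y Z)
          (eta_map U V W X) (restrict (\<lambda>x. x) (carrier (int2 K A Y Z))) t)) =
    eta_map U V (int1 K A W Y) (int1 K A X Z)
      (tmap1 (int2 K A U V) (int1 K A (int2 K A W X) (int2 K A Y Z)) (int2 K A U V) (int2 K A (int1 K A W Y) (int1 K A X Z))
        (restrict (\<lambda>x. x) (carrier (int2 K A U V))) (eta_map W X Y Z)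
        (assoc1 (int2 K A U V) (int2 K A W X) (int2 K A Y Z) t))"
proof -
  note [simp] = tensor1_rules tensor2_rules eta_rules
  show ?thesis
    by (rule int1_eqI_left[OF _ _ _ _ _ _ t, where X = "int1 K A U (int1 K A W Y) \<otimes>\<^sub>k int1 K A V (int1 K A X Z)"])
      (simp_all add: tmap2_eta_bal eta_map_bal[where M = U and P = "int1 K A W Y"], simp add: eta_map_bal)
qed

lemma eta_Tetra_assoc2:
  assumes [simp]: "tetra U" "tetra V" "tetra W" "tetra X" "tetra Y" "tetra Z"
    and t: "t \<in> carrier (int1 K A (int2 K A (int2 K A U V) W) (int2 K A (int2 K A X Y) Z))"
  shows "assoc2 (int1 K A U X) (int1 K A V Y) (int1 K A W Z)
      (tmap2 (int1 K A (int2 K A U V) (int2 K A X Y)) (int1 K A W Z) (int2 K A (int1 K A U X) (int1 K A V Y)) (int1 K A W Z)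
        (eta_map U V X Y) (restrict (\<lambda>x. x) (carrier (int1 K A W Z)))
        (eta_map (int2 K A U V) W (int2 K A X Y) Z t)) =
    tmap2 (int1 K A U X) (int1 K A (int2 K A V W) (int2 K A Y Z)) (int1 K A U X) (int2 K A (int1 K A V Y) (int1 K A W Z))
      (restrict (\<lambda>x. x) (carrier (int1 K A U X))) (eta_map V W Y Z)
      (eta_map U (int2 K A V W) X (int2 K A Y Z)
        (tmap1 (int2 K A (int2 K A U V) W) (int2 K A (int2 K A X Y) Z) (int2 K A U (int2 K A V W)) (int2 K A X (int2 K A Y Z))
          (assoc2 U V W) (assoc2 X Y Z) t))"
    (is "?F t = ?G t")
proof -
  let ?D = "int1 K A U X \<otimes>\<^sub>k int1 K A V Y \<otimes>\<^sub>k int1 K A W Z"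
  note [simp] = tensor1_rules tensor2_rules eta_rules
  let ?T = "\<lambda>u v w x y z. tn (int1 K A U X) (int1 K A V Y \<otimes>\<^sub>k int1 K A W Z) (bal U X u x) (tn (int1 K A V Y) (int1 K A W Z) (bal V Y v y) (bal W Z w z))"
  have eq: "?F (bal (int2 K A (int2 K A U V) W) (int2 K A (int2 K A X Y) Z) s r) =
      ?G (bal (int2 K A (int2 K A U V) W) (int2 K A (int2 K A X Y) Z) s r)"
    if [simp]: "s \<in> carrier (int2 K A (int2 K A U V) W)" "r \<in> carrier (int2 K A (int2 K A X Y) Z)" for s r
  proof (rule int2_right_eqI[of "int1 K A U X" "int1 K A V Y" "int1 K A W Z"])
    \<comment> \<open>The first bracketing sums over both outer tensors before opening the inner
      ones, whereas regrouping \<open>s\<close> requires its two sums to be adjacent; the sums over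
      \<open>u\<close>, \<open>v\<close> and over the outer level of \<open>r\<close> are
      independent.\<close>
    have "sw (int2 K A U V) W ?D s (\<lambda>s w. sw (int2 K A X Y) Z ?D r (\<lambda>r z. sw U V ?D s (\<lambda>u v. sw X Y ?D r (\<lambda>x y. ?T u v w x y z)))) =
      sw (int2 K A U V) W ?D s (\<lambda>s w. sw U V ?D s (\<lambda>u v. sw (int2 K A X Y) Z ?D r (\<lambda>r z. sw X Y ?D r (\<lambda>x y. ?T u v w x y z))))"
      by (rule sweedler_cong[OF refl refl refl refl], rule sweedler_swap) simp_all
    \<comment> \<open>With the sums of \<open>s\<close> adjacent, and likewise those of
      \<open>r\<close>, the associativity of \<open>\<otimes>\<^sub>2\<close> regroups each of them;
      a last exchange restores the order in which \<eta> takes the sums on the other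
      bracketing.\<close>
    also have "\<dots> = sw U (int2 K A V W) ?D (assoc2 U V W s) (\<lambda>u s. sw V W ?D s (\<lambda>v w.
        sw X (int2 K A Y Z) ?D (assoc2 X Y Z r) (\<lambda>x r. sw Y Z ?D r (\<lambda>y z. ?T u v w x y z))))"
      by simp
    also have "\<dots> = sw U (int2 K A V W) ?D (assoc2 U V W s) (\<lambda>u s.
        sw X (int2 K A Y Z) ?D (assoc2 X Y Z r) (\<lambda>x r. sw V W ?D s (\<lambda>v w. sw Y Z ?D r (\<lambda>y z. ?T u v w x y z))))"
      by (rule sweedler_cong[OF refl refl refl refl], rule sweedler_swap) simp_all
    finally show "sw (int1 K A U X) (int2 K A (int1 K A V Y) (int1 K A W Z)) ?D (?F (bal (int2 K A (int2 K A U V) W) (int2 K A (int2 K A X Y) Z) s r))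
        (\<lambda>m s. sw (int1 K A V Y) (int1 K A W Z) ?D s (\<lambda>n p. tn (int1 K A U X) (int1 K A V Y \<otimes>\<^sub>k int1 K A W Z) m (tn (int1 K A V Y) (int1 K A W Z) n p))) =
      sw (int1 K A U X) (int2 K A (int1 K A V Y) (int1 K A W Z)) ?D (?G (bal (int2 K A (int2 K A U V) W) (int2 K A (int2 K A X Y) Z) s r))
        (\<lambda>m s. sw (int1 K A V Y) (int1 K A W Z) ?D s (\<lambda>n p. tn (int1 K A U X) (int1 K A V Y \<otimes>\<^sub>k int1 K A W Z) m (tn (int1 K A V Y) (int1 K A W Z) n p)))"
      by (simp, simp add: eta_map_bal)
  qed simp_all
  show ?thesis
    by (rule int1_eqI[OF _ _ _ _ _ t, where F = ?F and G = ?G, OF _ _ _ _ _ eq, where P = "int2 K A (int1 K A U X) (int2 K A (int1 K A V Y) (int1 K A W Z))"]) simp_all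
qed

text \<open>The coproduct identifies \<open>A\<close> with \<open>A \<otimes>\<^sub>2 A\<close>, so
  every point of the latter is the coproduct of an element of \<open>A\<close>.\<close>

lemma lunit2_taut:
  assumes "r \<in> carrier (int2 K A (taut A) (taut A))"
  shows "r \<in> carrier (A \<otimes>\<^sub>k A)" and "lunit2 (taut A) r \<in> carrier A" and "\<Delta> (lunit2 (taut A) r) = r"
  using int2_mem_taut(1)[OF tetra_taut assms] lunit2_props(1,2)[OF tetra_taut assms] by simp_all

text \<open>If \<open>r\<close> is the coproduct of \<open>c\<close>, acting by its legs on the two
  factors is the diagonal right action of \<open>c\<close> on \<open>X \<otimes>\<^sub>2 Y\<close>,
  which is what the unit map of \<open>\<otimes>\<^sub>1\<close> computes.\<close>

lemma eta_Tetra_XYII: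
  assumes [simp]: "tetra X" "tetra Y"
    and t: "t \<in> carrier (int1 K A (int2 K A X Y) (int2 K A (taut A) (taut A)))"
  shows "tmap2 (int1 K A X (taut A)) (int1 K A Y (taut A)) X Y (runit1 X) (runit1 Y) (eta_map X Y (taut A) (taut A) t) =
    runit1 (int2 K A X Y) (tmap1 (int2 K A X Y) (int2 K A (taut A) (taut A)) (int2 K A X Y) (taut A)
      (restrict (\<lambda>x. x) (carrier (int2 K A X Y))) (lunit2 (taut A)) t)"
proof (rule int1_eqI[OF _ _ _ _ _ t, where P = "X \<otimes>\<^sub>k Y"])
  note [simp] = tensor1_rules tensor2_maps linear_int2_from linear_int2_incl int2_mem
    opaque_tetra_map[OF tetra_map_tmap2] opaque_tetra_map[OF tetra_map_lunit2] eta_rules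
  fix s r assume [simp]: "s \<in> carrier (int2 K A X Y)" and r: "r \<in> carrier (int2 K A (taut A) (taut A))"
  note [simp] = r lunit2_taut[OF r]
  have "tmap2 (int1 K A X (taut A)) (int1 K A Y (taut A)) X Y (runit1 X) (runit1 Y)
      (eta_map X Y (taut A) (taut A) (bal (int2 K A X Y) (int2 K A (taut A) (taut A)) s r)) =
    sw X Y (X \<otimes>\<^sub>k Y) s (\<lambda>x y. sw A A (X \<otimes>\<^sub>k Y) r (\<lambda>a b. tn X Y (ract X x a) (ract Y y b)))"
    by (simp add: tmap2_eta_bal)
  also have "\<dots> = sw A A (X \<otimes>\<^sub>k Y) r (\<lambda>a b. sw X Y (X \<otimes>\<^sub>k Y) s (\<lambda>x y. tn X Y (ract X x a) (ract Y y b)))"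
    by (rule sweedler_swap) simp_all
  \<comment> \<open>The element \<open>c\<close> is \<open>lunit2 (taut A) r\<close>, and the sum
    over \<open>r\<close> is a sum over its coproduct.\<close>
  also have "\<dots> = ract (int2 K A X Y) s (lunit2 (taut A) r)"
    by (simp add: int2_ops(5) ext2_ops)
  finally show "tmap2 (int1 K A X (taut A)) (int1 K A Y (taut A)) X Y (runit1 X) (runit1 Y)
      (eta_map X Y (taut A) (taut A) (bal (int2 K A X Y) (int2 K A (taut A) (taut A)) s r)) =
    runit1 (int2 K A X Y) (tmap1 (int2 K A X Y) (int2 K A (taut A) (taut A)) (int2 K A X Y) (taut A)
      (restrict (\<lambda>x. x) (carrier (int2 K A X Y))) (lunit2 (taut A)) (bal (int2 K A X Y) (int2 K A (taut A) (taut A)) s r))"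
    by simp
qed (simp_all add: tensor1_rules tensor2_rules eta_rules)

lemma eta_Tetra_IIXY:
  assumes [simp]: "tetra X" "tetra Y"
    and t: "t \<in> carrier (int1 K A (int2 K A (taut A) (taut A)) (int2 K A X Y))"
  shows "tmap2 (int1 K A (taut A) X) (int1 K A (taut A) Y) X Y (lunit1 X) (lunit1 Y) (eta_map (taut A) (taut A) X Y t) =
    lunit1 (int2 K A X Y) (tmap1 (int2 K A (taut A) (taut A)) (int2 K A X Y) (taut A) (int2 K A X Y)
      (lunit2 (taut A)) (restrict (\<lambda>x. x) (carrier (int2 K A X Y))) t)"
proof (rule int1_eqI[OF _ _ _ _ _ t, where P = "X \<otimes>\<^sub>k Y"])
  note [simp] = tensor1_rules tensor2_maps linear_int2_from linear_int2_incl int2_mem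
    opaque_tetra_map[OF tetra_map_tmap2] opaque_tetra_map[OF tetra_map_lunit2] eta_rules
  fix r s assume [simp]: "s \<in> carrier (int2 K A X Y)" and r: "r \<in> carrier (int2 K A (taut A) (taut A))"
  note [simp] = r lunit2_taut[OF r]
  show "tmap2 (int1 K A (taut A) X) (int1 K A (taut A) Y) X Y (lunit1 X) (lunit1 Y)
      (eta_map (taut A) (taut A) X Y (bal (int2 K A (taut A) (taut A)) (int2 K A X Y) r s)) =
    lunit1 (int2 K A X Y) (tmap1 (int2 K A (taut A) (taut A)) (int2 K A X Y) (taut A) (int2 K A X Y)
      (lunit2 (taut A)) (restrict (\<lambda>x. x) (carrier (int2 K A X Y))) (bal (int2 K A (taut A) (taut A)) (int2 K A X Y) r s))"
    by (simp add: tmap2_eta_bal int2_ops(4) ext2_ops)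
qed (simp_all add: tensor1_rules tensor2_rules eta_rules)

lemma bal_sweedler:
  assumes t: "tetra M" "tetra N" and V: "module K V" "module K W" "u \<in> carrier (V \<otimes>\<^sub>k W)"
  shows "n \<in> carrier N \<Longrightarrow> (\<And>v. v \<in> carrier V \<Longrightarrow> lin W M (\<lambda>w. f v w)) \<Longrightarrow> (\<And>w. w \<in> carrier W \<Longrightarrow> lin V M (\<lambda>v. f v w)) \<Longrightarrow>
      bal M N (sw V W M u f) n = sw V W (int1 K A M N) u (\<lambda>v w. bal M N (f v w) n)"
    and "m \<in> carrier M \<Longrightarrow> (\<And>v. v \<in> carrier V \<Longrightarrow> lin W N (\<lambda>w. g v w)) \<Longrightarrow> (\<And>w. w \<in> carrier W \<Longrightarrow> lin V N (\<lambda>v. g v w)) \<Longrightarrow>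
      bal M N m (sw V W N u g) = sw V W (int1 K A M N) u (\<lambda>v w. bal M N m (g v w))"
proof -
  note [simp] = t V
  show "bal M N (sw V W M u f) n = sw V W (int1 K A M N) u (\<lambda>v w. bal M N (f v w) n)"
    if "n \<in> carrier N" "\<And>v. v \<in> carrier V \<Longrightarrow> lin W M (\<lambda>w. f v w)" "\<And>w. w \<in> carrier W \<Longrightarrow> lin V M (\<lambda>v. f v w)"
    by (rule sweedler_linear[where g = "\<lambda>x. bal M N x n"]) (use that in simp_all)
  show "bal M N m (sw V W N u g) = sw V W (int1 K A M N) u (\<lambda>v w. bal M N m (g v w))"
    if "m \<in> carrier M" "\<And>v. v \<in> carrier V \<Longrightarrow> lin W N (\<lambda>w. g v w)" "\<And>w. w \<in> carrier W \<Longrightarrow> lin V N (\<lambda>v. g v w)"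
    by (rule sweedler_linear) (use that in simp_all)
qed

lemma bal_counit:
  assumes "tetra M" "tetra N" "m \<in> carrier M" "n \<in> carrier N" "a \<in> carrier A"
  shows "bal M N (\<epsilon> a \<odot>\<^bsub>M\<^esub> m) n = \<epsilon> a \<odot>\<^bsub>int1 K A M N\<^esub> bal M N m n"
    and "bal M N m (\<epsilon> a \<odot>\<^bsub>N\<^esub> n) = \<epsilon> a \<odot>\<^bsub>int1 K A M N\<^esub> bal M N m n"
proof -
  have "lin M (int1 K A M N) (\<lambda>x. bal M N x n)" "lin N (int1 K A M N) (bal M N m)"
    using assms by simp_all
  from this[THEN linear_mapD(3)] show "bal M N (\<epsilon> a \<odot>\<^bsub>M\<^esub> m) n = \<epsilon> a \<odot>\<^bsub>int1 K A M N\<^esub> bal M N m n"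
    "bal M N m (\<epsilon> a \<odot>\<^bsub>N\<^esub> n) = \<epsilon> a \<odot>\<^bsub>int1 K A M N\<^esub> bal M N m n"
    using assms by simp_all
qed

text \<open>With \<open>s\<close> a sum of \<open>x \<otimes> a\<close> and \<open>r\<close> a sum
  of \<open>y \<otimes> b\<close>, one side multiplies the class of \<open>x\<close> and
  \<open>y\<close> by \<epsilon> of the product of \<open>a\<close> and \<open>b\<close>, the other
  by the product of the two counits. The axiom thus rests on \<epsilon> being
  multiplicative.\<close>

lemma eta_Tetra_XIYI:
  assumes [simp]: "tetra X" "tetra Y"
    and t: "t \<in> carrier (int1 K A (int2 K A X (taut A)) (int2 K A Y (taut A)))"
  shows "runit2 (int1 K A X Y) (tmap2 (int1 K A X Y) (int1 K A (taut A) (taut A)) (int1 K A X Y) (taut A)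
      (restrict (\<lambda>x. x) (carrier (int1 K A X Y))) (lunit1 (taut A)) (eta_map X (taut A) Y (taut A) t)) =
    tmap1 (int2 K A X (taut A)) (int2 K A Y (taut A)) X Y (runit2 X) (runit2 Y) t"
proof (rule int1_eqI[OF _ _ _ _ _ t, where P = "int1 K A X Y"])
  note [simp] = tensor1_rules tensor2_rules eta_rules int2_mem_taut
  fix s r assume [simp]: "s \<in> carrier (int2 K A X (taut A))" "r \<in> carrier (int2 K A Y (taut A))"
  have c: "tmap2 (int1 K A X Y) (int1 K A (taut A) (taut A)) (int1 K A X Y) (taut A)
      (restrict (\<lambda>x. x) (carrier (int1 K A X Y))) (lunit1 (taut A)) (eta_map X (taut A) Y (taut A)
        (bal (int2 K A X (taut A)) (int2 K A Y (taut A)) s r)) \<in> carrier (int2 K A (int1 K A X Y) (taut A))"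
    by simp
  show "runit2 (int1 K A X Y) (tmap2 (int1 K A X Y) (int1 K A (taut A) (taut A)) (int1 K A X Y) (taut A)
      (restrict (\<lambda>x. x) (carrier (int1 K A X Y))) (lunit1 (taut A)) (eta_map X (taut A) Y (taut A)
        (bal (int2 K A X (taut A)) (int2 K A Y (taut A)) s r))) =
    tmap1 (int2 K A X (taut A)) (int2 K A Y (taut A)) X Y (runit2 X) (runit2 Y) (bal (int2 K A X (taut A)) (int2 K A Y (taut A)) s r)"
    unfolding runit2_eq(1)[OF tetra_int1[OF assms(1,2)] c]
    apply (simp add: tmap2_eta_bal)
    apply (simp add: bal_sweedler(1))
    apply (simp add: bal_sweedler(2))
    apply (simp add: bal_counit(1))
    apply (simp add: bal_counit(2))
    done
qed (simp_all add: tensor1_rules tensor2_rules eta_rules)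

lemma eta_Tetra_IXIY:
  assumes [simp]: "tetra X" "tetra Y"
    and t: "t \<in> carrier (int1 K A (int2 K A (taut A) X) (int2 K A (taut A) Y))"
  shows "lunit2 (int1 K A X Y) (tmap2 (int1 K A (taut A) (taut A)) (int1 K A X Y) (taut A) (int1 K A X Y)
      (lunit1 (taut A)) (restrict (\<lambda>x. x) (carrier (int1 K A X Y))) (eta_map (taut A) X (taut A) Y t)) =
    tmap1 (int2 K A (taut A) X) (int2 K A (taut A) Y) X Y (lunit2 X) (lunit2 Y) t"
proof (rule int1_eqI[OF _ _ _ _ _ t, where P = "int1 K A X Y"])
  note [simp] = tensor1_rules tensor2_rules eta_rules int2_mem_taut
  fix s r assume [simp]: "s \<in> carrier (int2 K A (taut A) X)" "r \<in> carrier (int2 K A (taut A) Y)"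
  have c: "tmap2 (int1 K A (taut A) (taut A)) (int1 K A X Y) (taut A) (int1 K A X Y)
      (lunit1 (taut A)) (restrict (\<lambda>x. x) (carrier (int1 K A X Y))) (eta_map (taut A) X (taut A) Y
        (bal (int2 K A (taut A) X) (int2 K A (taut A) Y) s r)) \<in> carrier (int2 K A (taut A) (int1 K A X Y))"
    by simp
  show "lunit2 (int1 K A X Y) (tmap2 (int1 K A (taut A) (taut A)) (int1 K A X Y) (taut A) (int1 K A X Y)
      (lunit1 (taut A)) (restrict (\<lambda>x. x) (carrier (int1 K A X Y))) (eta_map (taut A) X (taut A) Y
        (bal (int2 K A (taut A) X) (int2 K A (taut A) Y) s r))) =
    tmap1 (int2 K A (taut A) X) (int2 K A (taut A) Y) X Y (lunit2 X) (lunit2 Y) (bal (int2 K A (taut A) X) (int2 K A (taut A) Y) s r)"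
    unfolding lunit2_eq(1)[OF tetra_int1[OF assms(1,2)] c]
    apply (simp add: tmap2_eta_bal)
    apply (simp add: bal_sweedler(1))
    apply (simp add: bal_sweedler(2))
    apply (simp add: bal_counit(1))
    apply (simp add: bal_counit(2))
    done
qed (simp_all add: tensor1_rules tensor2_rules eta_rules)

lemma two_fold_monoidal_Tetra: "two_fold_monoidal_category (Tetra K A) (taut A) (tensor1 K A) (tensor2 K A) (eta K A)"
proof (intro two_fold_monoidal_category.intro monoidal_Tetra1 monoidal_Tetra2 two_fold_monoidal_category_axioms.intro)
  let ?C = "Tetra K A" and ?T = "tensor1 K A" and ?U = "tensor2 K A" and ?I = "taut A" and ?e = "eta K A"
  note s = Tetra_simps tensor1_simps tensor2_simps eta_eq tetra_mor.select_convs
  {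
    fix M N P Q assume "M \<in> Ob ?C" "N \<in> Ob ?C" "P \<in> Ob ?C" "Q \<in> Ob ?C"
    then have [simp]: "tetra M" "tetra N" "tetra P" "tetra Q" by (simp_all add: s)
    show "?e M N P Q \<in> Hom ?C (tobj ?T (tobj ?U M N) (tobj ?U P Q)) (tobj ?U (tobj ?T M P) (tobj ?T N Q))"
      by (simp add: s tetra_map_eta)
    fix M' N' P' Q' assume "M' \<in> Ob ?C" "N' \<in> Ob ?C" "P' \<in> Ob ?C" "Q' \<in> Ob ?C"
    then have [simp]: "tetra M'" "tetra N'" "tetra P'" "tetra Q'" by (simp_all add: s)
    fix F G H J assume "F \<in> Hom ?C M M'" "G \<in> Hom ?C N N'" "H \<in> Hom ?C P P'" "J \<in> Hom ?C Q Q'"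
    then obtain f g h j where "F = \<lparr>Dom = M, Cod = M', Map = f\<rparr>" "G = \<lparr>Dom = N, Cod = N', Map = g\<rparr>"
      "H = \<lparr>Dom = P, Cod = P', Map = h\<rparr>" "J = \<lparr>Dom = Q, Cod = Q', Map = j\<rparr>"
      and "tetra_map K A M M' f" "tetra_map K A N N' g" "tetra_map K A P P' h" "tetra_map K A Q Q' j"
      by (elim HomE)
    then show "Comp ?C (?e M' N' P' Q') (tmor ?T (tmor ?U F G) (tmor ?U H J)) =
        Comp ?C (tmor ?U (tmor ?T F H) (tmor ?T G J)) (?e M N P Q)"
      by (simp add: s, intro compose_eqI eta_Tetra_natural) simp_all
  }
  fix X Y assume "X \<in> Ob ?C" "Y \<in> Ob ?C"
  then have [simp]: "tetra X" "tetra Y" by (simp_all add: s)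
  show "Comp ?C (tmor ?U (runit ?T X) (runit ?T Y)) (?e X Y ?I ?I) =
      Comp ?C (runit ?T (tobj ?U X Y)) (tmor ?T (Id ?C (tobj ?U X Y)) (lunit ?U ?I))"
    by (simp add: s, intro compose_eqI eta_Tetra_XYII) simp_all
  show "Comp ?C (tmor ?U (lunit ?T X) (lunit ?T Y)) (?e ?I ?I X Y) =
      Comp ?C (lunit ?T (tobj ?U X Y)) (tmor ?T (lunit ?U ?I) (Id ?C (tobj ?U X Y)))"
    by (simp add: s, intro compose_eqI eta_Tetra_IIXY) simp_all
  \<comment> \<open>In the next two axioms only one side is a composition, so equality of functions
    also uses that both sides are extensional, not only that they agree on the carrier.\<close>
  have ext: "tmap1 M N M' N' f g \<in> extensional (carrier (int1 K A M N))" for M N M' N' f g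
    by (simp add: tmap1_def)
  show "Comp ?C (runit ?U (tobj ?T X Y)) (Comp ?C (tmor ?U (Id ?C (tobj ?T X Y)) (lunit ?T ?I)) (?e X ?I Y ?I)) =
      tmor ?T (runit ?U X) (runit ?U Y)"
    using eta_Tetra_XIYI[of X Y]
    by (simp add: s, intro extensionalityI[OF compose_extensional ext]) (simp add: compose_eq)
  show "Comp ?C (lunit ?U (tobj ?T X Y)) (Comp ?C (tmor ?U (lunit ?T ?I) (Id ?C (tobj ?T X Y))) (?e ?I X ?I Y)) =
      tmor ?T (lunit ?U X) (lunit ?U Y)"
    using eta_Tetra_IXIY[of X Y]
    by (simp add: s, intro extensionalityI[OF compose_extensional ext]) (simp add: compose_eq)
  fix U V W Z assume "U \<in> Ob ?C" "V \<in> Ob ?C" "W \<in> Ob ?C" "Z \<in> Ob ?C"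
  then have [simp]: "tetra U" "tetra V" "tetra W" "tetra Z" by (simp_all add: s)
  show "Comp ?C (tmor ?U (assoc ?T U W Y) (assoc ?T V X Z))
      (Comp ?C (?e (tobj ?T U W) (tobj ?T V X) Y Z) (tmor ?T (?e U V W X) (Id ?C (tobj ?U Y Z)))) =
    Comp ?C (?e U V (tobj ?T W Y) (tobj ?T X Z))
      (Comp ?C (tmor ?T (Id ?C (tobj ?U U V)) (?e W X Y Z)) (assoc ?T (tobj ?U U V) (tobj ?U W X) (tobj ?U Y Z)))"
    by (simp add: s, rule compose_eqI) (simp add: compose_eq eta_Tetra_assoc1)
  show "Comp ?C (assoc ?U (tobj ?T U X) (tobj ?T V Y) (tobj ?T W Z))
      (Comp ?C (tmor ?U (?e U V X Y) (Id ?C (tobj ?T W Z))) (?e (tobj ?U U V) W (tobj ?U X Y) Z)) =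
    Comp ?C (tmor ?U (Id ?C (tobj ?T U X)) (?e V W Y Z))
      (Comp ?C (?e U (tobj ?U V W) X (tobj ?U Y Z)) (tmor ?T (assoc ?U U V W) (assoc ?U X Y Z)))"
    by (simp add: s, rule compose_eqI) (simp add: compose_eq eta_Tetra_assoc2)
qed

end

theorem theorem4p7:
  fixes K :: "('k, 'c) ring_scheme" and A :: "('k, 'u) bialgebra"
  assumes "field K" and "bialgebra K A" and "infinite (UNIV :: 'u set)"
  shows "two_fold_monoidal_category (Tetra K A) (taut A) (tensor1 K A) (tensor2 K A) (eta K A)"
proof -
  interpret bialgebra_setting K A
    using assms by (intro bialgebra_setting.intro linear_setting.intro bialgebra_setting_axioms.intro)
  show ?thesis by (rule two_fold_monoidal_Tetra)
qed

end
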